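(* Let $g$ be a rational function. Consider the maps: (i) $F_\varepsilon(x,y)=\left(y,-x+\dfrac{a y}{1+y^2}+\varepsilon\,g(y)\right)$, with $\deg(g)>1$ and $a\in(-2,\infty)\setminus\{-1,0,2\}$; (ii) $G_\varepsilon(x,y)=\left(y,\dfrac{a+y+\varepsilon\,g(y)}{x}\right)$, with $\deg(g)>2$ and $a\in(-1/4,\infty)\setminus\{0,1\}$. Then, for $|\varepsilon|$ small enough, $F_\varepsilon$ or $G_\varepsilon$ are $\mathcal{C}^{6}$-locally integrable at its corresponding elliptic fixed points if and only if $\varepsilon=0$.
   Context: These are real planar maps depending on a real parameter $\varepsilon$. For a rational function $g=P/Q$, with $P,Q$ polynomials, $\deg(g)=\deg(P)-\deg(Q)$. Elliptic fixed point: a fixed point $p$ of a planar map such that the eigenvalues of the linear part of the map at $p$ lie on the unit circle of $\mathbb{C}$ and are different from $\pm1$. A planar map $F$ is $\mathcal{C}^m$-locally integrable at an elliptic fixed point $p$ ($m\ge2$) if there exist a neighborhood $\mathcal{U}$ of $p$ and a locally non-constant real valued function $V\in\mathcal{C}^m(\mathcal{U})$ (called first integral) such that $V(F(x))=V(x)$, all the level curves $\{V=h\}\cap\mathcal{U}$ are closed curves surrounding $p$ and, moreover, $p$ is an isolated non-degenerate critical point of $V$ in $\mathcal{U}$.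
   Formalization: In (ii) the elliptic fixed point (-1,-1), which is a fixed point of G_0 only for a=2, is excluded: its eigenvalues are primitive cube roots of unity and G_0 has no first integral with a non-degenerate critical point there, so the claim fails at ε=0. *)

theory Defs
  imports "HOL-Analysis.Analysis" "HOL-Computational_Algebra.Computational_Algebra"
begin

text \<open>
  A planar map is a total function on \<^typ>\<open>real^2\<close> together with an open set \<open>D\<close>, its domain;
  values outside \<open>D\<close> (where a denominator vanishes) are never used.
\<close>

definition rat_eval :: "real poly \<Rightarrow> real poly \<Rightarrow> real \<Rightarrow> real" where
  "rat_eval P Q y = poly P y / poly Q y"

definition rat_degree :: "real poly \<Rightarrow> real poly \<Rightarrow> int" where
  "rat_degree P Q = int (degree P) - int (degree Q)"

definition F_map :: "real \<Rightarrow> (real \<Rightarrow> real) \<Rightarrow> real \<Rightarrow> real^2 \<Rightarrow> real^2" where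
  "F_map a g \<epsilon> = (\<lambda>p. let x = p $ 1; y = p $ 2 in vector [y, - x + a * y / (1 + y^2) + \<epsilon> * g y])"

definition F_dom :: "real poly \<Rightarrow> (real^2) set" where
  "F_dom Q = {p. poly Q (p $ 2) \<noteq> 0}"

text \<open>
  For \<open>a = 2\<close> the unperturbed map \<open>G_map a g 0\<close> has at \<open>(-1, -1)\<close> an elliptic fixed point whose
  eigenvalues are primitive cube roots of unity. With \<open>x\<^sub>n = -1 + u\<^sub>n\<close> the recurrence is
  \<open>u\<^sub>n\<^sub>+\<^sub>1 + u\<^sub>n + u\<^sub>n\<^sub>-\<^sub>1 = u\<^sub>n\<^sub>+\<^sub>1 u\<^sub>n\<^sub>-\<^sub>1\<close>, with a resonant quadratic term, so there is no local first integral
  with a nondegenerate critical point. This point has to be excluded in statements about all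
  elliptic fixed points of \<open>G_map a g 0\<close>.
\<close>

definition G_map :: "real \<Rightarrow> (real \<Rightarrow> real) \<Rightarrow> real \<Rightarrow> real^2 \<Rightarrow> real^2" where
  "G_map a g \<epsilon> = (\<lambda>p. let x = p $ 1; y = p $ 2 in vector [y, (a + y + \<epsilon> * g y) / x])"

definition G_dom :: "real poly \<Rightarrow> (real^2) set" where
  "G_dom Q = {p. p $ 1 \<noteq> 0 \<and> poly Q (p $ 2) \<noteq> 0}"

definition complex_eigenvalue :: "real^'n^'n \<Rightarrow> complex \<Rightarrow> bool" where
  "complex_eigenvalue A z \<longleftrightarrow> (\<exists>v. v \<noteq> 0 \<and> map_matrix complex_of_real A *v v = z *s v)"

definition elliptic_fixed_point :: "(real^2) set \<Rightarrow> (real^2 \<Rightarrow> real^2) \<Rightarrow> real^2 \<Rightarrow> bool" where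
  "elliptic_fixed_point D F p \<longleftrightarrow>
     p \<in> D \<and> F p = p \<and> F differentiable (at p) \<and>
     (\<forall>z. complex_eigenvalue (jacobian F (at p)) z \<longrightarrow> cmod z = 1 \<and> z \<noteq> 1 \<and> z \<noteq> - 1)"

text \<open>The class \<open>C\<^sup>k\<close>, for open \<open>U\<close>.\<close>

fun C_k_on :: "nat \<Rightarrow> ('a::real_normed_vector \<Rightarrow> 'b::real_normed_vector) \<Rightarrow> 'a set \<Rightarrow> bool" where
  "C_k_on 0 f U \<longleftrightarrow> continuous_on U f"
| "C_k_on (Suc k) f U \<longleftrightarrow>
     (\<forall>x\<in>U. f differentiable (at x)) \<and> (\<forall>v. C_k_on k (\<lambda>x. frechet_derivative f (at x) v) U)"

definition locally_nonconstant_on :: "('a::topological_space \<Rightarrow> 'b) \<Rightarrow> 'a set \<Rightarrow> bool" where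
  "locally_nonconstant_on V U \<longleftrightarrow> (\<forall>W. open W \<and> W \<noteq> {} \<and> W \<subseteq> U \<longrightarrow> \<not> V constant_on W)"

definition closed_curve_surrounding :: "real^2 \<Rightarrow> (real^2) set \<Rightarrow> bool" where
  "closed_curve_surrounding p S \<longleftrightarrow>
     (\<exists>\<gamma>. simple_path \<gamma> \<and> pathfinish \<gamma> = pathstart \<gamma> \<and> path_image \<gamma> = S) \<and> p \<in> inside S"

definition hessian :: "(real^2 \<Rightarrow> real) \<Rightarrow> real^2 \<Rightarrow> real^2^2" where
  "hessian V p =
     (\<chi> i j. frechet_derivative (\<lambda>x. frechet_derivative V (at x) (axis j 1)) (at p) (axis i 1))"

definition isolated_nondegenerate_critical_point ::
    "(real^2 \<Rightarrow> real) \<Rightarrow> (real^2) set \<Rightarrow> real^2 \<Rightarrow> bool" where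
  "isolated_nondegenerate_critical_point V U p \<longleftrightarrow>
     p isolated_in {x \<in> U. (V has_derivative (\<lambda>_. 0)) (at x)} \<and> det (hessian V p) \<noteq> 0"

text \<open>
  Two conventions: the invariance \<open>V (F x) = V x\<close> is required at the points of \<open>U\<close> that \<open>F\<close> maps
  into \<open>U\<close>, where both sides are defined; and the level sets in question are those through the
  points of \<open>U\<close> other than \<open>p\<close> (the level set of \<open>p\<close> itself is then forced to be \<open>{p}\<close>).
\<close>

definition first_integral ::
    "nat \<Rightarrow> (real^2 \<Rightarrow> real^2) \<Rightarrow> real^2 \<Rightarrow> (real^2) set \<Rightarrow> (real^2 \<Rightarrow> real) \<Rightarrow> bool" where
  "first_integral m F p U V \<longleftrightarrow>
     C_k_on m V U \<and>
     locally_nonconstant_on V U \<and>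
     (\<forall>x\<in>U. F x \<in> U \<longrightarrow> V (F x) = V x) \<and>
     (\<forall>x\<in>U - {p}. closed_curve_surrounding p {y \<in> U. V y = V x}) \<and>
     isolated_nondegenerate_critical_point V U p"

definition locally_integrable_at ::
    "nat \<Rightarrow> (real^2) set \<Rightarrow> (real^2 \<Rightarrow> real^2) \<Rightarrow> real^2 \<Rightarrow> bool" where
  "locally_integrable_at m D F p \<longleftrightarrow>
     (\<exists>U V. open U \<and> p \<in> U \<and> U \<subseteq> D \<and> first_integral m F p U V)"

text \<open>
  The fixed point of \<open>F \<epsilon>\<close> corresponding to a fixed point \<open>p\<^sub>0\<close> of \<open>F 0\<close>: the continuous branch
  \<open>p\<close> through \<open>p\<^sub>0\<close> that describes all fixed points in a neighbourhood of \<open>p\<^sub>0\<close>, as provided by the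
  implicit function theorem (an elliptic fixed point does not have the eigenvalue 1).
\<close>

definition fixed_point_branch ::
    "(real^2) set \<Rightarrow> (real \<Rightarrow> real^2 \<Rightarrow> real^2) \<Rightarrow> real \<Rightarrow> real^2 \<Rightarrow> (real \<Rightarrow> real^2) \<Rightarrow> bool" where
  "fixed_point_branch D F e p0 p \<longleftrightarrow>
     p 0 = p0 \<and> continuous_on {- e<..<e} p \<and>
     (\<exists>U. open U \<and> p0 \<in> U \<and> (\<forall>\<epsilon>\<in>{- e<..<e}. {q \<in> D \<inter> U. F \<epsilon> q = q} = {p \<epsilon>}))"

end

theory Submission
  imports Defs "HOL-Library.Landau_Symbols"
begin

text \<open>
  Both maps are conjugate, near a fixed point, to $(x,y) \mapsto (y, -x + k(y))$; for the second
  family the conjugacy is $x = c e^u$. Let $t = k'$, $h_2 = k''$, $h_3 = k'''$ at the fixed point.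
  The twist (first Birkhoff) coefficient is a nonzero multiple of
  $W = h_3 (2-t)(1+t) + (2t+1) h_2^2$ divided by $(2-t)(1+t)$.

  A first integral with a nondegenerate critical point keeps orbits at an almost constant distance
  from the fixed point. If the twist does not vanish, then after $N \approx r^{-2}$ steps the
  accumulated rotation angles at the distances $r/2$ and $r$ differ by more than $2\pi$, so that on
  every ray some point comes back to its ray after $N$ steps. The first integral is strictly monotone
  on rays, hence that point is $N$-periodic, and there are infinitely many $N$-periodic points.
  For $\varepsilon \neq 0$ this is impossible: on the set of $N$-periodic sequences each $x_i^d$, with
  $d$ the degree of the numerator of the recurrence, equals a polynomial of smaller total degree, so
  the polynomial functions on that set form a finite dimensional space and each $x_i$ takes only
  finitely many values.

  The eigenvalues of order 3 and 4 ($t = -1$ and $t = 0$) are no obstacle, because the first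
  integral forces the resonant terms to vanish. At $\varepsilon = 0$ the twist is nonzero except for the
  first family with $a = 8$ at the points $\pm(\sqrt 3, \sqrt 3)$. There the fixed point equation
  makes $\varepsilon$ a function of the coordinate $y$ of the fixed point, $W$ becomes a rational
  function of $y$, and its behaviour at infinity shows that it does not vanish identically.
\<close>


subsection \<open>Dynamics of a twist map near its fixed point\<close>

text \<open>No exact conjugacy to a rotation is sought: resonances may obstruct it. An approximate
  one with error o(r^3) is built from the third-order jet of k alone. This order is just enough: an
  error o(r^3) in position is an error o(r^2) in angle, and over N steps, with N of order r^-2, it
  adds up to a small fraction of the difference of order b N r^2 produced by a twist coefficient b.
  The radius is not controlled by the normal form but by the first integral, whose value does not
  drift, so radial errors do not accumulate. The period N depends on r and not on the ray, which is
  what lets infinitely many points share one period. In the finiteness argument the numerator of the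
  recurrence must outweigh the two neighbours of a term. They enter as x_{n-1} + x_{n+1}, of degree
  1, or as x_{n-1} x_{n+1}, of degree 2; this is where deg g > 1 and deg g > 2 are used. The factors
  of W come from eliminating the coefficients of |z|^2 and Re(z^2) of the normal form, whose small
  divisors are 2 - t and, up to sign, (2 - t)(1 + t).\<close>

lemma iterates_norm_stable:
  fixes f :: "complex \<Rightarrow> complex" and v :: "complex \<Rightarrow> real"
  assumes c: "c \<noteq> 0"
    and v: "\<And>\<eta>. \<eta> > 0 \<Longrightarrow> \<exists>\<rho>>0. \<forall>z. cmod z < \<rho> \<longrightarrow> \<bar>v z - c * (cmod z)\<^sup>2\<bar> \<le> \<eta> * (cmod z)\<^sup>2"
    and \<rho>0: "\<rho>0 > 0"
    and inv: "\<And>z. cmod z < \<rho>0 \<Longrightarrow> v (f z) = v z"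
    and grow: "\<And>z. cmod z < \<rho>0 \<Longrightarrow> cmod (f z) \<le> 2 * cmod z"
    and \<eta>: "\<eta> > 0" "\<eta> \<le> 1"
  obtains \<rho> where "\<rho> > 0"
    "\<And>z n. cmod z < \<rho> \<Longrightarrow> \<bar>(cmod ((f ^^ n) z))\<^sup>2 - (cmod z)\<^sup>2\<bar> \<le> \<eta> * (cmod z)\<^sup>2"
    "\<And>z n. cmod z < \<rho> \<Longrightarrow> v ((f ^^ n) z) = v z"
proof -
  \<comment> \<open>17 = 16 + 1: before the sharp bound is available the next iterate is only known
    to have norm at most 4|z|, so the errors of v at the next iterate and at z add up to 17 \<eta>1
    |z|^2.\<close>
  define \<eta>1 where "\<eta>1 = \<bar>c\<bar> * \<eta> / 17"
  have \<eta>1: "\<eta>1 > 0" using c \<eta> by (simp add: \<eta>1_def)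
  from v[OF this] obtain \<rho>1 where \<rho>1: "\<rho>1 > 0"
    "\<And>z. cmod z < \<rho>1 \<Longrightarrow> \<bar>v z - c * (cmod z)\<^sup>2\<bar> \<le> \<eta>1 * (cmod z)\<^sup>2" by blast
  define \<rho> where "\<rho> = min \<rho>0 \<rho>1 / 4"
  have \<rho>: "\<rho> > 0" using \<rho>0 \<rho>1 by (simp add: \<rho>_def)
  \<comment> \<open>Each iterate is compared with z itself through the common value of v, not with
    its predecessor, so the same error bound holds for all n. The growth bound keeps the next
    iterate in the region where the estimate for v is valid.\<close>
  have main: "\<bar>(cmod ((f ^^ n) z))\<^sup>2 - (cmod z)\<^sup>2\<bar> \<le> \<eta> * (cmod z)\<^sup>2 \<and> v ((f ^^ n) z) = v z"
    if z: "cmod z < \<rho>" for z n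
  proof (induction n)
    case 0
    show ?case using \<eta> by simp
  next
    case (Suc n)
    let ?y = "(f ^^ n) z"
    have "(cmod ?y)\<^sup>2 \<le> (1 + \<eta>) * (cmod z)\<^sup>2"
      using Suc by (simp add: abs_le_iff algebra_simps)
    also have "\<dots> \<le> 4 * (cmod z)\<^sup>2"
      using \<eta> by (intro mult_right_mono) auto
    also have "\<dots> = (2 * cmod z)\<^sup>2" by (simp add: power_mult_distrib)
    finally have y2: "cmod ?y \<le> 2 * cmod z"
      by (rule power2_le_imp_le) auto
    hence "cmod ?y < \<rho>0" using z \<rho>0 \<rho>1 by (auto simp: \<rho>_def)
    hence fy: "v (f ?y) = v ?y" "cmod (f ?y) \<le> 2 * cmod ?y" using inv grow by auto
    hence y4: "cmod (f ?y) \<le> 4 * cmod z" using y2 by linarith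
    hence "cmod (f ?y) < \<rho>1" using z \<rho>0 \<rho>1 by (auto simp: \<rho>_def)
    note A = \<rho>1(2)[OF this]
    have "cmod z < \<rho>1" using z \<rho>0 \<rho>1 by (auto simp: \<rho>_def)
    note B = \<rho>1(2)[OF this]
    have eq: "v (f ?y) = v z" using fy Suc by simp
    have "(cmod (f ?y))\<^sup>2 \<le> (4 * cmod z)\<^sup>2" using y4 by (intro power_mono) auto
    hence S: "(cmod (f ?y))\<^sup>2 \<le> 16 * (cmod z)\<^sup>2" by (simp add: power_mult_distrib)
    have "\<bar>c\<bar> * \<bar>(cmod (f ?y))\<^sup>2 - (cmod z)\<^sup>2\<bar> = \<bar>c * (cmod (f ?y))\<^sup>2 - c * (cmod z)\<^sup>2\<bar>"
      by (simp flip: abs_mult add: right_diff_distrib)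
    also have "\<dots> \<le> \<eta>1 * (cmod (f ?y))\<^sup>2 + \<eta>1 * (cmod z)\<^sup>2" using A B eq by linarith
    also have "\<dots> \<le> \<eta>1 * (16 * (cmod z)\<^sup>2) + \<eta>1 * (cmod z)\<^sup>2"
      using S \<eta>1 by (intro add_right_mono mult_left_mono) auto
    also have "\<dots> = \<bar>c\<bar> * (\<eta> * (cmod z)\<^sup>2)" by (simp add: \<eta>1_def)
    finally have "\<bar>(cmod (f ?y))\<^sup>2 - (cmod z)\<^sup>2\<bar> \<le> \<eta> * (cmod z)\<^sup>2" using c by simp
    thus ?case using eq by simp
  qed
  show ?thesis by (rule that[of \<rho>]) (use main \<rho> in auto)
qed

text \<open>Between the smaller and the larger endpoint value there is room for a full period;
  \<open>m\<close> rounds the smaller value up to the next multiple of 2 pi.\<close>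

lemma IVT_multiple_2pi:
  fixes g :: "real \<Rightarrow> real"
  assumes g: "continuous_on {a..b} g" and ab: "a \<le> b" and big: "\<bar>g b - g a\<bar> \<ge> 2 * pi"
  obtains s m where "a \<le> s" "s \<le> b" "g s = 2 * pi * of_int m"
proof -
  define lo where "lo = min (g a) (g b)"
  define hi where "hi = max (g a) (g b)"
  define m where "m = \<lceil>lo / (2*pi)\<rceil>"
  have "lo / (2*pi) \<le> m" "m < lo / (2*pi) + 1" unfolding m_def by linarith+
  hence "lo \<le> 2*pi*m" "2*pi*m < lo + 2*pi" by (auto simp: field_simps)
  moreover have "lo + 2*pi \<le> hi" using big by (auto simp: lo_def hi_def)
  ultimately have m: "lo \<le> 2*pi*m" "2*pi*m \<le> hi" by auto
  have "\<exists>s. a \<le> s \<and> s \<le> b \<and> g s = 2*pi*m"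
  proof (cases "g a \<le> g b")
    case True
    thus ?thesis using IVT'[of g a "2*pi*m" b] m ab g by (auto simp: lo_def hi_def)
  next
    case False
    thus ?thesis using IVT2'[of g b "2*pi*m" a] m ab g by (auto simp: lo_def hi_def)
  qed
  thus ?thesis using that by blast
qed

text \<open>The order of quantifiers matters: \<open>N\<close> and \<open>r\<close> are chosen
  before the ray. The angle turned in N steps is lifted to a real function of the starting radius,
  continuous on [r/2, r], so that the intermediate value theorem applies to it.\<close>

lemma periodic_point_on_every_ray:
  fixes f :: "complex \<Rightarrow> complex" and v :: "complex \<Rightarrow> real"
  assumes c: "c \<noteq> 0" and b: "b \<noteq> 0"
    and v: "\<And>\<eta>. \<eta> > 0 \<Longrightarrow> \<exists>\<rho>>0. \<forall>z. cmod z < \<rho> \<longrightarrow> \<bar>v z - c * (cmod z)\<^sup>2\<bar> \<le> \<eta> * (cmod z)\<^sup>2"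
    and \<rho>0: "\<rho>0 > 0"
    and inv: "\<And>z. cmod z < \<rho>0 \<Longrightarrow> v (f z) = v z"
    and mono: "\<And>\<theta> s s'. 0 < s \<Longrightarrow> s < s' \<Longrightarrow> s' < \<rho>0 \<Longrightarrow> v (of_real s * cis \<theta>) \<noteq> v (of_real s' * cis \<theta>)"
    and cont: "continuous_on (ball 0 \<rho>0) f"
    and f: "\<And>\<eta>. \<eta> > 0 \<Longrightarrow> \<exists>\<rho>>0. \<forall>z. cmod z < \<rho> \<longrightarrow>
              cmod (f z - z * cis (\<alpha> + b * (cmod z)\<^sup>2)) \<le> \<eta> * (cmod z) ^ 3"
  obtains N r where "N > 0" "r > 0"
    "\<And>\<theta>. \<exists>s. r / 2 \<le> s \<and> s \<le> r \<and> (f ^^ N) (of_real s * cis \<theta>) = of_real s * cis \<theta> \<and>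
          (\<forall>j. cmod ((f ^^ j) (of_real s * cis \<theta>)) < \<rho>0)"
proof -
  \<comment> \<open>At an iterate y with |y|^2 \<le> 17/16 |z|^2 the angular error is at most 2
    \<eta>2 |y|^2, and 1/64 keeps this below |b| |z|^2 / 16. The cap 1/4 keeps the quotient
    \<open>G\<close> within 1/2 of 1.\<close>
  define \<eta>2 where "\<eta>2 = min (\<bar>b\<bar> / 64) (1/4)"
  have \<eta>2: "\<eta>2 > 0" "\<eta>2 \<le> \<bar>b\<bar> / 64" "\<eta>2 \<le> 1/4" using b by (auto simp: \<eta>2_def)
  from f[OF \<eta>2(1)] obtain \<rho>2 where \<rho>2: "\<rho>2 > 0"
    "\<And>z. cmod z < \<rho>2 \<Longrightarrow> cmod (f z - z * cis (\<alpha> + b * (cmod z)\<^sup>2)) \<le> \<eta>2 * (cmod z) ^ 3" by blast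
  define \<rho>3 where "\<rho>3 = min (min \<rho>0 \<rho>2) 1"
  have \<rho>3: "\<rho>3 > 0" "\<rho>3 \<le> \<rho>0" "\<rho>3 \<le> \<rho>2" "\<rho>3 \<le> 1" using \<rho>0 \<rho>2 by (auto simp: \<rho>3_def)
  \<comment> \<open>The true image divided by the model rotation. It stays in the right half plane,
    so the principal logarithm supplies its argument \<open>\<delta>\<close> without a branch jump,
    and \<open>\<delta>\<close> is continuous away from 0.\<close>
  define G where "G z = f z / (z * cis (\<alpha> + b * (cmod z)\<^sup>2))" for z
  define \<delta> where "\<delta> z = Im (Ln (G z))" for z
  have G1: "cmod (G z - 1) \<le> \<eta>2 * (cmod z)\<^sup>2" if "cmod z < \<rho>3" "z \<noteq> 0" for z
  proof -
    have "G z - 1 = (f z - z * cis (\<alpha> + b * (cmod z)\<^sup>2)) / (z * cis (\<alpha> + b * (cmod z)\<^sup>2))"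
      using that by (simp add: G_def field_simps)
    hence "cmod (G z - 1) = cmod (f z - z * cis (\<alpha> + b * (cmod z)\<^sup>2)) / cmod z"
      by (simp add: norm_divide norm_mult)
    also have "\<dots> \<le> \<eta>2 * (cmod z) ^ 3 / cmod z"
      using \<rho>2(2)[of z] that \<rho>3 by (intro divide_right_mono) auto
    also have "\<dots> = \<eta>2 * (cmod z)\<^sup>2" using that by (simp add: power3_eq_cube power2_eq_square)
    finally show ?thesis .
  qed
  have sq1: "(cmod z)\<^sup>2 < 1" if "cmod z < \<rho>3" for z
    using that \<rho>3 by (simp add: power_less_one_iff abs_square_less_1)
  have G2: "cmod (G z - 1) < 1/2" if "cmod z < \<rho>3" "z \<noteq> 0" for z
  proof -
    have "\<eta>2 * (cmod z)\<^sup>2 \<le> 1/4 * 1" using sq1[OF that(1)] \<eta>2 by (intro mult_mono) auto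
    thus ?thesis using G1[OF that] by linarith
  qed
  have Gnz: "G z \<noteq> 0" "Re (G z) > 0" if "cmod z < \<rho>3" "z \<noteq> 0" for z
    using G2[OF that] abs_Re_le_cmod[of "G z - 1"] by auto
  have \<delta>: "\<bar>\<delta> z\<bar> \<le> 2 * \<eta>2 * (cmod z)\<^sup>2" if "cmod z < \<rho>3" "z \<noteq> 0" for z
  proof -
    have "\<bar>\<delta> z\<bar> \<le> cmod (Ln (1 + (G z - 1)))" by (simp add: \<delta>_def abs_Im_le_cmod)
    also have "\<dots> \<le> 2 * cmod (G z - 1)" by (rule norm_Ln_le[OF G2[OF that]])
    finally show ?thesis using G1[OF that] by linarith
  qed
  have step: "f z = of_real (cmod (f z)) * cis (\<theta> + (\<alpha> + b * (cmod z)\<^sup>2 + \<delta> z))"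
    if z: "cmod z < \<rho>3" "z \<noteq> 0" "z = of_real (cmod z) * cis \<theta>" for z \<theta>
  proof -
    have "G z = exp (Ln (G z))" using Gnz[OF z(1,2)] by simp
    also have "\<dots> = of_real (exp (Re (Ln (G z)))) * cis (\<delta> z)"
      unfolding \<delta>_def by (simp add: exp_eq_polar)
    finally have G: "G z = of_real (exp (Re (Ln (G z)))) * cis (\<delta> z)" .
    have "f z = z * cis (\<alpha> + b * (cmod z)\<^sup>2) * G z" using z by (simp add: G_def)
    also have "\<dots> = of_real (cmod z) * cis \<theta> * cis (\<alpha> + b * (cmod z)\<^sup>2) * G z" using z(3) by simp
    also have "\<dots> = of_real (cmod z * exp (Re (Ln (G z)))) * cis (\<theta> + (\<alpha> + b * (cmod z)\<^sup>2 + \<delta> z))"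
      by (subst G) (simp add: cis_mult mult_ac add_ac flip: cis_mult)
    finally have E: "f z = of_real (cmod z * exp (Re (Ln (G z)))) * cis (\<theta> + (\<alpha> + b * (cmod z)\<^sup>2 + \<delta> z))" .
    have "cmod (f z) = cmod z * exp (Re (Ln (G z)))" by (subst E) (simp add: norm_mult)
    thus ?thesis using E by simp
  qed
  have grow: "cmod (f z) \<le> 2 * cmod z" if z: "cmod z < \<rho>3" for z
  proof -
    have "cmod (f z) \<le> cmod (f z - z * cis (\<alpha> + b * (cmod z)\<^sup>2)) + cmod (z * cis (\<alpha> + b * (cmod z)\<^sup>2))"
      using norm_triangle_sub by (metis add.commute)
    also have "\<dots> \<le> \<eta>2 * (cmod z) ^ 3 + cmod z"
      using \<rho>2(2)[of z] z \<rho>3 by (auto simp: norm_mult)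
    also have "\<eta>2 * (cmod z) ^ 3 = (\<eta>2 * (cmod z)\<^sup>2) * cmod z" by (simp add: power3_eq_cube power2_eq_square)
    also have "\<dots> \<le> (1 * 1) * cmod z"
      using sq1[OF z] \<eta>2 by (intro mult_right_mono mult_mono) auto
    finally show ?thesis by simp
  qed
  obtain \<rho> where \<rho>: "\<rho> > 0"
    "\<And>z n. cmod z < \<rho> \<Longrightarrow> \<bar>(cmod ((f ^^ n) z))\<^sup>2 - (cmod z)\<^sup>2\<bar> \<le> 1/16 * (cmod z)\<^sup>2"
    "\<And>z n. cmod z < \<rho> \<Longrightarrow> v ((f ^^ n) z) = v z"
    by (rule iterates_norm_stable[of c v \<rho>3 f "1/16"]) (use c v inv grow \<rho>3 in auto)
  \<comment> \<open>Iterates at most double the norm, so orbits starting at radius at most r never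
    leave the disc of radius \<open>\<rho>3\<close>.\<close>
  define r where "r = min \<rho> \<rho>3 / 4"
  have r: "r > 0" "r < \<rho>" using \<rho> \<rho>3 by (auto simp: r_def)
  have orb: "cmod ((f ^^ n) z) < \<rho>3" "(f ^^ n) z \<noteq> 0"
    "\<bar>(cmod ((f ^^ n) z))\<^sup>2 - (cmod z)\<^sup>2\<bar> \<le> 1/16 * (cmod z)\<^sup>2" if z: "z \<noteq> 0" "cmod z \<le> r" for z n
  proof -
    show *: "\<bar>(cmod ((f ^^ n) z))\<^sup>2 - (cmod z)\<^sup>2\<bar> \<le> 1/16 * (cmod z)\<^sup>2"
      using \<rho>(2) z r by auto
    have zp: "(cmod z)\<^sup>2 > 0" using z by simp
    show "(f ^^ n) z \<noteq> 0"
    proof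
      assume "(f ^^ n) z = 0"
      thus False using * zp by simp
    qed
    have "(cmod ((f ^^ n) z))\<^sup>2 \<le> 4 * (cmod z)\<^sup>2" using * zp by linarith
    hence "(cmod ((f ^^ n) z))\<^sup>2 \<le> (2 * cmod z)\<^sup>2" by (simp add: power_mult_distrib)
    hence "cmod ((f ^^ n) z) \<le> 2 * cmod z" by (rule power2_le_imp_le) auto
    thus "cmod ((f ^^ n) z) < \<rho>3" using z \<rho>3 \<rho> by (auto simp: r_def)
  qed
  \<comment> \<open>The angle turned in n steps as a real number, not modulo 2 pi: the single-step
    angles are summed along the orbit.\<close>
  define \<Theta> where "\<Theta> n z = (\<Sum>j<n. \<alpha> + b * (cmod ((f ^^ j) z))\<^sup>2 + \<delta> ((f ^^ j) z))" for n z
  have polar: "(f ^^ n) z = of_real (cmod ((f ^^ n) z)) * cis (\<theta> + \<Theta> n z)"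
    if z: "z \<noteq> 0" "cmod z \<le> r" "z = of_real (cmod z) * cis \<theta>" for z \<theta> n
  proof (induction n)
    case 0
    show ?case using z by (simp add: \<Theta>_def)
  next
    case (Suc n)
    have "f ((f ^^ n) z) = of_real (cmod (f ((f ^^ n) z))) *
        cis (\<theta> + \<Theta> n z + (\<alpha> + b * (cmod ((f ^^ n) z))\<^sup>2 + \<delta> ((f ^^ n) z)))"
      by (rule step) (use orb z Suc in auto)
    thus ?case by (simp add: \<Theta>_def add_ac)
  qed
  have est: "\<bar>\<Theta> n z - real n * \<alpha> - real n * b * (cmod z)\<^sup>2\<bar> \<le> real n * (\<bar>b\<bar> * (cmod z)\<^sup>2 / 8)"
    if z: "z \<noteq> 0" "cmod z \<le> r" for z n
  proof -
    have "\<Theta> n z - real n * \<alpha> - real n * b * (cmod z)\<^sup>2 =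
        (\<Sum>j<n. b * ((cmod ((f ^^ j) z))\<^sup>2 - (cmod z)\<^sup>2) + \<delta> ((f ^^ j) z))"
      by (simp add: \<Theta>_def sum.distrib sum_subtractf algebra_simps flip: sum_distrib_left)
    also have "\<bar>\<dots>\<bar> \<le> (\<Sum>j<n. \<bar>b\<bar> * (cmod z)\<^sup>2 / 8)"
    proof (rule order_trans[OF sum_abs sum_mono])
      fix j
      let ?y = "(f ^^ j) z"
      note o = orb[OF z, of j]
      have "(cmod ?y)\<^sup>2 \<le> 17/16 * (cmod z)\<^sup>2" using o(3) by linarith
      hence "2 * \<eta>2 * (cmod ?y)\<^sup>2 \<le> 2 * (\<bar>b\<bar> / 64) * (17/16 * (cmod z)\<^sup>2)"
        using \<eta>2 by (intro mult_mono) auto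
      moreover have "0 \<le> \<bar>b\<bar> * (cmod z)\<^sup>2" by simp
      ultimately have "\<bar>\<delta> ?y\<bar> \<le> 1/16 * (\<bar>b\<bar> * (cmod z)\<^sup>2)" using \<delta>[OF o(1,2)] by linarith
      moreover have "\<bar>b * ((cmod ?y)\<^sup>2 - (cmod z)\<^sup>2)\<bar> \<le> \<bar>b\<bar> * (1/16 * (cmod z)\<^sup>2)"
        unfolding abs_mult using o(3) by (intro mult_left_mono) auto
      ultimately show "\<bar>b * ((cmod ?y)\<^sup>2 - (cmod z)\<^sup>2) + \<delta> ?y\<bar> \<le> \<bar>b\<bar> * (cmod z)\<^sup>2 / 8"
        by linarith
    qed
    finally show ?thesis by simp
  qed
  \<comment> \<open>Put B = N b r^2. The lifted angle minus N \<alpha> is B up to |B|/8 at radius r,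
    and B/4 up to |B|/32 at radius r/2. The two differ by at least 19/32 |B|, hence by more than
    |B|/2, and |B| > 4 pi makes this exceed 2 pi.\<close>
  obtain N :: nat where N: "real N > 4 * pi / (\<bar>b\<bar> * r\<^sup>2)" using reals_Archimedean2 by blast
  have br: "\<bar>b\<bar> * r\<^sup>2 > 0" using b r by simp
  have N4: "real N * (\<bar>b\<bar> * r\<^sup>2) > 4 * pi" using N br by (simp add: field_simps)
  have N0: "N > 0" using N4 pi_gt_zero by (cases N) auto
  have ray: "of_real s * cis \<theta> \<noteq> 0" "cmod (of_real s * cis \<theta>) \<le> r" if "s \<in> {r/2..r}" for s \<theta>
    using that r by (auto simp: norm_mult)
  have fc: "continuous_on {r/2..r} (\<lambda>s. (f ^^ n) (of_real s * cis \<theta>))" for n \<theta>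
  proof (induction n)
    case 0
    have "continuous_on {r/2..r} (\<lambda>s. (of_real s * cis \<theta>)::complex)"
      by (rule continuous_on_mult[OF continuous_on_of_real[OF continuous_on_id] continuous_on_const])
    thus ?case by (simp only: funpow_0)
  next
    case (Suc n)
    have "continuous_on {r/2..r} (f \<circ> (\<lambda>s. (f ^^ n) (of_real s * cis \<theta>)))"
    proof (rule continuous_on_compose[OF Suc])
      show "continuous_on ((\<lambda>s. (f ^^ n) (complex_of_real s * cis \<theta>)) ` {r / 2..r}) f"
      proof (rule continuous_on_subset[OF cont], rule image_subsetI)
        fix s assume "s \<in> {r/2..r}"
        from orb(1)[OF ray[OF this], of n \<theta>] show "(f ^^ n) (complex_of_real s * cis \<theta>) \<in> ball 0 \<rho>0"
          using \<rho>3 by simp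
      qed
    qed
    thus ?case by (simp add: o_def)
  qed
  have Gc: "continuous_on (ball 0 \<rho>3 - {0}) G"
    unfolding G_def
    by (intro continuous_intros continuous_on_subset[OF cont]) (use \<rho>3 in auto)
  have \<delta>c: "continuous_on (ball 0 \<rho>3 - {0}) \<delta>"
    unfolding \<delta>_def
    by (intro continuous_intros Gc) (use Gnz(2) in \<open>fastforce simp: complex_nonpos_Reals_iff\<close>)
  have "\<exists>s. r / 2 \<le> s \<and> s \<le> r \<and> (f ^^ N) (of_real s * cis \<theta>) = of_real s * cis \<theta> \<and>
          (\<forall>j. cmod ((f ^^ j) (of_real s * cis \<theta>)) < \<rho>0)" for \<theta>
  proof -
    define g where "g s = \<Theta> N (of_real s * cis \<theta>)" for s
    have dc: "continuous_on {r/2..r} (\<lambda>s. \<delta> ((f ^^ j) (of_real s * cis \<theta>)))" for j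
    proof -
      have "continuous_on {r/2..r} (\<delta> \<circ> (\<lambda>s. (f ^^ j) (of_real s * cis \<theta>)))"
      proof (rule continuous_on_compose[OF fc])
        show "continuous_on ((\<lambda>s. (f ^^ j) (complex_of_real s * cis \<theta>)) ` {r / 2..r}) \<delta>"
        proof (rule continuous_on_subset[OF \<delta>c], rule image_subsetI)
          fix s assume "s \<in> {r/2..r}"
          from orb(1,2)[OF ray[OF this], of j \<theta>]
          show "(f ^^ j) (complex_of_real s * cis \<theta>) \<in> ball 0 \<rho>3 - {0}" by simp
        qed
      qed
      thus ?thesis by (simp add: o_def)
    qed
    have gc: "continuous_on {r/2..r} g"
      unfolding g_def \<Theta>_def by (intro continuous_intros fc dc)
    have e1: "\<bar>g r - real N * \<alpha> - real N * b * r\<^sup>2\<bar> \<le> real N * (\<bar>b\<bar> * r\<^sup>2 / 8)"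
      using est[of "of_real r * cis \<theta>" N] r by (simp add: g_def norm_mult)
    have e2: "\<bar>g (r/2) - real N * \<alpha> - real N * b * (r/2)\<^sup>2\<bar> \<le> real N * (\<bar>b\<bar> * (r/2)\<^sup>2 / 8)"
      using est[of "of_real (r/2) * cis \<theta>" N] r by (simp add: g_def norm_mult power_divide)
    define B where "B = real N * b * r\<^sup>2"
    have B: "real N * (\<bar>b\<bar> * r\<^sup>2) = \<bar>B\<bar>" by (simp add: B_def abs_mult)
    have "\<bar>g r - real N * \<alpha> - B\<bar> \<le> \<bar>B\<bar> / 8"
      using e1 B by (simp add: B_def)
    moreover have "\<bar>g (r/2) - real N * \<alpha> - B / 4\<bar> \<le> \<bar>B\<bar> / 32"
      using e2 B by (simp add: B_def power_divide)
    ultimately have "\<bar>g r - g (r/2)\<bar> \<ge> \<bar>B\<bar> / 2" by (cases "B \<ge> 0") linarith+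
    hence "\<bar>g r - g (r/2)\<bar> \<ge> 2 * pi" using N4 B by linarith
    from IVT_multiple_2pi[OF gc _ this] r obtain s m
      where s: "r/2 \<le> s" "s \<le> r" "g s = 2 * pi * of_int m" by auto
    define z where "z = of_real s * cis \<theta>"
    have s0: "s > 0" using s r by linarith
    have z: "z \<noteq> 0" "cmod z = s" using s0 by (auto simp: z_def norm_mult)
    define s' where "s' = cmod ((f ^^ N) z)"
    have "(f ^^ N) z = of_real s' * cis (\<theta> + \<Theta> N z)"
      unfolding s'_def by (rule polar) (use z s in \<open>auto simp: z_def\<close>)
    also have "\<Theta> N z = 2 * pi * of_int m" using s(3) by (simp add: g_def z_def)
    also have "cis (\<theta> + 2 * pi * of_int m) = cis \<theta>"
      by (simp add: cis_multiple_2pi flip: cis_mult)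
    finally have fz: "(f ^^ N) z = of_real s' * cis \<theta>" .
    have vz: "v ((f ^^ N) z) = v z" using \<rho>(3) z s r by auto
    have s'0: "s' > 0" using orb(2)[of z N] z s by (simp add: s'_def)
    have s'3: "s' < \<rho>0" using orb(1)[of z N] z s \<rho>3 by (simp add: s'_def)
    have s3: "s < \<rho>0" using orb(1)[of z 0] z s \<rho>3 by simp
    have "s' = s"
    proof (rule ccontr)
      assume "s' \<noteq> s"
      then consider "s < s'" | "s' < s" by linarith
      thus False
        using mono[of s s' \<theta>] mono[of s' s \<theta>] s0 s'0 s'3 s3 vz fz by cases (auto simp: z_def)
    qed
    thus ?thesis using s fz orb(1)[of z] z \<rho>3 unfolding z_def
      by (metis less_le_trans)
  qed
  thus ?thesis using that N0 r by blast
qed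

text \<open>Solving z + \<phi> z = y is a fixed point problem for the contraction z -> y - \<phi> z,
  which maps the closed disc of radius \<rho> into itself when |y| \<le> \<rho>/2. The inverse is
  obtained as a Lipschitz function, from Lipschitz bounds on \<phi> alone.\<close>

lemma lipschitz_perturbation_inverse:
  fixes \<phi> :: "complex \<Rightarrow> complex"
  assumes \<rho>: "\<rho> > 0" and \<phi>0: "\<phi> 0 = 0"
    and lip: "\<And>z w. cmod z \<le> \<rho> \<Longrightarrow> cmod w \<le> \<rho> \<Longrightarrow> cmod (\<phi> z - \<phi> w) \<le> cmod (z - w) / 2"
  obtains g where
    "\<And>y. cmod y \<le> \<rho> / 2 \<Longrightarrow> cmod (g y) \<le> \<rho> \<and> g y + \<phi> (g y) = y"
    "\<And>z. cmod z \<le> \<rho> \<Longrightarrow> cmod (z + \<phi> z) \<le> \<rho> / 2 \<Longrightarrow> g (z + \<phi> z) = z"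
    "\<And>y y'. cmod y \<le> \<rho> / 2 \<Longrightarrow> cmod y' \<le> \<rho> / 2 \<Longrightarrow> cmod (g y - g y') \<le> 2 * cmod (y - y')"
proof -
  have ex: "\<exists>!z\<in>cball 0 \<rho>. y - \<phi> z = z" if y: "cmod y \<le> \<rho> / 2" for y
  proof (rule Banach_fix[where c = "1/2"])
    show "complete (cball (0::complex) \<rho>)" by (simp add: complete_eq_closed)
    show "cball (0::complex) \<rho> \<noteq> {}" using \<rho> by simp
    show "(\<lambda>z. y - \<phi> z) ` cball 0 \<rho> \<subseteq> cball 0 \<rho>"
    proof
      fix u assume "u \<in> (\<lambda>z. y - \<phi> z) ` cball 0 \<rho>"
      then obtain z where z: "cmod z \<le> \<rho>" "u = y - \<phi> z" by auto
      have "cmod (\<phi> z) \<le> cmod z / 2" using lip[of z 0] z \<rho> \<phi>0 by simp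
      thus "u \<in> cball 0 \<rho>" using z y norm_triangle_ineq4[of y "\<phi> z"] by simp
    qed
    show "\<And>x z. x \<in> cball 0 \<rho> \<Longrightarrow> z \<in> cball 0 \<rho> \<Longrightarrow> dist (y - \<phi> x) (y - \<phi> z) \<le> 1 / 2 * dist x z"
      using lip by (simp add: dist_norm norm_minus_commute)
  qed auto
  define g where "g y = (THE z. z \<in> cball 0 \<rho> \<and> y - \<phi> z = z)" for y
  have g: "cmod (g y) \<le> \<rho> \<and> g y + \<phi> (g y) = y" if "cmod y \<le> \<rho> / 2" for y
    using theI'[OF ex[OF that]] unfolding g_def[symmetric] by (auto simp: algebra_simps)
  have g': "g (z + \<phi> z) = z" if "cmod z \<le> \<rho>" "cmod (z + \<phi> z) \<le> \<rho> / 2" for z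
    unfolding g_def by (rule the1_equality[OF ex[OF that(2)]]) (use that in auto)
  have "cmod (g y - g y') \<le> 2 * cmod (y - y')" if "cmod y \<le> \<rho> / 2" "cmod y' \<le> \<rho> / 2" for y y'
  proof -
    have "cmod (g y - g y') = cmod ((y - y') - (\<phi> (g y) - \<phi> (g y')))"
      using g[OF that(1)] g[OF that(2)] by (metis add_diff_cancel_right' add_diff_add)
    also have "\<dots> \<le> cmod (y - y') + cmod (g y - g y') / 2"
      using lip[of "g y" "g y'"] g that norm_triangle_ineq4 by (smt (verit, best))
    finally show ?thesis by simp
  qed
  thus ?thesis using that g g' by blast
qed

text \<open>The map id + \<phi> conjugates \<open>T\<close> to the twist rotation \<open>R\<close>
  up to o(|z|^3). Conjugating \<open>T\<close> back by it gives a map f that differs from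
  \<open>R\<close> by o(|z|^3) and has the same periodic orbits in the new coordinates. The
  hypothesis on \<open>V\<close> bounds increments by r |z' - z|, not values by r^2, because strict
  monotonicity on rays compares points that may be arbitrarily close.\<close>

lemma infinitely_many_periodic_points:
  fixes T \<phi> :: "complex \<Rightarrow> complex" and V :: "complex \<Rightarrow> real" and \<alpha> b :: real
  defines "R \<equiv> \<lambda>z. z * cis (\<alpha> + b * (cmod z)\<^sup>2)"
  assumes \<kappa>: "\<kappa> \<noteq> 0" and b: "b \<noteq> 0" and \<rho>0: "\<rho>0 > 0"
    and V: "\<And>\<eta>. \<eta> > 0 \<Longrightarrow> \<exists>\<rho>>0. \<forall>r z z'. r < \<rho> \<longrightarrow> cmod z \<le> r \<longrightarrow> cmod z' \<le> r \<longrightarrow>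
              \<bar>V z' - V z - \<kappa> * ((cmod z')\<^sup>2 - (cmod z)\<^sup>2)\<bar> \<le> \<eta> * r * cmod (z' - z)"
    and \<phi>0: "\<phi> 0 = 0"
    and \<phi>: "\<And>\<eta>. \<eta> > 0 \<Longrightarrow> \<exists>\<rho>>0. \<forall>z w. cmod z < \<rho> \<longrightarrow> cmod w < \<rho> \<longrightarrow>
              cmod (\<phi> z - \<phi> w) \<le> \<eta> * cmod (z - w)"
    and T: "\<And>\<eta>. \<eta> > 0 \<Longrightarrow> \<exists>\<rho>>0. \<forall>z. cmod z < \<rho> \<longrightarrow>
              cmod (T (z + \<phi> z) - (R z + \<phi> (R z))) \<le> \<eta> * (cmod z) ^ 3"
    and cont: "continuous_on (ball 0 \<rho>0) T"
    and inv: "\<And>w. cmod w < \<rho>0 \<Longrightarrow> cmod (T w) < \<rho>0 \<Longrightarrow> V (T w) = V w"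
  shows "\<exists>N>0. infinite {w. (\<forall>j. cmod ((T ^^ j) w) < \<rho>0) \<and> (T ^^ N) w = w}"
proof -
  define \<Psi> where "\<Psi> z = z + \<phi> z" for z
  have R[simp]: "cmod (R z) = cmod z" for z by (simp add: R_def norm_mult)
  \<comment> \<open>1/20 leaves room in the monotonicity argument: two errors of relative size 1/20
    and their product 1/400 keep |w'|^2 - |w|^2 above half of its main term K = (s' - s)(s' +
    s).\<close>
  obtain \<rho>a where \<rho>a: "\<rho>a > 0" "\<And>z w. cmod z < \<rho>a \<Longrightarrow> cmod w < \<rho>a \<Longrightarrow> cmod (\<phi> z - \<phi> w) \<le> 1/20 * cmod (z - w)"
    using \<phi>[of "1/20"] by auto
  obtain \<rho>b where \<rho>b: "\<rho>b > 0" "\<And>z. cmod z < \<rho>b \<Longrightarrow> cmod (T (\<Psi> z) - \<Psi> (R z)) \<le> 1 * (cmod z) ^ 3"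
    using T[of 1] unfolding \<Psi>_def by auto
  define \<rho>1 where "\<rho>1 = min (min \<rho>a \<rho>b) (min \<rho>0 1) / 2"
  have \<rho>1: "\<rho>1 > 0" "\<rho>1 < \<rho>a" "\<rho>1 < \<rho>b" "\<rho>1 < \<rho>0" "\<rho>1 < 1"
    using \<rho>a \<rho>b \<rho>0 by (auto simp: \<rho>1_def)
  have lip20: "cmod (\<phi> z - \<phi> w) \<le> cmod (z - w) / 20" if "cmod z \<le> \<rho>1" "cmod w \<le> \<rho>1" for z w
    using \<rho>a(2)[of z w] that \<rho>1 by simp
  obtain g where g:
    "\<And>y. cmod y \<le> \<rho>1 / 2 \<Longrightarrow> cmod (g y) \<le> \<rho>1 \<and> g y + \<phi> (g y) = y"
    "\<And>z. cmod z \<le> \<rho>1 \<Longrightarrow> cmod (z + \<phi> z) \<le> \<rho>1 / 2 \<Longrightarrow> g (z + \<phi> z) = z"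
    "\<And>y y'. cmod y \<le> \<rho>1 / 2 \<Longrightarrow> cmod y' \<le> \<rho>1 / 2 \<Longrightarrow> cmod (g y - g y') \<le> 2 * cmod (y - y')"
  proof (rule lipschitz_perturbation_inverse[of \<rho>1 \<phi>])
    show "cmod (\<phi> z - \<phi> w) \<le> cmod (z - w) / 2" if "cmod z \<le> \<rho>1" "cmod w \<le> \<rho>1" for z w
      using lip20[OF that] norm_ge_zero[of "z - w"] by linarith
  qed (use \<rho>1 \<phi>0 in auto)
  have \<Psi>diff: "cmod (\<Psi> z - \<Psi> w - (z - w)) \<le> cmod (z - w) / 20" if "cmod z \<le> \<rho>1" "cmod w \<le> \<rho>1" for z w
    using lip20[OF that] by (simp add: \<Psi>_def algebra_simps)
  have \<Psi>near: "cmod (\<Psi> z - z) \<le> cmod z / 20" if "cmod z \<le> \<rho>1" for z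
    using \<Psi>diff[of z 0] that \<rho>1 \<phi>0 by (simp add: \<Psi>_def)
  have \<Psi>n: "cmod (\<Psi> z) \<le> 2 * cmod z" if "cmod z \<le> \<rho>1" for z
    using \<Psi>near[OF that] norm_triangle_sub[of "\<Psi> z" z] norm_ge_zero[of z] by linarith
  have cube: "(cmod z) ^ 3 \<le> cmod z" if "cmod z \<le> \<rho>1" for z
  proof -
    have "(cmod z) ^ 3 \<le> (cmod z) ^ 1" by (rule power_decreasing) (use that \<rho>1 in auto)
    thus ?thesis by simp
  qed
  \<comment> \<open>The norm of \<open>T (\<Psi> z)\<close> is at most 3|z|, so the factor 6 places
    it in the disc of radius \<rho>1/2 on which the inverse \<open>g\<close> is controlled.\<close>
  define \<rho>2 where "\<rho>2 = \<rho>1 / 6"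
  have \<rho>2: "\<rho>2 > 0" "\<rho>2 < \<rho>1" "6 * \<rho>2 = \<rho>1" using \<rho>1 by (auto simp: \<rho>2_def)
  have T\<Psi>: "cmod (T (\<Psi> z)) \<le> \<rho>1 / 2" if z: "cmod z \<le> \<rho>2" for z
  proof -
    have "cmod (T (\<Psi> z)) \<le> cmod (T (\<Psi> z) - \<Psi> (R z)) + cmod (\<Psi> (R z))"
      by (metis diff_add_cancel norm_triangle_ineq)
    also have "\<dots> \<le> cmod z + 2 * cmod z"
      using \<rho>b(2)[of z] cube[of z] \<Psi>n[of "R z"] z \<rho>2 \<rho>1 by (intro add_mono) auto
    finally show ?thesis using z \<rho>2 by linarith
  qed
  define f where "f z = g (T (\<Psi> z))" for z
  have f\<Psi>: "\<Psi> (f z) = T (\<Psi> z)" "cmod (f z) \<le> \<rho>1" if "cmod z \<le> \<rho>2" for z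
    using g(1)[OF T\<Psi>[OF that]] by (auto simp: f_def \<Psi>_def)
  have fR: "cmod (f z - R z) \<le> 2 * cmod (T (\<Psi> z) - \<Psi> (R z))" if z: "cmod z \<le> \<rho>2" for z
  proof -
    have *: "cmod (\<Psi> (R z)) \<le> \<rho>1 / 2" using \<Psi>n[of "R z"] z \<rho>2 by simp
    have "g (\<Psi> (R z)) = R z" using g(2)[of "R z"] * z \<rho>2 by (simp add: \<Psi>_def)
    thus ?thesis using g(3)[OF T\<Psi>[OF z] *] by (simp add: f_def)
  qed
  define v where "v z = V (\<Psi> z) - V 0" for z
  have fas: "\<exists>\<rho>>0. \<forall>z. cmod z < \<rho> \<longrightarrow> cmod (f z - z * cis (\<alpha> + b * (cmod z)\<^sup>2)) \<le> \<eta> * (cmod z) ^ 3"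
    if "\<eta> > 0" for \<eta>
  proof -
    obtain \<rho> where \<rho>: "\<rho> > 0" "\<And>z. cmod z < \<rho> \<Longrightarrow> cmod (T (\<Psi> z) - \<Psi> (R z)) \<le> \<eta> / 2 * (cmod z) ^ 3"
      using T[of "\<eta>/2"] \<open>\<eta> > 0\<close> unfolding \<Psi>_def by auto
    show ?thesis
    proof (intro exI[of _ "min \<rho> \<rho>2"] conjI allI impI)
      fix z assume z: "cmod z < min \<rho> \<rho>2"
      show "cmod (f z - z * cis (\<alpha> + b * (cmod z)\<^sup>2)) \<le> \<eta> * (cmod z) ^ 3"
        using fR[of z] \<rho>(2)[of z] z by (simp add: R_def)
    qed (use \<rho> \<rho>2 in auto)
  qed
  have \<Psi>c: "continuous_on (ball 0 \<rho>2) \<Psi>"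
  proof (rule continuous_onI)
    fix x e :: real and z :: complex assume "z \<in> ball 0 \<rho>2" "e > 0"
    show "\<exists>d>0. \<forall>x'\<in>ball 0 \<rho>2. dist x' z < d \<longrightarrow> dist (\<Psi> x') (\<Psi> z) \<le> e"
    proof (intro exI[of _ "e/2"] conjI ballI impI)
      fix x' assume x': "x' \<in> ball 0 \<rho>2" "dist x' z < e/2"
      have "cmod (\<Psi> x' - \<Psi> z) \<le> cmod (\<Psi> x' - \<Psi> z - (x' - z)) + cmod (x' - z)"
        by (metis diff_add_cancel norm_triangle_ineq)
      also have "\<dots> \<le> cmod (x' - z) / 20 + cmod (x' - z)"
        by (intro add_right_mono \<Psi>diff) (use x' \<open>z \<in> _\<close> \<rho>2 in auto)
      finally show "dist (\<Psi> x') (\<Psi> z) \<le> e"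
        using x'(2) norm_ge_zero[of "x' - z"] unfolding dist_norm by linarith
    qed (use \<open>e > 0\<close> in auto)
  qed
  have gc: "continuous_on (cball 0 (\<rho>1 / 2)) g"
  proof (rule continuous_onI)
    fix x e :: real and z :: complex assume "z \<in> cball 0 (\<rho>1/2)" "e > 0"
    thus "\<exists>d>0. \<forall>x'\<in>cball 0 (\<rho>1/2). dist x' z < d \<longrightarrow> dist (g x') (g z) \<le> e"
      using g(3)[of _ z] by (intro exI[of _ "e/2"]) (fastforce simp: dist_norm)
  qed
  have \<Psi>in: "\<Psi> ` ball 0 \<rho>2 \<subseteq> ball 0 \<rho>0"
  proof (rule image_subsetI)
    fix z :: complex assume "z \<in> ball 0 \<rho>2"
    thus "\<Psi> z \<in> ball 0 \<rho>0" using \<Psi>n[of z] \<rho>2 \<rho>1 by simp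
  qed
  have T\<Psi>c: "continuous_on (ball 0 \<rho>2) (T \<circ> \<Psi>)"
    by (rule continuous_on_compose[OF \<Psi>c continuous_on_subset[OF cont \<Psi>in]])
  have fc: "continuous_on (ball 0 \<rho>2) (g \<circ> (T \<circ> \<Psi>))"
    by (rule continuous_on_compose[OF T\<Psi>c], rule continuous_on_subset[OF gc]) (use T\<Psi> in auto)
  have finv: "v (f z) = v z" if z: "cmod z < \<rho>2" for z
    using inv[of "\<Psi> z"] f\<Psi>(1)[of z] T\<Psi>[of z] \<Psi>in z \<rho>1 by (force simp: v_def)
  have vas: "\<exists>\<rho>>0. \<forall>z. cmod z < \<rho> \<longrightarrow> \<bar>v z - \<kappa> * (cmod z)\<^sup>2\<bar> \<le> \<eta> * (cmod z)\<^sup>2" if \<eta>: "\<eta> > 0" for \<eta>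
  proof -
    obtain \<rho> where \<rho>: "\<rho> > 0" "\<And>r z z'. r < \<rho> \<Longrightarrow> cmod z \<le> r \<Longrightarrow> cmod z' \<le> r \<Longrightarrow>
              \<bar>V z' - V z - \<kappa> * ((cmod z')\<^sup>2 - (cmod z)\<^sup>2)\<bar> \<le> (\<eta> / 8) * r * cmod (z' - z)"
      using V[of "\<eta>/8"] \<eta> by auto
    have "\<exists>\<rho>>0. \<forall>z w. cmod z < \<rho> \<longrightarrow> cmod w < \<rho> \<longrightarrow> cmod (\<phi> z - \<phi> w) \<le> (\<eta> / (6 * \<bar>\<kappa>\<bar>)) * cmod (z - w)"
      using \<eta> \<kappa> by (intro \<phi>) auto
    then obtain \<rho>' where \<rho>': "\<rho>' > 0" "\<And>z w. cmod z < \<rho>' \<Longrightarrow> cmod w < \<rho>' \<Longrightarrow>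
        cmod (\<phi> z - \<phi> w) \<le> (\<eta> / (6 * \<bar>\<kappa>\<bar>)) * cmod (z - w)" by blast
    show ?thesis
    proof (intro exI[of _ "min (\<rho> / 2) (min \<rho>' \<rho>2)"] conjI allI impI)
      fix z assume z: "cmod z < min (\<rho> / 2) (min \<rho>' \<rho>2)"
      have n: "cmod (\<Psi> z) \<le> 2 * cmod z" using \<Psi>n[of z] z \<rho>2 by simp
      have "\<bar>V (\<Psi> z) - V 0 - \<kappa> * (cmod (\<Psi> z))\<^sup>2\<bar> \<le> (\<eta> / 8) * (2 * cmod z) * cmod (\<Psi> z)"
        using \<rho>(2)[of "2 * cmod z" 0 "\<Psi> z"] z n by simp
      also have "\<dots> \<le> (\<eta> / 8) * (2 * cmod z) * (2 * cmod z)"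
        using \<eta> n by (intro mult_left_mono) auto
      finally have 1: "\<bar>v z - \<kappa> * (cmod (\<Psi> z))\<^sup>2\<bar> \<le> \<eta> / 2 * (cmod z)\<^sup>2"
        by (simp add: v_def power2_eq_square)
      have d: "\<bar>cmod (\<Psi> z) - cmod z\<bar> \<le> (\<eta> / (6 * \<bar>\<kappa>\<bar>)) * cmod z"
        using \<rho>'(2)[of z 0] z \<rho>' \<phi>0 norm_triangle_ineq3[of "\<Psi> z" z] by (simp add: \<Psi>_def)
      have "\<bar>\<kappa> * (cmod (\<Psi> z))\<^sup>2 - \<kappa> * (cmod z)\<^sup>2\<bar> = \<bar>\<kappa>\<bar> * (\<bar>cmod (\<Psi> z) - cmod z\<bar> * (cmod (\<Psi> z) + cmod z))"
        by (simp add: power2_eq_square abs_mult square_diff_square_factored flip: right_diff_distrib)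
      also have "\<dots> \<le> \<bar>\<kappa>\<bar> * ((\<eta> / (6 * \<bar>\<kappa>\<bar>)) * cmod z * (3 * cmod z))"
        using d n \<eta> by (intro mult_left_mono mult_mono) auto
      also have "\<dots> = \<eta> / 2 * (cmod z)\<^sup>2" using \<kappa> by (simp add: power2_eq_square field_simps)
      finally show "\<bar>v z - \<kappa> * (cmod z)\<^sup>2\<bar> \<le> \<eta> * (cmod z)\<^sup>2" using 1 by argo
    qed (use \<rho> \<rho>' \<rho>2 in auto)
  qed
  \<comment> \<open>With |\<kappa>|/16, equal values of \<open>V\<close> at two points of one ray
    would force |w'|^2 - |w|^2 \<le> K/4, against the lower bound K/2.\<close>
  obtain \<rho>d where \<rho>d: "\<rho>d > 0" "\<And>r z z'. r < \<rho>d \<Longrightarrow> cmod z \<le> r \<Longrightarrow> cmod z' \<le> r \<Longrightarrow>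
              \<bar>V z' - V z - \<kappa> * ((cmod z')\<^sup>2 - (cmod z)\<^sup>2)\<bar> \<le> (\<bar>\<kappa>\<bar> / 16) * r * cmod (z' - z)"
    using V[of "\<bar>\<kappa>\<bar> / 16"] \<kappa> by auto
  define \<rho>3 where "\<rho>3 = min \<rho>2 (\<rho>d / 2)"
  have \<rho>3: "\<rho>3 > 0" "\<rho>3 \<le> \<rho>2" "2 * \<rho>3 \<le> \<rho>d" using \<rho>2 \<rho>d by (auto simp: \<rho>3_def)
  have mono: "v (of_real s * cis \<theta>) \<noteq> v (of_real s' * cis \<theta>)"
    if s: "0 < s" "s < s'" "s' < \<rho>3" for s s' \<theta>
  proof
    assume eq: "v (of_real s * cis \<theta>) = v (of_real s' * cis \<theta>)"
    define z where "z = of_real s * cis \<theta>"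
    define z' where "z' = of_real s' * cis \<theta>"
    have n: "cmod z = s" "cmod z' = s'" using s by (auto simp: z_def z'_def norm_mult)
    have nd: "cmod (z' - z) = s' - s"
    proof -
      have "z' - z = of_real (s' - s) * cis \<theta>" by (simp add: z_def z'_def algebra_simps)
      thus ?thesis using s by (simp add: norm_mult del: of_real_diff)
    qed
    define w where "w = \<Psi> z"
    define w' where "w' = \<Psi> z'"
    define E where "E = (w' - w) - (z' - z)"
    define E1 where "E1 = (w' - z') + (w - z)"
    have E: "cmod E \<le> (s' - s) / 20"
      using \<Psi>diff[of z' z] n nd s \<rho>3 \<rho>2 by (simp add: E_def w_def w'_def)
    have E1: "cmod E1 \<le> (s' + s) / 20"
      using \<Psi>near[of z'] \<Psi>near[of z] n s \<rho>3 \<rho>2 norm_triangle_ineq[of "w' - z'" "w - z"]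
      by (simp add: E1_def w_def w'_def)
    have wd: "w' - w = of_real (s' - s) * cis \<theta> + E"
      by (simp add: E_def z_def z'_def algebra_simps)
    have ws: "w' + w = of_real (s' + s) * cis \<theta> + E1"
      by (simp add: E1_def z_def z'_def algebra_simps)
    have "(cmod w')\<^sup>2 - (cmod w)\<^sup>2 = (w' - w) \<bullet> (w' + w)"
      by (simp add: power2_norm_eq_inner inner_diff_left inner_diff_right inner_add_right inner_commute)
    also have "\<dots> = (s' - s) * (s' + s) * (cis \<theta> \<bullet> cis \<theta>)
        + (s' - s) * (cis \<theta> \<bullet> E1) + (s' + s) * (E \<bullet> cis \<theta>) + E \<bullet> E1"
    proof -
      have *: "of_real x * cis \<theta> = x *\<^sub>R cis \<theta>" for x by (simp add: scaleR_conv_of_real)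
      show ?thesis unfolding wd ws *
        by (simp only: inner_add_left inner_add_right inner_scaleR_left inner_scaleR_right) (simp add: algebra_simps)
    qed
    also have "cis \<theta> \<bullet> cis \<theta> = 1" by (simp flip: power2_norm_eq_inner)
    finally have Q: "(cmod w')\<^sup>2 - (cmod w)\<^sup>2 = (s' - s) * (s' + s)
        + (s' - s) * (cis \<theta> \<bullet> E1) + (s' + s) * (E \<bullet> cis \<theta>) + E \<bullet> E1" by simp
    define K where "K = (s' - s) * (s' + s)"
    have K: "K > 0" using s by (simp add: K_def)
    have b1: "\<bar>(s' - s) * (cis \<theta> \<bullet> E1)\<bar> \<le> K / 20"
    proof -
      have "\<bar>cis \<theta> \<bullet> E1\<bar> \<le> (s' + s) / 20" using Cauchy_Schwarz_ineq2[of "cis \<theta>" E1] E1 by simp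
      hence "(s' - s) * \<bar>cis \<theta> \<bullet> E1\<bar> \<le> (s' - s) * ((s' + s) / 20)" using s by (intro mult_left_mono) auto
      thus ?thesis using s by (simp add: K_def abs_mult)
    qed
    have b2: "\<bar>(s' + s) * (E \<bullet> cis \<theta>)\<bar> \<le> K / 20"
    proof -
      have "\<bar>E \<bullet> cis \<theta>\<bar> \<le> (s' - s) / 20" using Cauchy_Schwarz_ineq2[of E "cis \<theta>"] E by simp
      hence "(s' + s) * \<bar>E \<bullet> cis \<theta>\<bar> \<le> (s' + s) * ((s' - s) / 20)" using s by (intro mult_left_mono) auto
      thus ?thesis using s by (simp add: K_def abs_mult mult_ac)
    qed
    have b3: "\<bar>E \<bullet> E1\<bar> \<le> K / 400"
    proof -
      have "\<bar>E \<bullet> E1\<bar> \<le> cmod E * cmod E1" by (rule Cauchy_Schwarz_ineq2)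
      also have "\<dots> \<le> ((s' - s) / 20) * ((s' + s) / 20)" using E E1 s by (intro mult_mono) auto
      finally show ?thesis by (simp add: K_def)
    qed
    have Q': "(cmod w')\<^sup>2 - (cmod w)\<^sup>2 \<ge> K / 2" using Q b1 b2 b3 K unfolding K_def[symmetric] by linarith
    have "\<bar>V w' - V w - \<kappa> * ((cmod w')\<^sup>2 - (cmod w)\<^sup>2)\<bar> \<le> (\<bar>\<kappa>\<bar> / 16) * (2 * s') * cmod (w' - w)"
    proof (rule \<rho>d(2))
      show "2 * s' < \<rho>d" using s \<rho>3 by linarith
      show "cmod w' \<le> 2 * s'" using \<Psi>n[of z'] n s \<rho>3 \<rho>2 by (simp add: w'_def)
      have "cmod w \<le> 2 * s" using \<Psi>n[of z] n s \<rho>3 \<rho>2 by (simp add: w_def)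
      thus "cmod w \<le> 2 * s'" using s by linarith
    qed
    moreover have "V w' = V w" using eq by (simp add: v_def w_def w'_def z_def z'_def)
    ultimately have A: "\<bar>\<kappa>\<bar> * ((cmod w')\<^sup>2 - (cmod w)\<^sup>2) \<le> (\<bar>\<kappa>\<bar> / 16) * (2 * s') * cmod (w' - w)"
      using Q' K by (simp add: abs_mult)
    have "cmod (w' - w) \<le> 2 * (s' - s)"
      using E nd norm_triangle_ineq[of E "z' - z"] s by (simp add: E_def)
    hence "(\<bar>\<kappa>\<bar> / 16) * (2 * s') * cmod (w' - w) \<le> (\<bar>\<kappa>\<bar> / 16) * (2 * (s' + s)) * (2 * (s' - s))"
      using s by (intro mult_mono) auto
    also have "\<dots> = \<bar>\<kappa>\<bar> * (K / 4)" by (simp add: K_def algebra_simps)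
    finally have "\<bar>\<kappa>\<bar> * ((cmod w')\<^sup>2 - (cmod w)\<^sup>2) \<le> \<bar>\<kappa>\<bar> * (K / 4)" using A by linarith
    hence "(cmod w')\<^sup>2 - (cmod w)\<^sup>2 \<le> K / 4" using \<kappa> by simp
    thus False using Q' K by linarith
  qed
  obtain N r where N: "N > 0" "r > 0"
    "\<And>\<theta>. \<exists>s. r / 2 \<le> s \<and> s \<le> r \<and> (f ^^ N) (of_real s * cis \<theta>) = of_real s * cis \<theta> \<and>
          (\<forall>j. cmod ((f ^^ j) (of_real s * cis \<theta>)) < \<rho>3)"
  proof (rule periodic_point_on_every_ray[of \<kappa> b v \<rho>3 f \<alpha>])
    show "continuous_on (ball 0 \<rho>3) f"
      using continuous_on_subset[OF fc subset_ball[OF \<rho>3(2)]] by (auto simp: f_def[abs_def] o_def)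
  qed (use \<kappa> b vas \<rho>3 finv mono fas in auto)
  then obtain s where s: "\<And>\<theta>. r / 2 \<le> s \<theta>" "\<And>\<theta>. s \<theta> \<le> r"
    "\<And>\<theta>. (f ^^ N) (of_real (s \<theta>) * cis \<theta>) = of_real (s \<theta>) * cis \<theta>"
    "\<And>\<theta> j. cmod ((f ^^ j) (of_real (s \<theta>) * cis \<theta>)) < \<rho>3" by metis
  define p where "p \<theta> = of_real (s \<theta>) * cis \<theta>" for \<theta>
  have s0: "s \<theta> > 0" for \<theta> using s(1)[of \<theta>] N(2) by linarith
  have pn: "cmod (p \<theta>) = s \<theta>" for \<theta> using s0[of \<theta>] by (simp add: p_def norm_mult)
  have iter: "(T ^^ j) (\<Psi> (p \<theta>)) = \<Psi> ((f ^^ j) (p \<theta>))" for j \<theta>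
  proof (induction j)
    case (Suc j)
    have "\<Psi> (f ((f ^^ j) (p \<theta>))) = T (\<Psi> ((f ^^ j) (p \<theta>)))"
      using s(4)[of j \<theta>] \<rho>3 by (intro f\<Psi>) (auto simp: p_def)
    thus ?case using Suc by simp
  qed auto
  \<comment> \<open>The rays with angles in [0, 1] already supply infinitely many points, and cos is
    injective there because 1 < pi.\<close>
  have "inj_on (\<lambda>\<theta>. \<Psi> (p \<theta>)) {0..1}"
  proof (rule inj_onI)
    fix x y :: real assume xy: "x \<in> {0..1}" "y \<in> {0..1}" and eq: "\<Psi> (p x) = \<Psi> (p y)"
    have "cmod (p x) \<le> \<rho>1" "cmod (p y) \<le> \<rho>1"
      using s(4)[of 0 x] s(4)[of 0 y] \<rho>3 \<rho>2 by (auto simp: p_def)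
    from \<Psi>diff[OF this] eq have pxy: "p x = p y" by (simp add: norm_minus_commute)
    hence "s x = s y" using pn by metis
    hence "cis x = cis y" using pxy s0[of x] s0[of y] by (simp add: p_def)
    hence "cos x = cos y" by (metis cis.sel(1))
    thus "x = y" using xy pi_gt3 cos_inj_pi[of x y] by simp
  qed
  moreover have "infinite {0..1::real}" by simp
  ultimately have "infinite ((\<lambda>\<theta>. \<Psi> (p \<theta>)) ` {0..1})" using finite_imageD by blast
  moreover have "(\<lambda>\<theta>. \<Psi> (p \<theta>)) ` {0..1} \<subseteq> {w. (\<forall>j. cmod ((T ^^ j) w) < \<rho>0) \<and> (T ^^ N) w = w}"
  proof (rule image_subsetI, rule CollectI, intro conjI allI)
    fix \<theta> :: real and j
    have "(f ^^ j) (p \<theta>) \<in> ball 0 \<rho>2" using s(4)[of j \<theta>] \<rho>3 by (simp add: p_def)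
    hence "\<Psi> ((f ^^ j) (p \<theta>)) \<in> ball 0 \<rho>0" using \<Psi>in by blast
    thus "cmod ((T ^^ j) (\<Psi> (p \<theta>))) < \<rho>0" unfolding iter by simp
    show "(T ^^ N) (\<Psi> (p \<theta>)) = \<Psi> (p \<theta>)" unfolding iter using s(3)[of \<theta>] by (simp add: p_def)
  qed
  ultimately show ?thesis using N(1) infinite_super by blast
qed

subsection \<open>Normal form\<close>

lemma norm_cis_diff_le: "cmod (cis x - cis y) \<le> \<bar>x - y\<bar>"
proof -
  have "cis x - cis y = cis y * (exp (\<i> * of_real (x - y)) - 1)"
    by (simp add: cis_conv_exp algebra_simps flip: exp_add)
  hence "cmod (cis x - cis y) = 2 * \<bar>sin ((x - y) / 2)\<bar>"
    by (simp only: norm_mult norm_cis dist_exp_i_1)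
  also have "\<dots> \<le> 2 * \<bar>(x - y) / 2\<bar>" by (intro mult_left_mono abs_sin_x_le_abs_x) auto
  finally show ?thesis by simp
qed

lemma abs_cos_diff_le: "\<bar>cos x - cos (y::real)\<bar> \<le> \<bar>x - y\<bar>"
  using norm_cis_diff_le[of x y] abs_Re_le_cmod[of "cis x - cis y"] by simp

lemma cos_linearization_smallo:
  fixes \<alpha> :: real and h :: "'a \<Rightarrow> real"
  assumes "(h \<longlongrightarrow> 0) F"
  shows "(\<lambda>z. cos (\<alpha> + h z) - cos \<alpha> + sin \<alpha> * h z) \<in> o[F](h)"
proof (rule landau_o.smallI)
  fix e :: real assume e: "e > 0"
  have "(cos has_derivative (*) (- sin \<alpha>)) (at \<alpha>)"
    using DERIV_cos[of \<alpha>] unfolding has_field_derivative_def .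
  then obtain d where d: "d > 0" "\<And>y. \<bar>y - \<alpha>\<bar> < d \<Longrightarrow> \<bar>cos y - cos \<alpha> - (- sin \<alpha> * (y - \<alpha>))\<bar> \<le> e * \<bar>y - \<alpha>\<bar>"
    unfolding has_derivative_at_alt real_norm_def using e by blast
  have "\<forall>\<^sub>F z in F. dist (h z) 0 < d" using assms d(1) by (rule tendstoD)
  thus "\<forall>\<^sub>F z in F. norm (cos (\<alpha> + h z) - cos \<alpha> + sin \<alpha> * h z) \<le> e * norm (h z)"
    by eventually_elim (use d(2)[of "\<alpha> + h _"] in auto)
qed

text \<open>
  The ansatz for the normal form of the recurrence $x_{n+1} + x_{n-1} = k(x_n)$: with $A$, $B$, $C$ chosen
  to solve the homological equations, $x_n$ is the profile of a point that rotates at a constant radius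
  by an angle depending on the radius, up to an error of higher than third order.
\<close>

definition trig_profile :: "real \<Rightarrow> real \<Rightarrow> real \<Rightarrow> complex \<Rightarrow> real" where
  "trig_profile A B C z = Re z + (A * (cmod z)\<^sup>2 + B * Re (z\<^sup>2) + C * Re (z ^ 3))"

lemma trig_profile_rotate_sum:
  "trig_profile A B C (z * cis w) + trig_profile A B C (z * cis (- w)) =
     2 * cos w * Re z + 2 * A * (cmod z)\<^sup>2 + 2 * B * cos (2 * w) * Re (z\<^sup>2) + 2 * C * cos (3 * w) * Re (z ^ 3)"
proof -
  have R: "Re (u * cis x) + Re (u * cis (- x)) = 2 * cos x * Re u" for u x
    by simp
  have P: "(z * cis x) ^ n = z ^ n * cis (real n * x)" for n x
    by (simp only: power_mult_distrib Complex.DeMoivre)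
  have "Re ((z * cis w) ^ n) + Re ((z * cis (- w)) ^ n) = 2 * cos (n * w) * Re (z ^ n)" for n :: nat
    unfolding P using R[of "z ^ n" "real n * w"] by simp
  note P' = this
  have "Re (z * cis w) + Re (z * cis (- w)) = 2 * cos w * Re z"
    "Re ((z * cis w)\<^sup>2) + Re ((z * cis (- w))\<^sup>2) = 2 * cos (2 * w) * Re (z\<^sup>2)"
    "Re ((z * cis w) ^ 3) + Re ((z * cis (- w)) ^ 3) = 2 * cos (3 * w) * Re (z ^ 3)"
    using P'[of 1] P'[of 2] P'[of 3] by simp_all
  moreover have "cmod (z * cis x) = cmod z" for x by (simp add: norm_mult)
  moreover have "r + (A * n + B * r2 + C * r3) + (r' + (A * n + B * r2' + C * r3')) =
      c + 2 * A * n + 2 * B * c2 * d2 + 2 * C * c3 * d3"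
    if "r + r' = c" "r2 + r2' = 2 * c2 * d2" "r3 + r3' = 2 * c3 * d3"
    for n r r' r2 r2' r3 r3' c c2 d2 c3 d3 :: real
  proof -
    have "r + (A * n + B * r2 + C * r3) + (r' + (A * n + B * r2' + C * r3')) =
      (r + r') + 2 * A * n + B * (r2 + r2') + C * (r3 + r3')" by (simp add: algebra_simps)
    thus ?thesis unfolding that by simp
  qed
  ultimately show ?thesis unfolding trig_profile_def by simp
qed

text \<open>The equations \<open>NF\<close> match the coefficients of |z|^2, Re(z^2), Re(z^3) and
  |z|^2 Re z. The last harmonic turns with the frequency of the linear part, so no coefficient of
  the profile can absorb it; it is absorbed by the frequency shift b, since 2 cos(\<alpha> + b r^2)
  differs from 2 cos \<alpha> by -2 sin \<alpha> b r^2 to leading order.\<close>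

lemma normal_form_defect:
  assumes \<alpha>: "2 * cos \<alpha> = t"
    and NF: "2 * A = t * A + p / 2" "(t\<^sup>2 - 2) * B = t * B + p / 2" "(t ^ 3 - 3 * t) * C = t * C + p * B + q / 4"
      "- 2 * sin \<alpha> * b = 2 * p * A + p * B + 3 * q / 4"
    and k: "(\<lambda>u. k u - (t * u + p * u\<^sup>2 + q * u ^ 3)) \<in> o[nhds 0](\<lambda>u. u ^ 3)"
  defines "\<omega> \<equiv> \<lambda>z. \<alpha> + b * (cmod z)\<^sup>2"
  shows "(\<lambda>z. trig_profile A B C (z * cis (\<omega> z)) + trig_profile A B C (z * cis (- \<omega> z))
            - k (trig_profile A B C z)) \<in> o[nhds 0](\<lambda>z. (cmod z) ^ 3)"
proof -
  define X where "X = trig_profile A B C"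
  define n where "n z = cmod z" for z
  define a where "a z = Re z" for z
  define s where "s z = (cmod z)\<^sup>2" for z
  define R2 where "R2 z = Re (z\<^sup>2)" for z
  define R3 where "R3 z = Re (z ^ 3)" for z
  define Xn where "Xn z = A * s z + B * R2 z + C * R3 z" for z
  note defs = a_def s_def R2_def R3_def
  have X: "X z = a z + Xn z" for z by (simp add: X_def trig_profile_def Xn_def defs)
  have sx: "s z = (Re z)\<^sup>2 + (Im z)\<^sup>2" for z by (simp add: s_def cmod_power2)
  \<comment> \<open>Products of harmonics are rewritten linearly in the four harmonics, so that
    coefficients can be compared.\<close>
  have Ia: "(a z)\<^sup>2 = (s z + R2 z) / 2" for z
    by (simp add: a_def R2_def sx Re_power2)
  have Ib: "a z * R2 z = (R3 z + s z * a z) / 2" for z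
    by (simp add: a_def R2_def R3_def sx power2_eq_square power3_eq_cube algebra_simps)
  have Ic: "(a z) ^ 3 = (R3 z + 3 * s z * a z) / 4" for z
    by (simp add: a_def R2_def R3_def sx power2_eq_square power3_eq_cube algebra_simps)
  have c2: "2 * cos (2 * \<alpha>) = t\<^sup>2 - 2" unfolding \<alpha>[symmetric] by (simp add: cos_double_cos power_mult_distrib)
  have c3: "2 * cos (3 * \<alpha>) = t ^ 3 - 3 * t" unfolding \<alpha>[symmetric] by (simp add: cos_treble_cos power_mult_distrib)
  \<comment> \<open>By \<open>NF\<close> all terms of order at most three cancel. Each summand left
    on the right is o(r^3): the linearised cosine, the variation of the two higher cosines, the
    Taylor remainder of k, and products of order at least four.\<close>
  have id: "X (z * cis (\<omega> z)) + X (z * cis (- \<omega> z)) - k (X z) =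
     2 * (a z * (cos (\<omega> z) - cos \<alpha> + sin \<alpha> * (b * s z))) + 2 * B * ((cos (2 * \<omega> z) - cos (2 * \<alpha>)) * R2 z)
     + 2 * C * ((cos (3 * \<omega> z) - cos (3 * \<alpha>)) * R3 z)
     - (k (X z) - (t * X z + p * (X z)\<^sup>2 + q * (X z) ^ 3))
     - p * (2 * C * (a z * R3 z) + Xn z * Xn z) - q * (Xn z * ((X z)\<^sup>2 + X z * a z + (a z)\<^sup>2))" for z
  proof -
    have e2: "(X z)\<^sup>2 = (a z)\<^sup>2 + 2 * A * (s z * a z) + 2 * B * (a z * R2 z) + (2 * C * (a z * R3 z) + Xn z * Xn z)"
      by (simp add: X Xn_def power2_eq_square algebra_simps)
    have e3: "(X z) ^ 3 = (a z) ^ 3 + Xn z * ((X z)\<^sup>2 + X z * a z + (a z)\<^sup>2)"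
      by (simp add: X power2_eq_square power3_eq_cube algebra_simps)
    have main: "t * X z + p * ((a z)\<^sup>2 + 2 * A * (s z * a z) + 2 * B * (a z * R2 z)) + q * (a z) ^ 3 =
       t * a z - 2 * sin \<alpha> * b * (s z * a z) + 2 * A * s z + (t\<^sup>2 - 2) * B * R2 z + (t ^ 3 - 3 * t) * C * R3 z"
    proof -
      have "t * X z + p * ((a z)\<^sup>2 + 2 * A * (s z * a z) + 2 * B * (a z * R2 z)) + q * (a z) ^ 3 =
        t * a z + (t * A + p / 2) * s z + (t * B + p / 2) * R2 z + (t * C + p * B + q / 4) * R3 z
          + (2 * p * A + p * B + 3 * q / 4) * (s z * a z)"
        unfolding Ia Ib Ic X Xn_def by (simp add: field_simps)
      also have "\<dots> = t * a z - 2 * sin \<alpha> * b * (s z * a z) + 2 * A * s z + (t\<^sup>2 - 2) * B * R2 z + (t ^ 3 - 3 * t) * C * R3 z"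
        unfolding NF[symmetric] by (simp add: algebra_simps)
      finally show ?thesis .
    qed
    have sum: "X (z * cis (\<omega> z)) + X (z * cis (- \<omega> z)) =
       2 * cos (\<omega> z) * a z + 2 * A * s z + 2 * B * cos (2 * \<omega> z) * R2 z + 2 * C * cos (3 * \<omega> z) * R3 z"
      unfolding X_def defs by (rule trig_profile_rotate_sum)
    show ?thesis unfolding sum using main e2 e3 \<alpha> c2 c3 by algebra
  qed
  have n: "(\<lambda>z. (n z) ^ j) \<in> O[nhds 0](\<lambda>z. (n z) ^ i)" if "i \<le> j" for i j
  proof (rule landau_o.bigI[of 1])
    have "\<forall>\<^sub>F z in nhds 0. n z < 1"
      unfolding n_def using eventually_nhds_ball[of 1 "0::complex"] by (auto elim!: eventually_mono)
    thus "\<forall>\<^sub>F z in nhds 0. norm ((n z) ^ j) \<le> 1 * norm ((n z) ^ i)"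
      by eventually_elim (use that in \<open>auto simp: n_def intro: power_decreasing\<close>)
  qed simp
  have aO: "a \<in> O[nhds 0](\<lambda>z. (n z) ^ 1)"
    by (rule landau_o.bigI[of 1]) (auto simp: a_def n_def abs_Re_le_cmod)
  have sO: "s \<in> O[nhds 0](\<lambda>z. (n z) ^ 2)"
    by (rule landau_o.bigI[of 1]) (auto simp: s_def n_def)
  have R2O: "R2 \<in> O[nhds 0](\<lambda>z. (n z) ^ 2)"
    by (rule landau_o.bigI[of 1]) (use abs_Re_le_cmod[of "_ ^ 2"] in \<open>auto simp: R2_def n_def norm_power\<close>)
  have R3O: "R3 \<in> O[nhds 0](\<lambda>z. (n z) ^ 3)"
    by (rule landau_o.bigI[of 1]) (use abs_Re_le_cmod[of "_ ^ 3"] in \<open>auto simp: R3_def n_def norm_power\<close>)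
  have XnO: "Xn \<in> O[nhds 0](\<lambda>z. (n z) ^ 2)"
    unfolding Xn_def[abs_def]
    by (intro sum_in_bigo) (use sO R2O landau_o.big_trans[OF R3O n[of 2 3]] in auto)
  have XO: "X \<in> O[nhds 0](\<lambda>z. (n z) ^ 1)"
    unfolding X[abs_def]
    by (intro sum_in_bigo aO landau_o.big_trans[OF XnO n]) auto
  have O4: "f \<in> o[nhds 0](\<lambda>z. (n z) ^ 3)" if "f \<in> O[nhds 0](\<lambda>z. (n z) ^ 4)" for f :: "complex \<Rightarrow> real"
  proof (rule landau_o.big_small_trans[OF that], rule landau_o.smallI)
    fix c :: real assume c: "c > 0"
    have "\<forall>\<^sub>F z in nhds 0. n z < c"
      unfolding n_def using eventually_nhds_ball[of c "0::complex"] c by (auto elim!: eventually_mono)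
    thus "\<forall>\<^sub>F z in nhds 0. norm ((n z) ^ 4) \<le> c * norm ((n z) ^ 3)"
    proof eventually_elim
      case (elim z)
      have "n z * (n z) ^ 3 \<le> c * (n z) ^ 3" using elim by (intro mult_right_mono) (auto simp: n_def)
      thus ?case by (simp add: n_def flip: power_Suc)
    qed
  qed
  have pm: "(\<lambda>z. f z * g z) \<in> O[nhds 0](\<lambda>z. (n z) ^ (i + j))"
    if "f \<in> O[nhds 0](\<lambda>z. (n z) ^ i)" "g \<in> O[nhds 0](\<lambda>z. (n z) ^ j)" for f g :: "complex \<Rightarrow> real" and i j
    unfolding power_add by (rule landau_o.big.mult[OF that])
  have s0: "((\<lambda>z. b * s z) \<longlongrightarrow> 0) (nhds 0)"
  proof -
    have "isCont (\<lambda>z. b * s z) 0" unfolding s_def by (intro continuous_intros)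
    thus ?thesis by (simp add: continuous_at tendsto_nhds_iff s_def)
  qed
  have cosO: "(\<lambda>z. cos (j * \<omega> z) - cos (j * \<alpha>)) \<in> O[nhds 0](\<lambda>z. (n z) ^ 2)" for j
  proof (rule landau_o.big_trans)
    show "(\<lambda>z. cos (j * \<omega> z) - cos (j * \<alpha>)) \<in> O[nhds 0](\<lambda>z. j * b * s z)"
      by (rule landau_o.bigI[of 1])
        (use abs_cos_diff_le[of "j * \<omega> _" "j * \<alpha>"] in \<open>auto simp: \<omega>_def s_def algebra_simps\<close>)
    show "(\<lambda>z. j * b * s z) \<in> O[nhds 0](\<lambda>z. (n z) ^ 2)" using sO by simp
  qed
  have t1: "(\<lambda>z. a z * (cos (\<omega> z) - cos \<alpha> + sin \<alpha> * (b * s z))) \<in> o[nhds 0](\<lambda>z. (n z) ^ 3)"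
  proof -
    have "(\<lambda>z. cos (\<alpha> + b * s z) - cos \<alpha> + sin \<alpha> * (b * s z)) \<in> o[nhds 0](\<lambda>z. b * s z)"
      by (rule cos_linearization_smallo[OF s0])
    also have "(\<lambda>z. b * s z) \<in> O[nhds 0](\<lambda>z. (n z) ^ 2)" using sO by simp
    finally have "(\<lambda>z. cos (\<omega> z) - cos \<alpha> + sin \<alpha> * (b * s z)) \<in> o[nhds 0](\<lambda>z. (n z) ^ 2)"
      by (simp add: \<omega>_def s_def)
    from landau_o.big_small_mult[OF aO this] show ?thesis by (simp flip: power_Suc)
  qed
  have t2: "(\<lambda>z. (cos (2 * \<omega> z) - cos (2 * \<alpha>)) * R2 z) \<in> o[nhds 0](\<lambda>z. (n z) ^ 3)"
    using pm[OF cosO R2O] by (intro O4) simp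
  have t3: "(\<lambda>z. (cos (3 * \<omega> z) - cos (3 * \<alpha>)) * R3 z) \<in> o[nhds 0](\<lambda>z. (n z) ^ 3)"
    using landau_o.big_trans[OF pm[OF cosO R3O] n[of 4 "2 + 3"]] by (intro O4) simp
  have X0: "(X \<longlongrightarrow> 0) (nhds 0)"
  proof -
    have "(X \<longlongrightarrow> Re 0 + (A * (cmod 0)\<^sup>2 + B * Re (0\<^sup>2) + C * Re (0 ^ 3))) (nhds 0)"
      unfolding X_def trig_profile_def[abs_def] by (intro tendsto_intros filterlim_ident)
    thus ?thesis by simp
  qed
  have t4: "(\<lambda>z. k (X z) - (t * X z + p * (X z)\<^sup>2 + q * (X z) ^ 3)) \<in> o[nhds 0](\<lambda>z. (n z) ^ 3)"
  proof (rule landau_o.small_big_trans)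
    show "(\<lambda>z. k (X z) - (t * X z + p * (X z)\<^sup>2 + q * (X z) ^ 3)) \<in> o[nhds 0](\<lambda>z. (X z) ^ 3)"
      by (rule landau_o.small.compose[OF k X0])
    show "(\<lambda>z. (X z) ^ 3) \<in> O[nhds 0](\<lambda>z. (n z) ^ 3)"
      using landau_o.big_power[OF XO, of 3] by simp
  qed
  have t5: "(\<lambda>z. 2 * C * (a z * R3 z) + Xn z * Xn z) \<in> o[nhds 0](\<lambda>z. (n z) ^ 3)"
    by (intro O4 sum_in_bigo) (use pm[OF aO R3O] pm[OF XnO XnO] in auto)
  have t6: "(\<lambda>z. Xn z * ((X z)\<^sup>2 + X z * a z + (a z)\<^sup>2)) \<in> o[nhds 0](\<lambda>z. (n z) ^ 3)"
  proof -
    have "(\<lambda>z. (X z)\<^sup>2 + X z * a z + (a z)\<^sup>2) \<in> O[nhds 0](\<lambda>z. (n z) ^ 2)"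
      unfolding power2_eq_square[of "X _"] power2_eq_square[of "a _"]
      by (intro sum_in_bigo) (use pm[OF XO XO] pm[OF XO aO] pm[OF aO aO] in \<open>auto simp: power2_eq_square\<close>)
    from pm[OF XnO this] show ?thesis by (intro O4) simp
  qed
  have cm: "(\<lambda>z. c * f z) \<in> o[nhds 0](\<lambda>z. (n z) ^ 3)" if "f \<in> o[nhds 0](\<lambda>z. (n z) ^ 3)"
    for f :: "complex \<Rightarrow> real" and c using that by simp
  have "(\<lambda>z. X (z * cis (\<omega> z)) + X (z * cis (- \<omega> z)) - k (X z)) \<in> o[nhds 0](\<lambda>z. (n z) ^ 3)"
    unfolding id
    by (rule sum_in_smallo(2)[OF sum_in_smallo(2)[OF sum_in_smallo(2)[OF sum_in_smallo(1)[OF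
          sum_in_smallo(1)[OF cm[OF t1] cm[OF t2]] cm[OF t3]] t4] cm[OF t5]] cm[OF t6]])
  thus ?thesis by (simp add: X_def n_def)
qed

section \<open>From the normal form to periodic points of the map itself\<close>

lemma smallo_nhds_0_bound:
  fixes f :: "'a::real_normed_vector \<Rightarrow> real"
  assumes "f \<in> o[nhds 0](g)" "\<eta> > 0"
  shows "\<exists>\<rho>>0. \<forall>z. norm z < \<rho> \<longrightarrow> \<bar>f z\<bar> \<le> \<eta> * \<bar>g z\<bar>"
  using landau_o.smallD[OF assms] unfolding eventually_nhds_metric by (simp add: dist_norm)

lemma norm_Complex_le: "cmod (Complex x y) \<le> \<bar>x\<bar> + \<bar>y\<bar>"
  using cmod_le[of "Complex x y"] by simp

text \<open>In the coordinates given by \<open>L\<close> the linear part of \<open>T\<close> is the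
  rotation by \<alpha> = arccos(t/2), and x^2 - t x y + y^2 becomes sin^2 \<alpha> |z|^2. The first
  integral is then close to a multiple of |z|^2, as the twist argument requires.\<close>

lemma twist_map_periodic_points:
  fixes k :: "real \<Rightarrow> real" and V :: "complex \<Rightarrow> real"
  assumes t: "\<bar>t\<bar> < 2" and \<kappa>: "\<kappa> \<noteq> 0" and \<rho>0: "\<rho>0 > 0"
    and NF: "2 * A = t * A + p / 2" "(t\<^sup>2 - 2) * B = t * B + p / 2"
      "(t ^ 3 - 3 * t) * C = t * C + p * B + q / 4"
    and twist: "2 * p * A + p * B + 3 * q / 4 \<noteq> 0"
    and k: "(\<lambda>u. k u - (t * u + p * u\<^sup>2 + q * u ^ 3)) \<in> o[nhds 0](\<lambda>u. u ^ 3)"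
    and kc: "continuous_on {-\<rho>0<..<\<rho>0} k"
    and V: "\<And>\<eta>. \<eta> > 0 \<Longrightarrow> \<exists>\<rho>>0. \<forall>r w w'. r < \<rho> \<longrightarrow> cmod w \<le> r \<longrightarrow> cmod w' \<le> r \<longrightarrow>
        \<bar>V w' - V w - \<kappa> * (((Re w')\<^sup>2 - t * Re w' * Im w' + (Im w')\<^sup>2) - ((Re w)\<^sup>2 - t * Re w * Im w + (Im w)\<^sup>2))\<bar>
          \<le> \<eta> * r * cmod (w' - w)"
    and inv: "\<And>w. cmod w < \<rho>0 \<Longrightarrow> cmod (T w) < \<rho>0 \<Longrightarrow> V (T w) = V w"
    and T: "\<And>w. T w = Complex (Im w) (k (Im w) - Re w)"
  shows "\<exists>N>0. infinite {w. (\<forall>j. cmod ((T ^^ j) w) < \<rho>0) \<and> (T ^^ N) w = w}"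
proof -
  define \<alpha> where "\<alpha> = arccos (t / 2)"
  define S where "S = sin \<alpha>"
  have c\<alpha>: "2 * cos \<alpha> = t" using t by (simp add: \<alpha>_def)
  have S: "S > 0"
  proof -
    have "0 < \<alpha>" "\<alpha> < pi" using arccos_lt_bounded[of "t/2"] t unfolding \<alpha>_def by auto
    thus ?thesis unfolding S_def by (rule sin_gt_zero)
  qed
  \<comment> \<open>The solution of the resonant equation of the normal form; \<open>twist\<close>
    says exactly that it is nonzero.\<close>
  define b where "b = - (2 * p * A + p * B + 3 * q / 4) / (2 * S)"
  have b: "b \<noteq> 0" "- 2 * sin \<alpha> * b = 2 * p * A + p * B + 3 * q / 4"
    using twist S by (auto simp: b_def S_def[symmetric])
  define \<omega> where "\<omega> z = \<alpha> + b * (cmod z)\<^sup>2" for z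
  \<comment> \<open>Two consecutive terms, at times -1 and 0, of the linear solution Re(z exp(i n
    \<alpha>)). The map \<open>\<Phi>\<close> below does the same for the nonlinear profile with its
    radius-dependent angle.\<close>
  define L where "L z = Complex (Re (z * cis (- \<alpha>))) (Re z)" for z
  define Li where "Li w = Complex (Im w) ((Re w - cos \<alpha> * Im w) / S)" for w
  define X where "X = trig_profile A B C"
  define \<Phi> where "\<Phi> z = Complex (X (z * cis (- \<omega> z))) (X z)" for z
  define \<phi> where "\<phi> z = Li (\<Phi> z - L z)" for z
  define R where "R z = z * cis (\<omega> z)" for z
  define T' where "T' z = Li (T (L z))" for z
  have LiL[simp]: "Li (L z) = z" for z
    using S by (auto simp: Li_def L_def complex_eq_iff S_def)
  have LLi[simp]: "L (Li w) = w" for w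
    using S by (auto simp: Li_def L_def complex_eq_iff S_def)
  have Li_diff: "Li (x - y) = Li x - Li y" for x y
    by (simp add: Li_def complex_eq_iff algebra_simps flip: diff_divide_distrib)
  have L_diff: "L (x - y) = L x - L y" for x y
    by (simp add: L_def complex_eq_iff algebra_simps)
  define M where "M = 1 + 2 / S"
  have M: "M > 0" using S by (simp add: M_def add_pos_pos)
  have Li_le: "cmod (Li w) \<le> M * cmod w" for w
  proof -
    have "\<bar>cos \<alpha> * Im w\<bar> \<le> 1 * cmod w" unfolding abs_mult
      by (intro mult_mono abs_Im_le_cmod) auto
    hence "\<bar>Re w - cos \<alpha> * Im w\<bar> \<le> 2 * cmod w" using abs_Re_le_cmod[of w] by linarith
    hence "\<bar>(Re w - cos \<alpha> * Im w) / S\<bar> \<le> 2 * cmod w / S" using S by (simp add: divide_right_mono)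
    thus ?thesis unfolding Li_def
      using norm_Complex_le[of "Im w" "(Re w - cos \<alpha> * Im w) / S"] abs_Im_le_cmod[of w]
      by (simp add: M_def algebra_simps)
  qed
  have L_le: "cmod (L z) \<le> 2 * cmod z" for z
    unfolding L_def using norm_Complex_le[of "Re (z * cis (- \<alpha>))" "Re z"] abs_Re_le_cmod[of z]
      abs_Re_le_cmod[of "z * cis (- \<alpha>)"] by (simp add: norm_mult)
  have \<phi>_eq: "z + \<phi> z = Li (\<Phi> z)" for z by (simp add: \<phi>_def Li_diff)
  have \<Phi>0: "\<Phi> 0 = 0" by (simp add: \<Phi>_def X_def trig_profile_def complex_eq_iff)
  \<comment> \<open>On a disc of radius \<rho> \<le> 1 the functions |z|^2 and Re(z^2) have
    Lipschitz constant 2 \<rho>, and Re(z^3) has 3 \<rho>^2 \<le> 3 \<rho>; so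
    \<open>K * \<rho>\<close> serves for the nonlinear part of the profile.\<close>
  define K where "K = 2 * \<bar>A\<bar> + 2 * \<bar>B\<bar> + 3 * \<bar>C\<bar>"
  have K: "K \<ge> 0" by (simp add: K_def)
  have Xlip: "\<bar>(X z - Re z) - (X w - Re w)\<bar> \<le> K * \<rho> * cmod (z - w)"
    if zw: "cmod z \<le> \<rho>" "cmod w \<le> \<rho>" "\<rho> \<le> 1" for z w \<rho>
  proof -
    have \<rho>: "\<rho> \<ge> 0" using zw norm_ge_zero order_trans by blast
    let ?d = "cmod (z - w)"
    have 1: "\<bar>(cmod z)\<^sup>2 - (cmod w)\<^sup>2\<bar> \<le> (2 * \<rho>) * ?d"
    proof -
      have "\<bar>(cmod z)\<^sup>2 - (cmod w)\<^sup>2\<bar> = (cmod z + cmod w) * \<bar>cmod z - cmod w\<bar>"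
        by (simp add: power2_eq_square square_diff_square_factored abs_mult)
      also have "\<dots> \<le> (2 * \<rho>) * ?d"
        using zw \<rho> norm_triangle_ineq3[of z w] by (intro mult_mono) auto
      finally show ?thesis .
    qed
    have 2: "\<bar>Re (z\<^sup>2) - Re (w\<^sup>2)\<bar> \<le> (2 * \<rho>) * ?d"
    proof -
      have "\<bar>Re (z\<^sup>2) - Re (w\<^sup>2)\<bar> \<le> cmod (z\<^sup>2 - w\<^sup>2)" using abs_Re_le_cmod[of "z\<^sup>2 - w\<^sup>2"] by simp
      also have "z\<^sup>2 - w\<^sup>2 = (z + w) * (z - w)" by (simp add: power2_eq_square algebra_simps)
      also have "cmod \<dots> \<le> (2 * \<rho>) * ?d" unfolding norm_mult
        using zw norm_triangle_ineq[of z w] by (intro mult_right_mono) auto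
      finally show ?thesis .
    qed
    have 3: "\<bar>Re (z ^ 3) - Re (w ^ 3)\<bar> \<le> (3 * \<rho>) * ?d"
    proof -
      have "\<bar>Re (z ^ 3) - Re (w ^ 3)\<bar> \<le> cmod (z ^ 3 - w ^ 3)" using abs_Re_le_cmod[of "z ^ 3 - w ^ 3"] by simp
      also have "z ^ 3 - w ^ 3 = (z * z + z * w + w * w) * (z - w)" by (simp add: power3_eq_cube algebra_simps)
      also have "cmod \<dots> \<le> (3 * \<rho>) * ?d" unfolding norm_mult
      proof (intro mult_right_mono)
        have p: "cmod (x * y) \<le> \<rho>" if "cmod x \<le> \<rho>" "cmod y \<le> \<rho>" for x y
          using mult_mono[OF that(1) order_trans[OF that(2) zw(3)]] \<rho> by (simp add: norm_mult)
        show "cmod (z * z + z * w + w * w) \<le> 3 * \<rho>"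
          using p[of z z] p[of z w] p[of w w] zw norm_triangle_ineq[of "z * z + z * w" "w * w"]
            norm_triangle_ineq[of "z * z" "z * w"] by linarith
      qed auto
      finally show ?thesis .
    qed
    have "(X z - Re z) - (X w - Re w) = A * ((cmod z)\<^sup>2 - (cmod w)\<^sup>2) + B * (Re (z\<^sup>2) - Re (w\<^sup>2)) + C * (Re (z ^ 3) - Re (w ^ 3))"
      by (simp add: X_def trig_profile_def algebra_simps)
    also have "\<bar>\<dots>\<bar> \<le> \<bar>A * ((cmod z)\<^sup>2 - (cmod w)\<^sup>2)\<bar> + \<bar>B * (Re (z\<^sup>2) - Re (w\<^sup>2))\<bar> + \<bar>C * (Re (z ^ 3) - Re (w ^ 3))\<bar>"
      by linarith
    also have "\<dots> \<le> \<bar>A\<bar> * ((2 * \<rho>) * ?d) + \<bar>B\<bar> * ((2 * \<rho>) * ?d) + \<bar>C\<bar> * ((3 * \<rho>) * ?d)"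
      unfolding abs_mult using 1 2 3 by (intro add_mono mult_left_mono) auto
    also have "\<dots> = K * \<rho> * ?d" by (simp add: K_def algebra_simps)
    finally show ?thesis .
  qed
  \<comment> \<open>The rotation by -\<omega> is split into the rotation by -\<alpha>, which is
    matched by \<open>L\<close>, and this remainder, whose Lipschitz constant is small near
    0.\<close>
  define D where "D z = z * (cis (- \<omega> z) - cis (- \<alpha>))" for z
  have Dlip: "cmod (D z - D w) \<le> 3 * \<bar>b\<bar> * \<rho> * cmod (z - w)"
    if zw: "cmod z \<le> \<rho>" "cmod w \<le> \<rho>" "\<rho> \<le> 1" for z w \<rho>
  proof -
    have \<rho>: "\<rho> \<ge> 0" using zw norm_ge_zero order_trans by blast
    let ?d = "cmod (z - w)"
    have zz: "(cmod z)\<^sup>2 \<le> \<rho>"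
      using mult_mono[OF zw(1) order_trans[OF zw(1,3)]] \<rho> by (simp add: power2_eq_square)
    have e1: "cmod (cis (- \<omega> z) - cis (- \<alpha>)) \<le> \<bar>b\<bar> * \<rho>"
    proof -
      have "cmod (cis (- \<omega> z) - cis (- \<alpha>)) \<le> \<bar>b\<bar> * (cmod z)\<^sup>2"
        using norm_cis_diff_le[of "- \<omega> z" "- \<alpha>"] by (simp add: \<omega>_def abs_mult)
      also have "\<dots> \<le> \<bar>b\<bar> * \<rho>" using zz by (intro mult_left_mono) auto
      finally show ?thesis .
    qed
    have e2: "cmod (cis (- \<omega> z) - cis (- \<omega> w)) \<le> \<bar>b\<bar> * (2 * ?d)"
    proof -
      have "cmod (cis (- \<omega> z) - cis (- \<omega> w)) \<le> \<bar>b\<bar> * \<bar>(cmod z)\<^sup>2 - (cmod w)\<^sup>2\<bar>"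
        using norm_cis_diff_le[of "- \<omega> z" "- \<omega> w"]
        by (simp add: \<omega>_def abs_minus_commute flip: abs_mult right_diff_distrib)
      also have "\<bar>(cmod z)\<^sup>2 - (cmod w)\<^sup>2\<bar> = (cmod z + cmod w) * \<bar>cmod z - cmod w\<bar>"
        by (simp add: power2_eq_square square_diff_square_factored abs_mult)
      also have "\<dots> \<le> 2 * ?d"
        using zw norm_triangle_ineq3[of z w] by (intro mult_mono) auto
      finally show ?thesis by (simp add: mult_left_mono)
    qed
    have "D z - D w = (z - w) * (cis (- \<omega> z) - cis (- \<alpha>)) + w * (cis (- \<omega> z) - cis (- \<omega> w))"
      by (simp add: D_def algebra_simps)
    also have "cmod \<dots> \<le> ?d * cmod (cis (- \<omega> z) - cis (- \<alpha>)) + cmod w * cmod (cis (- \<omega> z) - cis (- \<omega> w))"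
      using norm_triangle_ineq by (metis norm_mult)
    also have "\<dots> \<le> ?d * (\<bar>b\<bar> * \<rho>) + \<rho> * (\<bar>b\<bar> * (2 * ?d))"
      using e1 e2 zw \<rho> by (intro add_mono mult_mono) auto
    finally show ?thesis by (simp add: algebra_simps)
  qed
  define K' where "K' = 3 * \<bar>b\<bar> + K * (1 + 3 * \<bar>b\<bar>) + K"
  have K': "K' \<ge> 0" using K by (simp add: K'_def)
  have \<Phi>lip: "cmod ((\<Phi> z - L z) - (\<Phi> w - L w)) \<le> K' * \<rho> * cmod (z - w)"
    if zw: "cmod z \<le> \<rho>" "cmod w \<le> \<rho>" "\<rho> \<le> 1" for z w \<rho>
  proof -
    have \<rho>: "\<rho> \<ge> 0" using zw norm_ge_zero order_trans by blast
    let ?d = "cmod (z - w)"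
    define m where "m u = u * cis (- \<omega> u)" for u
    have mn: "cmod (m u) = cmod u" for u by (simp add: m_def norm_mult)
    have mD: "m u = u * cis (- \<alpha>) + D u" for u by (simp add: m_def D_def algebra_simps)
    have Dl: "cmod (D z - D w) \<le> 3 * \<bar>b\<bar> * ?d"
    proof -
      have "3 * \<bar>b\<bar> * \<rho> * ?d \<le> 3 * \<bar>b\<bar> * 1 * ?d" using zw by (intro mult_right_mono mult_left_mono) auto
      thus ?thesis using Dlip[OF zw] by simp
    qed
    have "m z - m w = (z - w) * cis (- \<alpha>) + (D z - D w)" by (simp add: mD algebra_simps)
    hence "cmod (m z - m w) \<le> ?d + cmod (D z - D w)"
      using norm_triangle_ineq[of "(z - w) * cis (- \<alpha>)" "D z - D w"] by (simp add: norm_mult)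
    hence ml: "cmod (m z - m w) \<le> (1 + 3 * \<bar>b\<bar>) * ?d" using Dl by (simp add: algebra_simps)
    have "Re ((\<Phi> z - L z) - (\<Phi> w - L w)) = ((X (m z) - Re (m z)) - (X (m w) - Re (m w))) + Re (D z - D w)"
      by (simp add: \<Phi>_def L_def mD flip: m_def)
    also have "\<bar>\<dots>\<bar> \<le> K * \<rho> * cmod (m z - m w) + 3 * \<bar>b\<bar> * \<rho> * ?d"
      using Xlip[of "m z" \<rho> "m w"] Dlip[OF zw] abs_Re_le_cmod[of "D z - D w"] zw unfolding mn by linarith
    also have "\<dots> \<le> K * \<rho> * ((1 + 3 * \<bar>b\<bar>) * ?d) + 3 * \<bar>b\<bar> * \<rho> * ?d"
      using ml K \<rho> by (intro add_right_mono mult_left_mono) auto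
    finally have 1: "\<bar>Re ((\<Phi> z - L z) - (\<Phi> w - L w))\<bar> \<le> K * \<rho> * ((1 + 3 * \<bar>b\<bar>) * ?d) + 3 * \<bar>b\<bar> * \<rho> * ?d" .
    have 2: "\<bar>Im ((\<Phi> z - L z) - (\<Phi> w - L w))\<bar> \<le> K * \<rho> * ?d"
      using Xlip[OF zw] by (simp add: \<Phi>_def L_def)
    have "K * \<rho> * ((1 + 3 * \<bar>b\<bar>) * ?d) + 3 * \<bar>b\<bar> * \<rho> * ?d + K * \<rho> * ?d = K' * \<rho> * ?d"
      by (simp add: K'_def algebra_simps)
    thus ?thesis using 1 2 cmod_le[of "(\<Phi> z - L z) - (\<Phi> w - L w)"] by linarith
  qed
  have defect: "(\<lambda>z. X (z * cis (\<omega> z)) + X (z * cis (- \<omega> z)) - k (X z)) \<in> o[nhds 0](\<lambda>z. (cmod z) ^ 3)"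
    unfolding X_def \<omega>_def by (rule normal_form_defect[OF c\<alpha> NF b(2) k])
  \<comment> \<open>The radius is halved because \<open>L\<close> may double norms.\<close>
  have "\<exists>N>0. infinite {w. (\<forall>j. cmod ((T' ^^ j) w) < \<rho>0 / 2) \<and> (T' ^^ N) w = w}"
  proof (rule infinitely_many_periodic_points[where V = "\<lambda>z. V (L z)" and \<kappa> = "\<kappa> * S\<^sup>2" and \<phi> = \<phi> and b = b and \<alpha> = \<alpha>])
    show "\<kappa> * S\<^sup>2 \<noteq> 0" using \<kappa> S by simp
    show "b \<noteq> 0" by (rule b)
    show "\<rho>0 / 2 > 0" using \<rho>0 by simp
    show "\<phi> 0 = 0" by (simp add: \<phi>_def \<Phi>0 L_def Li_def complex_eq_iff)
    fix \<eta> :: real assume \<eta>: "\<eta> > 0"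
    show "\<exists>\<rho>>0. \<forall>z w. cmod z < \<rho> \<longrightarrow> cmod w < \<rho> \<longrightarrow> cmod (\<phi> z - \<phi> w) \<le> \<eta> * cmod (z - w)"
    proof (intro exI[of _ "min 1 (\<eta> / (M * K' + 1))"] conjI allI impI)
      have MK: "M * K' + 1 > 0" using M K' by (simp add: add_nonneg_pos)
      thus "min 1 (\<eta> / (M * K' + 1)) > 0" using \<eta> by simp
      define \<rho> where "\<rho> = min 1 (\<eta> / (M * K' + 1))"
      have "\<rho> \<le> \<eta> / (M * K' + 1)" by (simp add: \<rho>_def)
      hence \<rho>3: "\<rho> * (M * K' + 1) \<le> \<eta>" by (simp only: pos_le_divide_eq[OF MK])
      have \<rho>: "\<rho> \<le> 1" "\<rho> > 0" using \<eta> MK by (simp_all add: \<rho>_def)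
      fix z w assume "cmod z < min 1 (\<eta> / (M * K' + 1))" "cmod w < min 1 (\<eta> / (M * K' + 1))"
      hence zw: "cmod z \<le> \<rho>" "cmod w \<le> \<rho>" by (simp_all add: \<rho>_def)
      have "cmod (\<phi> z - \<phi> w) \<le> M * cmod ((\<Phi> z - L z) - (\<Phi> w - L w))"
        unfolding \<phi>_def Li_diff[symmetric] by (rule Li_le)
      also have "\<dots> \<le> M * (K' * \<rho> * cmod (z - w))"
        using M \<Phi>lip[OF zw \<rho>(1)] by (intro mult_left_mono) auto
      also have "\<dots> = (\<rho> * (M * K')) * cmod (z - w)" by simp
      also have "\<dots> \<le> \<eta> * cmod (z - w)"
        using \<rho> \<rho>3 by (intro mult_right_mono) (auto simp: algebra_simps)
      finally show "cmod (\<phi> z - \<phi> w) \<le> \<eta> * cmod (z - w)" .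
    qed
    show "\<exists>\<rho>>0. \<forall>z. cmod z < \<rho> \<longrightarrow>
       cmod (T' (z + \<phi> z) - (z * cis (\<alpha> + b * (cmod z)\<^sup>2) + \<phi> (z * cis (\<alpha> + b * (cmod z)\<^sup>2)))) \<le> \<eta> * (cmod z) ^ 3"
    proof -
      have "\<eta> / M > 0" using \<eta> M by simp
      from smallo_nhds_0_bound[OF defect this] obtain \<rho> where \<rho>: "\<rho> > 0"
        "\<And>z. cmod z < \<rho> \<Longrightarrow> \<bar>X (R z) + X (z * cis (- \<omega> z)) - k (X z)\<bar> \<le> \<eta> / M * (cmod z) ^ 3"
        by (auto simp: R_def)
      show ?thesis
      proof (intro exI[of _ \<rho>] conjI allI impI \<rho>(1))
        fix z assume z: "cmod z < \<rho>"
        have Rz: "\<omega> (R z) = \<omega> z" by (simp add: R_def \<omega>_def norm_mult)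
        have RR: "R z * cis (- \<omega> (R z)) = z" unfolding Rz by (simp add: R_def mult.assoc cis_mult)
        \<comment> \<open>Rotation preserves the radius, so \<open>R z\<close> turned back by its
          own angle is z. Hence the first components agree, and the second is minus the defect of
          the ansatz.\<close>
        have TE: "T (\<Phi> z) - \<Phi> (R z) = Complex 0 (k (X z) - X (z * cis (- \<omega> z)) - X (R z))"
          by (simp add: T \<Phi>_def RR complex_eq_iff)
        have E: "cmod (T (\<Phi> z) - \<Phi> (R z)) \<le> \<eta> / M * (cmod z) ^ 3"
          unfolding TE using norm_Complex_le[of 0 "k (X z) - X (z * cis (- \<omega> z)) - X (R z)"] \<rho>(2)[OF z] by linarith
        have "T' (z + \<phi> z) - (R z + \<phi> (R z)) = Li (T (\<Phi> z) - \<Phi> (R z))"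
          by (simp add: \<phi>_eq T'_def Li_diff)
        hence "cmod (T' (z + \<phi> z) - (R z + \<phi> (R z))) \<le> M * (\<eta> / M * (cmod z) ^ 3)"
          using Li_le[of "T (\<Phi> z) - \<Phi> (R z)"] mult_left_mono[OF E, of M] M by simp
        thus "cmod (T' (z + \<phi> z) - (z * cis (\<alpha> + b * (cmod z)\<^sup>2) + \<phi> (z * cis (\<alpha> + b * (cmod z)\<^sup>2)))) \<le> \<eta> * (cmod z) ^ 3"
          using M by (simp add: R_def \<omega>_def)
      qed
    qed
    show "\<exists>\<rho>>0. \<forall>r z z'. r < \<rho> \<longrightarrow> cmod z \<le> r \<longrightarrow> cmod z' \<le> r \<longrightarrow>
        \<bar>V (L z') - V (L z) - \<kappa> * S\<^sup>2 * ((cmod z')\<^sup>2 - (cmod z)\<^sup>2)\<bar> \<le> \<eta> * r * cmod (z' - z)"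
    proof -
      obtain \<rho> where \<rho>: "\<rho> > 0" "\<And>r w w'. r < \<rho> \<Longrightarrow> cmod w \<le> r \<Longrightarrow> cmod w' \<le> r \<Longrightarrow>
        \<bar>V w' - V w - \<kappa> * (((Re w')\<^sup>2 - t * Re w' * Im w' + (Im w')\<^sup>2) - ((Re w)\<^sup>2 - t * Re w * Im w + (Im w)\<^sup>2))\<bar>
          \<le> \<eta> / 4 * r * cmod (w' - w)"
        using V[of "\<eta> / 4"] \<eta> by auto
      show ?thesis
      proof (intro exI[of _ "\<rho> / 2"] conjI allI impI)
        fix r z z' assume r: "r < \<rho> / 2" "cmod z \<le> r" "cmod z' \<le> r"
        have r0: "r \<ge> 0" using r norm_ge_zero order_trans by blast
        have Q: "(Re (L u))\<^sup>2 - t * Re (L u) * Im (L u) + (Im (L u))\<^sup>2 = S\<^sup>2 * (cmod u)\<^sup>2" for u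
        proof -
          have *: "(x * c + y * s)\<^sup>2 - 2 * c * (x * c + y * s) * x + x\<^sup>2 = s\<^sup>2 * (x\<^sup>2 + y\<^sup>2)"
            if "s\<^sup>2 + c\<^sup>2 = 1" for x y c s :: real using that by algebra
          show ?thesis unfolding S_def cmod_power2 using *[OF sin_cos_squared_add[of \<alpha>], of "Re u" "Im u"]
            by (simp add: L_def c\<alpha>[symmetric])
        qed
        have "\<bar>V (L z') - V (L z) - \<kappa> * (S\<^sup>2 * (cmod z')\<^sup>2 - S\<^sup>2 * (cmod z)\<^sup>2)\<bar> \<le> \<eta> / 4 * (2 * r) * cmod (L z' - L z)"
          using \<rho>(2)[of "2 * r" "L z" "L z'"] r L_le[of z] L_le[of z'] unfolding Q by linarith
        also have "\<dots> \<le> \<eta> / 4 * (2 * r) * (2 * cmod (z' - z))"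
          using L_le[of "z' - z"] \<eta> r0 by (intro mult_left_mono) (auto simp: L_diff)
        finally show "\<bar>V (L z') - V (L z) - \<kappa> * S\<^sup>2 * ((cmod z')\<^sup>2 - (cmod z)\<^sup>2)\<bar> \<le> \<eta> * r * cmod (z' - z)"
          by (simp add: algebra_simps)
      qed (use \<rho> in auto)
    qed
  next
    have ball: "\<bar>Re z\<bar> < \<rho>0" if "cmod z < \<rho>0 / 2" for z using that abs_Re_le_cmod[of z] \<rho>0 by linarith
    have kRe: "continuous_on (ball 0 (\<rho>0 / 2)) (\<lambda>z. k (Re z))"
      by (rule continuous_on_compose2[OF kc]) (use ball in \<open>auto intro!: continuous_intros simp: abs_less_iff\<close>, smt (verit))
    show "continuous_on (ball 0 (\<rho>0 / 2)) T'"
      unfolding T'_def[abs_def] T L_def Li_def Complex_eq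
      by (simp, intro continuous_intros kRe) (use S in auto)
  next
    fix w assume w: "cmod w < \<rho>0 / 2" "cmod (T' w) < \<rho>0 / 2"
    have "L (T' w) = T (L w)" by (simp add: T'_def)
    moreover have "cmod (L w) < \<rho>0" "cmod (L (T' w)) < \<rho>0" using L_le[of w] L_le[of "T' w"] w by linarith+
    ultimately show "V (L (T' w)) = V (L w)" using inv by simp
  qed
  then obtain N where N: "N > 0" "infinite {w. (\<forall>j. cmod ((T' ^^ j) w) < \<rho>0 / 2) \<and> (T' ^^ N) w = w}" by blast
  have it: "L ((T' ^^ j) w) = (T ^^ j) (L w)" for j w
    by (induction j) (auto simp: T'_def)
  have "L ` {w. (\<forall>j. cmod ((T' ^^ j) w) < \<rho>0 / 2) \<and> (T' ^^ N) w = w} \<subseteq> {w. (\<forall>j. cmod ((T ^^ j) w) < \<rho>0) \<and> (T ^^ N) w = w}"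
  proof (rule image_subsetI, rule CollectI, intro conjI allI)
    fix w j assume w: "w \<in> {w. (\<forall>j. cmod ((T' ^^ j) w) < \<rho>0 / 2) \<and> (T' ^^ N) w = w}"
    hence "cmod ((T' ^^ j) w) < \<rho>0 / 2" by blast
    thus "cmod ((T ^^ j) (L w)) < \<rho>0" unfolding it[symmetric] using L_le[of "(T' ^^ j) w"] by linarith
    show "(T ^^ N) (L w) = L w" unfolding it[symmetric] using w by simp
  qed
  moreover have "inj L" by (metis LiL injI)
  ultimately have "infinite {w. (\<forall>j. cmod ((T ^^ j) w) < \<rho>0) \<and> (T ^^ N) w = w}"
    using N(2) finite_imageD[of L] by (metis (no_types, lifting) finite_subset inj_on_subset top_greatest)
  thus ?thesis using N(1) by blast
qed

subsection \<open>Jets, second derivatives and resonances\<close>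

text \<open>Expansions are taken only along curves issuing from the fixed point, with parameter s >
  0. Composing such one-variable jets replaces a Taylor expansion of the iterates of the map in two
  variables, and suffices to detect resonant terms.\<close>

definition cubic_jet :: "(real \<Rightarrow> real) \<Rightarrow> real \<Rightarrow> real \<Rightarrow> real \<Rightarrow> bool" where
  "cubic_jet u c1 c2 c3 \<longleftrightarrow> (\<lambda>s. u s - (c1 * s + c2 * s\<^sup>2 + c3 * s ^ 3)) \<in> o[at_right 0](\<lambda>s. s ^ 3)"

lemma cubic_jet_diff:
  assumes "cubic_jet u c1 c2 c3" "cubic_jet v d1 d2 d3"
  shows "cubic_jet (\<lambda>s. u s - v s) (c1 - d1) (c2 - d2) (c3 - d3)"
  using sum_in_smallo(2)[OF assms[unfolded cubic_jet_def]]
  unfolding cubic_jet_def by (simp add: algebra_simps)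

lemma cubic_jet_linear: "cubic_jet (\<lambda>s. c * s) c 0 0"
  by (simp add: cubic_jet_def)

lemma power_bigo_at_right_0: "j \<ge> i \<Longrightarrow> (\<lambda>s::real. s ^ j) \<in> O[at_right 0](\<lambda>s. s ^ i)"
proof (rule landau_o.bigI[of 1])
  assume ij: "i \<le> j"
  have "\<forall>\<^sub>F s::real in at_right 0. s \<in> {0<..<1}" by (rule eventually_at_right_real) simp
  thus "\<forall>\<^sub>F s::real in at_right 0. norm (s ^ j) \<le> 1 * norm (s ^ i)"
    by eventually_elim (use ij in \<open>auto intro: power_decreasing\<close>)
qed simp

lemma power_smallo_at_right_0:
  assumes "j > i"
  shows "(\<lambda>s::real. s ^ j) \<in> o[at_right 0](\<lambda>s. s ^ i)"
proof (rule landau_o.smallI)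
  fix c :: real assume c: "c > 0"
  have "\<forall>\<^sub>F s::real in at_right 0. s \<in> {0<..<min 1 c}" by (rule eventually_at_right_real) (use c in simp)
  thus "\<forall>\<^sub>F s::real in at_right 0. norm (s ^ j) \<le> c * norm (s ^ i)"
  proof eventually_elim
    case (elim s)
    have "s ^ j \<le> s ^ Suc i" by (rule power_decreasing) (use assms elim in auto)
    also have "\<dots> \<le> c * s ^ i" using elim by (simp add: mult_right_mono)
    finally show ?case using elim by simp
  qed
qed

lemma cubic_jet_bigo:
  assumes "cubic_jet u c1 c2 c3"
  shows "u \<in> O[at_right 0](\<lambda>s. s ^ 1)"
proof -
  have cm: "(\<lambda>s. c * s ^ j) \<in> O[at_right 0](\<lambda>s::real. s ^ 1)" if "j \<ge> 1" for c j
    using power_bigo_at_right_0[OF that] by simp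
  have "(\<lambda>s. u s - (c1 * s + c2 * s\<^sup>2 + c3 * s ^ 3)) \<in> O[at_right 0](\<lambda>s. s ^ 1)"
    using landau_o.big_trans[OF landau_o.small_imp_big[OF assms[unfolded cubic_jet_def]] power_bigo_at_right_0[of 1 3]]
    by simp
  from sum_in_bigo(1)[OF this, of "\<lambda>s. c1 * s + c2 * s\<^sup>2 + c3 * s ^ 3"] show ?thesis
    using sum_in_bigo(1)[OF sum_in_bigo(1)[OF cm[of 1 c1] cm[of 2 c2]] cm[of 3 c3]] by simp
qed

lemma cubic_jet_tendsto_0:
  assumes "cubic_jet u c1 c2 c3"
  shows "(u \<longlongrightarrow> 0) (at_right 0)"
proof -
  from landau_o.bigE[OF cubic_jet_bigo[OF assms]] obtain c where
    c: "c > 0" "\<forall>\<^sub>F s in at_right 0. norm (u s) \<le> c * norm (s ^ 1)" by blast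
  have "((\<lambda>s::real. c * norm (s ^ 1)) \<longlongrightarrow> 0) (at_right 0)"
    by (rule tendsto_eq_intros refl | simp)+
  with c(2) show ?thesis by (rule Lim_null_comparison)
qed

lemma cubic_jet_compose:
  assumes u: "cubic_jet u c1 c2 c3"
    and k: "(\<lambda>u. k u - (t * u + p * u\<^sup>2 + q * u ^ 3)) \<in> o[nhds 0](\<lambda>u. u ^ 3)"
  shows "cubic_jet (\<lambda>s. k (u s)) (t * c1) (t * c2 + p * c1\<^sup>2) (t * c3 + 2 * p * c1 * c2 + q * c1 ^ 3)"
proof -
  define v where "v s = c1 * s + c2 * s\<^sup>2 + c3 * s ^ 3" for s
  define r where "r s = u s - v s" for s
  have r: "r \<in> o[at_right 0](\<lambda>s. s ^ 3)" using u unfolding cubic_jet_def r_def v_def .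
  have uO: "u \<in> O[at_right 0](\<lambda>s. s ^ 1)" by (rule cubic_jet_bigo[OF u])
  have vO: "v \<in> O[at_right 0](\<lambda>s. s ^ 1)" unfolding v_def
    by (rule cubic_jet_bigo[of _ c1 c2 c3]) (simp add: cubic_jet_def)
  have O1: "f \<in> O[at_right 0](\<lambda>_. 1)" if "f \<in> O[at_right 0](\<lambda>s. s ^ 1)" for f :: "real \<Rightarrow> real"
    using landau_o.big_trans[OF that power_bigo_at_right_0[of 0 1]] by simp
  have e: "(\<lambda>s. k (u s) - (t * u s + p * (u s)\<^sup>2 + q * (u s) ^ 3)) \<in> o[at_right 0](\<lambda>s. s ^ 3)"
  proof (rule landau_o.small_big_trans)
    show "(\<lambda>s. k (u s) - (t * u s + p * (u s)\<^sup>2 + q * (u s) ^ 3)) \<in> o[at_right 0](\<lambda>s. (u s) ^ 3)"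
      by (rule landau_o.small.compose[OF k cubic_jet_tendsto_0[OF u]])
    show "(\<lambda>s. (u s) ^ 3) \<in> O[at_right 0](\<lambda>s. s ^ 3)"
      using landau_o.big_power[OF uO, of 3] by simp
  qed
  have mO: "(\<lambda>s. r s * f s) \<in> o[at_right 0](\<lambda>s. s ^ 3)" if "f \<in> O[at_right 0](\<lambda>_. 1)" for f
    using landau_o.small_big_mult[OF r that] by simp
  have r1: "(\<lambda>s. r s * (t + p * (u s + v s) + q * (u s * u s + u s * v s + v s * v s))) \<in> o[at_right 0](\<lambda>s. s ^ 3)"
  proof (rule mO)
    have mul: "(\<lambda>s. f s * g s) \<in> O[at_right 0](\<lambda>_. 1)" if "f \<in> O[at_right 0](\<lambda>_. 1)" "g \<in> O[at_right 0](\<lambda>_. 1)"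
      for f g :: "real \<Rightarrow> real" using landau_o.big.mult[OF that] by simp
    have con: "(\<lambda>_. c) \<in> O[at_right (0::real)](\<lambda>_. 1::real)" for c by simp
    show "(\<lambda>s. t + p * (u s + v s) + q * (u s * u s + u s * v s + v s * v s)) \<in> O[at_right 0](\<lambda>_. 1)"
      by (intro sum_in_bigo(1) mul con O1 uO vO)
  qed
  have r2: "(\<lambda>s. s ^ 4 * (p * (c2\<^sup>2 + 2 * c1 * c3 + 2 * c2 * c3 * s + c3\<^sup>2 * s\<^sup>2) +
      q * (c2 + c3 * s) * ((c1 + c2 * s + c3 * s\<^sup>2)\<^sup>2 + (c1 + c2 * s + c3 * s\<^sup>2) * c1 + c1\<^sup>2))) \<in> o[at_right 0](\<lambda>s. s ^ 3)"
  proof -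
    define g where "g s = p * (c2\<^sup>2 + 2 * c1 * c3 + 2 * c2 * c3 * s + c3\<^sup>2 * s\<^sup>2) +
      q * (c2 + c3 * s) * ((c1 + c2 * s + c3 * s\<^sup>2)\<^sup>2 + (c1 + c2 * s + c3 * s\<^sup>2) * c1 + c1\<^sup>2)" for s
    have "(g \<longlongrightarrow> g 0) (at_right 0)" unfolding g_def[abs_def] by (intro tendsto_intros)
    hence "g \<in> O[at_right 0](\<lambda>_. 1)" by (intro bigoI_tendsto[where c = "g 0"]) auto
    from landau_o.small_big_mult[OF power_smallo_at_right_0[of 3 4] this] show ?thesis by (simp add: g_def)
  qed
  \<comment> \<open>Three remainders: the Taylor remainder of k at u, the difference of the cubic at
    u and at its jet v (divisible by r = u - v), and the terms of degree at least four of the cubic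
    at v.\<close>
  have "k (u s) - (t * c1 * s + (t * c2 + p * c1\<^sup>2) * s\<^sup>2 + (t * c3 + 2 * p * c1 * c2 + q * c1 ^ 3) * s ^ 3) =
      (k (u s) - (t * u s + p * (u s)\<^sup>2 + q * (u s) ^ 3)) +
      r s * (t + p * (u s + v s) + q * (u s * u s + u s * v s + v s * v s)) +
      s ^ 4 * (p * (c2\<^sup>2 + 2 * c1 * c3 + 2 * c2 * c3 * s + c3\<^sup>2 * s\<^sup>2) +
      q * (c2 + c3 * s) * ((c1 + c2 * s + c3 * s\<^sup>2)\<^sup>2 + (c1 + c2 * s + c3 * s\<^sup>2) * c1 + c1\<^sup>2))" for s
  proof -
    have 1: "r s * (t + p * (u s + v s) + q * (u s * u s + u s * v s + v s * v s)) =
      (t * u s + p * (u s)\<^sup>2 + q * (u s) ^ 3) - (t * v s + p * (v s)\<^sup>2 + q * (v s) ^ 3)"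
      unfolding r_def by (simp add: algebra_simps power2_eq_square power3_eq_cube)
    have 2: "(t * v s + p * (v s)\<^sup>2 + q * (v s) ^ 3) - (t * c1 * s + (t * c2 + p * c1\<^sup>2) * s\<^sup>2 + (t * c3 + 2 * p * c1 * c2 + q * c1 ^ 3) * s ^ 3) =
      s ^ 4 * (p * (c2\<^sup>2 + 2 * c1 * c3 + 2 * c2 * c3 * s + c3\<^sup>2 * s\<^sup>2) +
      q * (c2 + c3 * s) * ((c1 + c2 * s + c3 * s\<^sup>2)\<^sup>2 + (c1 + c2 * s + c3 * s\<^sup>2) * c1 + c1\<^sup>2))"
      unfolding v_def by (simp add: algebra_simps power2_eq_square power3_eq_cube power4_eq_xxxx)
    show ?thesis using 1 2 by linarith
  qed
  hence "(\<lambda>s. k (u s) - (t * c1 * s + (t * c2 + p * c1\<^sup>2) * s\<^sup>2 + (t * c3 + 2 * p * c1 * c2 + q * c1 ^ 3) * s ^ 3)) = (\<lambda>s.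
      (k (u s) - (t * u s + p * (u s)\<^sup>2 + q * (u s) ^ 3)) +
      r s * (t + p * (u s + v s) + q * (u s * u s + u s * v s + v s * v s)) +
      s ^ 4 * (p * (c2\<^sup>2 + 2 * c1 * c3 + 2 * c2 * c3 * s + c3\<^sup>2 * s\<^sup>2) +
      q * (c2 + c3 * s) * ((c1 + c2 * s + c3 * s\<^sup>2)\<^sup>2 + (c1 + c2 * s + c3 * s\<^sup>2) * c1 + c1\<^sup>2)))"
    by (rule ext)
  thus ?thesis unfolding cubic_jet_def
    by (simp only:) (rule sum_in_smallo(1)[OF sum_in_smallo(1)[OF e r1] r2])
qed

text \<open>Young's theorem, with partial derivatives that are differentiable at the point only. The
  second difference of \<open>V\<close> over a square of side s is evaluated by the mean value
  theorem in either order; divided by s, it is h s in one order and h' s in the other, up to a small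
  multiple of s.\<close>

lemma symmetric_second_derivative:
  fixes V Vx Vy :: "complex \<Rightarrow> real"
  assumes \<rho>0: "\<rho>0 > 0"
    and V: "\<And>w. cmod w < \<rho>0 \<Longrightarrow> (V has_derivative (\<lambda>d. Vx w * Re d + Vy w * Im d)) (at w)"
    and Vx: "\<And>\<eta>. \<eta> > 0 \<Longrightarrow> \<exists>\<rho>>0. \<forall>w. cmod w < \<rho> \<longrightarrow> \<bar>Vx w - (a * Re w + h * Im w)\<bar> \<le> \<eta> * cmod w"
    and Vy: "\<And>\<eta>. \<eta> > 0 \<Longrightarrow> \<exists>\<rho>>0. \<forall>w. cmod w < \<rho> \<longrightarrow> \<bar>Vy w - (h' * Re w + e * Im w)\<bar> \<le> \<eta> * cmod w"
  shows "h = h'"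
proof (rule ccontr)
  assume ne: "h \<noteq> h'"
  \<comment> \<open>Each of the two evaluations has error at most 4 \<eta> s, so |h - h'| \<le> 8
    \<eta>, which is half of |h - h'|.\<close>
  define \<eta> where "\<eta> = \<bar>h - h'\<bar> / 16"
  have \<eta>: "\<eta> > 0" using ne by (simp add: \<eta>_def)
  obtain \<rho>1 where \<rho>1: "\<rho>1 > 0" "\<And>w. cmod w < \<rho>1 \<Longrightarrow> \<bar>Vx w - (a * Re w + h * Im w)\<bar> \<le> \<eta> * cmod w"
    using Vx[OF \<eta>] by blast
  obtain \<rho>2 where \<rho>2: "\<rho>2 > 0" "\<And>w. cmod w < \<rho>2 \<Longrightarrow> \<bar>Vy w - (h' * Re w + e * Im w)\<bar> \<le> \<eta> * cmod w"
    using Vy[OF \<eta>] by blast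
  define s where "s = min \<rho>0 (min \<rho>1 \<rho>2) / 4"
  have s: "s > 0" "2 * s < \<rho>0" "2 * s < \<rho>1" "2 * s < \<rho>2"
    using \<rho>0 \<rho>1 \<rho>2 by (auto simp: s_def)
  have n: "cmod (Complex x y) \<le> 2 * s" if "0 \<le> x" "x \<le> s" "0 \<le> y" "y \<le> s" for x y
    using that cmod_le[of "Complex x y"] by simp
  have DX: "((\<lambda>x. V (Complex x y)) has_real_derivative Vx (Complex x y)) (at x)"
    if "0 \<le> x" "x \<le> s" "0 \<le> y" "y \<le> s" for x y
  proof -
    have "((\<lambda>x. Complex x y) has_derivative (\<lambda>d. Complex d 0)) (at x)"
      unfolding Complex_eq by (auto intro!: derivative_eq_intros)
    moreover have "(V has_derivative (\<lambda>d. Vx (Complex x y) * Re d + Vy (Complex x y) * Im d)) (at (Complex x y))"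
      by (rule V) (use n[OF that] s in linarith)
    ultimately have "((\<lambda>x. V (Complex x y)) has_derivative
        (\<lambda>d. Vx (Complex x y) * Re (Complex d 0) + Vy (Complex x y) * Im (Complex d 0))) (at x)"
      by (rule has_derivative_compose)
    thus ?thesis by (simp add: has_field_derivative_def mult.commute[of _ "Vx _"])
  qed
  have DY: "((\<lambda>y. V (Complex x y)) has_real_derivative Vy (Complex x y)) (at y)"
    if "0 \<le> x" "x \<le> s" "0 \<le> y" "y \<le> s" for x y
  proof -
    have "((\<lambda>y. Complex x y) has_derivative (\<lambda>d. Complex 0 d)) (at y)"
      unfolding Complex_eq by (auto intro!: derivative_eq_intros)
    moreover have "(V has_derivative (\<lambda>d. Vx (Complex x y) * Re d + Vy (Complex x y) * Im d)) (at (Complex x y))"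
      by (rule V) (use n[OF that] s in linarith)
    ultimately have "((\<lambda>y. V (Complex x y)) has_derivative
        (\<lambda>d. Vx (Complex x y) * Re (Complex 0 d) + Vy (Complex x y) * Im (Complex 0 d))) (at y)"
      by (rule has_derivative_compose)
    thus ?thesis by (simp add: has_field_derivative_def mult.commute[of _ "Vy _"])
  qed
  define \<Delta> where "\<Delta> = V (Complex s s) - V (Complex s 0) - V (Complex 0 s) + V (Complex 0 0)"
  obtain y where y: "0 < y" "y < s"
    "(V (Complex s s) - V (Complex 0 s)) - (V (Complex s 0) - V (Complex 0 0)) = (s - 0) * (Vy (Complex s y) - Vy (Complex 0 y))"
    using MVT2[of 0 s "\<lambda>y. V (Complex s y) - V (Complex 0 y)" "\<lambda>y. Vy (Complex s y) - Vy (Complex 0 y)"]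
      DERIV_diff[OF DY[of s] DY[of 0]] s by auto
  obtain x where x: "0 < x" "x < s"
    "(V (Complex s s) - V (Complex s 0)) - (V (Complex 0 s) - V (Complex 0 0)) = (s - 0) * (Vx (Complex x s) - Vx (Complex x 0))"
    using MVT2[of 0 s "\<lambda>x. V (Complex x s) - V (Complex x 0)" "\<lambda>x. Vx (Complex x s) - Vx (Complex x 0)"]
      DERIV_diff[OF DX[of _ s] DX[of _ 0]] s by auto
  have bx: "\<bar>Vx (Complex x y) - (a * x + h * y)\<bar> \<le> \<eta> * (2 * s)" if "0 \<le> x" "x \<le> s" "0 \<le> y" "y \<le> s" for x y
  proof -
    have "cmod (Complex x y) < \<rho>1" using n[OF that] s by linarith
    from \<rho>1(2)[OF this, unfolded complex.sel] mult_left_mono[OF n[OF that], of \<eta>] \<eta>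
    show ?thesis by linarith
  qed
  have bY: "\<bar>Vy (Complex x y) - (h' * x + e * y)\<bar> \<le> \<eta> * (2 * s)" if "0 \<le> x" "x \<le> s" "0 \<le> y" "y \<le> s" for x y
  proof -
    have "cmod (Complex x y) < \<rho>2" using n[OF that] s by linarith
    from \<rho>2(2)[OF this, unfolded complex.sel] mult_left_mono[OF n[OF that], of \<eta>] \<eta>
    show ?thesis by linarith
  qed
  have "\<bar>Vy (Complex s y) - Vy (Complex 0 y) - h' * s\<bar> \<le> 4 * \<eta> * s"
    using bY[of s y] bY[of 0 y] y s by simp
  moreover have "\<bar>Vx (Complex x s) - Vx (Complex x 0) - h * s\<bar> \<le> 4 * \<eta> * s"
    using bx[of x s] bx[of x 0] x s by simp
  moreover have "Vy (Complex s y) - Vy (Complex 0 y) = Vx (Complex x s) - Vx (Complex x 0)"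
  proof -
    have "s * (Vy (Complex s y) - Vy (Complex 0 y)) = s * (Vx (Complex x s) - Vx (Complex x 0))"
      using x(3) y(3) unfolding diff_zero by linarith
    thus ?thesis using s by simp
  qed
  ultimately have "\<bar>h * s - h' * s\<bar> \<le> 8 * \<eta> * s" by linarith
  hence "\<bar>h - h'\<bar> * s \<le> 8 * \<eta> * s" using s by (simp add: abs_mult flip: left_diff_distrib)
  hence "\<bar>h - h'\<bar> \<le> 8 * \<eta>" using s by simp
  thus False using ne by (simp add: \<eta>_def)
qed

text \<open>The gradient of V - Q is o(|w|), and the mean value inequality on the disc of radius r
  turns this into a bound for increments, finer than a bound for values when w and w' are
  close.\<close>

lemma quadratic_approximation:
  fixes V Vx Vy :: "complex \<Rightarrow> real" and a h e :: real
  defines "Q \<equiv> \<lambda>w. (a * (Re w)\<^sup>2 + 2 * h * Re w * Im w + e * (Im w)\<^sup>2) / 2"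
  assumes \<rho>0: "\<rho>0 > 0"
    and V: "\<And>w. cmod w < \<rho>0 \<Longrightarrow> (V has_derivative (\<lambda>d. Vx w * Re d + Vy w * Im d)) (at w)"
    and Vx: "\<And>\<eta>. \<eta> > 0 \<Longrightarrow> \<exists>\<rho>>0. \<forall>w. cmod w < \<rho> \<longrightarrow> \<bar>Vx w - (a * Re w + h * Im w)\<bar> \<le> \<eta> * cmod w"
    and Vy: "\<And>\<eta>. \<eta> > 0 \<Longrightarrow> \<exists>\<rho>>0. \<forall>w. cmod w < \<rho> \<longrightarrow> \<bar>Vy w - (h * Re w + e * Im w)\<bar> \<le> \<eta> * cmod w"
    and \<eta>: "\<eta> > 0"
  shows "\<exists>\<rho>>0. \<forall>r w w'. r < \<rho> \<longrightarrow> cmod w \<le> r \<longrightarrow> cmod w' \<le> r \<longrightarrow>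
           \<bar>V w' - V w - (Q w' - Q w)\<bar> \<le> \<eta> * r * cmod (w' - w)"
proof -
  have "\<eta> / 2 > 0" using \<eta> by simp
  obtain \<rho>1 where \<rho>1: "\<rho>1 > 0" "\<And>w. cmod w < \<rho>1 \<Longrightarrow> \<bar>Vx w - (a * Re w + h * Im w)\<bar> \<le> \<eta> / 2 * cmod w"
    using Vx[OF \<open>\<eta> / 2 > 0\<close>] by blast
  obtain \<rho>2 where \<rho>2: "\<rho>2 > 0" "\<And>w. cmod w < \<rho>2 \<Longrightarrow> \<bar>Vy w - (h * Re w + e * Im w)\<bar> \<le> \<eta> / 2 * cmod w"
    using Vy[OF \<open>\<eta> / 2 > 0\<close>] by blast
  show ?thesis
  proof (intro exI[of _ "min \<rho>0 (min \<rho>1 \<rho>2)"] conjI allI impI)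
    fix r w w' assume r: "r < min \<rho>0 (min \<rho>1 \<rho>2)" "cmod w \<le> r" "cmod w' \<le> r"
    define g where "g x = V x - Q x" for x
    define g' where "g' x d = (Vx x - (a * Re x + h * Im x)) * Re d + (Vy x - (h * Re x + e * Im x)) * Im d" for x d
    have "norm (g w' - g w) \<le> (\<eta> * r) * norm (w' - w)"
    proof (rule differentiable_bound[of "cball 0 r" g g'])
      fix x :: complex assume x: "x \<in> cball 0 r"
      have dRe: "(Re has_derivative Re) (at x)" and dIm: "(Im has_derivative Im) (at x)"
        by (rule bounded_linear_imp_has_derivative[OF bounded_linear_Re],
            rule bounded_linear_imp_has_derivative[OF bounded_linear_Im])
      have "((\<lambda>w. (a/2) * (Re w * Re w) + h * (Re w * Im w) + (e/2) * (Im w * Im w)) has_derivative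
        (\<lambda>d. (a/2) * (Re x * Re d + Re d * Re x) + h * (Re x * Im d + Re d * Im x) + (e/2) * (Im x * Im d + Im d * Im x))) (at x)"
        by (intro has_derivative_add has_derivative_mult_right has_derivative_mult dRe dIm)
      moreover have "(V has_derivative (\<lambda>d. Vx x * Re d + Vy x * Im d)) (at x)"
        by (rule V) (use x r in simp)
      ultimately have "((\<lambda>w. V w - ((a/2) * (Re w * Re w) + h * (Re w * Im w) + (e/2) * (Im w * Im w))) has_derivative
        (\<lambda>d. (Vx x * Re d + Vy x * Im d) -
          ((a/2) * (Re x * Re d + Re d * Re x) + h * (Re x * Im d + Re d * Im x) + (e/2) * (Im x * Im d + Im d * Im x)))) (at x)"
        using has_derivative_diff by blast
      moreover have "g = (\<lambda>w. V w - ((a/2) * (Re w * Re w) + h * (Re w * Im w) + (e/2) * (Im w * Im w)))"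
        by (simp add: fun_eq_iff g_def Q_def power2_eq_square field_simps)
      moreover have "g' x = (\<lambda>d. (Vx x * Re d + Vy x * Im d) -
          ((a/2) * (Re x * Re d + Re d * Re x) + h * (Re x * Im d + Re d * Im x) + (e/2) * (Im x * Im d + Im d * Im x)))"
        by (simp add: fun_eq_iff g'_def field_simps)
      ultimately have "(g has_derivative g' x) (at x)" by simp
      thus "(g has_derivative g' x) (at x within cball 0 r)" by (rule has_derivative_at_withinI)
      show "onorm (g' x) \<le> \<eta> * r"
      proof (rule onorm_le)
        fix d
        have "\<bar>(Vx x - (a * Re x + h * Im x)) * Re d\<bar> \<le> (\<eta> / 2 * r) * cmod d"
          unfolding abs_mult
        proof (intro mult_mono abs_Re_le_cmod)
          have "\<eta> / 2 * cmod x \<le> \<eta> / 2 * r" using x \<eta> by (intro mult_left_mono) auto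
          thus "\<bar>Vx x - (a * Re x + h * Im x)\<bar> \<le> \<eta> / 2 * r" using \<rho>1(2)[of x] x r by simp
          show "0 \<le> \<eta> / 2 * r" using \<eta> r norm_ge_zero[of w] by (intro mult_nonneg_nonneg) linarith+
        qed auto
        moreover have "\<bar>(Vy x - (h * Re x + e * Im x)) * Im d\<bar> \<le> (\<eta> / 2 * r) * cmod d"
          unfolding abs_mult
        proof (intro mult_mono abs_Im_le_cmod)
          have "\<eta> / 2 * cmod x \<le> \<eta> / 2 * r" using x \<eta> by (intro mult_left_mono) auto
          thus "\<bar>Vy x - (h * Re x + e * Im x)\<bar> \<le> \<eta> / 2 * r" using \<rho>2(2)[of x] x r by simp
          show "0 \<le> \<eta> / 2 * r" using \<eta> r norm_ge_zero[of w] by (intro mult_nonneg_nonneg) linarith+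
        qed auto
        ultimately show "norm (g' x d) \<le> \<eta> * r * norm d" unfolding g'_def real_norm_def by linarith
      qed
    qed (use r in auto)
    thus "\<bar>V w' - V w - (Q w' - Q w)\<bar> \<le> \<eta> * r * cmod (w' - w)" by (simp add: g_def algebra_simps)
  qed (use \<rho>0 \<rho>1 \<rho>2 in auto)
qed

text \<open>Let B be the symmetric bilinear form with Q(w) = B(w, w)/2. Then Q(w') - Q(w) = B(w +
  w', w' - w)/2, and division by s^(d+1) leaves B(W + W', P)/2 in the limit, while the error of
  \<open>V\<close> becomes an arbitrarily small constant. With an iterate of w as w', every choice
  of a curve gives one algebraic condition on the jet of the map; d is the order at which the two
  curves are compared.\<close>

lemma invariance_along_curves:
  fixes V :: "complex \<Rightarrow> real" and w w' :: "real \<Rightarrow> complex" and a h e :: real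
  defines "Q \<equiv> \<lambda>w. (a * (Re w)\<^sup>2 + 2 * h * Re w * Im w + e * (Im w)\<^sup>2) / 2"
  assumes V: "\<And>\<eta>. \<eta> > 0 \<Longrightarrow> \<exists>\<rho>>0. \<forall>r w w'. r < \<rho> \<longrightarrow> cmod w \<le> r \<longrightarrow> cmod w' \<le> r \<longrightarrow>
           \<bar>V w' - V w - (Q w' - Q w)\<bar> \<le> \<eta> * r * cmod (w' - w)"
    and w: "((\<lambda>s. w s / of_real s) \<longlongrightarrow> W) (at_right 0)"
    and w': "((\<lambda>s. w' s / of_real s) \<longlongrightarrow> W') (at_right 0)"
    and d: "((\<lambda>s. (w' s - w s) / of_real (s ^ d)) \<longlongrightarrow> P) (at_right 0)"
    and eq: "\<forall>\<^sub>F s in at_right 0. V (w' s) = V (w s)"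
  shows "a * (Re W + Re W') * Re P + h * ((Re W + Re W') * Im P + (Im W + Im W') * Re P) + e * (Im W + Im W') * Im P = 0"
proof -
  define B where "B x y = a * Re x * Re y + h * (Re x * Im y + Im x * Re y) + e * Im x * Im y" for x y
  have QB: "Q y - Q x = B (x + y) (y - x) / 2" for x y
    by (simp add: Q_def B_def power2_eq_square field_simps)
  have Bs: "B (x / of_real s) (y / of_real s') = B x y / (s * s')" for x y s s'
    by (simp add: B_def add_divide_distrib algebra_simps)
  define f where "f s = \<bar>B (w s / of_real s + w' s / of_real s) ((w' s - w s) / of_real (s ^ d))\<bar> / 2" for s
  define g where "g \<eta> s = \<eta> * (cmod (w s / of_real s) + cmod (w' s / of_real s)) * cmod ((w' s - w s) / of_real (s ^ d))" for \<eta> s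
  have z: "(w \<longlongrightarrow> 0) (at_right 0)" if "((\<lambda>s. w s / of_real s) \<longlongrightarrow> W) (at_right 0)" for w :: "real \<Rightarrow> complex" and W
  proof -
    have "((\<lambda>s. w s / of_real s * of_real s) \<longlongrightarrow> W * of_real 0) (at_right 0)"
      by (intro tendsto_mult that tendsto_of_real) auto
    hence "((\<lambda>s. w s / of_real s * of_real s) \<longlongrightarrow> 0) (at_right 0)" by simp
    thus ?thesis
      by (rule Lim_transform_eventually) (rule eventually_mono[OF eventually_at_right_less[of 0]], simp)
  qed
  have le: "\<bar>B (W + W') P\<bar> / 2 \<le> \<eta> * (cmod W + cmod W') * cmod P" if \<eta>: "\<eta> > 0" for \<eta>
  proof (rule tendsto_le)
    show "at_right (0::real) \<noteq> bot" by simp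
    show "(f \<longlongrightarrow> \<bar>B (W + W') P\<bar> / 2) (at_right 0)"
      unfolding f_def[abs_def] B_def by (intro tendsto_intros w w' d) auto
    show "(g \<eta> \<longlongrightarrow> \<eta> * (cmod W + cmod W') * cmod P) (at_right 0)"
      unfolding g_def[abs_def] by (intro tendsto_intros w w' d)
    obtain \<rho> where \<rho>: "\<rho> > 0" "\<And>r w w'. r < \<rho> \<Longrightarrow> cmod w \<le> r \<Longrightarrow> cmod w' \<le> r \<Longrightarrow>
           \<bar>V w' - V w - (Q w' - Q w)\<bar> \<le> \<eta> * r * cmod (w' - w)" using V[OF \<eta>] by blast
    have "((\<lambda>s. cmod (w s) + cmod (w' s)) \<longlongrightarrow> cmod 0 + cmod 0) (at_right 0)"
      by (intro tendsto_intros z[OF w] z[OF w'])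
    hence "\<forall>\<^sub>F s in at_right 0. cmod (w s) + cmod (w' s) < \<rho>"
      using \<rho>(1) by (intro order_tendstoD) auto
    moreover have "\<forall>\<^sub>F s in at_right (0::real). s > 0" by (rule eventually_at_right_less)
    ultimately show "\<forall>\<^sub>F s in at_right 0. f s \<le> g \<eta> s"
      using eq
    proof eventually_elim
      case (elim s)
      have "\<bar>B (w s + w' s) (w' s - w s)\<bar> / 2 \<le> \<eta> * (cmod (w s) + cmod (w' s)) * cmod (w' s - w s)"
        using \<rho>(2)[of "cmod (w s) + cmod (w' s)" "w s" "w' s"] elim QB[of "w' s" "w s"] by simp
      hence "(\<bar>B (w s + w' s) (w' s - w s)\<bar> / 2) / (s * s ^ d) \<le> (\<eta> * (cmod (w s) + cmod (w' s)) * cmod (w' s - w s)) / (s * s ^ d)"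
        using elim by (intro divide_right_mono) auto
      moreover have "f s = (\<bar>B (w s + w' s) (w' s - w s)\<bar> / 2) / (s * s ^ d)"
        unfolding f_def add_divide_distrib[symmetric] Bs using elim by (simp add: abs_mult)
      moreover have "g \<eta> s = (\<eta> * (cmod (w s) + cmod (w' s)) * cmod (w' s - w s)) / (s * s ^ d)"
        using elim by (simp add: g_def norm_divide norm_power add_divide_distrib distrib_left distrib_right)
      ultimately show ?case by simp
    qed
  qed
  have "\<bar>B (W + W') P\<bar> \<le> 0"
  proof (rule ccontr)
    assume n: "\<not> ?thesis"
    define M where "M = (cmod W + cmod W') * cmod P"
    have M: "M \<ge> 0" by (simp add: M_def)
    have "\<bar>B (W + W') P\<bar> / 2 \<le> \<bar>B (W + W') P\<bar> / (4 * (M + 1)) * M"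
    proof -
      have "\<bar>B (W + W') P\<bar> / (4 * (M + 1)) > 0" using n M by (intro divide_pos_pos) auto
      from le[OF this] show ?thesis by (simp add: M_def mult.assoc)
    qed
    also have "\<dots> = \<bar>B (W + W') P\<bar> / 4 * (M / (M + 1))" by simp
    also have "\<dots> \<le> \<bar>B (W + W') P\<bar> / 4 * 1" using M by (intro mult_left_mono) auto
    finally show False using n by simp
  qed
  thus ?thesis by (simp add: B_def mult.assoc)
qed

text \<open>The quadratic part of \<open>V\<close> is invariant under the linear part of
  \<open>T\<close>, hence a multiple of x^2 - t x y + y^2. Where a homological equation degenerates,
  at t = -1 and t = 0, invariance along three or four steps yields p = 0 or q = p^2, and these
  relations make the degenerate equation solvable.\<close>

lemma first_integral_imp_periodic_points:
  fixes k :: "real \<Rightarrow> real" and V Vx Vy :: "complex \<Rightarrow> real"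
  assumes t: "\<bar>t\<bar> < 2" and \<rho>0: "\<rho>0 > 0"
    and k: "(\<lambda>u. k u - (t * u + p * u\<^sup>2 + q * u ^ 3)) \<in> o[nhds 0](\<lambda>u. u ^ 3)"
    and kc: "continuous_on {-\<rho>0<..<\<rho>0} k"
    and V: "\<And>w. cmod w < \<rho>0 \<Longrightarrow> (V has_derivative (\<lambda>d. Vx w * Re d + Vy w * Im d)) (at w)"
    and Vx: "\<And>\<eta>. \<eta> > 0 \<Longrightarrow> \<exists>\<rho>>0. \<forall>w. cmod w < \<rho> \<longrightarrow> \<bar>Vx w - (a * Re w + h * Im w)\<bar> \<le> \<eta> * cmod w"
    and Vy: "\<And>\<eta>. \<eta> > 0 \<Longrightarrow> \<exists>\<rho>>0. \<forall>w. cmod w < \<rho> \<longrightarrow> \<bar>Vy w - (h' * Re w + e * Im w)\<bar> \<le> \<eta> * cmod w"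
    and det: "a * e - h * h' \<noteq> 0"
    and inv: "\<And>w. cmod w < \<rho>0 \<Longrightarrow> cmod (T w) < \<rho>0 \<Longrightarrow> V (T w) = V w"
    and T: "\<And>w. T w = Complex (Im w) (k (Im w) - Re w)"
    and twist: "6 * q * (2 - t) * (1 + t) + (2 * t + 1) * (2 * p)\<^sup>2 \<noteq> 0 \<or> t = -1 \<and> q \<noteq> 0"
  shows "\<exists>N>0. infinite {w. (\<forall>j. cmod ((T ^^ j) w) < \<rho>0) \<and> (T ^^ N) w = w}"
proof -
  have hh: "h' = h" using symmetric_second_derivative[OF \<rho>0 V Vx Vy] by simp
  define Q where "Q w = (a * (Re w)\<^sup>2 + 2 * h * Re w * Im w + e * (Im w)\<^sup>2) / 2" for w
  have Q: "\<exists>\<rho>>0. \<forall>r w w'. r < \<rho> \<longrightarrow> cmod w \<le> r \<longrightarrow> cmod w' \<le> r \<longrightarrow>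
           \<bar>V w' - V w - (Q w' - Q w)\<bar> \<le> \<eta> * r * cmod (w' - w)" if "\<eta> > 0" for \<eta>
    unfolding Q_def by (rule quadratic_approximation[OF \<rho>0 V Vx Vy[unfolded hh] that])
  \<comment> \<open>This and the next two facts read off the lowest jet coefficient as a limit, in
    the form in which invariance along curves consumes it.\<close>
  have div: "((\<lambda>s. u s / s) \<longlongrightarrow> c1) (at_right 0)" if "cubic_jet u c1 c2 c3" for u c1 c2 c3
  proof -
    have "(\<lambda>s. u s - (c1 * s + c2 * s\<^sup>2 + c3 * s ^ 3)) \<in> o[at_right 0](\<lambda>s. s ^ 1)"
      using landau_o.small_big_trans[OF that[unfolded cubic_jet_def] power_bigo_at_right_0[of 1 3]] by simp
    from smalloD_tendsto[OF this] have "((\<lambda>s. (u s - (c1 * s + c2 * s\<^sup>2 + c3 * s ^ 3)) / s) \<longlongrightarrow> 0) (at_right 0)" by simp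
    moreover have "((\<lambda>s. c1 + c2 * s + c3 * s\<^sup>2) \<longlongrightarrow> c1) (at_right 0)"
      by (rule tendsto_eq_intros refl | simp)+
    ultimately have "((\<lambda>s. (u s - (c1 * s + c2 * s\<^sup>2 + c3 * s ^ 3)) / s + (c1 + c2 * s + c3 * s\<^sup>2)) \<longlongrightarrow> 0 + c1) (at_right 0)"
      by (rule tendsto_add)
    hence "((\<lambda>s. (u s - (c1 * s + c2 * s\<^sup>2 + c3 * s ^ 3)) / s + (c1 + c2 * s + c3 * s\<^sup>2)) \<longlongrightarrow> c1) (at_right 0)" by simp
    thus ?thesis
      by (rule Lim_transform_eventually)
        (auto simp: field_simps power2_eq_square power3_eq_cube intro!: eventually_mono[OF eventually_at_right_less[of 0]])
  qed
  have div2: "((\<lambda>s. u s / s\<^sup>2) \<longlongrightarrow> c2) (at_right 0)" if "cubic_jet u 0 c2 c3" for u c2 c3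
  proof -
    have "(\<lambda>s. u s - (0 * s + c2 * s\<^sup>2 + c3 * s ^ 3)) \<in> o[at_right 0](\<lambda>s. s ^ 2)"
      using landau_o.small_big_trans[OF that[unfolded cubic_jet_def] power_bigo_at_right_0[of 2 3]] by simp
    from smalloD_tendsto[OF this] have "((\<lambda>s. (u s - (c2 * s\<^sup>2 + c3 * s ^ 3)) / s\<^sup>2) \<longlongrightarrow> 0) (at_right 0)" by simp
    moreover have "((\<lambda>s. c2 + c3 * s) \<longlongrightarrow> c2) (at_right 0)"
      by (rule tendsto_eq_intros refl | simp)+
    ultimately have "((\<lambda>s. (u s - (c2 * s\<^sup>2 + c3 * s ^ 3)) / s\<^sup>2 + (c2 + c3 * s)) \<longlongrightarrow> 0 + c2) (at_right 0)"
      by (rule tendsto_add)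
    hence "((\<lambda>s. (u s - (c2 * s\<^sup>2 + c3 * s ^ 3)) / s\<^sup>2 + (c2 + c3 * s)) \<longlongrightarrow> c2) (at_right 0)" by simp
    thus ?thesis
      by (rule Lim_transform_eventually)
        (auto simp: field_simps power2_eq_square power3_eq_cube intro!: eventually_mono[OF eventually_at_right_less[of 0]])
  qed
  have div3: "((\<lambda>s. u s / s ^ 3) \<longlongrightarrow> c3) (at_right 0)" if "cubic_jet u 0 0 c3" for u c3
  proof -
    from smalloD_tendsto[OF that[unfolded cubic_jet_def]]
    have "((\<lambda>s. (u s - c3 * s ^ 3) / s ^ 3) \<longlongrightarrow> 0) (at_right 0)" by simp
    from tendsto_add[OF this tendsto_const[of c3]]
    have "((\<lambda>s. (u s - c3 * s ^ 3) / s ^ 3 + c3) \<longlongrightarrow> c3) (at_right 0)" by simp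
    thus ?thesis
      by (rule Lim_transform_eventually)
        (auto simp: field_simps intro!: eventually_mono[OF eventually_at_right_less[of 0]])
  qed
  have near: "\<forall>\<^sub>F s in at_right 0. cmod (Complex (u s) (v s)) < \<rho>0"
    if "cubic_jet u c1 c2 c3" "cubic_jet v d1 d2 d3" for u v c1 c2 c3 d1 d2 d3
  proof -
    have "((\<lambda>s. Complex (u s) (v s)) \<longlongrightarrow> Complex 0 0) (at_right 0)"
      by (intro tendsto_Complex cubic_jet_tendsto_0[OF that(1)] cubic_jet_tendsto_0[OF that(2)])
    from tendsto_norm[OF this] have "((\<lambda>s. cmod (Complex (u s) (v s))) \<longlongrightarrow> 0) (at_right 0)"
      by (simp add: norm_complex_def)
    thus ?thesis using \<rho>0 by (intro order_tendstoD(2)) auto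
  qed
  have Tstep: "\<forall>\<^sub>F s in at_right 0. V (Complex (v s) (k (v s) - u s)) = V (Complex (u s) (v s))"
    if "cubic_jet u c1 c2 c3" "cubic_jet v d1 d2 d3" for u v c1 c2 c3 d1 d2 d3
    using near[OF that] near[OF that(2) cubic_jet_diff[OF cubic_jet_compose[OF that(2) k] that(1)]]
    by eventually_elim (use inv[of "Complex (u _) (v _)"] in \<open>simp add: T\<close>)
  have Cdiv: "Complex x y / of_real s = Complex (x / s) (y / s)" for x y s
    by (simp add: complex_eq_iff)
  have Cdiff: "Complex x y - Complex x' y' = Complex (x - x') (y - y')" for x y x' y'
    by (simp add: complex_eq_iff)
  note curves = invariance_along_curves[OF Q[unfolded Q_def], where d = 1]
  \<comment> \<open>One step of \<open>T\<close> compared at order d = 1. The directions (1, 0) and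
    (1, 1) then determine the form up to a factor.\<close>
  have lin: "a * (x + y) * (y - x) + h * ((x + y) * ((t * y - x) - y) + (y + (t * y - x)) * (y - x))
      + e * (y + (t * y - x)) * ((t * y - x) - y) = 0" for x y
  proof -
    define w where "w s = Complex (x * s) (y * s)" for s
    define w' where "w' s = Complex (y * s) (k (y * s) - x * s)" for s
    note jx = cubic_jet_linear[of x] and jy = cubic_jet_linear[of y]
    note jz = cubic_jet_diff[OF cubic_jet_compose[OF jy k] jx]
    have 1: "((\<lambda>s. w s / of_real s) \<longlongrightarrow> Complex x y) (at_right 0)"
      unfolding w_def Cdiv by (intro tendsto_Complex div[OF jx] div[OF jy])
    have 2: "((\<lambda>s. w' s / of_real s) \<longlongrightarrow> Complex y (t * y - x)) (at_right 0)"
      unfolding w'_def Cdiv by (intro tendsto_Complex div[OF jy] div[OF jz])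
    have 3: "((\<lambda>s. (w' s - w s) / of_real (s ^ 1)) \<longlongrightarrow> Complex (y - x) ((t * y - x) - y)) (at_right 0)"
      unfolding w'_def w_def Cdiff Cdiv power_one_right
      by (intro tendsto_Complex div[OF cubic_jet_diff[OF jy jx]] div[OF cubic_jet_diff[OF jz jy]])
    have 4: "\<forall>\<^sub>F s in at_right 0. V (w' s) = V (w s)"
      unfolding w'_def w_def by (rule Tstep[OF jx jy])
    from invariance_along_curves[OF Q[unfolded Q_def] 1 2 3 4] show ?thesis by simp
  qed
  have ea: "e = a" using lin[of 1 0] by (simp add: algebra_simps)
  have "(t - 2) * (2 * h + t * a) = 0" using lin[of 1 1] unfolding ea by (simp add: algebra_simps)
  hence "2 * h + t * a = 0" using t by auto
  hence h2: "2 * h = - t * a" by simp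
  have a: "a \<noteq> 0"
  proof
    assume "a = 0"
    thus False using h2 det hh ea by simp
  qed
  \<comment> \<open>Here the linear part has order three, so three steps from (s, 0) lead back to
    first order; the second-order discrepancy is (p, 0), and its pairing with the starting direction
    is a nonzero multiple of p.\<close>
  have res3: "p = 0" if t1: "t = -1"
  proof -
    note j0 = cubic_jet_linear[of 1] and j1 = cubic_jet_linear[of 0]
    define u2 where "u2 = (\<lambda>s. k (0 * s) - 1 * s)"
    have j2: "cubic_jet u2 (-1) 0 0"
      using cubic_jet_diff[OF cubic_jet_compose[OF j1 k] j0] by (simp add: u2_def)
    define u3 where "u3 = (\<lambda>s. k (u2 s) - 0 * s)"
    have j3: "cubic_jet u3 1 p (- q)"
      using cubic_jet_diff[OF cubic_jet_compose[OF j2 k] j1] t1 by (simp add: u3_def)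
    define u4 where "u4 = (\<lambda>s. k (u3 s) - u2 s)"
    have j4: "cubic_jet u4 0 0 (q + 2 * p * p + q)"
      using cubic_jet_diff[OF cubic_jet_compose[OF j3 k] j2] t1 by (simp add: u4_def)
    define w where "w s = Complex (1 * s) (0 * s)" for s
    define w' where "w' s = Complex (u3 s) (u4 s)" for s
    have 1: "((\<lambda>s. w s / of_real s) \<longlongrightarrow> Complex 1 0) (at_right 0)"
      unfolding w_def Cdiv by (intro tendsto_Complex div[OF j0] div[OF j1])
    have 2: "((\<lambda>s. w' s / of_real s) \<longlongrightarrow> Complex 1 0) (at_right 0)"
      unfolding w'_def Cdiv by (intro tendsto_Complex div[OF j3] div[OF j4])
    have 3: "((\<lambda>s. (w' s - w s) / of_real (s ^ 2)) \<longlongrightarrow> Complex p 0) (at_right 0)"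
      unfolding w'_def w_def Cdiff Cdiv
    proof (intro tendsto_Complex)
      show "((\<lambda>s. (u3 s - 1 * s) / s\<^sup>2) \<longlongrightarrow> p) (at_right 0)"
        by (rule div2) (use cubic_jet_diff[OF j3 j0] in simp)
      show "((\<lambda>s. (u4 s - 0 * s) / s\<^sup>2) \<longlongrightarrow> 0) (at_right 0)"
        by (rule div2) (use cubic_jet_diff[OF j4 j1] in simp)
    qed
    have 4: "\<forall>\<^sub>F s in at_right 0. V (w' s) = V (w s)"
      using Tstep[OF j0 j1] Tstep[OF j1 j2] Tstep[OF j2 j3]
      by eventually_elim (simp add: w_def w'_def u2_def u3_def u4_def)
    from invariance_along_curves[OF Q[unfolded Q_def] 1 2 3 4] a show ?thesis by simp
  qed
  \<comment> \<open>Here the linear part has order four. For a start (x s, y s), the third-order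
    discrepancy after four steps, paired with (x, y), is a multiple of x y (x^2 - y^2) (q - p^2).
    The direction (1, 2) avoids the zeros of the first factors; (1, 0) or (1, 1) would give no
    information.\<close>
  have res4: "q = p\<^sup>2" if t0: "t = 0"
  proof -
    note j0 = cubic_jet_linear[of 1] and j1 = cubic_jet_linear[of 2]
    define u2 where "u2 = (\<lambda>s. k (2 * s) - 1 * s)"
    have j2: "cubic_jet u2 (-1) (4 * p) (8 * q)"
      using cubic_jet_diff[OF cubic_jet_compose[OF j1 k] j0] t0 by (simp add: u2_def mult_ac)
    define u3 where "u3 = (\<lambda>s. k (u2 s) - 2 * s)"
    have j3: "cubic_jet u3 (-2) p (- 8 * p\<^sup>2 - q)"
      using cubic_jet_diff[OF cubic_jet_compose[OF j2 k] j1] t0 by (simp add: u3_def power2_eq_square mult_ac)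
    define u4 where "u4 = (\<lambda>s. k (u3 s) - u2 s)"
    have j4: "cubic_jet u4 1 0 (- 4 * p\<^sup>2 - 16 * q)"
      using cubic_jet_diff[OF cubic_jet_compose[OF j3 k] j2] t0 by (simp add: u4_def power2_eq_square algebra_simps)
    define u5 where "u5 = (\<lambda>s. k (u4 s) - u3 s)"
    have j5: "cubic_jet u5 2 0 (8 * p\<^sup>2 + 2 * q)"
      using cubic_jet_diff[OF cubic_jet_compose[OF j4 k] j3] t0 by (simp add: u5_def power2_eq_square algebra_simps)
    define w where "w s = Complex (1 * s) (2 * s)" for s
    define w' where "w' s = Complex (u4 s) (u5 s)" for s
    have 1: "((\<lambda>s. w s / of_real s) \<longlongrightarrow> Complex 1 2) (at_right 0)"
      unfolding w_def Cdiv by (intro tendsto_Complex div[OF j0] div[OF j1])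
    have 2: "((\<lambda>s. w' s / of_real s) \<longlongrightarrow> Complex 1 2) (at_right 0)"
      unfolding w'_def Cdiv by (intro tendsto_Complex div[OF j4] div[OF j5])
    have 3: "((\<lambda>s. (w' s - w s) / of_real (s ^ 3)) \<longlongrightarrow> Complex (- 4 * p\<^sup>2 - 16 * q) (8 * p\<^sup>2 + 2 * q)) (at_right 0)"
      unfolding w'_def w_def Cdiff Cdiv
    proof (intro tendsto_Complex)
      show "((\<lambda>s. (u4 s - 1 * s) / s ^ 3) \<longlongrightarrow> - 4 * p\<^sup>2 - 16 * q) (at_right 0)"
        by (rule div3) (use cubic_jet_diff[OF j4 j0] in simp)
      show "((\<lambda>s. (u5 s - 2 * s) / s ^ 3) \<longlongrightarrow> 8 * p\<^sup>2 + 2 * q) (at_right 0)"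
        by (rule div3) (use cubic_jet_diff[OF j5 j1] in simp)
    qed
    have 4: "\<forall>\<^sub>F s in at_right 0. V (w' s) = V (w s)"
      using Tstep[OF j0 j1] Tstep[OF j1 j2] Tstep[OF j2 j3] Tstep[OF j3 j4]
      by eventually_elim (simp add: w_def w'_def u2_def u3_def u4_def u5_def)
    have h0: "h = 0" using h2 t0 by simp
    from invariance_along_curves[OF Q[unfolded Q_def] 1 2 3 4] have "a * (p\<^sup>2 - q) = 0"
      unfolding h0 ea by (simp add: algebra_simps)
    thus ?thesis using a by simp
  qed
  have "\<exists>A B C. 2 * A = t * A + p / 2 \<and> (t\<^sup>2 - 2) * B = t * B + p / 2 \<and>
      (t ^ 3 - 3 * t) * C = t * C + p * B + q / 4 \<and> 2 * p * A + p * B + 3 * q / 4 \<noteq> 0"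
  proof -
    consider "t = -1" | "t = 0" | "t \<noteq> -1" "t \<noteq> 0" by blast
    thus ?thesis
    \<comment> \<open>At t = -1, where p = 0, the equation for B is void and B = 0 is chosen. At t =
      0, where q = p^2, both sides of the equation for C vanish and C = 0 is chosen. The remaining
      coefficients are forced.\<close>
    proof cases
      case 1
      thus ?thesis using res3[OF 1] twist
        by (intro exI[of _ 0] exI[of _ "q / 12"]) (auto simp: field_simps)
    next
      case 2
      thus ?thesis using res4[OF 2] twist
        by (intro exI[of _ "p / 4"] exI[of _ "- p / 4"] exI[of _ 0]) (auto simp: field_simps power2_eq_square)
    next
      case 3
      define A where "A = p / (2 * (2 - t))"
      define B where "B = p / (2 * (t\<^sup>2 - t - 2))"
      define C where "C = (p * B + q / 4) / (t ^ 3 - 4 * t)"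
      have f: "t\<^sup>2 - t - 2 = (t - 2) * (t + 1)" "t ^ 3 - 4 * t = t * (t - 2) * (t + 2)"
        by (simp_all add: power2_eq_square power3_eq_cube algebra_simps)
      have nz: "2 - t \<noteq> 0" "t\<^sup>2 - t - 2 \<noteq> 0" "t ^ 3 - 4 * t \<noteq> 0" "1 + t \<noteq> 0"
        using t 3 unfolding f by auto
      have A: "2 * (2 - t) * A = p" using nz by (simp add: A_def)
      have B: "2 * (t\<^sup>2 - t - 2) * B = p" using nz by (simp add: B_def)
      have C: "(t ^ 3 - 4 * t) * C = p * B + q / 4" using nz by (simp add: C_def)
      \<comment> \<open>The origin of W: 2 p and 6 q are the second and third derivatives of k at
        the fixed point.\<close>
      have "8 * (2 - t) * (1 + t) * (2 * p * A + p * B + 3 * q / 4) =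
          6 * q * (2 - t) * (1 + t) + (2 * t + 1) * (2 * p)\<^sup>2"
      proof -
        have "8 * (2 - t) * (1 + t) * (2 * p * A + p * B + 3 * q / 4) =
          8 * p * (1 + t) * (2 * (2 - t) * A) - 4 * p * (2 * (t\<^sup>2 - t - 2) * B) + 6 * q * (2 - t) * (1 + t)"
          by (simp add: power2_eq_square algebra_simps)
        thus ?thesis unfolding A B by (simp add: power2_eq_square algebra_simps)
      qed
      hence "2 * p * A + p * B + 3 * q / 4 \<noteq> 0" using twist 3 by auto
      moreover have "2 * A = t * A + p / 2" using A by (simp add: algebra_simps)
      moreover have "(t\<^sup>2 - 2) * B = t * B + p / 2" using B by (simp add: algebra_simps)
      moreover have "(t ^ 3 - 3 * t) * C = t * C + p * B + q / 4" using C by (simp add: algebra_simps)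
      ultimately show ?thesis by blast
    qed
  qed
  then obtain A B C where ABC: "2 * A = t * A + p / 2" "(t\<^sup>2 - 2) * B = t * B + p / 2"
      "(t ^ 3 - 3 * t) * C = t * C + p * B + q / 4" "2 * p * A + p * B + 3 * q / 4 \<noteq> 0" by blast
  have Q': "Q w = a / 2 * ((Re w)\<^sup>2 - t * Re w * Im w + (Im w)\<^sup>2)" for w
  proof -
    have "Q w = (a * (Re w)\<^sup>2 + (2 * h) * (Re w * Im w) + a * (Im w)\<^sup>2) / 2" by (simp add: Q_def ea)
    thus ?thesis unfolding h2 by (simp add: field_simps)
  qed
  show ?thesis
  proof (rule twist_map_periodic_points[where T = T and V = V and \<kappa> = "a / 2", OF t _ \<rho>0 ABC k kc _ inv T])
    show "a / 2 \<noteq> 0" using a by simp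
    show "\<exists>\<rho>>0. \<forall>r w w'. r < \<rho> \<longrightarrow> cmod w \<le> r \<longrightarrow> cmod w' \<le> r \<longrightarrow>
        \<bar>V w' - V w - a / 2 * (((Re w')\<^sup>2 - t * Re w' * Im w' + (Im w')\<^sup>2) - ((Re w)\<^sup>2 - t * Re w * Im w + (Im w)\<^sup>2))\<bar>
          \<le> \<eta> * r * cmod (w' - w)" if "\<eta> > 0" for \<eta>
      using Q[OF that] unfolding Q' by (simp only: right_diff_distrib)
  qed
qed

subsection \<open>Finiteness of the set of periodic points\<close>

definition mon :: "nat \<Rightarrow> (nat \<Rightarrow> nat) \<Rightarrow> (nat \<Rightarrow> real) \<Rightarrow> real" where
  "mon N e x = (\<Prod>i<N. x i ^ e i)"

text \<open>Polynomial functions of bounded total degree in the first N coordinates, given as the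
  span of monomials. Only values on a set of sequences matter later, and spanning claims become rule
  inductions.\<close>

inductive deg_le :: "nat \<Rightarrow> nat \<Rightarrow> ((nat \<Rightarrow> real) \<Rightarrow> real) \<Rightarrow> bool" for N where
  mon: "(\<Sum>i<N. e i) \<le> n \<Longrightarrow> deg_le N n (mon N e)"
| add: "deg_le N n F \<Longrightarrow> deg_le N n G \<Longrightarrow> deg_le N n (\<lambda>x. F x + G x)"
| scale: "deg_le N n F \<Longrightarrow> deg_le N n (\<lambda>x. c * F x)"

lemma mon_mult: "mon N e x * mon N e' x = mon N (\<lambda>i. e i + e' i) x"
  by (simp add: mon_def power_add prod.distrib)

lemma deg_le_mono: "deg_le N n F \<Longrightarrow> n \<le> m \<Longrightarrow> deg_le N m F"
  by (induction rule: deg_le.induct) (auto intro: deg_le.intros)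

lemma deg_le_mult:
  assumes "deg_le N n F" "deg_le N m G"
  shows "deg_le N (n + m) (\<lambda>x. F x * G x)"
  using assms(1)
proof (induction rule: deg_le.induct)
  case (mon e n)
  from assms(2) show ?case
  proof (induction rule: deg_le.induct)
    case (mon e' m)
    show ?case unfolding mon_mult
      using mon \<open>sum e {..<N} \<le> n\<close> by (intro deg_le.mon) (simp add: sum.distrib)
  next
    case (add m F G)
    thus ?case using deg_le.add by (simp add: distrib_left)
  next
    case (scale m F c)
    thus ?case using deg_le.scale[of N "n + m" "\<lambda>x. mon N e x * F x" c] by (simp add: mult_ac)
  qed
next
  case (add n F F')
  thus ?case using deg_le.add by (simp add: distrib_right)
next
  case (scale n F c)
  thus ?case using deg_le.scale[of N "n + m" "\<lambda>x. F x * G x" c] by (simp add: mult_ac)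
qed

lemma deg_le_const: "deg_le N n (\<lambda>_. c)"
  using deg_le.scale[OF deg_le.mon[where N = N and e = "\<lambda>_. 0" and n = n], of c] by (simp add: mon_def)

lemma deg_le_power: "i < N \<Longrightarrow> deg_le N j (\<lambda>x. x i ^ j)"
proof -
  assume i: "i < N"
  have eq: "mon N (\<lambda>k. if k = i then j else 0) x = x i ^ j" for x
  proof -
    have "mon N (\<lambda>k. if k = i then j else 0) x = (\<Prod>k<N. if k = i then x k ^ j else 1)"
      unfolding mon_def by (intro prod.cong) auto
    thus ?thesis using i by simp
  qed
  have "deg_le N j (mon N (\<lambda>k. if k = i then j else 0))"
    using i by (intro deg_le.mon) simp
  thus ?thesis by (simp add: eq[abs_def])
qed

lemma deg_le_var: "i < N \<Longrightarrow> deg_le N 1 (\<lambda>x. x i)"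
  using deg_le_power[of i N 1] by simp

lemma deg_le_sum:
  "finite I \<Longrightarrow> (\<And>j. j \<in> I \<Longrightarrow> deg_le N n (F j)) \<Longrightarrow> deg_le N n (\<lambda>x. \<Sum>j\<in>I. F j x)"
  by (induction rule: finite_induct) (auto intro: deg_le.add deg_le_const)

lemma deg_le_poly: "i < N \<Longrightarrow> deg_le N (degree p) (\<lambda>x. poly p (x i))"
  unfolding poly_altdef
  by (intro deg_le_sum deg_le.scale) (auto intro: deg_le_mono[OF deg_le_power])

text \<open>Gaussian elimination, one equation per induction step: a pivot removes one unknown
  together with one equation, so unknowns still outnumber equations.\<close>

lemma underdetermined_system_kernel:
  fixes M :: "'j \<Rightarrow> 'b \<Rightarrow> real"
  assumes "finite B" "finite J" "card B < card J"
  shows "\<exists>c. (\<exists>j\<in>J. c j \<noteq> 0) \<and> (\<forall>b\<in>B. (\<Sum>j\<in>J. c j * M j b) = 0)"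
  using assms
proof (induction B arbitrary: J M rule: finite_induct)
  case empty
  then obtain j where "j \<in> J" by fastforce
  thus ?case by (intro exI[of _ "\<lambda>_. 1"]) auto
next
  case (insert b B)
  show ?case
  proof (cases "\<forall>j\<in>J. M j b = 0")
    case True
    have "card B < card J" using insert by simp
    from insert.IH[OF insert.prems(1) this, of M] obtain c where
      "\<exists>j\<in>J. c j \<noteq> 0" "\<forall>b\<in>B. (\<Sum>j\<in>J. c j * M j b) = 0" by blast
    thus ?thesis using True by (intro exI[of _ c]) auto
  next
    case False
    then obtain k where k: "k \<in> J" "M k b \<noteq> 0" by blast
    define M' where "M' j b' = M j b' - M j b / M k b * M k b'" for j b'
    have "card B < card (J - {k})" using insert k by simp
    from insert.IH[OF _ this, of M'] insert.prems obtain c where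
      c: "\<exists>j\<in>J-{k}. c j \<noteq> 0" "\<forall>b\<in>B. (\<Sum>j\<in>J-{k}. c j * M' j b) = 0" by blast
    \<comment> \<open>The pivot coefficient is chosen to satisfy equation b; the other equations
      then turn into those of the eliminated system \<open>M'\<close>.\<close>
    define c' where "c' j = (if j = k then - (\<Sum>j\<in>J-{k}. c j * M j b) / M k b else c j)" for j
    have expand: "(\<Sum>j\<in>J. c' j * M j b') = (\<Sum>j\<in>J-{k}. c j * M' j b')" for b'
    proof -
      have "(\<Sum>j\<in>J. c' j * M j b') = c' k * M k b' + (\<Sum>j\<in>J-{k}. c' j * M j b')"
        using insert.prems k by (simp add: sum.remove)
      also have "(\<Sum>j\<in>J-{k}. c' j * M j b') = (\<Sum>j\<in>J-{k}. c j * M j b')"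
        by (intro sum.cong) (auto simp: c'_def)
      also have "c' k * M k b' = - ((\<Sum>j\<in>J-{k}. c j * M j b) * (M k b' / M k b))" by (simp add: c'_def)
      finally have "(\<Sum>j\<in>J. c' j * M j b') = (\<Sum>j\<in>J-{k}. c j * M j b' - c j * M j b * (M k b' / M k b))"
        by (simp add: sum_subtractf sum_distrib_right sum_divide_distrib)
      also have "\<dots> = (\<Sum>j\<in>J-{k}. c j * M' j b')"
        by (intro sum.cong) (auto simp: M'_def algebra_simps)
      finally show ?thesis .
    qed
    have "M' j b = 0" for j using k by (simp add: M'_def)
    hence "\<forall>b'\<in>insert b B. (\<Sum>j\<in>J. c' j * M j b') = 0" using c(2) by (auto simp: expand)
    moreover have "\<exists>j\<in>J. c' j \<noteq> 0" using c(1) by (auto simp: c'_def)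
    ultimately show ?thesis by blast
  qed
qed

text \<open>Replacing x_k^d by \<open>R\<close> strictly lowers the total degree, so the reduction
  terminates and on \<open>S\<close> every polynomial function is a combination of the finitely many
  monomials with all exponents below d. Hence sufficiently many powers of x_i are linearly dependent
  on \<open>S\<close>, and x_i is a root of one fixed nonzero polynomial.\<close>

lemma finite_coordinate_if_reducible:
  fixes S :: "(nat \<Rightarrow> real) set"
  assumes d: "d > 0" and i: "i < N"
    and red: "\<And>i. i < N \<Longrightarrow> \<exists>R. deg_le N (d - 1) R \<and> (\<forall>x\<in>S. x i ^ d = R x)"
  shows "finite ((\<lambda>x. x i) ` S)"
proof -
  \<comment> \<open>Exponents are normalised to 0 outside the first N places; otherwise this set of
    functions would be infinite.\<close>
  define B where "B = {e :: nat \<Rightarrow> nat. \<forall>i. (i \<in> {..<N} \<longrightarrow> e i \<in> {..<d}) \<and> (i \<notin> {..<N} \<longrightarrow> e i = 0)}"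
  have finB: "finite B" unfolding B_def by (rule finite_set_of_finite_funs) auto
  define sp where "sp F \<longleftrightarrow> (\<exists>c. \<forall>x\<in>S. F x = (\<Sum>e\<in>B. c e * mon N e x))" for F
  have sp_add: "sp (\<lambda>x. F x + G x)" if FG: "sp F" "sp G" for F G
  proof -
    from FG obtain c c' where "\<forall>x\<in>S. F x = (\<Sum>e\<in>B. c e * mon N e x)" "\<forall>x\<in>S. G x = (\<Sum>e\<in>B. c' e * mon N e x)"
      unfolding sp_def by blast
    thus ?thesis unfolding sp_def
      by (intro exI[of _ "\<lambda>e. c e + c' e"]) (simp add: distrib_right sum.distrib)
  qed
  have sp_scale: "sp (\<lambda>x. a * F x)" if F: "sp F" for F a
  proof -
    from F obtain c where "\<forall>x\<in>S. F x = (\<Sum>e\<in>B. c e * mon N e x)"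
      unfolding sp_def by blast
    thus ?thesis unfolding sp_def
      by (intro exI[of _ "\<lambda>e. a * c e"]) (simp add: sum_distrib_left mult_ac)
  qed
  have sp_cong: "sp F" if "sp G" "\<And>x. x \<in> S \<Longrightarrow> F x = G x" for F G
    using that unfolding sp_def by simp
  have mon: "sp (mon N e)" if "(\<Sum>i<N. e i) = n" for e n
    using that
  proof (induction n arbitrary: e rule: less_induct)
    case (less n)
    show ?case
    proof (cases "\<forall>i<N. e i < d")
      case True
      define e' where "e' i = (if i < N then e i else 0)" for i
      have e'B: "e' \<in> B" using True by (auto simp: e'_def B_def)
      have "mon N e = mon N e'" by (auto simp: mon_def e'_def fun_eq_iff)
      moreover have "sp (mon N e')"
        unfolding sp_def using e'B finB by (intro exI[of _ "\<lambda>e. if e = e' then 1 else 0"]) (simp add: if_distrib[of "\<lambda>t. t * _"] cong: if_cong)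
      ultimately show ?thesis by simp
    next
      case False
      then obtain k where k: "k < N" "e k \<ge> d" by (meson not_less)
      define e' where "e' = e(k := e k - d)"
      have me: "mon N e x = x k ^ d * mon N e' x" for x
      proof -
        have "mon N e x = x k ^ e k * (\<Prod>i\<in>{..<N}-{k}. x i ^ e i)"
          unfolding mon_def using k by (simp add: prod.remove)
        moreover have "mon N e' x = x k ^ (e k - d) * (\<Prod>i\<in>{..<N}-{k}. x i ^ e i)"
        proof -
          have "mon N e' x = x k ^ e' k * (\<Prod>i\<in>{..<N}-{k}. x i ^ e' i)"
            unfolding mon_def using k by (simp add: prod.remove)
          also have "(\<Prod>i\<in>{..<N}-{k}. x i ^ e' i) = (\<Prod>i\<in>{..<N}-{k}. x i ^ e i)"
            by (intro prod.cong) (auto simp: e'_def)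
          also have "e' k = e k - d" by (simp add: e'_def)
          finally show ?thesis .
        qed
        moreover have "x k ^ e k = x k ^ d * x k ^ (e k - d)" using k by (simp flip: power_add)
        ultimately show ?thesis by simp
      qed
      have deg: "(\<Sum>i<N. e i) = d + (\<Sum>i<N. e' i)"
      proof -
        have "(\<Sum>i<N. e i) = e k + (\<Sum>i\<in>{..<N}-{k}. e i)" using k by (simp add: sum.remove)
        moreover have "(\<Sum>i<N. e' i) = e' k + (\<Sum>i\<in>{..<N}-{k}. e' i)" using k by (simp add: sum.remove)
        moreover have "(\<Sum>i\<in>{..<N}-{k}. e' i) = (\<Sum>i\<in>{..<N}-{k}. e i)"
          by (intro sum.cong) (auto simp: e'_def)
        ultimately show ?thesis using k by (simp add: e'_def)
      qed
      from red[OF k(1)] obtain R where R: "deg_le N (d - 1) R" "\<forall>x\<in>S. x k ^ d = R x" by blast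
      have "deg_le N (d - 1 + (\<Sum>i<N. e' i)) (\<lambda>x. R x * mon N e' x)"
        by (intro deg_le_mult R deg_le.mon) simp
      moreover have "sp F" if "deg_le N m F" "m < n" for F m
        using that by (induction rule: deg_le.induct) (auto intro: sp_add sp_scale less.IH[OF le_less_trans, OF _ _ refl])
      ultimately have "sp (\<lambda>x. R x * mon N e' x)" using deg less.prems d by simp
      thus ?thesis by (rule sp_cong) (use R me in auto)
    qed
  qed
  have spdeg: "sp F" if "deg_le N m F" for F m
    using that by (induction rule: deg_le.induct) (auto intro: sp_add sp_scale mon)
  have "\<forall>j. \<exists>c. \<forall>x\<in>S. x i ^ j = (\<Sum>e\<in>B. c e * mon N e x)"
    using spdeg[OF deg_le_power[OF i]] unfolding sp_def by simp
  then obtain M where M: "\<And>j x. x \<in> S \<Longrightarrow> x i ^ j = (\<Sum>e\<in>B. M j e * mon N e x)" by metis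
  \<comment> \<open>The range {..card B} counts from 0, so there is one power more than there are
    spanning monomials and a nontrivial relation exists.\<close>
  obtain c where c: "\<exists>j\<in>{..card B}. c j \<noteq> 0" "\<forall>e\<in>B. (\<Sum>j\<in>{..card B}. c j * M j e) = 0"
    using underdetermined_system_kernel[OF finB, of "{..card B}" M] by auto
  define p where "p = (\<Sum>j\<le>card B. Polynomial.monom (c j) j)"
  have pc: "coeff p j = c j" if "j \<le> card B" for j
    using that by (simp add: p_def coeff_sum if_distrib cong: if_cong)
  have p0: "p \<noteq> 0" using c(1) pc by (metis atMost_iff coeff_0)
  have "poly p (x i) = 0" if x: "x \<in> S" for x
  proof -
    have "poly p (x i) = (\<Sum>j\<le>card B. c j * x i ^ j)" by (simp add: p_def poly_sum poly_monom)
    also have "\<dots> = (\<Sum>j\<le>card B. \<Sum>e\<in>B. c j * M j e * mon N e x)"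
      by (simp add: M[OF x] sum_distrib_left mult.assoc)
    also have "\<dots> = (\<Sum>e\<in>B. (\<Sum>j\<le>card B. c j * M j e) * mon N e x)"
      by (subst sum.swap) (simp add: sum_distrib_right)
    also have "\<dots> = 0" using c(2) by simp
    finally show ?thesis .
  qed
  hence "(\<lambda>x. x i) ` S \<subseteq> {y. poly p y = 0}" by auto
  thus ?thesis using poly_roots_finite[OF p0] finite_subset by blast
qed

lemma finite_coordinate_of_polynomial_system:
  fixes S :: "(nat \<Rightarrow> real) set" and p q :: "real poly"
  assumes i: "i < N" and E: "\<And>i. i < N \<Longrightarrow> deg_le N m (E i)" and deg: "degree q + m < degree p"
    and eq: "\<And>x i. x \<in> S \<Longrightarrow> i < N \<Longrightarrow> poly p (x i) = poly q (x i) * E i x"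
  shows "finite ((\<lambda>x. x i) ` S)"
proof (rule finite_coordinate_if_reducible[OF _ i])
  show "degree p > 0" using deg by simp
  fix i assume i: "i < N"
  define l where "l = lead_coeff p"
  have l: "l \<noteq> 0" using deg by (auto simp: l_def)
  \<comment> \<open>The equation solved for the leading power of x_i. By \<open>deg\<close>
    everything else has total degree below \<open>degree p\<close>.\<close>
  define R where "R x = (1 / l) * (poly q (x i) * E i x + (- 1) * (\<Sum>j<degree p. coeff p j * x i ^ j))" for x
  have "deg_le N (degree p - 1) R"
    unfolding R_def
  proof (intro deg_le.scale deg_le.add deg_le_sum)
    show "deg_le N (degree p - 1) (\<lambda>x. poly q (x i) * E i x)"
      by (rule deg_le_mono[OF deg_le_mult[OF deg_le_poly[OF i] E[OF i]]]) (use deg in auto)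
    show "deg_le N (degree p - 1) (\<lambda>x. x i ^ j)" if "j \<in> {..<degree p}" for j
      by (rule deg_le_mono[OF deg_le_power[OF i]]) (use that in auto)
  qed auto
  moreover have "x i ^ degree p = R x" if "x \<in> S" for x
  proof -
    have "poly p (x i) = (\<Sum>j<degree p. coeff p j * x i ^ j) + l * x i ^ degree p"
      unfolding poly_altdef l_def by (simp flip: lessThan_Suc_atMost)
    thus ?thesis using eq[OF that i] l by (simp add: R_def field_simps)
  qed
  ultimately show "\<exists>R. deg_le N (degree p - 1) R \<and> (\<forall>x\<in>S. x i ^ degree p = R x)" by blast
qed

subsection \<open>From integrability to periodic points\<close>

text \<open>\<open>comb\<close> joins the two neighbours of a term, by addition in one family and by
  multiplication in the other, and \<open>eq\<close> is the recurrence with denominators cleared.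
  Two consecutive terms recover the point, so finitely many values of the coordinates leave finitely
  many points.\<close>

lemma finite_periodic_orbits:
  fixes x :: "'a \<Rightarrow> nat \<Rightarrow> real" and P Q :: "real poly" and comb :: "real \<Rightarrow> real \<Rightarrow> real"
  assumes N: "N > 0"
    and per: "\<And>w j. w \<in> W \<Longrightarrow> x w (j + N) = x w j"
    and comb: "\<And>i j. i < N \<Longrightarrow> j < N \<Longrightarrow> deg_le N m (\<lambda>y. comb (y i) (y j))"
    and eq: "\<And>w j. w \<in> W \<Longrightarrow> poly P (x w (Suc j)) = poly Q (x w (Suc j)) * comb (x w j) (x w (Suc (Suc j)))"
    and deg: "degree Q + m < degree P"
    and inj: "inj_on (\<lambda>w. (x w 0, x w 1)) W"
  shows "finite W"
proof -
  have perk: "x w (j + n * N) = x w j" if "w \<in> W" for w j n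
  proof (induction n)
    case (Suc n)
    have "x w (j + Suc n * N) = x w ((j + n * N) + N)" by (simp add: algebra_simps)
    thus ?case using per[OF that] Suc by simp
  qed simp
  have xmod: "x w j = x w (j mod N)" if "w \<in> W" for w j
    using perk[OF that, of "j mod N" "j div N"] by simp
  \<comment> \<open>The cyclic predecessor is written with i + N - 1, since truncated subtraction
    would fail at i = 0.\<close>
  define E where "E i y = comb (y ((i + N - 1) mod N)) (y ((i + 1) mod N))" for i and y :: "nat \<Rightarrow> real"
  have fin: "finite ((\<lambda>y. y i) ` (x ` W))" if i: "i < N" for i
  proof (rule finite_coordinate_of_polynomial_system[OF i _ deg])
    show "deg_le N m (E i)" for i unfolding E_def[abs_def] using N by (intro comb) auto
    fix y i assume y: "y \<in> x ` W" and i: "i < N"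
    then obtain w where w: "w \<in> W" "y = x w" by blast
    have S: "Suc (i + N - 1) = i + N" "Suc (i + N) = (i + 1) + N" using N by auto
    have "poly P (x w (i + N)) = poly Q (x w (i + N)) * comb (x w (i + N - 1)) (x w ((i + 1) + N))"
      using eq[OF w(1), of "i + N - 1"] unfolding S .
    thus "poly P (y i) = poly Q (y i) * E i y"
      unfolding per[OF w(1)] w(2) E_def xmod[OF w(1), of "i + N - 1"] xmod[OF w(1), of "i + 1"] .
  qed
  have "finite ((\<lambda>w. x w 0) ` W)" using fin[OF N] by (simp add: image_image)
  moreover have "finite ((\<lambda>w. x w 1) ` W)"
  proof -
    have "(\<lambda>w. x w 1) ` W = (\<lambda>w. x w (1 mod N)) ` W" by (rule image_cong[OF refl xmod])
    thus ?thesis using fin[of "1 mod N"] N by (simp add: image_image)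
  qed
  ultimately have "finite (((\<lambda>w. x w 0) ` W) \<times> ((\<lambda>w. x w 1) ` W))" by blast
  moreover have "(\<lambda>w. (x w 0, x w 1)) ` W \<subseteq> ((\<lambda>w. x w 0) ` W) \<times> ((\<lambda>w. x w 1) ` W)" by auto
  ultimately show ?thesis using inj finite_imageD finite_subset by blast
qed

section \<open>Plane coordinates and transport of a first integral to a chart\<close>

lemma vector2_eq_axis: "(vector [x, y] :: real^2) = x *\<^sub>R axis 1 1 + y *\<^sub>R axis 2 1"
  by (simp add: vec_eq_iff forall_2 vector_2 axis_def)

lemma vec2_eq_axis: "(d :: real^2) = d $ 1 *\<^sub>R axis 1 1 + d $ 2 *\<^sub>R axis 2 1"
  by (simp add: vec_eq_iff forall_2 axis_def)

lemma linear_real2_eq: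
  fixes f :: "real^2 \<Rightarrow> real"
  assumes "linear f"
  shows "f d = f (axis 1 1) * d $ 1 + f (axis 2 1) * d $ 2"
proof -
  have "f d = f (d $ 1 *\<^sub>R axis 1 1 + d $ 2 *\<^sub>R axis 2 1)" using vec2_eq_axis[of d] by simp
  thus ?thesis by (simp only: linear_add[OF assms] linear_cmul[OF assms]) (simp add: mult.commute)
qed

lemma has_derivative_vector2:
  assumes "(f has_derivative f') (at x)" "(g has_derivative g') (at x)"
  shows "((\<lambda>x. vector [f x, g x] :: real^2) has_derivative (\<lambda>d. vector [f' d, g' d])) (at x)"
  unfolding vector2_eq_axis
  by (intro has_derivative_add bounded_linear.has_derivative[OF bounded_linear_scaleR_left] assms)

lemma has_derivative_frechet_coordinates:
  fixes f :: "real^2 \<Rightarrow> real"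
  assumes "f differentiable (at p)"
  shows "(f has_derivative (\<lambda>d. frechet_derivative f (at p) (axis 1 1) * d $ 1
            + frechet_derivative f (at p) (axis 2 1) * d $ 2)) (at p)"
proof -
  have "(f has_derivative frechet_derivative f (at p)) (at p)"
    using assms frechet_derivative_works by blast
  moreover from this have "linear (frechet_derivative f (at p))"
    by (rule has_derivative_linear)
  ultimately show ?thesis by (subst linear_real2_eq[symmetric])
qed

text \<open>The chart applies \<open>\<xi>\<close> to both coordinates: u -> c + u for the first
  family, u -> c exp u for the second. As p is critical, the second derivative of
  \<open>\<xi>\<close> drops out of the Hessian of the pulled-back integral, which is the old one
  times \<xi>'(0)^2 and so remains nondegenerate. Membership of the orbits in \<open>D\<close> is
  recorded because denominators must be cleared along them later.\<close>

lemma integrable_imp_periodic_points: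
  fixes \<xi> \<xi>1 k :: "real \<Rightarrow> real"
  defines "chart \<equiv> \<lambda>w. vector [\<xi> (Re w), \<xi> (Im w)] :: real^2"
    and "T \<equiv> \<lambda>w. Complex (Im w) (k (Im w) - Re w)"
  assumes int: "locally_integrable_at 6 D F p" and p: "p = vector [\<xi> 0, \<xi> 0]"
    and \<rho>: "\<rho> > 0"
    and \<xi>: "\<And>u. \<bar>u\<bar> < \<rho> \<Longrightarrow> (\<xi> has_real_derivative \<xi>1 u) (at u)"
    and \<xi>1: "(\<xi>1 has_real_derivative \<xi>2) (at 0)" "\<xi>1 0 \<noteq> 0"
    and conj: "\<And>w. cmod w < \<rho> \<Longrightarrow> F (chart w) = chart (T w)"
    and t: "\<bar>t\<bar> < 2"
    and k: "(\<lambda>u. k u - (t * u + p2 * u\<^sup>2 + q * u ^ 3)) \<in> o[nhds 0](\<lambda>u. u ^ 3)"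
    and kc: "continuous_on {-\<rho><..<\<rho>} k"
    and twist: "6 * q * (2 - t) * (1 + t) + (2 * t + 1) * (2 * p2)\<^sup>2 \<noteq> 0 \<or> t = -1 \<and> q \<noteq> 0"
  shows "\<exists>N>0. infinite {w. (\<forall>j. cmod ((T ^^ j) w) < \<rho> \<and> chart ((T ^^ j) w) \<in> D) \<and> (T ^^ N) w = w}"
proof -
  from int obtain U V where U: "open U" "p \<in> U" "U \<subseteq> D" and fi: "first_integral 6 F p U V"
    unfolding locally_integrable_at_def by blast
  from fi have Ck: "C_k_on 6 V U"
    and VF: "\<And>x. x \<in> U \<Longrightarrow> F x \<in> U \<Longrightarrow> V (F x) = V x"
    and crit: "p isolated_in {x \<in> U. (V has_derivative (\<lambda>_. 0)) (at x)}"
    and hess: "det (hessian V p) \<noteq> 0"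
    unfolding first_integral_def isolated_nondegenerate_critical_point_def by auto
  have Ck': "C_k_on (Suc (Suc 4)) V U" using Ck by (simp add: eval_nat_numeral)
  have Vd: "V differentiable (at x)" if "x \<in> U" for x using Ck' that unfolding C_k_on.simps by blast
  have Vd2: "(\<lambda>x. frechet_derivative V (at x) v) differentiable (at x)" if "x \<in> U" for x v
    using Ck' that unfolding C_k_on.simps by blast
  define Vx where "Vx P = frechet_derivative V (at P) (axis 1 1)" for P
  define Vy where "Vy P = frechet_derivative V (at P) (axis 2 1)" for P
  have DV: "(V has_derivative (\<lambda>d. Vx P * d $ 1 + Vy P * d $ 2)) (at P)" if "P \<in> U" for P
    unfolding Vx_def Vy_def by (rule has_derivative_frechet_coordinates[OF Vd[OF that]])
  have "(V has_derivative (\<lambda>_. 0)) (at p)" using crit by (auto simp: isolated_in_def)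
  hence "frechet_derivative V (at p) = (\<lambda>_. 0)" using frechet_derivative_at by fastforce
  hence V0: "Vx p = 0" "Vy p = 0" by (auto simp: Vx_def Vy_def)
  define H where "H i j = hessian V p $ i $ j" for i j :: 2
  have DVx: "(Vx has_derivative (\<lambda>d. H 1 1 * d $ 1 + H 2 1 * d $ 2)) (at p)"
    using has_derivative_frechet_coordinates[OF Vd2[OF U(2), of "axis 1 1"]]
    by (simp add: Vx_def[abs_def] H_def hessian_def)
  have DVy: "(Vy has_derivative (\<lambda>d. H 1 2 * d $ 1 + H 2 2 * d $ 2)) (at p)"
    using has_derivative_frechet_coordinates[OF Vd2[OF U(2), of "axis 2 1"]]
    by (simp add: Vy_def[abs_def] H_def hessian_def)
  have detH: "H 1 1 * H 2 2 - H 1 2 * H 2 1 \<noteq> 0" using hess by (simp add: det_2 H_def)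
  have dRe: "(Re has_derivative Re) (at x)" and dIm: "(Im has_derivative Im) (at x)" for x
    by (rule bounded_linear_imp_has_derivative[OF bounded_linear_Re],
        rule bounded_linear_imp_has_derivative[OF bounded_linear_Im])
  have chart0: "chart 0 = p" by (simp add: chart_def p)
  have dchart: "(chart has_derivative (\<lambda>d. vector [\<xi>1 (Re w) * Re d, \<xi>1 (Im w) * Im d])) (at w)"
    if w: "cmod w < \<rho>" for w
  proof -
    have "\<bar>Re w\<bar> < \<rho>" "\<bar>Im w\<bar> < \<rho>" using abs_Re_le_cmod[of w] abs_Im_le_cmod[of w] w by linarith+
    from \<xi>[OF this(1)] \<xi>[OF this(2)]
    have "(\<xi> has_derivative (*) (\<xi>1 (Re w))) (at (Re w))" "(\<xi> has_derivative (*) (\<xi>1 (Im w))) (at (Im w))"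
      unfolding has_field_derivative_def .
    from has_derivative_compose[OF dRe this(1)] has_derivative_compose[OF dIm this(2)]
    show ?thesis unfolding chart_def by (rule has_derivative_vector2)
  qed
  have "open (chart -` U \<inter> ball 0 \<rho>)"
  proof (rule continuous_open_preimage[of "ball 0 \<rho>" chart U, unfolded Int_commute[of "ball 0 \<rho>"]])
    show "continuous_on (ball 0 \<rho>) chart"
      by (intro continuous_at_imp_continuous_on ballI has_derivative_continuous[OF dchart]) simp
  qed (use U in auto)
  moreover have "0 \<in> chart -` U \<inter> ball 0 \<rho>" using chart0 U \<rho> by simp
  ultimately obtain \<rho>0 where \<rho>0: "\<rho>0 > 0" "ball 0 \<rho>0 \<subseteq> chart -` U \<inter> ball 0 \<rho>"
    using open_contains_ball by metis
  have small: "chart w \<in> U" "cmod w < \<rho>" if "cmod w < \<rho>0" for w using \<rho>0(2) that by auto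
  define V' where "V' w = V (chart w)" for w
  define Vx' where "Vx' w = Vx (chart w) * \<xi>1 (Re w)" for w
  define Vy' where "Vy' w = Vy (chart w) * \<xi>1 (Im w)" for w
  define c where "c = \<xi>1 0"
  have c: "c \<noteq> 0" using \<xi>1 by (simp add: c_def)
  have DV': "(V' has_derivative (\<lambda>d. Vx' w * Re d + Vy' w * Im d)) (at w)" if "cmod w < \<rho>0" for w
    using has_derivative_compose[OF dchart[OF small(2)[OF that]] DV[OF small(1)[OF that]]]
    by (simp add: V'_def[abs_def] Vx'_def Vy'_def mult.assoc)
  have "(\<xi>1 has_derivative (*) \<xi>2) (at (Re 0))" "(\<xi>1 has_derivative (*) \<xi>2) (at (Im 0))"
    using \<xi>1(1) unfolding has_field_derivative_def by simp_all
  note d\<xi>1 = has_derivative_compose[OF dRe this(1)] has_derivative_compose[OF dIm this(2)]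
  have dc0: "(chart has_derivative (\<lambda>d. vector [c * Re d, c * Im d])) (at 0)"
    using dchart[of 0] \<rho> by (simp add: c_def)
  have DVx': "(Vx' has_derivative (\<lambda>d. (c * H 1 1 * c) * Re d + (c * H 2 1 * c) * Im d)) (at 0)"
    using has_derivative_mult[OF has_derivative_compose[OF dc0 DVx[folded chart0]] d\<xi>1(1)]
    by (simp add: Vx'_def[abs_def] chart0 V0 c_def algebra_simps)
  have DVy': "(Vy' has_derivative (\<lambda>d. (c * H 1 2 * c) * Re d + (c * H 2 2 * c) * Im d)) (at 0)"
    using has_derivative_mult[OF has_derivative_compose[OF dc0 DVy[folded chart0]] d\<xi>1(2)]
    by (simp add: Vy'_def[abs_def] chart0 V0 c_def algebra_simps)
  have V'0: "Vx' 0 = 0" "Vy' 0 = 0" by (simp_all add: Vx'_def Vy'_def chart0 V0)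
  have "\<exists>N>0. infinite {w. (\<forall>j. cmod ((T ^^ j) w) < \<rho>0) \<and> (T ^^ N) w = w}"
  proof (rule first_integral_imp_periodic_points[where V = V' and k = k, OF t \<rho>0(1) k])
    show "continuous_on {-\<rho>0<..<\<rho>0} k"
    proof (rule continuous_on_subset[OF kc], rule subsetI)
      fix u assume u: "u \<in> {-\<rho>0<..<\<rho>0}"
      have "cmod (of_real u) < \<rho>" by (rule small(2)) (use u in auto)
      thus "u \<in> {-\<rho><..<\<rho>}" by auto
    qed
    show "(V' has_derivative (\<lambda>d. Vx' w * Re d + Vy' w * Im d)) (at w)" if "cmod w < \<rho>0" for w
      by (rule DV'[OF that])
    show "\<exists>\<rho>>0. \<forall>w. cmod w < \<rho> \<longrightarrow> \<bar>Vx' w - ((c * H 1 1 * c) * Re w + (c * H 2 1 * c) * Im w)\<bar> \<le> \<eta> * cmod w"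
      if "\<eta> > 0" for \<eta>
      using DVx' that unfolding has_derivative_at_alt by (simp add: V'0)
    show "\<exists>\<rho>>0. \<forall>w. cmod w < \<rho> \<longrightarrow> \<bar>Vy' w - ((c * H 1 2 * c) * Re w + (c * H 2 2 * c) * Im w)\<bar> \<le> \<eta> * cmod w"
      if "\<eta> > 0" for \<eta>
      using DVy' that unfolding has_derivative_at_alt by (simp add: V'0)
    have "(c * H 1 1 * c) * (c * H 2 2 * c) - (c * H 2 1 * c) * (c * H 1 2 * c) = c ^ 4 * (H 1 1 * H 2 2 - H 1 2 * H 2 1)"
      by (simp add: power4_eq_xxxx algebra_simps)
    thus "(c * H 1 1 * c) * (c * H 2 2 * c) - (c * H 2 1 * c) * (c * H 1 2 * c) \<noteq> 0" using c detH by simp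
    show "T w = Complex (Im w) (k (Im w) - Re w)" for w by (simp add: T_def)
    show "V' (T w) = V' w" if "cmod w < \<rho>0" "cmod (T w) < \<rho>0" for w
      using VF[of "chart w"] conj[of w] small[OF that(1)] small[OF that(2)] by (simp add: V'_def)
  qed (rule twist)
  then obtain N where N: "N > 0" "infinite {w. (\<forall>j. cmod ((T ^^ j) w) < \<rho>0) \<and> (T ^^ N) w = w}" by blast
  have "{w. (\<forall>j. cmod ((T ^^ j) w) < \<rho>0) \<and> (T ^^ N) w = w} \<subseteq>
      {w. (\<forall>j. cmod ((T ^^ j) w) < \<rho> \<and> chart ((T ^^ j) w) \<in> D) \<and> (T ^^ N) w = w}"
    using small U(3) by blast
  thus ?thesis using N infinite_super by blast
qed

section \<open>Taylor expansion and non-integrability of the perturbed maps\<close>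

lemma smallo_of_derivative_smallo:
  fixes \<phi> \<phi>' :: "real \<Rightarrow> real"
  assumes \<rho>: "\<rho> > 0" and D: "\<And>u. \<bar>u\<bar> < \<rho> \<Longrightarrow> (\<phi> has_real_derivative \<phi>' u) (at u)"
    and \<phi>0: "\<phi> 0 = 0" and \<phi>': "\<phi>' \<in> o[nhds 0](\<lambda>u. u ^ n)"
  shows "\<phi> \<in> o[nhds 0](\<lambda>u. u ^ Suc n)"
proof (rule landau_o.smallI)
  fix e :: real assume e: "e > 0"
  from smallo_nhds_0_bound[OF \<phi>' e] obtain r where r: "r > 0" "\<And>u. \<bar>u\<bar> < r \<Longrightarrow> \<bar>\<phi>' u\<bar> \<le> e * \<bar>u ^ n\<bar>"
    by auto
  have main: "\<bar>\<phi> u\<bar> \<le> e * \<bar>u ^ Suc n\<bar>" if u: "\<bar>u\<bar> < min r \<rho>" for u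
  proof (cases "u = 0")
    case True
    thus ?thesis by (simp add: \<phi>0)
  next
    case False
    have "\<exists>z. \<bar>z\<bar> \<le> \<bar>u\<bar> \<and> \<phi> u = u * \<phi>' z"
    proof (cases "u > 0")
      case True
      from MVT2[of 0 u \<phi> \<phi>'] True D u obtain z where "0 < z" "z < u" "\<phi> u - \<phi> 0 = (u - 0) * \<phi>' z" by auto
      thus ?thesis by (intro exI[of _ z]) (auto simp: \<phi>0)
    next
      case False
      with \<open>u \<noteq> 0\<close> have "u < 0" by simp
      from MVT2[of u 0 \<phi> \<phi>'] this D u obtain z where "u < z" "z < 0" "\<phi> 0 - \<phi> u = (0 - u) * \<phi>' z" by auto
      thus ?thesis by (intro exI[of _ z]) (auto simp: \<phi>0)
    qed
    then obtain z where z: "\<bar>z\<bar> \<le> \<bar>u\<bar>" "\<phi> u = u * \<phi>' z" by blast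
    have "\<bar>\<phi>' z\<bar> \<le> e * \<bar>z ^ n\<bar>" using r(2)[of z] z u by simp
    also have "\<dots> \<le> e * \<bar>u ^ n\<bar>"
      using e power_mono[OF z(1), of n] by (intro mult_left_mono) (auto simp: power_abs)
    finally have "\<bar>u\<bar> * \<bar>\<phi>' z\<bar> \<le> \<bar>u\<bar> * (e * \<bar>u ^ n\<bar>)" by (intro mult_left_mono) auto
    thus ?thesis using z by (simp add: abs_mult mult_ac)
  qed
  have "\<forall>\<^sub>F u in nhds 0. \<bar>u\<bar> < min r \<rho>"
    using eventually_nhds_ball[of "min r \<rho>" "0::real"] r \<rho> by (auto elim!: eventually_mono)
  thus "\<forall>\<^sub>F u in nhds 0. norm (\<phi> u) \<le> e * norm (u ^ Suc n)"
    by eventually_elim (use main in auto)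
qed

text \<open>Differentiability of the second derivative at 0 gives its remainder, and the mean value
  theorem raises the order twice. The third derivative is thus asked for at one point only.\<close>

lemma Taylor_Peano_3:
  fixes f f1 f2 :: "real \<Rightarrow> real"
  assumes \<rho>: "\<rho> > 0"
    and f: "\<And>u. \<bar>u\<bar> < \<rho> \<Longrightarrow> (f has_real_derivative f1 u) (at u)"
    and f1: "\<And>u. \<bar>u\<bar> < \<rho> \<Longrightarrow> (f1 has_real_derivative f2 u) (at u)"
    and f2: "(f2 has_real_derivative f3) (at 0)"
  shows "(\<lambda>u. f u - f 0 - (f1 0 * u + f2 0 / 2 * u\<^sup>2 + f3 / 6 * u ^ 3)) \<in> o[nhds 0](\<lambda>u. u ^ 3)"
proof -
  have 1: "(\<lambda>u. f2 u - f2 0 - f3 * u) \<in> o[nhds 0](\<lambda>u. u ^ 1)"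
  proof (rule landau_o.smallI)
    fix e :: real assume "e > 0"
    then obtain d where d: "d > 0" "\<And>u. \<bar>u\<bar> < d \<Longrightarrow> \<bar>f2 u - f2 0 - f3 * u\<bar> \<le> e * \<bar>u\<bar>"
      using f2 unfolding has_field_derivative_def has_derivative_at_alt by auto
    have "\<forall>\<^sub>F u in nhds 0. \<bar>u\<bar> < d"
      using eventually_nhds_ball[OF d(1), of "0::real"] by (auto elim!: eventually_mono)
    thus "\<forall>\<^sub>F u in nhds 0. norm (f2 u - f2 0 - f3 * u) \<le> e * norm (u ^ 1)"
      by eventually_elim (use d in auto)
  qed
  have 2: "(\<lambda>u. f1 u - f1 0 - f2 0 * u - f3 / 2 * u\<^sup>2) \<in> o[nhds 0](\<lambda>u. u ^ Suc 1)"
    by (rule smallo_of_derivative_smallo[OF \<rho> _ _ 1]) (auto intro!: derivative_eq_intros f1)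
  have "(\<lambda>u. f u - f 0 - f1 0 * u - f2 0 / 2 * u\<^sup>2 - f3 / 6 * u ^ 3) \<in> o[nhds 0](\<lambda>u. u ^ Suc (Suc 1))"
    by (rule smallo_of_derivative_smallo[OF \<rho> _ _ 2])
      (auto intro!: derivative_eq_intros f simp: power2_eq_square)
  thus ?thesis by (simp add: eval_nat_numeral algebra_simps)
qed

text \<open>The map is the recurrence x_{n-1} + x_{n+1} = h(x_n); with x = c + u it takes the form
  u_{n-1} + u_{n+1} = k(u_n). Infinitely many N-periodic points from a first integral contradict
  their finiteness. The second alternative in \<open>twist\<close> covers t = -1, where W is just
  -h2^2, which a first integral forces to vanish, and the twist is governed by the third
  derivative.\<close>

lemma F_map_not_integrable:
  fixes h h1 h2 :: "real \<Rightarrow> real"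
  assumes \<epsilon>: "\<epsilon> \<noteq> 0" and deg: "degree P > degree Q + 1" and Q: "Q \<noteq> 0"
    and h: "\<And>y. h y = a * y / (1 + y\<^sup>2) + \<epsilon> * rat_eval P Q y" and hc: "h c = 2 * c"
    and \<rho>: "\<rho> > 0"
    and d0: "\<And>y. \<bar>y - c\<bar> < \<rho> \<Longrightarrow> (h has_real_derivative h1 y) (at y)"
    and d1: "\<And>y. \<bar>y - c\<bar> < \<rho> \<Longrightarrow> (h1 has_real_derivative h2 y) (at y)"
    and d2: "(h2 has_real_derivative h3) (at c)"
    and t: "\<bar>h1 c\<bar> < 2"
    and twist: "h3 * (2 - h1 c) * (1 + h1 c) + (2 * h1 c + 1) * (h2 c)\<^sup>2 \<noteq> 0 \<or> h1 c = -1 \<and> h3 \<noteq> 0"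
  shows "\<not> locally_integrable_at 6 (F_dom Q) (F_map a (rat_eval P Q) \<epsilon>) (vector [c, c])"
proof
  assume int: "locally_integrable_at 6 (F_dom Q) (F_map a (rat_eval P Q) \<epsilon>) (vector [c, c])"
  define k where "k u = h (c + u) - 2 * c" for u
  define T where "T w = Complex (Im w) (k (Im w) - Re w)" for w
  have shift: "((\<lambda>u. f (c + u)) has_real_derivative f' (c + u)) (at u)"
    if "(f has_real_derivative f' (c + u)) (at (c + u))" for f f' :: "real \<Rightarrow> real" and u
    using that DERIV_shift[of f "f' (c + u)" u c] by (simp add: add.commute)
  have dh: "((\<lambda>u. h (c + u)) has_real_derivative h1 (c + u)) (at u)" if "\<bar>u\<bar> < \<rho>" for u
    by (rule shift[where f = h and f' = h1], rule d0) (use that in simp)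
  have dh1: "((\<lambda>u. h1 (c + u)) has_real_derivative h2 (c + u)) (at u)" if "\<bar>u\<bar> < \<rho>" for u
    by (rule shift[where f = h1 and f' = h2], rule d1) (use that in simp)
  have K: "(\<lambda>u. k u - (h1 c * u + (h2 c / 2) * u\<^sup>2 + (h3 / 6) * u ^ 3)) \<in> o[nhds 0](\<lambda>u. u ^ 3)"
  proof -
    have "(\<lambda>u. h (c + u) - h (c + 0) - (h1 (c + 0) * u + h2 (c + 0) / 2 * u\<^sup>2 + h3 / 6 * u ^ 3)) \<in> o[nhds 0](\<lambda>u. u ^ 3)"
    proof (rule Taylor_Peano_3[OF \<rho>, where f = "\<lambda>u. h (c + u)" and ?f1.0 = "\<lambda>u. h1 (c + u)" and ?f2.0 = "\<lambda>u. h2 (c + u)"])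
      show "((\<lambda>u. h2 (c + u)) has_real_derivative h3) (at 0)"
        using shift[of h2 "\<lambda>_. h3" 0] d2 by simp
    qed (auto intro!: dh dh1)
    thus ?thesis by (simp add: k_def hc)
  qed
  have "\<exists>N>0. infinite {w. (\<forall>j. cmod ((T ^^ j) w) < \<rho> \<and> vector [c + Re ((T ^^ j) w), c + Im ((T ^^ j) w)] \<in> F_dom Q) \<and> (T ^^ N) w = w}"
    unfolding T_def
  proof (rule integrable_imp_periodic_points[where \<xi> = "\<lambda>u. c + u" and ?\<xi>1.0 = "\<lambda>_. 1" and k = k, OF int _ \<rho>])
    show "\<bar>h1 c\<bar> < 2" by (rule t)
    show "(\<lambda>u. k u - (h1 c * u + (h2 c / 2) * u\<^sup>2 + (h3 / 6) * u ^ 3)) \<in> o[nhds 0](\<lambda>u. u ^ 3)" by (rule K)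
    show "6 * (h3 / 6) * (2 - h1 c) * (1 + h1 c) + (2 * h1 c + 1) * (2 * (h2 c / 2))\<^sup>2 \<noteq> 0 \<or> h1 c = - 1 \<and> h3 / 6 \<noteq> 0"
      using twist by simp
    show "continuous_on {- \<rho><..<\<rho>} k" unfolding k_def[abs_def]
      by (intro continuous_at_imp_continuous_on ballI continuous_intros DERIV_isCont[OF dh]) auto
    show "F_map a (rat_eval P Q) \<epsilon> (vector [c + Re w, c + Im w]) =
        vector [c + Re (Complex (Im w) (k (Im w) - Re w)), c + Im (Complex (Im w) (k (Im w) - Re w))]" for w
      using h[of "c + Im w"] by (simp add: F_map_def vector_2 k_def Let_def vec_eq_iff forall_2)
  qed (auto intro!: derivative_eq_intros)
  then obtain N where N: "N > 0" and inf: "infinite {w. (\<forall>j. cmod ((T ^^ j) w) < \<rho> \<and> vector [c + Re ((T ^^ j) w), c + Im ((T ^^ j) w)] \<in> F_dom Q) \<and> (T ^^ N) w = w}"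
    (is "infinite ?W") by blast
  define x where "x w j = c + Re ((T ^^ j) w)" for w j
  have xS: "x w (Suc j) = c + Im ((T ^^ j) w)" for w j by (simp add: x_def T_def)
  have "finite ?W"
  \<comment> \<open>After multiplication by (1 + y^2) Q the left side has degree deg P + 2, and the
    right side deg Q + 2, plus 1 for the sum of the neighbours. The comparison is deg g > 1.\<close>
  proof (rule finite_periodic_orbits[of N ?W x 1 "\<lambda>y z. y + z" "[:0, a:] * Q + smult \<epsilon> ([:1, 0, 1:] * P)" "[:1, 0, 1:] * Q"])
    show "x w (j + N) = x w j" if "w \<in> ?W" for w j
      using that by (simp add: x_def funpow_add)
    show "deg_le N 1 (\<lambda>y. y i + y j)" if "i < N" "j < N" for i j
      by (intro deg_le.add deg_le_var that)
    show "poly ([:0, a:] * Q + smult \<epsilon> ([:1, 0, 1:] * P)) (x w (Suc j)) =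
        poly ([:1, 0, 1:] * Q) (x w (Suc j)) * (x w j + x w (Suc (Suc j)))" if "w \<in> ?W" for w j
    proof -
      let ?y = "x w (Suc j)"
      have "poly Q ?y \<noteq> 0" using that unfolding xS by (simp add: F_dom_def vector_2)
      moreover have "x w j + x w (Suc (Suc j)) = h ?y"
        by (simp add: xS x_def) (simp add: T_def k_def)
      moreover have "1 + ?y\<^sup>2 \<noteq> 0" using zero_le_power2[of ?y] by linarith
      moreover have "q * z * (b / z + e * (r / q)) = b * q + e * z * r" if "q \<noteq> 0" "z \<noteq> 0" for q z b e r :: real
        using that by (simp add: field_simps)
      moreover have "poly ([:0, a:] * Q + smult \<epsilon> ([:1, 0, 1:] * P)) ?y = a * ?y * poly Q ?y + \<epsilon> * (1 + ?y\<^sup>2) * poly P ?y"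
        "poly ([:1, 0, 1:] * Q) ?y = poly Q ?y * (1 + ?y\<^sup>2)"
        by (simp_all add: power2_eq_square algebra_simps)
      ultimately show ?thesis by (simp add: h rat_eval_def)
    qed
    have P0: "P \<noteq> 0" using deg by auto
    have d1: "degree ([:1, 0, 1:] * P) = degree P + 2" "degree ([:1, 0, 1:] * Q) = degree Q + 2"
      using P0 Q degree_mult_eq[of "[:1, 0, 1::real:]" P] degree_mult_eq[of "[:1, 0, 1::real:]" Q]
      by (simp_all del: mult_pCons_left)
    have "degree ([:0, a:] * Q) \<le> 1 + degree Q"
      by (rule order_trans[OF degree_mult_le]) (simp add: degree_pCons_le)
    hence "degree ([:0, a:] * Q) < degree (smult \<epsilon> ([:1, 0, 1:] * P))"
      using d1 deg \<epsilon> by (simp add: degree_smult_eq del: mult_pCons_left)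
    hence "degree ([:0, a:] * Q + smult \<epsilon> ([:1, 0, 1:] * P)) = degree P + 2"
      using d1 \<epsilon> by (simp add: degree_add_eq_right degree_smult_eq del: mult_pCons_left)
    thus "degree ([:1, 0, 1:] * Q) + 1 < degree ([:0, a:] * Q + smult \<epsilon> ([:1, 0, 1:] * P))"
      using d1 deg by (simp del: mult_pCons_left)
    show "inj_on (\<lambda>w. (x w 0, x w 1)) ?W"
      by (rule inj_onI) (simp add: x_def T_def complex_eq_iff)
  qed (rule N)
  thus False using inf by blast
qed

text \<open>With x = c exp u the recurrence x_{n-1} x_{n+1} = f(x_n) becomes additive, with k(u) =
  ln(f(c exp u) / c^2). The logarithm is legitimate near u = 0 for either sign of c because f(c) =
  c^2 > 0. The numbers \<open>k1\<close>, \<open>k2\<close>, \<open>k3\<close> are the derivatives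
  of k at 0 in terms of those of f at c.\<close>

lemma G_map_not_integrable:
  fixes f f1 f2 :: "real \<Rightarrow> real"
  assumes \<epsilon>: "\<epsilon> \<noteq> 0" and deg: "degree P > degree Q + 2" and Q: "Q \<noteq> 0"
    and f: "\<And>y. f y = a + y + \<epsilon> * rat_eval P Q y" and c: "c \<noteq> 0" and fc: "f c = c\<^sup>2"
    and \<rho>: "\<rho>0 > 0"
    and d0: "\<And>y. \<bar>y - c\<bar> < \<rho>0 \<Longrightarrow> (f has_real_derivative f1 y) (at y)"
    and d1: "\<And>y. \<bar>y - c\<bar> < \<rho>0 \<Longrightarrow> (f1 has_real_derivative f2 y) (at y)"
    and d2: "(f2 has_real_derivative f3) (at c)"
    and k1: "k1 = f1 c / c" and k2: "k2 = k1 + f2 c - k1\<^sup>2"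
    and k3: "k3 = k1 + 3 * f2 c + c * f3 - 3 * k1\<^sup>2 - 3 * k1 * f2 c + 2 * k1 ^ 3"
    and t: "\<bar>k1\<bar> < 2"
    and twist: "k3 * (2 - k1) * (1 + k1) + (2 * k1 + 1) * k2\<^sup>2 \<noteq> 0"
  shows "\<not> locally_integrable_at 6 (G_dom Q) (G_map a (rat_eval P Q) \<epsilon>) (vector [c, c])"
proof
  assume int: "locally_integrable_at 6 (G_dom Q) (G_map a (rat_eval P Q) \<epsilon>) (vector [c, c])"
  define X where "X u = c * exp u" for u
  have DX: "(X has_real_derivative X u) (at u)" for u
    unfolding X_def[abs_def] by (auto intro!: derivative_eq_intros)
  have fpos: "f c > 0" using c by (simp add: fc)
  have "isCont f c" using d0[of c] \<rho> by (auto intro: DERIV_isCont)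
  hence "isCont (\<lambda>u. f (X u)) 0" by (intro isCont_o2[OF DERIV_isCont[OF DX]]) (simp add: X_def)
  hence "\<forall>\<^sub>F u in nhds 0. f (X u) > 0"
    using fpos by (intro order_tendstoD(1)[of _ "f (X 0)"]) (auto simp: continuous_at tendsto_nhds_iff X_def)
  moreover have "\<forall>\<^sub>F u in nhds 0. \<bar>X u - c\<bar> < \<rho>0"
  proof -
    have "isCont (\<lambda>u. \<bar>X u - c\<bar>) 0" by (intro continuous_intros DERIV_isCont[OF DX])
    thus ?thesis using \<rho> by (intro order_tendstoD(2)[of _ "\<bar>X 0 - c\<bar>"]) (auto simp: continuous_at tendsto_nhds_iff X_def)
  qed
  ultimately have "\<forall>\<^sub>F u in nhds 0. f (X u) > 0 \<and> \<bar>X u - c\<bar> < \<rho>0" by (rule eventually_conj)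
  then obtain \<rho> where \<rho>: "\<rho> > 0" "\<And>u. \<bar>u\<bar> < \<rho> \<Longrightarrow> f (X u) > 0 \<and> \<bar>X u - c\<bar> < \<rho>0"
    unfolding eventually_nhds_metric by (auto simp: dist_norm)
  define k where "k u = ln (f (X u) / c\<^sup>2)" for u
  define T where "T w = Complex (Im w) (k (Im w) - Re w)" for w
  have Xk: "X (k v - u) = c * (f (X v) / c\<^sup>2) / exp u" if "f (X v) > 0" for u v
  proof -
    have "exp (k v) = f (X v) / c\<^sup>2" using that c by (simp add: k_def)
    hence "exp (k v - u) = (f (X v) / c\<^sup>2) / exp u" by (simp only: exp_diff)
    moreover have "X (k v - u) = c * exp (k v - u)" by (rule X_def)
    ultimately show ?thesis by simp
  qed
  \<comment> \<open>\<open>m1\<close> and \<open>m2\<close> are y f'(y)/f(y) and y^2 f''(y)/f(y) at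
    y = c exp u. Since d/du = y d/dy, this gives k' = m1 and k'' = m1 + m2 - m1^2.\<close>
  define m1 where "m1 u = X u * f1 (X u) / f (X u)" for u
  define m2 where "m2 u = (X u)\<^sup>2 * f2 (X u) / f (X u)" for u
  have chain: "((\<lambda>u. g (X u)) has_real_derivative g' * X u) (at u)" if "(g has_real_derivative g') (at (X u))" for g g' u
    by (rule DERIV_chain2[OF that DX])
  have Dk: "(k has_real_derivative m1 u) (at u)" if "\<bar>u\<bar> < \<rho>" for u
  proof -
    have "((\<lambda>u. ln (f (X u) / c\<^sup>2)) has_real_derivative (1 / (f (X u) / c\<^sup>2)) * (f1 (X u) * X u / c\<^sup>2)) (at u)"
      using \<rho>(2)[OF that] c
      by (intro DERIV_chain2[OF DERIV_ln_divide] DERIV_cdivide chain d0) auto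
    thus ?thesis unfolding k_def[abs_def] m1_def using \<rho>(2)[OF that] c by (simp add: mult_ac)
  qed
  have Dm1: "(m1 has_real_derivative m1 u + m2 u - (m1 u)\<^sup>2) (at u)" if "\<bar>u\<bar> < \<rho>" for u
  proof -
    have fp: "f (X u) \<noteq> 0" "f (X u) > 0" "\<bar>X u - c\<bar> < \<rho>0" using \<rho>(2)[OF that] by auto
    have "((\<lambda>u. X u * f1 (X u) / f (X u)) has_real_derivative
        ((X u * f1 (X u) + (f2 (X u) * X u) * X u) * f (X u) - (X u * f1 (X u)) * (f1 (X u) * X u)) / (f (X u) * f (X u))) (at u)"
      by (intro DERIV_divide DERIV_mult DX chain d0 d1 fp)
    moreover have "((X u * f1 (X u) + (f2 (X u) * X u) * X u) * f (X u) - (X u * f1 (X u)) * (f1 (X u) * X u)) / (f (X u) * f (X u))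
        = m1 u + m2 u - (m1 u)\<^sup>2"
      using fp by (simp add: m1_def m2_def field_simps power2_eq_square)
    ultimately show ?thesis unfolding m1_def[abs_def] by simp
  qed
  have X0: "X 0 = c" by (simp add: X_def)
  have m0: "m1 0 = k1" "m2 0 = f2 c" using c by (simp_all add: m1_def m2_def X0 fc k1 power2_eq_square)
  have Dm2: "(m2 has_real_derivative 2 * f2 c + c * f3 - k1 * f2 c) (at 0)"
  proof -
    have fp: "f (X 0) \<noteq> 0" "\<bar>X 0 - c\<bar> < \<rho>0" using \<rho>(2)[of 0] \<rho>(1) by auto
    have "((\<lambda>u. (X u * X u) * f2 (X u) / f (X u)) has_real_derivative
        (((X 0 * X 0 + X 0 * X 0) * f2 (X 0) + (f3 * X 0) * (X 0 * X 0)) * f (X 0) - ((X 0 * X 0) * f2 (X 0)) * (f1 (X 0) * X 0)) / (f (X 0) * f (X 0))) (at 0)"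
      by (intro DERIV_divide DERIV_mult DX chain d0 fp) (use d2 X0 in simp)
    moreover have "(((X 0 * X 0 + X 0 * X 0) * f2 (X 0) + (f3 * X 0) * (X 0 * X 0)) * f (X 0) - ((X 0 * X 0) * f2 (X 0)) * (f1 (X 0) * X 0)) / (f (X 0) * f (X 0))
        = 2 * f2 c + c * f3 - k1 * f2 c"
      using c by (simp add: X0 fc k1 field_simps power2_eq_square)
    ultimately show ?thesis unfolding m2_def[abs_def] power2_eq_square by simp
  qed
  have Dk2: "((\<lambda>u. m1 u + m2 u - (m1 u)\<^sup>2) has_real_derivative k3) (at 0)"
  proof -
    have "((\<lambda>u. m1 u + m2 u - (m1 u)\<^sup>2) has_real_derivative
       (m1 0 + m2 0 - (m1 0)\<^sup>2) + (2 * f2 c + c * f3 - k1 * f2 c) - 2 * (m1 0 + m2 0 - (m1 0)\<^sup>2) * m1 0) (at 0)"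
      using \<rho>(1) by (auto intro!: derivative_eq_intros Dm1 Dm2)
    moreover have "(m1 0 + m2 0 - (m1 0)\<^sup>2) + (2 * f2 c + c * f3 - k1 * f2 c) - 2 * (m1 0 + m2 0 - (m1 0)\<^sup>2) * m1 0 = k3"
      unfolding m0 k3 by (simp add: algebra_simps power2_eq_square power3_eq_cube)
    ultimately show ?thesis by simp
  qed
  have K: "(\<lambda>u. k u - (k1 * u + (k2 / 2) * u\<^sup>2 + (k3 / 6) * u ^ 3)) \<in> o[nhds 0](\<lambda>u. u ^ 3)"
  proof -
    have "k 0 = 0" using c by (simp add: k_def X0 fc)
    thus ?thesis using Taylor_Peano_3[OF \<rho>(1) Dk Dm1 Dk2] by (simp add: m0 k2)
  qed
  have "\<exists>N>0. infinite {w. (\<forall>j. cmod ((T ^^ j) w) < \<rho> \<and> vector [X (Re ((T ^^ j) w)), X (Im ((T ^^ j) w))] \<in> G_dom Q) \<and> (T ^^ N) w = w}"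
    unfolding T_def
  proof (rule integrable_imp_periodic_points[where \<xi> = X and ?\<xi>1.0 = X and k = k, OF int _ \<rho>(1)])
    show "\<bar>k1\<bar> < 2" by (rule t)
    show "(\<lambda>u. k u - (k1 * u + (k2 / 2) * u\<^sup>2 + (k3 / 6) * u ^ 3)) \<in> o[nhds 0](\<lambda>u. u ^ 3)" by (rule K)
    show "6 * (k3 / 6) * (2 - k1) * (1 + k1) + (2 * k1 + 1) * (2 * (k2 / 2))\<^sup>2 \<noteq> 0 \<or> k1 = - 1 \<and> k3 / 6 \<noteq> 0"
      using twist by simp
    show "continuous_on {- \<rho><..<\<rho>} k"
      by (intro continuous_at_imp_continuous_on ballI DERIV_isCont[OF Dk]) auto
    show "(X has_real_derivative X u) (at u)" for u by (rule DX)
    show "(X has_real_derivative c) (at 0)" using DX[of 0] by (simp add: X0)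
    show "X 0 \<noteq> 0" "vector [c, c] = vector [X 0, X 0]" using c by (simp_all add: X0)
    show "G_map a (rat_eval P Q) \<epsilon> (vector [X (Re w), X (Im w)]) =
        vector [X (Re (Complex (Im w) (k (Im w) - Re w))), X (Im (Complex (Im w) (k (Im w) - Re w)))]" if "cmod w < \<rho>" for w
    proof -
      have "\<bar>Im w\<bar> < \<rho>" using abs_Im_le_cmod[of w] that by linarith
      from \<rho>(2)[OF this] have fp: "f (X (Im w)) > 0" by simp
      have "X (k (Im w) - Re w) = c * (f (X (Im w)) / c\<^sup>2) / exp (Re w)" by (rule Xk[OF fp])
      also have "\<dots> = f (X (Im w)) / X (Re w)" using c by (simp add: X_def power2_eq_square)
      finally show ?thesis using f[of "X (Im w)"] by (simp add: G_map_def vector_2 Let_def)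
    qed
  qed
  then obtain N where N: "N > 0" and inf: "infinite {w. (\<forall>j. cmod ((T ^^ j) w) < \<rho> \<and> vector [X (Re ((T ^^ j) w)), X (Im ((T ^^ j) w))] \<in> G_dom Q) \<and> (T ^^ N) w = w}"
    (is "infinite ?W") by blast
  define x where "x w j = X (Re ((T ^^ j) w))" for w j
  have xS: "x w (Suc j) = X (Im ((T ^^ j) w))" for w j by (simp add: x_def T_def)
  have "finite ?W"
  \<comment> \<open>The product of the neighbours has degree 2, whence the comparison deg P > deg Q
    + 2. The unperturbed part (a + y) Q has degree at most deg Q + 1 and cannot cancel the leading
    term of \<epsilon> P.\<close>
  proof (rule finite_periodic_orbits[of N ?W x 2 "\<lambda>y z. y * z" "[:a, 1:] * Q + smult \<epsilon> P" Q])
    show "x w (j + N) = x w j" if "w \<in> ?W" for w j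
      using that by (simp add: x_def funpow_add)
    show "deg_le N 2 (\<lambda>y. y i * y j)" if "i < N" "j < N" for i j
      using deg_le_mult[OF deg_le_var[OF that(1)] deg_le_var[OF that(2)]] by (simp add: eval_nat_numeral)
    show "poly ([:a, 1:] * Q + smult \<epsilon> P) (x w (Suc j)) =
        poly Q (x w (Suc j)) * (x w j * x w (Suc (Suc j)))" if w: "w \<in> ?W" for w j
    proof -
      let ?y = "x w (Suc j)"
      have "poly Q ?y \<noteq> 0" using w unfolding xS by (simp add: G_dom_def vector_2)
      moreover have "x w j * x w (Suc (Suc j)) = f ?y"
      proof -
        let ?z = "(T ^^ j) w"
        have "cmod ?z < \<rho>" using w by blast
        hence "\<bar>Im ?z\<bar> < \<rho>" using abs_Im_le_cmod[of ?z] by linarith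
        from \<rho>(2)[OF this] have fp: "f (X (Im ?z)) > 0" by simp
        have "x w (Suc (Suc j)) = X (k (Im ?z) - Re ?z)" unfolding xS by (simp add: T_def)
        also have "\<dots> = c * (f (X (Im ?z)) / c\<^sup>2) / exp (Re ?z)" by (rule Xk[OF fp])
        finally show ?thesis using c unfolding xS by (simp add: x_def X_def[of "Re _"] power2_eq_square)
      qed
      ultimately show ?thesis by (simp add: f rat_eval_def field_simps)
    qed
    have "degree ([:a, 1:] * Q) \<le> 1 + degree Q"
      by (rule order_trans[OF degree_mult_le]) (simp add: degree_pCons_le)
    hence "degree ([:a, 1:] * Q) < degree (smult \<epsilon> P)"
      using deg \<epsilon> by (simp add: degree_smult_eq del: mult_pCons_left)
    hence "degree ([:a, 1:] * Q + smult \<epsilon> P) = degree P"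
      using \<epsilon> by (simp add: degree_add_eq_right degree_smult_eq del: mult_pCons_left)
    thus "degree Q + 2 < degree ([:a, 1:] * Q + smult \<epsilon> P)" using deg by (simp del: mult_pCons_left)
    show "inj_on (\<lambda>w. (x w 0, x w 1)) ?W"
      by (rule inj_onI) (use c in \<open>simp add: x_def T_def X_def complex_eq_iff\<close>)
  qed (rule N)
  thus False using inf by blast
qed

subsection \<open>First integrals with definite Hessian\<close>

text \<open>A class closed under directional derivatives. Membership gives every order of smoothness
  by one induction, so the rational first integrals need not be differentiated six times.\<close>

inductive_set regular_fun :: "(real^2) set \<Rightarrow> (real^2 \<Rightarrow> real) set" for U where
  const: "(\<lambda>_. c) \<in> regular_fun U"
| coord: "(\<lambda>x. x $ i) \<in> regular_fun U"
| add: "f \<in> regular_fun U \<Longrightarrow> g \<in> regular_fun U \<Longrightarrow> (\<lambda>x. f x + g x) \<in> regular_fun U"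
| mult: "f \<in> regular_fun U \<Longrightarrow> g \<in> regular_fun U \<Longrightarrow> (\<lambda>x. f x * g x) \<in> regular_fun U"
| inverse: "f \<in> regular_fun U \<Longrightarrow> (\<And>x. x \<in> U \<Longrightarrow> f x \<noteq> 0) \<Longrightarrow> (\<lambda>x. inverse (f x)) \<in> regular_fun U"

lemma regular_fun_derivative:
  assumes "f \<in> regular_fun U"
  shows "\<exists>f'. (\<forall>x\<in>U. (f has_derivative f' x) (at x)) \<and> (\<forall>v. (\<lambda>x. f' x v) \<in> regular_fun U)"
  using assms
proof (induction rule: regular_fun.induct)
  case (const c)
  show ?case by (intro exI[of _ "\<lambda>_ _. 0"]) (auto intro: regular_fun.const)
next
  case (coord i)
  have "((\<lambda>x::real^2. x $ i) has_derivative (\<lambda>v. v $ i)) (at x)" for x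
    by (rule bounded_linear_imp_has_derivative[OF bounded_linear_vec_nth])
  thus ?case by (intro exI[of _ "\<lambda>_ v. v $ i"]) (auto intro: regular_fun.const)
next
  case (add f g)
  then obtain f' g' where "\<forall>x\<in>U. (f has_derivative f' x) (at x)" "\<forall>v. (\<lambda>x. f' x v) \<in> regular_fun U"
    "\<forall>x\<in>U. (g has_derivative g' x) (at x)" "\<forall>v. (\<lambda>x. g' x v) \<in> regular_fun U" by blast
  thus ?case by (intro exI[of _ "\<lambda>x v. f' x v + g' x v"]) (auto intro: has_derivative_add regular_fun.add)
next
  case (mult f g)
  then obtain f' g' where *: "\<forall>x\<in>U. (f has_derivative f' x) (at x)" "\<forall>v. (\<lambda>x. f' x v) \<in> regular_fun U"
    "\<forall>x\<in>U. (g has_derivative g' x) (at x)" "\<forall>v. (\<lambda>x. g' x v) \<in> regular_fun U" by blast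
  show ?case
  proof (intro exI[of _ "\<lambda>x v. f x * g' x v + f' x v * g x"] conjI ballI allI)
    show "((\<lambda>x. f x * g x) has_derivative (\<lambda>v. f x * g' x v + f' x v * g x)) (at x)" if "x \<in> U" for x
      using has_derivative_mult * that by blast
  qed (intro regular_fun.add regular_fun.mult mult.hyps *(2)[rule_format] *(4)[rule_format])+
next
  case (inverse f)
  then obtain f' where f': "\<forall>x\<in>U. (f has_derivative f' x) (at x)" "\<forall>v. (\<lambda>x. f' x v) \<in> regular_fun U" by blast
  have I: "(\<lambda>x. inverse (f x)) \<in> regular_fun U" using inverse by (intro regular_fun.inverse) auto
  show ?case
  proof (intro exI[of _ "\<lambda>x v. - 1 * (inverse (f x) * f' x v * inverse (f x))"] conjI ballI allI)
    show "((\<lambda>x. inverse (f x)) has_derivative (\<lambda>v. - 1 * (inverse (f x) * f' x v * inverse (f x)))) (at x)" if "x \<in> U" for x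
    proof -
      have "f x \<noteq> 0" "(f has_derivative f' x) (at x)" using inverse that f' by auto
      from Deriv.has_derivative_inverse[OF this] show ?thesis by simp
    qed
  qed (intro regular_fun.mult regular_fun.const I f'(2)[rule_format])
qed

text \<open>Derivatives on an open set depend only on values there. This lets a derivative computed
  on \<open>U\<close> replace \<open>frechet_derivative\<close>, with which it agrees only on
  \<open>U\<close>.\<close>

lemma C_k_on_cong:
  assumes "open U" "\<And>x. x \<in> U \<Longrightarrow> f x = g x" "C_k_on k f U"
  shows "C_k_on k g U"
  using assms(2,3)
proof (induction k arbitrary: f g)
  case 0
  thus ?case using continuous_on_cong[of U U f g] by simp
next
  case (Suc k)
  have D: "(g has_derivative frechet_derivative f (at x)) (at x)" if "x \<in> U" for x
  proof -
    have "(f has_derivative frechet_derivative f (at x)) (at x)"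
      using Suc.prems(2) that frechet_derivative_works by auto
    thus ?thesis by (rule has_derivative_transform_within_open[OF _ assms(1) that]) (use Suc.prems(1) in auto)
  qed
  show ?case unfolding C_k_on.simps
  proof (intro conjI ballI allI)
    show "g differentiable at x" if "x \<in> U" for x using D[OF that] by (auto simp: differentiable_def)
    show "C_k_on k (\<lambda>x. frechet_derivative g (at x) v) U" for v
    proof (rule Suc.IH)
      show "C_k_on k (\<lambda>x. frechet_derivative f (at x) v) U" using Suc.prems(2) by simp
      show "frechet_derivative f (at x) v = frechet_derivative g (at x) v" if "x \<in> U" for x
        using frechet_derivative_at[OF D[OF that]] by simp
    qed
  qed
qed

lemma regular_fun_C_k_on:
  assumes "open U" "f \<in> regular_fun U"
  shows "C_k_on k f U"
  using assms(2)
proof (induction k arbitrary: f)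
  case 0
  from regular_fun_derivative[OF 0] obtain f' where "\<forall>x\<in>U. (f has_derivative f' x) (at x)" by blast
  thus ?case by (simp, blast intro: continuous_at_imp_continuous_on has_derivative_continuous)
next
  case (Suc k)
  from regular_fun_derivative[OF Suc.prems] obtain f' where
    f': "\<forall>x\<in>U. (f has_derivative f' x) (at x)" "\<forall>v. (\<lambda>x. f' x v) \<in> regular_fun U" by blast
  show ?case unfolding C_k_on.simps
  proof (intro conjI ballI allI)
    show "f differentiable at x" if "x \<in> U" for x using f' that by (auto simp: differentiable_def)
    show "C_k_on k (\<lambda>x. frechet_derivative f (at x) v) U" for v
    proof (rule C_k_on_cong[OF assms(1)])
      show "C_k_on k (\<lambda>x. f' x v) U" using f' by (intro Suc.IH) auto
      show "f' x v = frechet_derivative f (at x) v" if "x \<in> U" for x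
        using frechet_derivative_at f'(1) that by metis
    qed
  qed
qed

lemma C_k_on_subset: "C_k_on k f U \<Longrightarrow> U' \<subseteq> U \<Longrightarrow> C_k_on k f U'"
  by (induction k arbitrary: f) (auto intro: continuous_on_subset)

section \<open>Star-shaped closed curves and definite critical points\<close>

definition unit_vec :: "real \<Rightarrow> real^2" where "unit_vec t = vector [cos t, sin t]"

lemma norm_vec2: "norm (x :: real^2) = sqrt ((x $ 1)\<^sup>2 + (x $ 2)\<^sup>2)"
  by (simp add: norm_vec_def L2_set_def sum_2)

lemma norm_unit_vec [simp]: "norm (unit_vec t) = 1"
  by (simp add: norm_vec2 unit_vec_def vector_2)

lemma unit_vec_surj:
  fixes e :: "real^2"
  assumes "norm e = 1"
  obtains t where "0 \<le> t" "t \<le> 1" "e = unit_vec (2 * pi * t)"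
proof -
  have "(e $ 1)\<^sup>2 + (e $ 2)\<^sup>2 = 1" using assms by (simp add: norm_vec2)
  then obtain s where s: "0 \<le> s" "s \<le> 2 * pi" "e $ 1 = cos s" "e $ 2 = sin s"
    using sincos_total_2pi_le by metis
  show ?thesis
  proof (rule that[of "s / (2 * pi)"])
    show "e = unit_vec (2 * pi * (s / (2 * pi)))"
      using s by (simp add: unit_vec_def vec_eq_iff forall_2 vector_2)
  qed (use s in \<open>auto simp: field_simps\<close>)
qed

lemma unit_vec_eqD:
  assumes "unit_vec (2 * pi * s) = unit_vec (2 * pi * t)" "0 \<le> s" "s \<le> 1" "0 \<le> t" "t \<le> 1"
  shows "s = t \<or> s = 0 \<and> t = 1 \<or> s = 1 \<and> t = 0"
proof -
  have "sin (2 * pi * s) = sin (2 * pi * t) \<and> cos (2 * pi * s) = cos (2 * pi * t)"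
    using assms(1) by (simp add: unit_vec_def vec_eq_iff forall_2 vector_2)
  then obtain n :: int where "2 * pi * s = 2 * pi * t + 2 * pi * n" unfolding sin_cos_eq_iff by blast
  hence "2 * pi * s = 2 * pi * (t + n)" by (simp add: distrib_left)
  hence n: "s = t + n" by simp
  hence "\<bar>real_of_int n\<bar> \<le> 1" using assms by linarith
  hence "n = -1 \<or> n = 0 \<or> n = 1" by linarith
  thus ?thesis using n assms by auto
qed

text \<open>Radial projection from p is a continuous bijection of \<open>S\<close> onto the unit
  circle; its inverse, composed with the angle parametrisation, is the required closed
  curve.\<close>

lemma closed_curve_star_shaped:
  fixes p :: "real^2"
  assumes S: "compact S" "p \<notin> S" and ray: "\<And>e. norm e = 1 \<Longrightarrow> \<exists>!r. r > 0 \<and> p + r *\<^sub>R e \<in> S"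
    and ins: "p \<in> inside S"
  shows "closed_curve_surrounding p S"
proof -
  define \<pi> where "\<pi> y = (y - p) /\<^sub>R norm (y - p)" for y
  define r where "r e = (THE r. r > 0 \<and> p + r *\<^sub>R e \<in> S)" for e
  have r: "r e > 0" "p + r e *\<^sub>R e \<in> S" if "norm e = 1" for e
    using theI'[OF ray[OF that]] unfolding r_def by auto
  have r1: "s = r e" if "norm e = 1" "s > 0" "p + s *\<^sub>R e \<in> S" for e s
    using ray[OF that(1)] r[OF that(1)] that by blast
  define g where "g e = p + r e *\<^sub>R e" for e
  have yp: "y \<noteq> p" if "y \<in> S" for y using that S by auto
  have \<pi>n: "norm (\<pi> y) = 1" if "y \<in> S" for y using yp[OF that] by (simp add: \<pi>_def)
  have py: "p + norm (y - p) *\<^sub>R \<pi> y = y" if "y \<in> S" for y using yp[OF that] by (simp add: \<pi>_def)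
  have g\<pi>: "g (\<pi> y) = y" if "y \<in> S" for y
    using r1[OF \<pi>n[OF that], of "norm (y - p)"] py[OF that] that yp[OF that] by (simp add: g_def)
  have \<pi>g: "\<pi> (g e) = e" if "norm e = 1" for e
    using r[OF that] that by (simp add: \<pi>_def g_def)
  have \<pi>S: "\<pi> ` S = sphere 0 1"
  proof (intro equalityI subsetI)
    fix e assume "e \<in> sphere (0::real^2) 1"
    thus "e \<in> \<pi> ` S" using \<pi>g[of e] r[of e] by (intro image_eqI[of _ _ "g e"]) (auto simp: g_def)
  qed (use \<pi>n in auto)
  have "continuous_on S \<pi>" unfolding \<pi>_def[abs_def]
    by (intro continuous_intros) (use yp in auto)
  \<comment> \<open>Compactness of \<open>S\<close> makes the inverse continuous, so the radius
    function \<open>r\<close> need not be shown continuous directly.\<close>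
  hence gc: "continuous_on (sphere 0 1) g"
    using continuous_on_inv[of S \<pi> g] S g\<pi> unfolding \<pi>S by auto
  define \<gamma> where "\<gamma> t = g (unit_vec (2 * pi * t))" for t
  have uc: "continuous_on {0..1} (\<lambda>t. unit_vec (2 * pi * t))"
    unfolding unit_vec_def vector2_eq_axis by (intro continuous_intros)
  have "path \<gamma>" unfolding path_def \<gamma>_def[abs_def]
    by (rule continuous_on_compose2[OF gc uc]) auto
  moreover have "loop_free \<gamma>" unfolding loop_free_def
  proof (intro ballI impI)
    fix x y :: real assume xy: "x \<in> {0..1}" "y \<in> {0..1}" "\<gamma> x = \<gamma> y"
    have "\<pi> (\<gamma> x) = \<pi> (\<gamma> y)" by (simp only: xy(3))
    hence "unit_vec (2 * pi * x) = unit_vec (2 * pi * y)" unfolding \<gamma>_def \<pi>g[OF norm_unit_vec] .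
    from unit_vec_eqD[OF this] xy show "x = y \<or> x = 0 \<and> y = 1 \<or> x = 1 \<and> y = 0" by auto
  qed
  ultimately have "simple_path \<gamma>" by (simp add: simple_path_def)
  moreover have "pathfinish \<gamma> = pathstart \<gamma>"
    by (simp add: pathfinish_def pathstart_def \<gamma>_def unit_vec_def)
  moreover have "path_image \<gamma> = S"
  proof (intro equalityI subsetI)
    fix y assume "y \<in> path_image \<gamma>"
    thus "y \<in> S" using r by (auto simp: path_image_def \<gamma>_def g_def)
  next
    fix y assume y: "y \<in> S"
    obtain t where t: "0 \<le> t" "t \<le> 1" "\<pi> y = unit_vec (2 * pi * t)" by (rule unit_vec_surj[OF \<pi>n[OF y]])
    hence "y = \<gamma> t" using g\<pi>[OF y] by (simp add: \<gamma>_def)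
    thus "y \<in> path_image \<gamma>" using t by (auto simp: path_image_def)
  qed
  ultimately show ?thesis unfolding closed_curve_surrounding_def using ins by blast
qed

text \<open>The condition |B| < A makes the Hessian positive definite, so \<open>V\<close> increases
  strictly along every ray in a small disc, and each level below the minimum on the bounding circle
  meets every ray exactly once. The diagonal entries are equal because the integrals used here are
  symmetric in the two coordinates and the fixed points lie on the diagonal.\<close>

lemma locally_integrable_of_definite_hessian:
  fixes V Vx Vy :: "real^2 \<Rightarrow> real"
  assumes U0: "open U0" "p \<in> U0" "U0 \<subseteq> D" and V: "V \<in> regular_fun U0"
    and inv: "\<And>x. x \<in> U0 \<Longrightarrow> F x \<in> U0 \<Longrightarrow> V (F x) = V x"
    and DV: "\<And>x. x \<in> U0 \<Longrightarrow> (V has_derivative (\<lambda>d. Vx x * d $ 1 + Vy x * d $ 2)) (at x)"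
    and V0: "Vx p = 0" "Vy p = 0"
    and DVx: "(Vx has_derivative (\<lambda>d. A * d $ 1 + B * d $ 2)) (at p)"
    and DVy: "(Vy has_derivative (\<lambda>d. B * d $ 1 + A * d $ 2)) (at p)"
    and AB: "\<bar>B\<bar> < A"
  shows "locally_integrable_at 6 D F p"
proof -
  \<comment> \<open>The quadratic form is at least 4 \<eta> |w|^2, and the two gradient errors
    together take away at most 2 \<eta> |w|^2.\<close>
  define \<eta> where "\<eta> = (A - \<bar>B\<bar>) / 4"
  have \<eta>: "\<eta> > 0" using AB by (simp add: \<eta>_def)
  obtain \<rho>1 where \<rho>1: "\<rho>1 > 0" "\<And>w. norm w < \<rho>1 \<Longrightarrow> \<bar>Vx (p + w) - (A * w $ 1 + B * w $ 2)\<bar> \<le> \<eta> * norm w"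
  proof -
    from DVx \<eta> obtain d where "d > 0" "\<And>y. norm (y - p) < d \<Longrightarrow> \<bar>Vx y - (A * (y - p) $ 1 + B * (y - p) $ 2)\<bar> \<le> \<eta> * norm (y - p)"
      unfolding has_derivative_at_alt by (auto simp: V0)
    thus ?thesis using that[of d] by (metis add_diff_cancel_left')
  qed
  obtain \<rho>2 where \<rho>2: "\<rho>2 > 0" "\<And>w. norm w < \<rho>2 \<Longrightarrow> \<bar>Vy (p + w) - (B * w $ 1 + A * w $ 2)\<bar> \<le> \<eta> * norm w"
  proof -
    from DVy \<eta> obtain d where "d > 0" "\<And>y. norm (y - p) < d \<Longrightarrow> \<bar>Vy y - (B * (y - p) $ 1 + A * (y - p) $ 2)\<bar> \<le> \<eta> * norm (y - p)"
      unfolding has_derivative_at_alt by (auto simp: V0)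
    thus ?thesis using that[of d] by (metis add_diff_cancel_left')
  qed
  obtain \<rho>3 where \<rho>3: "\<rho>3 > 0" "ball p \<rho>3 \<subseteq> U0" using U0 open_contains_ball by blast
  define \<rho> where "\<rho> = min \<rho>1 (min \<rho>2 \<rho>3) / 2"
  have \<rho>: "\<rho> > 0" "\<rho> < \<rho>1" "\<rho> < \<rho>2" "\<rho> < \<rho>3" using \<rho>1 \<rho>2 \<rho>3 by (auto simp: \<rho>_def)
  have in0: "p + w \<in> U0" if "norm w \<le> \<rho>" for w using \<rho>3(2) that \<rho> by (auto simp: dist_norm)
  have pos: "Vx (p + w) * w $ 1 + Vy (p + w) * w $ 2 > 0" if w: "w \<noteq> 0" "norm w \<le> \<rho>" for w
  proof -
    have n2: "(norm w)\<^sup>2 = (w $ 1)\<^sup>2 + (w $ 2)\<^sup>2" by (simp add: norm_vec2)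
    have c1: "\<bar>w $ i\<bar> \<le> norm w" for i by (rule component_le_norm_cart)
    have e1: "\<bar>(Vx (p + w) - (A * w $ 1 + B * w $ 2)) * w $ 1\<bar> \<le> (\<eta> * norm w) * norm w"
      unfolding abs_mult using \<rho>1(2)[of w] w \<rho> \<eta> by (intro mult_mono c1) auto
    have e2: "\<bar>(Vy (p + w) - (B * w $ 1 + A * w $ 2)) * w $ 2\<bar> \<le> (\<eta> * norm w) * norm w"
      unfolding abs_mult using \<rho>2(2)[of w] w \<rho> \<eta> by (intro mult_mono c1) auto
    have "2 * \<bar>B * (w $ 1 * w $ 2)\<bar> \<le> \<bar>B\<bar> * (norm w)\<^sup>2"
    proof -
      have "2 * \<bar>w $ 1 * w $ 2\<bar> \<le> (norm w)\<^sup>2"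
        unfolding n2 using sum_squares_bound[of "\<bar>w $ 1\<bar>" "\<bar>w $ 2\<bar>"] by (simp add: abs_mult)
      hence "\<bar>B\<bar> * (2 * \<bar>w $ 1 * w $ 2\<bar>) \<le> \<bar>B\<bar> * (norm w)\<^sup>2" by (intro mult_left_mono) auto
      thus ?thesis by (simp add: abs_mult mult_ac)
    qed
    hence q: "A * (norm w)\<^sup>2 + 2 * (B * (w $ 1 * w $ 2)) \<ge> (A - \<bar>B\<bar>) * (norm w)\<^sup>2"
      by (simp add: algebra_simps abs_le_iff)
    have "Vx (p + w) * w $ 1 + Vy (p + w) * w $ 2 = A * (norm w)\<^sup>2 + 2 * (B * (w $ 1 * w $ 2))
       + (Vx (p + w) - (A * w $ 1 + B * w $ 2)) * w $ 1 + (Vy (p + w) - (B * w $ 1 + A * w $ 2)) * w $ 2"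
      unfolding n2 by (simp add: algebra_simps power2_eq_square)
    moreover have "(\<eta> * norm w) * norm w = \<eta> * (norm w)\<^sup>2" by (simp add: power2_eq_square)
    moreover have "(A - \<bar>B\<bar>) * (norm w)\<^sup>2 = 4 * (\<eta> * (norm w)\<^sup>2)" by (simp add: \<eta>_def)
    moreover have "\<eta> * (norm w)\<^sup>2 > 0" using \<eta> w by simp
    ultimately show ?thesis using q e1 e2 by linarith
  qed
  have mono: "V (p + s *\<^sub>R e) < V (p + s' *\<^sub>R e)" if e: "norm e = 1" and s: "0 \<le> s" "s < s'" "s' \<le> \<rho>" for e s s'
  proof (rule DERIV_pos_imp_increasing_open[OF s(2)])
    fix u assume u: "s < u" "u < s'"
    have "((\<lambda>u. p + u *\<^sub>R e) has_derivative (\<lambda>d. d *\<^sub>R e)) (at u)"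
      by (auto intro!: derivative_eq_intros)
    from has_derivative_compose[OF this DV[OF in0]]
    have "((\<lambda>u. V (p + u *\<^sub>R e)) has_derivative (\<lambda>d. Vx (p + u *\<^sub>R e) * (d *\<^sub>R e) $ 1 + Vy (p + u *\<^sub>R e) * (d *\<^sub>R e) $ 2)) (at u)"
      using u s e by simp
    hence "((\<lambda>u. V (p + u *\<^sub>R e)) has_real_derivative (Vx (p + u *\<^sub>R e) * e $ 1 + Vy (p + u *\<^sub>R e) * e $ 2)) (at u)"
      unfolding has_field_derivative_def by (rule has_derivative_eq_rhs) (simp add: fun_eq_iff algebra_simps)
    moreover have "Vx (p + u *\<^sub>R e) * e $ 1 + Vy (p + u *\<^sub>R e) * e $ 2 > 0"
    proof -
      have "u * (Vx (p + u *\<^sub>R e) * e $ 1 + Vy (p + u *\<^sub>R e) * e $ 2) > 0"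
        using pos[of "u *\<^sub>R e"] u s e by (fastforce simp: algebra_simps)
      thus ?thesis using u s by (simp add: zero_less_mult_iff)
    qed
    ultimately show "\<exists>y. ((\<lambda>u. V (p + u *\<^sub>R e)) has_real_derivative y) (at u) \<and> 0 < y" by blast
  next
    show "continuous_on {s..s'} (\<lambda>u. V (p + u *\<^sub>R e))"
    proof (intro continuous_at_imp_continuous_on ballI)
      fix u assume u: "u \<in> {s..s'}"
      have "isCont V (p + u *\<^sub>R e)"
        by (rule has_derivative_continuous[OF DV[OF in0]]) (use u s e in auto)
      moreover have "isCont (\<lambda>u. p + u *\<^sub>R e) u" by (intro continuous_intros)
      ultimately show "isCont (\<lambda>u. V (p + u *\<^sub>R e)) u" by (rule isCont_o2[rotated])
    qed
  qed
  have Vc: "continuous_on (cball p \<rho>) V"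
  proof (intro continuous_at_imp_continuous_on ballI)
    fix x assume "x \<in> cball p \<rho>"
    hence "p + (x - p) \<in> U0" by (intro in0) (simp add: dist_norm norm_minus_commute)
    thus "isCont V x" using has_derivative_continuous[OF DV] by simp
  qed
  have "continuous_on (sphere p \<rho>) V" by (rule continuous_on_subset[OF Vc]) auto
  moreover have "sphere p \<rho> \<noteq> {}" using \<rho> by simp
  ultimately obtain y0 where y0: "y0 \<in> sphere p \<rho>" "\<And>y. y \<in> sphere p \<rho> \<Longrightarrow> V y0 \<le> V y"
    using continuous_attains_inf[of "sphere p \<rho>" V] by auto
  define m where "m = V y0"
  have polar: "x = p + norm (x - p) *\<^sub>R ((x - p) /\<^sub>R norm (x - p))" if "x \<noteq> p" for x
    using that by simp
  have polar1: "norm ((x - p) /\<^sub>R norm (x - p)) = 1" if "x \<noteq> p" for x using that by simp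
  have gtp: "V p < V x" if "x \<noteq> p" "x \<in> cball p \<rho>" for x
    using mono[OF polar1[OF that(1)], of 0 "norm (x - p)"] polar[OF that(1)] that
    by (simp add: dist_norm norm_minus_commute)
  have mp: "V p < m"
    unfolding m_def by (rule gtp) (use y0 \<rho> in \<open>auto simp: dist_norm\<close>)
  \<comment> \<open>A disc would cut off level curves near its boundary. The part of the disc below
    the minimum of \<open>V\<close> on the bounding circle consists of whole level curves.\<close>
  define U where "U = {x \<in> ball p \<rho>. V x < m}"
  have Uopen: "open U"
  proof -
    have "open (ball p \<rho> \<inter> V -` {..<m})"
      by (rule continuous_open_preimage[OF continuous_on_subset[OF Vc]]) auto
    moreover have "U = ball p \<rho> \<inter> V -` {..<m}" by (auto simp: U_def)
    ultimately show ?thesis by simp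
  qed
  have pU: "p \<in> U" using mp \<rho> by (simp add: U_def)
  have UU0: "U \<subseteq> U0"
  proof
    fix x assume "x \<in> U"
    hence "norm (x - p) \<le> \<rho>" by (simp add: U_def dist_norm norm_minus_commute)
    from in0[OF this] show "x \<in> U0" by simp
  qed
  have curve: "closed_curve_surrounding p {y \<in> U. V y = V x}" if x: "x \<in> U - {p}" for x
  proof -
    define h where "h = V x"
    have h: "V p < h" "h < m" using gtp[of x] x by (auto simp: h_def U_def)
    define S where "S = {y \<in> U. V y = h}"
    have Scball: "S = cball p \<rho> \<inter> V -` {h}"
    proof (intro equalityI subsetI)
      fix y assume y: "y \<in> cball p \<rho> \<inter> V -` {h}"
      have "y \<notin> sphere p \<rho>" using y0(2)[of y] y h by (auto simp: m_def)
      thus "y \<in> S" using y h by (auto simp: S_def U_def dist_norm)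
    qed (auto simp: S_def U_def)
    have cS: "compact S" unfolding Scball
      using continuous_closed_preimage[OF Vc closed_cball, of "{h}"] compact_Int_closed[OF compact_cball]
      by (simp add: compact_eq_bounded_closed bounded_Int)
    have pS: "p \<notin> S" using h by (simp add: S_def)
    have "closed_curve_surrounding p S"
    proof (rule closed_curve_star_shaped[OF cS pS])
      fix e :: "real^2" assume e: "norm e = 1"
      have hr: "h < V (p + \<rho> *\<^sub>R e)" using y0(2)[of "p + \<rho> *\<^sub>R e"] h e \<rho> by (simp add: m_def dist_norm)
      have "continuous_on {0..\<rho>} (\<lambda>u. V (p + u *\<^sub>R e))"
        by (rule continuous_on_compose2[OF Vc]) (use e in \<open>auto intro!: continuous_intros simp: dist_norm\<close>)
      then obtain r where r: "0 \<le> r" "r \<le> \<rho>" "V (p + r *\<^sub>R e) = h"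
        using IVT'[of "\<lambda>u. V (p + u *\<^sub>R e)" 0 h \<rho>] h hr \<rho> by auto
      have r0: "r > 0" using r h by (cases "r = 0") auto
      show "\<exists>!r. r > 0 \<and> p + r *\<^sub>R e \<in> S"
      proof (rule ex1I[of _ r])
        show "r > 0 \<and> p + r *\<^sub>R e \<in> S" using r r0 e by (simp add: Scball dist_norm)
        fix s assume s: "s > 0 \<and> p + s *\<^sub>R e \<in> S"
        hence s': "s \<le> \<rho>" "V (p + s *\<^sub>R e) = h" using e by (auto simp: Scball dist_norm)
        show "s = r"
          using mono[OF e, of s r] mono[OF e, of r s] s s' r by (cases s r rule: linorder_cases) auto
      qed
    next
      \<comment> \<open>\<open>Aset\<close> and \<open>Bset\<close> are disjoint open sets that
        cover the component of p in the complement of \<open>S\<close>. This component therefore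
        stays in the bounded set \<open>Aset\<close>, which means that p is inside.\<close>
      define Aset where "Aset = {y \<in> ball p \<rho>. V y < h}"
      define Bset where "Bset = - (cball p \<rho> \<inter> V -` {..h})"
      have oA: "open Aset"
      proof -
        have "open (ball p \<rho> \<inter> V -` {..<h})"
          by (rule continuous_open_preimage[OF continuous_on_subset[OF Vc]]) auto
        moreover have "Aset = ball p \<rho> \<inter> V -` {..<h}" by (auto simp: Aset_def)
        ultimately show ?thesis by simp
      qed
      have oB: "open Bset" unfolding Bset_def
        using continuous_closed_preimage[OF Vc closed_cball, of "{..h}"] by (simp add: open_closed)
      define K where "K = connected_component_set (- S) p"
      have K: "connected K" "K \<subseteq> - S" "p \<in> K"
        using pS connected_component_subset[of "- S" p] by (auto simp: K_def)
      have KAB: "K \<subseteq> Aset \<union> Bset"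
      proof
        fix y assume "y \<in> K"
        hence yS: "y \<notin> S" using K by blast
        show "y \<in> Aset \<union> Bset"
        proof (cases "y \<in> cball p \<rho> \<and> V y \<le> h")
          case True
          hence "V y < h" using yS by (auto simp: Scball less_le)
          moreover have "y \<notin> sphere p \<rho>" using y0(2)[of y] \<open>V y < h\<close> h by (auto simp: m_def)
          ultimately show ?thesis using True by (auto simp: Aset_def)
        next
          case False
          thus ?thesis by (auto simp: Bset_def)
        qed
      qed
      have "Aset \<inter> Bset = {}" by (auto simp: Aset_def Bset_def)
      moreover have "p \<in> Aset" using \<rho> h by (simp add: Aset_def)
      ultimately have "K \<inter> Bset = {}"
        using connectedD[OF K(1) oA oB _ KAB] K(3) by blast
      hence "K \<subseteq> ball p \<rho>" using KAB by (auto simp: Aset_def)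
      hence "bounded K" using bounded_ball bounded_subset by blast
      thus "p \<in> inside S" using pS by (simp add: inside_def K_def)
    qed
    thus ?thesis by (simp add: S_def h_def)
  qed
  have noncrit: "\<not> (V has_derivative (\<lambda>_. 0)) (at x)" if x: "x \<in> U" "x \<noteq> p" for x
  proof
    assume *: "(V has_derivative (\<lambda>_. 0)) (at x)"
    have "x \<in> U0" using x UU0 by blast
    from fun_cong[OF has_derivative_unique[OF * DV[OF this]], of "x - p"]
    have "Vx x * (x - p) $ 1 + Vy x * (x - p) $ 2 = 0" by simp
    moreover have "Vx (p + (x - p)) * (x - p) $ 1 + Vy (p + (x - p)) * (x - p) $ 2 > 0"
      by (rule pos) (use x in \<open>auto simp: U_def dist_norm norm_minus_commute\<close>)
    ultimately show False by simp
  qed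
  have frV: "frechet_derivative V (at x) v = Vx x * v $ 1 + Vy x * v $ 2" if "x \<in> U0" for x v
    using frechet_derivative_at[OF DV[OF that]] by metis
  have hess: "hessian V p $ i $ 1 = (if i = 1 then A else B)" "hessian V p $ i $ 2 = (if i = 1 then B else A)" for i
  proof -
    have "((\<lambda>x. frechet_derivative V (at x) (axis 1 1)) has_derivative (\<lambda>d. A * d $ 1 + B * d $ 2)) (at p)"
      by (rule has_derivative_transform_within_open[OF DVx U0(1,2)]) (simp add: frV axis_def)
    from frechet_derivative_at[OF this, symmetric]
    show "hessian V p $ i $ 1 = (if i = 1 then A else B)" using exhaust_2[of i] by (auto simp: hessian_def axis_def)
    have "((\<lambda>x. frechet_derivative V (at x) (axis 2 1)) has_derivative (\<lambda>d. B * d $ 1 + A * d $ 2)) (at p)"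
      by (rule has_derivative_transform_within_open[OF DVy U0(1,2)]) (simp add: frV axis_def)
    from frechet_derivative_at[OF this, symmetric]
    show "hessian V p $ i $ 2 = (if i = 1 then B else A)" using exhaust_2[of i] by (auto simp: hessian_def axis_def)
  qed
  have "det (hessian V p) = A * A - B * B" by (simp add: det_2 hess)
  moreover have "B * B < A * A" using mult_strict_mono[of "\<bar>B\<bar>" A "\<bar>B\<bar>" A] AB by (simp add: abs_mult)
  ultimately have det: "det (hessian V p) \<noteq> 0" by simp
  have "p isolated_in {x \<in> U. (V has_derivative (\<lambda>_. 0)) (at x)}"
    unfolding isolated_in_def
  proof (intro conjI exI[of _ UNIV])
    show "p \<in> {x \<in> U. (V has_derivative (\<lambda>_. 0)) (at x)}" using DV[of p] U0 V0 pU by simp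
    thus "UNIV \<inter> {x \<in> U. (V has_derivative (\<lambda>_. 0)) (at x)} = {p}" using noncrit by blast
  qed simp
  moreover have "locally_nonconstant_on V U"
    unfolding locally_nonconstant_on_def
  proof (intro allI impI notI)
    fix W :: "(real^2) set" assume W: "open W \<and> W \<noteq> {} \<and> W \<subseteq> U" "V constant_on W"
    have "W \<noteq> {p}" using W not_open_singleton by blast
    then obtain x where x: "x \<in> W" "x \<noteq> p" using W by blast
    from W(2) obtain c where c: "\<And>x. x \<in> W \<Longrightarrow> V x = c" by (auto simp: constant_on_def)
    have "(V has_derivative (\<lambda>_. 0)) (at x)"
      by (rule has_derivative_transform_within_open[OF has_derivative_const[of c], of W]) (use W x c in auto)
    thus False using noncrit[of x] x W by blast
  qed
  moreover have "C_k_on 6 V U" by (rule C_k_on_subset[OF regular_fun_C_k_on[OF U0(1) V] UU0])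
  ultimately have "first_integral 6 F p U V"
    unfolding first_integral_def isolated_nondegenerate_critical_point_def
    using inv UU0 curve det by blast
  thus ?thesis unfolding locally_integrable_at_def using Uopen pU UU0 U0(3) by blast
qed

subsection \<open>Elliptic fixed points and their branches\<close>

lemma complex_quadratic_unit_roots:
  fixes t :: real and z :: complex
  assumes t: "\<bar>t\<bar> < 2" and z: "z\<^sup>2 - of_real t * z + 1 = 0"
  shows "cmod z = 1 \<and> z \<noteq> 1 \<and> z \<noteq> -1"
proof -
  define x y where "x = Re z" and "y = Im z"
  have "Re (z\<^sup>2 - of_real t * z + 1) = 0" "Im (z\<^sup>2 - of_real t * z + 1) = 0" using z by simp_all
  hence re: "x\<^sup>2 - y\<^sup>2 - t * x + 1 = 0" and im: "2 * x * y - t * y = 0"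
    by (simp_all add: x_def y_def Re_power2 Im_power2)
  have t4: "t\<^sup>2 < 4" using abs_square_less_1[of "t / 2"] t by (simp add: power_divide)
  have y0: "y \<noteq> 0"
  proof
    assume "y = 0"
    hence "(2 * x - t)\<^sup>2 = t\<^sup>2 - 4" using re by (simp add: power2_eq_square algebra_simps)
    thus False using t4 zero_le_power2[of "2 * x - t"] by linarith
  qed
  have "y * (2 * x - t) = 0" using im by (simp add: algebra_simps)
  hence x: "t = 2 * x" using y0 by simp
  have "x\<^sup>2 + y\<^sup>2 = 1" using re unfolding x by (simp add: power2_eq_square algebra_simps)
  hence "cmod z = 1" by (simp add: cmod_def x_def y_def)
  thus ?thesis using y0 by (auto simp: y_def)
qed

text \<open>The characteristic polynomial is z^2 - t z + 1. For |t| < 2 its roots are conjugate, not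
  real, of modulus 1. For |t| \<ge> 2 there is a real root, and a real number on the unit circle is
  1 or -1.\<close>

lemma elliptic_fixed_point_iff:
  fixes F :: "real^2 \<Rightarrow> real^2"
  assumes F: "(F has_derivative (\<lambda>d. vector [d $ 2, - d $ 1 + t * d $ 2])) (at p)"
  shows "elliptic_fixed_point D F p \<longleftrightarrow> p \<in> D \<and> F p = p \<and> \<bar>t\<bar> < 2"
proof -
  define J where "J = jacobian F (at p)"
  have fr: "frechet_derivative F (at p) = (\<lambda>d. vector [d $ 2, - d $ 1 + t * d $ 2])"
    using frechet_derivative_at[OF F] by simp
  have J: "J $ 1 $ 1 = 0" "J $ 1 $ 2 = 1" "J $ 2 $ 1 = -1" "J $ 2 $ 2 = t"
    by (simp_all add: J_def jacobian_def matrix_def fr vector_2 axis_def)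
  have ev: "complex_eigenvalue J z \<longleftrightarrow> z\<^sup>2 - of_real t * z + 1 = 0" for z
  proof
    assume "complex_eigenvalue J z"
    then obtain v where v: "v \<noteq> 0" "map_matrix complex_of_real J *v v = z *s v"
      unfolding complex_eigenvalue_def by blast
    have "(map_matrix complex_of_real J *v v) $ i = (z *s v) $ i" for i using v(2) by simp
    from this[of 1] this[of 2] have 1: "v $ 2 = z * v $ 1" and 2: "- v $ 1 + of_real t * v $ 2 = z * v $ 2"
      by (simp_all add: matrix_vector_mult_def sum_2 map_matrix_def J)
    have v1: "v $ 1 \<noteq> 0"
    proof
      assume "v $ 1 = 0"
      hence "v = 0" using 1 by (simp add: vec_eq_iff forall_2)
      thus False using v(1) by simp
    qed
    have "v $ 1 * (z\<^sup>2 - of_real t * z + 1) = 0" using 2 unfolding 1 by (simp add: power2_eq_square algebra_simps)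
    thus "z\<^sup>2 - of_real t * z + 1 = 0" using v1 by simp
  next
    assume z: "z\<^sup>2 - of_real t * z + 1 = 0"
    define v :: "complex^2" where "v = vector [1, z]"
    have "v \<noteq> 0" by (auto simp: v_def vec_eq_iff vector_2 forall_2)
    moreover have "map_matrix complex_of_real J *v v = z *s v"
      using z by (simp add: vec_eq_iff forall_2 matrix_vector_mult_def sum_2 map_matrix_def J v_def vector_2 power2_eq_square algebra_simps)
    ultimately show "complex_eigenvalue J z" unfolding complex_eigenvalue_def by blast
  qed
  have "(\<forall>z. complex_eigenvalue J z \<longrightarrow> cmod z = 1 \<and> z \<noteq> 1 \<and> z \<noteq> - 1) \<longleftrightarrow> \<bar>t\<bar> < 2"
  proof
    assume A: "\<forall>z. complex_eigenvalue J z \<longrightarrow> cmod z = 1 \<and> z \<noteq> 1 \<and> z \<noteq> - 1"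
    show "\<bar>t\<bar> < 2"
    proof (rule ccontr)
      assume "\<not> \<bar>t\<bar> < 2"
      hence "2\<^sup>2 \<le> \<bar>t\<bar>\<^sup>2" by (intro power_mono) auto
      hence t4: "t\<^sup>2 - 4 \<ge> 0" by simp
      define x where "x = (t + sqrt (t\<^sup>2 - 4)) / 2"
      have "2 * x - t = sqrt (t\<^sup>2 - 4)" unfolding x_def by (simp add: field_simps)
      hence "(2 * x - t)\<^sup>2 = t\<^sup>2 - 4" using t4 by simp
      hence x: "x\<^sup>2 - t * x + 1 = 0" by (simp add: power2_eq_square algebra_simps)
      have "(of_real x :: complex)\<^sup>2 - of_real t * of_real x + 1 = of_real (x\<^sup>2 - t * x + 1)" by simp
      hence "complex_eigenvalue J (of_real x)" unfolding ev x by simp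
      from A[rule_format, OF this] have "\<bar>x\<bar> = 1" "complex_of_real x \<noteq> 1" "complex_of_real x \<noteq> -1" by auto
      thus False by (metis abs_1 abs_eq_iff of_real_1 of_real_minus)
    qed
  next
    assume "\<bar>t\<bar> < 2"
    thus "\<forall>z. complex_eigenvalue J z \<longrightarrow> cmod z = 1 \<and> z \<noteq> 1 \<and> z \<noteq> - 1"
      unfolding ev using complex_quadratic_unit_roots by blast
  qed
  moreover have "F differentiable (at p)" using F by (auto simp: differentiable_def)
  ultimately show ?thesis unfolding elliptic_fixed_point_def J_def by blast
qed

text \<open>An implicit function theorem with a neighbourhood of c that does not depend on
  \<epsilon>, as a fixed point branch demands. Up to the sign of \<kappa>'(c), the function \<kappa>
  - \<epsilon> g has slope at least m/2 there, uniformly in \<epsilon>; this gives existence,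
  uniqueness and Lipschitz dependence of the zero.\<close>

lemma zero_branch:
  fixes \<kappa> \<kappa>1 g g1 :: "real \<Rightarrow> real"
  assumes \<rho>: "\<rho> > 0"
    and d\<kappa>: "\<And>x. \<bar>x - c\<bar> < \<rho> \<Longrightarrow> (\<kappa> has_real_derivative \<kappa>1 x) (at x)"
    and dg: "\<And>x. \<bar>x - c\<bar> < \<rho> \<Longrightarrow> (g has_real_derivative g1 x) (at x)"
    and cont: "isCont \<kappa>1 c" "isCont g1 c" and \<kappa>c: "\<kappa> c = 0" and \<kappa>1c: "\<kappa>1 c \<noteq> 0"
  shows "\<exists>\<delta> e z. 0 < \<delta> \<and> \<delta> < \<rho> \<and> e > 0 \<and> z 0 = c \<and> continuous_on {-e<..<e} z \<and>
      (\<forall>\<epsilon>. \<bar>\<epsilon>\<bar> < e \<longrightarrow> \<bar>z \<epsilon> - c\<bar> < \<delta> \<and> (\<forall>x. \<bar>x - c\<bar> < \<delta> \<longrightarrow> (\<kappa> x = \<epsilon> * g x \<longleftrightarrow> x = z \<epsilon>)))"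
proof -
  define s where "s = sgn (\<kappa>1 c)"
  have s: "s \<noteq> 0" "s * \<kappa>1 c = \<bar>\<kappa>1 c\<bar>" "\<bar>s\<bar> = 1" using \<kappa>1c by (auto simp: s_def sgn_if)
  define m where "m = \<bar>\<kappa>1 c\<bar> / 2"
  have m: "m > 0" using \<kappa>1c by (simp add: m_def)
  define M where "M = \<bar>g1 c\<bar> + 1"
  have M: "M > 0" by (simp add: M_def add_nonneg_pos)
  have "isCont (\<lambda>x. s * \<kappa>1 x) c" by (intro continuous_intros cont)
  hence "\<forall>\<^sub>F x in nhds c. s * \<kappa>1 x > m"
    using s m \<kappa>1c by (intro order_tendstoD(1)[of _ "s * \<kappa>1 c"]) (auto simp: continuous_at tendsto_nhds_iff m_def)
  moreover have "\<forall>\<^sub>F x in nhds c. \<bar>g1 x\<bar> < M"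
  proof -
    have "isCont (\<lambda>x. \<bar>g1 x\<bar>) c" by (intro continuous_intros cont)
    thus ?thesis by (intro order_tendstoD(2)[of _ "\<bar>g1 c\<bar>"]) (auto simp: continuous_at tendsto_nhds_iff M_def)
  qed
  ultimately have "\<forall>\<^sub>F x in nhds c. s * \<kappa>1 x > m \<and> \<bar>g1 x\<bar> < M" by (rule eventually_conj)
  then obtain \<delta>1 where \<delta>1: "\<delta>1 > 0" "\<And>x. \<bar>x - c\<bar> < \<delta>1 \<Longrightarrow> s * \<kappa>1 x > m \<and> \<bar>g1 x\<bar> < M"
    unfolding eventually_nhds_metric by (auto simp: dist_norm)
  define \<delta> where "\<delta> = min \<rho> \<delta>1 / 2"
  have \<delta>: "\<delta> > 0" "\<delta> < \<rho>" "\<delta> < \<delta>1" using \<rho> \<delta>1 by (auto simp: \<delta>_def)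
  define \<Phi> where "\<Phi> \<epsilon> x = s * (\<kappa> x - \<epsilon> * g x)" for \<epsilon> x
  define e1 where "e1 = m / (2 * M)"
  have e1: "e1 > 0" using m M by (simp add: e1_def)
  have inc: "\<Phi> \<epsilon> y - \<Phi> \<epsilon> x \<ge> m / 2 * (y - x)"
    if xy: "c - \<delta> \<le> x" "x \<le> y" "y \<le> c + \<delta>" and \<epsilon>: "\<bar>\<epsilon>\<bar> \<le> e1" for \<epsilon> x y
  proof (cases "x = y")
    case False
    hence "x < y" using xy by simp
    have D: "(\<Phi> \<epsilon> has_real_derivative s * (\<kappa>1 u - \<epsilon> * g1 u)) (at u)" if "x \<le> u" "u \<le> y" for u
    proof -
      have u: "\<bar>u - c\<bar> < \<rho>" using that xy \<delta> by (auto simp: abs_less_iff)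
      show ?thesis unfolding \<Phi>_def[abs_def] by (intro DERIV_cmult DERIV_diff d\<kappa>[OF u] dg[OF u])
    qed
    obtain u where u: "x < u" "u < y" "\<Phi> \<epsilon> y - \<Phi> \<epsilon> x = (y - x) * (s * (\<kappa>1 u - \<epsilon> * g1 u))"
      using MVT2[OF \<open>x < y\<close> D] by blast
    have uc: "\<bar>u - c\<bar> < \<delta>1" using u xy \<delta> by (auto simp: abs_less_iff)
    have "\<bar>s * (\<epsilon> * g1 u)\<bar> \<le> 1 * (e1 * M)"
      unfolding abs_mult s(3) using \<delta>1(2)[OF uc] \<epsilon> e1 by (intro mult_mono) auto
    also have "\<dots> = m / 2" using M by (simp add: e1_def)
    finally have "s * (\<kappa>1 u - \<epsilon> * g1 u) \<ge> m / 2"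
      using \<delta>1(2)[OF uc] unfolding right_diff_distrib by linarith
    hence "(y - x) * (s * (\<kappa>1 u - \<epsilon> * g1 u)) \<ge> (y - x) * (m / 2)" using xy by (intro mult_left_mono) auto
    thus ?thesis using u(3) by (simp add: mult.commute)
  qed simp
  have gc: "continuous_on {c-\<delta>..c+\<delta>} g"
    by (intro continuous_at_imp_continuous_on ballI DERIV_isCont[OF dg]) (use \<delta> in \<open>auto simp: abs_less_iff\<close>)
  have \<kappa>cont: "continuous_on {c-\<delta>..c+\<delta>} \<kappa>"
    by (intro continuous_at_imp_continuous_on ballI DERIV_isCont[OF d\<kappa>]) (use \<delta> in \<open>auto simp: abs_less_iff\<close>)
  have "compact (g ` {c-\<delta>..c+\<delta>})" by (rule compact_continuous_image[OF gc]) simp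
  then obtain B where B: "B > 0" "\<And>x. x \<in> {c-\<delta>..c+\<delta>} \<Longrightarrow> \<bar>g x\<bar> \<le> B"
    using compact_imp_bounded bounded_pos by (metis image_eqI real_norm_def)
  \<comment> \<open>The second bound keeps |\<epsilon> g| at most m \<delta> / 4, less than the
    change m \<delta> / 2 guaranteed by the slope between c and c + \<delta> or c - \<delta>, so the
    sign change survives. The first bound \<open>e1\<close> preserves the slope.\<close>
  define e where "e = min e1 (m * \<delta> / (4 * B))"
  have e: "e > 0" "e \<le> e1" "e \<le> m * \<delta> / (4 * B)" using e1 m \<delta> B by (auto simp: e_def)
  have eB: "\<bar>\<epsilon> * g x\<bar> < m / 2 * \<delta>" if "\<bar>\<epsilon>\<bar> < e" "x \<in> {c-\<delta>..c+\<delta>}" for \<epsilon> x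
  proof -
    have "\<bar>\<epsilon> * g x\<bar> \<le> e * B" unfolding abs_mult using that B e by (intro mult_mono) auto
    also have "\<dots> \<le> (m * \<delta> / (4 * B)) * B" using e B by (intro mult_right_mono) auto
    also have "\<dots> = m * \<delta> / 4" using B by simp
    also have "\<dots> < m / 2 * \<delta>" using m \<delta> by simp
    finally show ?thesis .
  qed
  have \<Phi>0: "\<Phi> \<epsilon> c = - (s * (\<epsilon> * g c))" for \<epsilon> by (simp add: \<Phi>_def \<kappa>c)
  have sabs: "\<bar>s * r\<bar> = \<bar>r\<bar>" for r using s by (simp add: abs_mult)
  have ex: "\<exists>x. \<bar>x - c\<bar> < \<delta> \<and> \<Phi> \<epsilon> x = 0" if \<epsilon>: "\<bar>\<epsilon>\<bar> < e" for \<epsilon>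
  proof -
    have g0: "\<bar>\<Phi> \<epsilon> c\<bar> < m / 2 * \<delta>" using eB[OF \<epsilon>, of c] \<delta> unfolding \<Phi>0 by (simp add: sabs)
    have r: "\<Phi> \<epsilon> (c + \<delta>) > 0" using inc[of c "c + \<delta>" \<epsilon>] \<delta> \<epsilon> e g0 by simp
    have l: "\<Phi> \<epsilon> (c - \<delta>) < 0" using inc[of "c - \<delta>" c \<epsilon>] \<delta> \<epsilon> e g0 by simp
    have "continuous_on {c-\<delta>..c+\<delta>} (\<Phi> \<epsilon>)" unfolding \<Phi>_def[abs_def]
      by (intro continuous_intros gc \<kappa>cont)
    with IVT'[of "\<Phi> \<epsilon>" "c - \<delta>" 0 "c + \<delta>"] l r \<delta> obtain x where
      x: "c - \<delta> \<le> x" "x \<le> c + \<delta>" "\<Phi> \<epsilon> x = 0" by auto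
    have "x \<noteq> c - \<delta>" "x \<noteq> c + \<delta>" using x l r by auto
    thus ?thesis using x by (intro exI[of _ x]) (auto simp: abs_less_iff)
  qed
  have low: "m / 2 * \<bar>y - x\<bar> \<le> \<bar>\<Phi> \<epsilon> y - \<Phi> \<epsilon> x\<bar>"
    if "\<bar>x - c\<bar> < \<delta>" "\<bar>y - c\<bar> < \<delta>" "\<bar>\<epsilon>\<bar> < e" for x y \<epsilon>
  proof (cases "x \<le> y")
    case True
    have "m / 2 * (y - x) \<le> \<Phi> \<epsilon> y - \<Phi> \<epsilon> x"
      by (rule inc) (use True that e in \<open>auto simp: abs_less_iff\<close>)
    also have "y - x = \<bar>y - x\<bar>" using True by simp
    finally show ?thesis using abs_ge_self[of "\<Phi> \<epsilon> y - \<Phi> \<epsilon> x"] by linarith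
  next
    case False
    have "m / 2 * (x - y) \<le> \<Phi> \<epsilon> x - \<Phi> \<epsilon> y"
      by (rule inc) (use False that e in \<open>auto simp: abs_less_iff\<close>)
    also have "x - y = \<bar>y - x\<bar>" using False by simp
    finally show ?thesis using abs_ge_minus_self[of "\<Phi> \<epsilon> y - \<Phi> \<epsilon> x"] by linarith
  qed
  have uniq: "x = y" if "\<bar>x - c\<bar> < \<delta>" "\<bar>y - c\<bar> < \<delta>" "\<bar>\<epsilon>\<bar> < e" "\<Phi> \<epsilon> x = 0" "\<Phi> \<epsilon> y = 0" for x y \<epsilon>
    using low[OF that(1-3)] that(4,5) m by (simp add: mult_le_0_iff)
  obtain z where z: "\<And>\<epsilon>. \<bar>\<epsilon>\<bar> < e \<Longrightarrow> \<bar>z \<epsilon> - c\<bar> < \<delta> \<and> \<Phi> \<epsilon> (z \<epsilon>) = 0" using ex by metis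
  have \<Phi>iff: "\<Phi> \<epsilon> x = 0 \<longleftrightarrow> \<kappa> x = \<epsilon> * g x" for \<epsilon> x using s by (simp add: \<Phi>_def)
  have "z 0 = c" by (rule uniq[of _ _ 0]) (use z[of 0] e \<delta> in \<open>auto simp: \<Phi>0\<close>)
  moreover have "continuous_on {-e<..<e} z"
  proof (rule continuous_onI)
    fix \<epsilon> \<eta> :: real assume \<epsilon>: "\<epsilon> \<in> {-e<..<e}" and \<eta>: "\<eta> > 0"
    have \<epsilon>': "\<bar>\<epsilon>\<bar> < e" using \<epsilon> by auto
    show "\<exists>d>0. \<forall>x'\<in>{-e<..<e}. dist x' \<epsilon> < d \<longrightarrow> dist (z x') (z \<epsilon>) \<le> \<eta>"
    proof (intro exI[of _ "\<eta> * m / (2 * B)"] conjI ballI impI)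
      show "\<eta> * m / (2 * B) > 0" using \<eta> m B by simp
      fix \<epsilon>2 assume e2: "\<epsilon>2 \<in> {-e<..<e}" "dist \<epsilon>2 \<epsilon> < \<eta> * m / (2 * B)"
      have e2': "\<bar>\<epsilon>2\<bar> < e" using e2 by auto
      have "\<Phi> \<epsilon> (z \<epsilon>2) - \<Phi> \<epsilon>2 (z \<epsilon>2) = s * ((\<epsilon>2 - \<epsilon>) * g (z \<epsilon>2))" by (simp add: \<Phi>_def algebra_simps)
      hence "\<bar>\<Phi> \<epsilon> (z \<epsilon>2) - \<Phi> \<epsilon> (z \<epsilon>)\<bar> = \<bar>\<epsilon>2 - \<epsilon>\<bar> * \<bar>g (z \<epsilon>2)\<bar>"
        using z[OF \<epsilon>'] z[OF e2'] s(3) by (simp add: abs_mult)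
      also have "\<dots> \<le> (\<eta> * m / (2 * B)) * B"
        using e2 B(2)[of "z \<epsilon>2"] z[OF e2'] B \<eta> m by (intro mult_mono) (auto simp: dist_norm abs_less_iff)
      also have "\<dots> = m / 2 * \<eta>" using B by simp
      finally have "m / 2 * \<bar>z \<epsilon>2 - z \<epsilon>\<bar> \<le> m / 2 * \<eta>" using low[of "z \<epsilon>" "z \<epsilon>2" \<epsilon>] z[OF \<epsilon>'] z[OF e2'] \<epsilon>' by linarith
      thus "dist (z \<epsilon>2) (z \<epsilon>) \<le> \<eta>" using m by (simp add: dist_norm)
    qed
  qed
  moreover have "\<kappa> x = \<epsilon> * g x \<longleftrightarrow> x = z \<epsilon>" if "\<bar>\<epsilon>\<bar> < e" "\<bar>x - c\<bar> < \<delta>" for \<epsilon> x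
    using uniq[of x "z \<epsilon>" \<epsilon>] z[OF that(1)] that \<Phi>iff by blast
  ultimately show ?thesis using \<delta> e z by blast
qed

section \<open>Fixed points, linear parts and explicit first integrals of the two maps\<close>

lemma F_map_fixed_iff:
  fixes q :: "real^2"
  shows "F_map a g \<epsilon> q = q \<longleftrightarrow> q $ 1 = q $ 2 \<and> 2 * q $ 2 - a * q $ 2 / (1 + (q $ 2)\<^sup>2) = \<epsilon> * g (q $ 2)"
  by (auto simp: F_map_def Let_def vec_eq_iff forall_2 vector_2)

lemma G_map_fixed_iff:
  fixes q :: "real^2"
  assumes "q $ 1 \<noteq> 0"
  shows "G_map a g \<epsilon> q = q \<longleftrightarrow> q $ 1 = q $ 2 \<and> (q $ 2)\<^sup>2 - (a + q $ 2) = \<epsilon> * g (q $ 2)"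
  using assms by (auto simp: G_map_def Let_def vec_eq_iff forall_2 vector_2 field_simps power2_eq_square)

lemma vec2_diagonal:
  fixes q :: "real^2"
  shows "q = vector [z, z] \<longleftrightarrow> q $ 1 = q $ 2 \<and> q $ 2 = z"
  by (auto simp: vec_eq_iff forall_2 vector_2)

lemma F_map_has_derivative:
  assumes "((\<lambda>y. a * y / (1 + y\<^sup>2) + \<epsilon> * g y) has_real_derivative t) (at c)"
  shows "(F_map a g \<epsilon> has_derivative (\<lambda>d. vector [d $ 2, - d $ 1 + t * d $ 2])) (at (vector [c, c]))"
proof -
  let ?p = "vector [c, c] :: real^2"
  have v: "((\<lambda>x::real^2. x $ i) has_derivative (\<lambda>d. d $ i)) (at ?p)" for i
    by (rule bounded_linear_imp_has_derivative[OF bounded_linear_vec_nth])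
  have "((\<lambda>y. a * y / (1 + y\<^sup>2) + \<epsilon> * g y) has_derivative (*) t) (at (?p $ 2))"
    using assms unfolding has_field_derivative_def by (simp add: vector_2)
  from has_derivative_compose[OF v this]
  have "((\<lambda>x. a * x $ 2 / (1 + (x $ 2)\<^sup>2) + \<epsilon> * g (x $ 2)) has_derivative (\<lambda>d. t * d $ 2)) (at ?p)" .
  note has_derivative_vector2[OF v[of 2] has_derivative_add[OF has_derivative_minus[OF v[of 1]] this]]
  moreover have "F_map a g \<epsilon> = (\<lambda>x. vector [x $ 2, - x $ 1 + (a * x $ 2 / (1 + (x $ 2)\<^sup>2) + \<epsilon> * g (x $ 2))])"
    by (simp add: fun_eq_iff F_map_def Let_def algebra_simps)
  ultimately show ?thesis by (simp only:)
qed

lemma G_map_has_derivative: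
  assumes "((\<lambda>y. a + y + \<epsilon> * g y) has_real_derivative f1) (at c)" and c: "c \<noteq> 0"
    and fc: "a + c + \<epsilon> * g c = c\<^sup>2"
  shows "(G_map a g \<epsilon> has_derivative (\<lambda>d. vector [d $ 2, - d $ 1 + f1 / c * d $ 2])) (at (vector [c, c]))"
proof -
  let ?p = "vector [c, c] :: real^2"
  have v: "((\<lambda>x::real^2. x $ i) has_derivative (\<lambda>d. d $ i)) (at ?p)" for i
    by (rule bounded_linear_imp_has_derivative[OF bounded_linear_vec_nth])
  have "((\<lambda>y. a + y + \<epsilon> * g y) has_derivative (*) f1) (at (?p $ 2))"
    using assms(1) unfolding has_field_derivative_def by (simp add: vector_2)
  from has_derivative_compose[OF v this]
  have "((\<lambda>x. a + x $ 2 + \<epsilon> * g (x $ 2)) has_derivative (\<lambda>d. f1 * d $ 2)) (at ?p)" .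
  from has_derivative_divide'[OF this v[of 1]] c
  have "((\<lambda>x. (a + x $ 2 + \<epsilon> * g (x $ 2)) / x $ 1) has_derivative
     (\<lambda>d. (f1 * d $ 2 * c - (a + c + \<epsilon> * g c) * d $ 1) / (c * c))) (at ?p)" by (simp add: vector_2)
  moreover have "(f1 * d $ 2 * c - (a + c + \<epsilon> * g c) * d $ 1) / (c * c) = - d $ 1 + f1 / c * d $ 2" for d :: "real^2"
    unfolding fc using c by (simp add: field_simps power2_eq_square)
  ultimately have "((\<lambda>x. (a + x $ 2 + \<epsilon> * g (x $ 2)) / x $ 1) has_derivative (\<lambda>d. - d $ 1 + f1 / c * d $ 2)) (at ?p)"
    by simp
  from has_derivative_vector2[OF v[of 2] this]
  show ?thesis by (simp add: G_map_def[abs_def] Let_def)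
qed

lemma open_F_dom: "open (F_dom Q)"
proof -
  have "F_dom Q = {p. poly Q (p $ 2) \<noteq> 0}" by (simp add: F_dom_def)
  thus ?thesis by (simp add: open_Collect_neq continuous_intros)
qed

lemma open_G_dom: "open (G_dom Q)"
proof -
  have "G_dom Q = {p. p $ 1 \<noteq> 0} \<inter> {p. poly Q (p $ 2) \<noteq> 0}" by (auto simp: G_dom_def)
  thus ?thesis by (simp add: open_Int open_Collect_neq continuous_intros)
qed

lemma has_derivative_vec_nth: "((\<lambda>x::real^2. x $ i) has_derivative (\<lambda>d. d $ i)) (at p)"
  by (rule bounded_linear_imp_has_derivative[OF bounded_linear_vec_nth])

text \<open>V = x^2 y^2 + x^2 + y^2 - a x y is the biquadratic invariant of the McMillan map: if (u,
  v) goes to (v, w), then V(v, w) - V(u, v) = (w - u) ((1 + v^2) (w + u) - a v), and the last factor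
  is zero. Hypothesis \<open>fx\<close> makes the point critical and \<open>ab\<close> makes the
  Hessian definite.\<close>

lemma F_map_0_integrable:
  assumes c: "poly Q c \<noteq> 0" and ab: "\<bar>4 * c\<^sup>2 - a\<bar> < 2 * c\<^sup>2 + 2" and fx: "2 * c * (1 + c\<^sup>2) = a * c"
  shows "locally_integrable_at 6 (F_dom Q) (F_map a g 0) (vector [c, c])"
proof -
  let ?p = "vector [c, c] :: real^2"
  define V :: "real^2 \<Rightarrow> real" where "V x = (x $ 1 * x $ 1) * (x $ 2 * x $ 2) + x $ 1 * x $ 1 + x $ 2 * x $ 2 + (- a) * (x $ 1 * x $ 2)" for x
  define Vx :: "real^2 \<Rightarrow> real" where "Vx x = 2 * (x $ 1 * (x $ 2 * x $ 2)) + 2 * x $ 1 - a * x $ 2" for x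
  define Vy :: "real^2 \<Rightarrow> real" where "Vy x = 2 * (x $ 2 * (x $ 1 * x $ 1)) + 2 * x $ 2 - a * x $ 1" for x
  note D = has_derivative_vec_nth
  show ?thesis
  proof (rule locally_integrable_of_definite_hessian[where ?U0.0 = "F_dom Q" and V = V and Vx = Vx and Vy = Vy and A = "2 * c\<^sup>2 + 2" and B = "4 * c\<^sup>2 - a"])
    show "open (F_dom Q)" by (rule open_F_dom)
    show "?p \<in> F_dom Q" using c by (simp add: F_dom_def vector_2)
    show "V \<in> regular_fun (F_dom Q)" unfolding V_def[abs_def] by (intro regular_fun.intros)
    show "V (F_map a g 0 x) = V x" for x
    proof -
      define u v where "u = x $ 1" and "v = x $ 2"
      have nz: "1 + v\<^sup>2 \<noteq> 0" using zero_le_power2[of v] by linarith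
      define w where "w = - u + a * v / (1 + v\<^sup>2)"
      have w: "(1 + v\<^sup>2) * (w + u) = a * v" using nz by (simp add: w_def)
      have "F_map a g 0 x = vector [v, w]" by (simp add: F_map_def Let_def u_def v_def w_def)
      hence "V (F_map a g 0 x) - V x = (v * v) * (w * w) + v * v + w * w - a * (v * w) - ((u * u) * (v * v) + u * u + v * v - a * (u * v))"
        by (simp add: V_def vector_2 u_def v_def)
      also have "\<dots> = (w - u) * ((1 + v\<^sup>2) * (w + u) - a * v)" by (simp add: algebra_simps power2_eq_square)
      finally show ?thesis using w by simp
    qed
    show "(V has_derivative (\<lambda>d. Vx x * d $ 1 + Vy x * d $ 2)) (at x)" for x
      unfolding V_def[abs_def] Vx_def Vy_def
      by (rule has_derivative_eq_rhs, (rule has_derivative_add has_derivative_mult has_derivative_const D)+)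
        (simp add: fun_eq_iff algebra_simps)
    show "Vx ?p = 0" "Vy ?p = 0" using fx by (simp_all add: Vx_def Vy_def vector_2 algebra_simps power2_eq_square)
    show "(Vx has_derivative (\<lambda>d. (2 * c\<^sup>2 + 2) * d $ 1 + (4 * c\<^sup>2 - a) * d $ 2)) (at ?p)"
      unfolding Vx_def[abs_def]
      by (rule has_derivative_eq_rhs, (rule has_derivative_add has_derivative_diff has_derivative_mult has_derivative_const D)+)
        (simp add: fun_eq_iff algebra_simps vector_2 power2_eq_square)
    show "(Vy has_derivative (\<lambda>d. (4 * c\<^sup>2 - a) * d $ 1 + (2 * c\<^sup>2 + 2) * d $ 2)) (at ?p)"
      unfolding Vy_def[abs_def]
      by (rule has_derivative_eq_rhs, (rule has_derivative_add has_derivative_diff has_derivative_mult has_derivative_const D)+)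
        (simp add: fun_eq_iff algebra_simps vector_2 power2_eq_square)
  qed (use ab in auto)
qed

text \<open>The Lyness invariant (x + 1) (y + 1) (x + y + a) / (x y), divided by c + 1. The division
  makes the diagonal Hessian entry 2 / c^2, positive whatever the sign of c + 1; the other entry is
  -1 / c^3, and definiteness amounts to |1 / c| < 2.\<close>

lemma G_map_0_integrable:
  assumes Q: "poly Q c \<noteq> 0" and c: "c \<noteq> 0" "c \<noteq> -1" and fx: "c\<^sup>2 = a + c" and t: "\<bar>1 / c\<bar> < 2"
  shows "locally_integrable_at 6 (G_dom Q) (G_map a g 0) (vector [c, c])"
proof -
  let ?p = "vector [c, c] :: real^2"
  \<comment> \<open>The invariant has a pole also on the line y = 0, which the domain of the map
    need not exclude.\<close>
  define U where "U = G_dom Q \<inter> {x. x $ 2 \<noteq> 0}"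
  have U: "open U" "?p \<in> U" "U \<subseteq> G_dom Q" "\<And>x. x \<in> U \<Longrightarrow> x $ 1 \<noteq> 0 \<and> x $ 2 \<noteq> 0"
    using Q c by (auto simp: U_def G_dom_def vector_2 intro!: open_Int open_G_dom[unfolded G_dom_def] open_Collect_neq continuous_intros)
  define i :: "real \<Rightarrow> real" where "i = inverse"
  define V :: "real^2 \<Rightarrow> real" where "V x = i (c + 1) * ((x $ 1 + 1) * i (x $ 1) * ((x $ 2 + 1) * i (x $ 2)) * (x $ 1 + x $ 2 + a))" for x
  define Vx :: "real^2 \<Rightarrow> real" where "Vx x = i (c + 1) * ((1 + (- 1) * ((x $ 2 + a) * (i (x $ 1) * i (x $ 1)))) * ((x $ 2 + 1) * i (x $ 2)))" for x
  define Vy :: "real^2 \<Rightarrow> real" where "Vy x = i (c + 1) * ((1 + (- 1) * ((x $ 1 + a) * (i (x $ 2) * i (x $ 2)))) * ((x $ 1 + 1) * i (x $ 1)))" for x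
  note D = has_derivative_vec_nth
  have Di: "((\<lambda>x::real^2. i (x $ j)) has_derivative (\<lambda>d. - (i (x $ j) * d $ j * i (x $ j)))) (at x)"
    if "x $ j \<noteq> 0" for x :: "real^2" and j
    using Deriv.has_derivative_inverse[OF that D[of j x]] by (simp add: i_def)
  have c1: "c + 1 \<noteq> 0" using c by linarith
  have aeq: "a = c * c - c" using fx by (simp add: power2_eq_square)
  show ?thesis
  proof (rule locally_integrable_of_definite_hessian[where ?U0.0 = U and V = V and Vx = Vx and Vy = Vy and A = "2 / c\<^sup>2" and B = "- 1 / c ^ 3"])
    have inv: "(\<lambda>x. i (x $ j)) \<in> regular_fun U" for j :: 2
      unfolding i_def using U(4) exhaust_2[of j] by (intro regular_fun.intros) auto
    show "V \<in> regular_fun U" unfolding V_def[abs_def] by (intro regular_fun.intros inv)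
    show "V (G_map a g 0 x) = V x" if x: "x \<in> U" "G_map a g 0 x \<in> U" for x
    proof -
      define u v where "u = x $ 1" and "v = x $ 2"
      define w where "w = (a + v) / u"
      have G: "G_map a g 0 x = vector [v, w]" by (simp add: G_map_def Let_def u_def v_def w_def)
      have nz: "u \<noteq> 0" "v \<noteq> 0" "w \<noteq> 0" using U(4)[OF x(1)] U(4)[OF x(2)] by (auto simp: G vector_2 u_def v_def)
      have w: "w * u = a + v" using nz by (simp add: w_def)
      have key: "(w + 1) * (v + w + a) * u = (u + 1) * (u + v + a) * w"
      proof -
        have "(w + 1) * (v + w + a) * u = (w + 1) * (w * u + w) * u" using w by (simp add: algebra_simps)
        also have "\<dots> = (u + 1) * (u + w * u) * w" by (simp add: algebra_simps)
        also have "\<dots> = (u + 1) * (u + v + a) * w" using w by (simp add: algebra_simps)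
        finally show ?thesis .
      qed
      have "(w + 1) * i w * (v + w + a) = (u + 1) * i u * (u + v + a)"
        using key nz by (simp add: i_def field_simps)
      hence "i (c + 1) * ((v + 1) * i v * ((w + 1) * i w * (v + w + a))) = i (c + 1) * ((v + 1) * i v * ((u + 1) * i u * (u + v + a)))"
        by simp
      thus ?thesis by (simp add: V_def G vector_2 u_def v_def mult_ac)
    qed
    show "(V has_derivative (\<lambda>d. Vx x * d $ 1 + Vy x * d $ 2)) (at x)" if x: "x \<in> U" for x
    proof -
      have nz: "x $ 1 \<noteq> 0" "x $ 2 \<noteq> 0" using U(4)[OF x] by auto
      define u v where "u = x $ 1" and "v = x $ 2"
      have e1: "u * i u = 1" "v * i v = 1" using nz by (simp_all add: i_def u_def v_def)
      show ?thesis
        unfolding V_def[abs_def] Vx_def Vy_def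
        by (rule has_derivative_eq_rhs, (rule has_derivative_add has_derivative_mult has_derivative_const D Di[OF nz(1)] Di[OF nz(2)])+)
          (rule ext, unfold u_def[symmetric] v_def[symmetric], use e1 in algebra)
    qed
    have ic: "i c * c = 1" "i (c + 1) * (c + 1) = 1" using c c1 by (simp_all add: i_def)
    show "Vx ?p = 0" "Vy ?p = 0" using ic(1) unfolding Vx_def Vy_def aeq by (simp_all add: vector_2) (algebra, algebra)
    have nz: "?p $ 1 \<noteq> 0" "?p $ 2 \<noteq> 0" using c by (simp_all add: vector_2)
    have i2: "2 / c\<^sup>2 = 2 * (i c * i c)" "- 1 / c ^ 3 = - (i c * i c * i c)"
      by (simp_all add: i_def divide_inverse power_inverse power2_eq_square power3_eq_cube)
    have p12: "?p $ 1 = c" "?p $ 2 = c" by (simp_all add: vector_2)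
    show "(Vx has_derivative (\<lambda>d. 2 / c\<^sup>2 * d $ 1 + - 1 / c ^ 3 * d $ 2)) (at ?p)"
      unfolding Vx_def[abs_def] i2
      by (rule has_derivative_eq_rhs, (rule has_derivative_add has_derivative_mult has_derivative_const D Di[OF nz(1)] Di[OF nz(2)])+)
        (rule ext, unfold p12 aeq, use ic in algebra)
    show "(Vy has_derivative (\<lambda>d. - 1 / c ^ 3 * d $ 1 + 2 / c\<^sup>2 * d $ 2)) (at ?p)"
      unfolding Vy_def[abs_def] i2
      by (rule has_derivative_eq_rhs, (rule has_derivative_add has_derivative_mult has_derivative_const D Di[OF nz(1)] Di[OF nz(2)])+)
        (rule ext, unfold p12 aeq, use ic in algebra)
    have "\<bar>- 1 / c ^ 3\<bar> = \<bar>1 / c\<bar> * (1 / c\<^sup>2)" by (simp add: power3_eq_cube power2_eq_square abs_mult)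
    also have "\<dots> < 2 * (1 / c\<^sup>2)" using t c by (intro mult_strict_right_mono) auto
    finally show "\<bar>- 1 / c ^ 3\<bar> < 2 / c\<^sup>2" by simp
  qed (use U in auto)
qed

subsection \<open>Rational functions at infinity\<close>

lemma poly_over_power_tendsto:
  fixes r :: "real poly"
  assumes "degree r \<le> n"
  shows "((\<lambda>y. poly r y / y ^ n) \<longlongrightarrow> coeff r n) at_top"
proof -
  have pw: "((\<lambda>y::real. y ^ i / y ^ n) \<longlongrightarrow> (if i = n then 1 else 0)) at_top" if "i \<le> n" for i
  proof (cases "i = n")
    case True
    have "((\<lambda>_::real. 1::real) \<longlongrightarrow> 1) at_top" by simp
    moreover have "\<forall>\<^sub>F y::real in at_top. 1 = y ^ i / y ^ n"
      using eventually_gt_at_top[of 0] by eventually_elim (simp add: True)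
    ultimately have "((\<lambda>y::real. y ^ i / y ^ n) \<longlongrightarrow> 1) at_top" by (rule Lim_transform_eventually)
    thus ?thesis using True by simp
  next
    case False
    hence "i < n" using that by simp
    have "((\<lambda>y::real. inverse (y ^ (n - i))) \<longlongrightarrow> 0) at_top"
      by (intro tendsto_inverse_0_at_top filterlim_pow_at_top filterlim_ident) (use \<open>i < n\<close> in auto)
    moreover have "\<forall>\<^sub>F y::real in at_top. inverse (y ^ (n - i)) = y ^ i / y ^ n"
      using eventually_gt_at_top[of 0]
    proof eventually_elim
      case (elim y)
      have "y ^ n = y ^ i * y ^ (n - i)" using \<open>i < n\<close> by (simp flip: power_add)
      thus ?case using elim by (simp add: field_simps)
    qed
    ultimately have "((\<lambda>y::real. y ^ i / y ^ n) \<longlongrightarrow> 0) at_top" by (rule Lim_transform_eventually)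
    thus ?thesis using False by simp
  qed
  have "((\<lambda>y. \<Sum>i\<le>degree r. coeff r i * (y ^ i / y ^ n)) \<longlongrightarrow> (\<Sum>i\<le>degree r. coeff r i * (if i = n then 1 else 0))) at_top"
    by (intro tendsto_sum tendsto_mult_left pw) (use assms in auto)
  moreover have "(\<Sum>i\<le>degree r. coeff r i * (if i = n then 1 else 0)) = coeff r n"
    using assms by (cases "degree r = n") (auto simp: if_distrib coeff_eq_0 cong: if_cong)
  moreover have "(\<lambda>y. \<Sum>i\<le>degree r. coeff r i * (y ^ i / y ^ n)) = (\<lambda>y. poly r y / y ^ n)"
    by (simp add: poly_altdef sum_divide_distrib)
  ultimately show ?thesis by simp
qed

lemma poly_eventually_nonzero_at_top:
  fixes p :: "real poly"
  assumes "p \<noteq> 0"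
  shows "\<forall>\<^sub>F y in at_top. poly p y \<noteq> 0"
proof -
  have "finite {y. poly p y = 0}" by (rule poly_roots_finite[OF assms])
  hence "bdd_above {y. poly p y = 0}" by simp
  then obtain M where M: "\<And>y. poly p y = 0 \<Longrightarrow> y \<le> M" unfolding bdd_above_def by blast
  show ?thesis using eventually_gt_at_top[of M] by eventually_elim (use M in force)
qed

lemma euler_pderiv_tendsto:
  fixes p r :: "real poly"
  assumes p: "p \<noteq> 0" and r: "degree r \<le> degree p" "coeff r (degree p) = m * lead_coeff p"
  shows "((\<lambda>y. poly r y / poly p y) \<longlongrightarrow> m) at_top"
proof -
  have "((\<lambda>y. (poly r y / y ^ degree p) / (poly p y / y ^ degree p)) \<longlongrightarrow> (m * lead_coeff p) / lead_coeff p) at_top"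
    using p by (intro tendsto_divide poly_over_power_tendsto[OF r(1), unfolded r(2)] poly_over_power_tendsto) auto
  hence "((\<lambda>y. (poly r y / y ^ degree p) / (poly p y / y ^ degree p)) \<longlongrightarrow> m) at_top" using p by simp
  moreover have "\<forall>\<^sub>F y in at_top. (poly r y / y ^ degree p) / (poly p y / y ^ degree p) = poly r y / poly p y"
    using eventually_gt_at_top[of 0] by eventually_elim simp
  ultimately show ?thesis by (rule Lim_transform_eventually)
qed

text \<open>At infinity p may be replaced by its leading monomial: multiplying the j-th derivative
  by y^j restores the degree d and multiplies the leading coefficient by the falling factorial of
  d.\<close>

lemma poly_log_derivatives_tendsto:
  fixes p :: "real poly"
  assumes p: "p \<noteq> 0"
  defines "d \<equiv> real (degree p)"
  shows "((\<lambda>y. y * poly (pderiv p) y / poly p y) \<longlongrightarrow> d) at_top"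
    "((\<lambda>y. y\<^sup>2 * poly (pderiv (pderiv p)) y / poly p y) \<longlongrightarrow> d * (d - 1)) at_top"
    "((\<lambda>y. y ^ 3 * poly (pderiv (pderiv (pderiv p))) y / poly p y) \<longlongrightarrow> d * (d - 1) * (d - 2)) at_top"
proof -
  have c: "coeff (pderiv r) n = real (Suc n) * coeff r (Suc n)" for r :: "real poly" and n
    by (simp add: coeff_pderiv)
  have m: "coeff (monom 1 k * r) n = (if n < k then 0 else coeff r (n - k))" for k n and r :: "real poly"
    by (simp add: coeff_monom_mult)
  have dg: "degree (monom 1 k * r) \<le> degree p" if "\<And>n. n > degree p \<Longrightarrow> coeff (monom 1 k * r) n = 0" for k and r :: "real poly"
    using that by (intro degree_le) auto
  have z: "coeff p n = 0" if "n > degree p" for n using that by (rule coeff_eq_0)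
  have 1: "((\<lambda>y. poly (monom 1 1 * pderiv p) y / poly p y) \<longlongrightarrow> d) at_top"
  proof (rule euler_pderiv_tendsto[OF p dg])
    show "coeff (monom 1 1 * pderiv p) n = 0" if "n > degree p" for n using that z by (auto simp: m c)
    show "coeff (monom 1 1 * pderiv p) (degree p) = d * lead_coeff p" by (cases "degree p") (auto simp: m c d_def)
  qed
  have 2: "((\<lambda>y. poly (monom 1 2 * pderiv (pderiv p)) y / poly p y) \<longlongrightarrow> d * (d - 1)) at_top"
  proof (rule euler_pderiv_tendsto[OF p dg])
    show "coeff (monom 1 2 * pderiv (pderiv p)) n = 0" if "n > degree p" for n using that z[of "Suc (Suc (n - 2))"] by (auto simp: m c)
    show "coeff (monom 1 2 * pderiv (pderiv p)) (degree p) = d * (d - 1) * lead_coeff p"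
    proof -
      consider "degree p = 0" | "degree p = 1" | k where "degree p = Suc (Suc k)"
        by (metis One_nat_def not0_implies_Suc)
      thus ?thesis unfolding m c by cases (auto simp: d_def algebra_simps)
    qed
  qed
  have 3: "((\<lambda>y. poly (monom 1 3 * pderiv (pderiv (pderiv p))) y / poly p y) \<longlongrightarrow> d * (d - 1) * (d - 2)) at_top"
  proof (rule euler_pderiv_tendsto[OF p dg])
    show "coeff (monom 1 3 * pderiv (pderiv (pderiv p))) n = 0" if "n > degree p" for n
      using that z[of "Suc (Suc (Suc (n - 3)))"] by (auto simp: m c)
    show "coeff (monom 1 3 * pderiv (pderiv (pderiv p))) (degree p) = d * (d - 1) * (d - 2) * lead_coeff p"
    proof -
      consider "degree p = 0" | "degree p = 1" | "degree p = 2" | k where "degree p = Suc (Suc (Suc k))"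
        by (metis One_nat_def Suc_1 not0_implies_Suc)
      thus ?thesis unfolding m c by cases (auto simp: d_def algebra_simps)
    qed
  qed
  show "((\<lambda>y. y * poly (pderiv p) y / poly p y) \<longlongrightarrow> d) at_top" using 1 by (simp add: poly_monom)
  show "((\<lambda>y. y\<^sup>2 * poly (pderiv (pderiv p)) y / poly p y) \<longlongrightarrow> d * (d - 1)) at_top" using 2 by (simp add: poly_monom)
  show "((\<lambda>y. y ^ 3 * poly (pderiv (pderiv (pderiv p))) y / poly p y) \<longlongrightarrow> d * (d - 1) * (d - 2)) at_top" using 3 by (simp add: poly_monom)
qed

text \<open>The numerators of the derivatives of $P/Q$ over $Q^2$, $Q^3$, $Q^4$.\<close>

definition rat1 :: "real poly \<Rightarrow> real poly \<Rightarrow> real poly" where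
  "rat1 P Q = pderiv P * Q - P * pderiv Q"

definition rat2 :: "real poly \<Rightarrow> real poly \<Rightarrow> real poly" where
  "rat2 P Q = pderiv (rat1 P Q) * Q - smult 2 (rat1 P Q * pderiv Q)"

definition rat3 :: "real poly \<Rightarrow> real poly \<Rightarrow> real poly" where
  "rat3 P Q = pderiv (rat2 P Q) * Q - smult 3 (rat2 P Q * pderiv Q)"

lemma rat_eval_power_derivative:
  assumes "poly Q y \<noteq> 0"
  shows "(rat_eval N (Q ^ Suc k) has_real_derivative
    rat_eval (pderiv N * Q - smult (real (Suc k)) (N * pderiv Q)) (Q ^ Suc (Suc k)) y) (at y)"
proof -
  have "((\<lambda>y. poly N y / poly Q y ^ Suc k) has_real_derivative
     (poly (pderiv N) y * poly Q y ^ Suc k - poly N y * (real (Suc k) * poly (pderiv Q) y * poly Q y ^ k)) / (poly Q y ^ Suc k * poly Q y ^ Suc k)) (at y)"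
    using assms by (auto intro!: derivative_eq_intros poly_DERIV simp del: power_Suc)
  moreover have "(n' * v ^ Suc k - n * (r * v' * v ^ k)) / (v ^ Suc k * v ^ Suc k) = (n' * v - r * (n * v')) / v ^ Suc (Suc k)"
    if "v \<noteq> 0" for n n' v v' r :: real using that by (simp add: field_simps)
  ultimately show ?thesis using assms by (simp add: rat_eval_def[abs_def] del: power_Suc)
qed

lemma rat_eval_derivatives:
  assumes "poly Q y \<noteq> 0"
  shows "(rat_eval P Q has_real_derivative rat_eval (rat1 P Q) (Q\<^sup>2) y) (at y)"
    "(rat_eval (rat1 P Q) (Q\<^sup>2) has_real_derivative rat_eval (rat2 P Q) (Q ^ 3) y) (at y)"
    "(rat_eval (rat2 P Q) (Q ^ 3) has_real_derivative rat_eval (rat3 P Q) (Q ^ 4) y) (at y)"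
  using rat_eval_power_derivative[OF assms, of P 0] rat_eval_power_derivative[OF assms, of "rat1 P Q" 1]
    rat_eval_power_derivative[OF assms, of "rat2 P Q" 2]
  by (simp_all add: rat1_def rat2_def rat3_def eval_nat_numeral del: power_Suc)

lemma poly_rat:
  "poly (rat1 P Q) y = poly (pderiv P) y * poly Q y - poly P y * poly (pderiv Q) y"
  "poly (rat2 P Q) y = poly (pderiv (pderiv P)) y * (poly Q y)\<^sup>2 - 2 * poly (pderiv P) y * poly (pderiv Q) y * poly Q y
     - poly P y * poly (pderiv (pderiv Q)) y * poly Q y + 2 * poly P y * (poly (pderiv Q) y)\<^sup>2"
  "poly (rat3 P Q) y = poly (pderiv (pderiv (pderiv P))) y * (poly Q y) ^ 3 - 3 * poly (pderiv (pderiv P)) y * poly (pderiv Q) y * (poly Q y)\<^sup>2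
     - 3 * poly (pderiv P) y * poly (pderiv (pderiv Q)) y * (poly Q y)\<^sup>2 + 6 * poly (pderiv P) y * (poly (pderiv Q) y)\<^sup>2 * poly Q y
     - poly P y * poly (pderiv (pderiv (pderiv Q))) y * (poly Q y)\<^sup>2 + 6 * poly P y * poly (pderiv Q) y * poly (pderiv (pderiv Q)) y * poly Q y
     - 6 * poly P y * (poly (pderiv Q) y) ^ 3"
  by (simp_all add: rat1_def rat2_def rat3_def pderiv_mult pderiv_diff pderiv_smult)
    (simp_all add: algebra_simps power2_eq_square power3_eq_cube)

lemma isCont_rat_eval:
  assumes "poly Q y \<noteq> 0"
  shows "isCont (rat_eval P Q) y"
  unfolding rat_eval_def[abs_def] using assms by (intro continuous_intros)

text \<open>After division by g, the derivatives of P/Q are polynomials in the quotients already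
  treated for P and for Q. In these limits g behaves like y^n, also for negative n; the case n = -1
  is applied to a y / (1 + y^2).\<close>

lemma rat_eval_log_derivatives_tendsto:
  fixes P Q :: "real poly"
  assumes P: "P \<noteq> 0" and Q: "Q \<noteq> 0"
  defines "n \<equiv> real (degree P) - real (degree Q)" and "g \<equiv> rat_eval P Q"
  shows "((\<lambda>y. y * rat_eval (rat1 P Q) (Q\<^sup>2) y / g y) \<longlongrightarrow> n) at_top"
    "((\<lambda>y. y\<^sup>2 * rat_eval (rat2 P Q) (Q ^ 3) y / g y) \<longlongrightarrow> n * (n - 1)) at_top"
    "((\<lambda>y. y ^ 3 * rat_eval (rat3 P Q) (Q ^ 4) y / g y) \<longlongrightarrow> n * (n - 1) * (n - 2)) at_top"
proof -
  define p q where "p = real (degree P)" and "q = real (degree Q)"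
  define p1 q1 where "p1 y = y * poly (pderiv P) y / poly P y" and "q1 y = y * poly (pderiv Q) y / poly Q y" for y
  define p2 q2 where "p2 y = y\<^sup>2 * poly (pderiv (pderiv P)) y / poly P y" and "q2 y = y\<^sup>2 * poly (pderiv (pderiv Q)) y / poly Q y" for y
  define p3 q3 where "p3 y = y ^ 3 * poly (pderiv (pderiv (pderiv P))) y / poly P y" and "q3 y = y ^ 3 * poly (pderiv (pderiv (pderiv Q))) y / poly Q y" for y
  note LP = poly_log_derivatives_tendsto[OF P, folded p1_def p2_def p3_def p_def]
  note LQ = poly_log_derivatives_tendsto[OF Q, folded q1_def q2_def q3_def q_def]
  have ev: "\<forall>\<^sub>F y in at_top. poly P y \<noteq> 0 \<and> poly Q y \<noteq> 0"
    by (intro eventually_conj poly_eventually_nonzero_at_top P Q)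
  have key: "y * rat_eval (rat1 P Q) (Q\<^sup>2) y / g y = p1 y - q1 y"
    "y\<^sup>2 * rat_eval (rat2 P Q) (Q ^ 3) y / g y = p2 y - 2 * p1 y * q1 y - q2 y + 2 * (q1 y * q1 y)"
    "y ^ 3 * rat_eval (rat3 P Q) (Q ^ 4) y / g y =
      p3 y - 3 * p2 y * q1 y - 3 * p1 y * q2 y + 6 * p1 y * (q1 y * q1 y) - q3 y + 6 * q1 y * q2 y - 6 * (q1 y * q1 y * q1 y)"
    if nz: "poly P y \<noteq> 0 \<and> poly Q y \<noteq> 0" for y
  proof -
    define u v where "u = poly P y" and "v = poly Q y"
    have uv: "u \<noteq> 0" "v \<noteq> 0" using nz by (auto simp: u_def v_def)
    define a1 a2 a3 where "a1 = poly (pderiv P) y / u" and "a2 = poly (pderiv (pderiv P)) y / u"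
      and "a3 = poly (pderiv (pderiv (pderiv P))) y / u"
    define b1 b2 b3 where "b1 = poly (pderiv Q) y / v" and "b2 = poly (pderiv (pderiv Q)) y / v"
      and "b3 = poly (pderiv (pderiv (pderiv Q))) y / v"
    have ab: "poly (pderiv P) y = u * a1" "poly (pderiv (pderiv P)) y = u * a2" "poly (pderiv (pderiv (pderiv P))) y = u * a3"
      "poly (pderiv Q) y = v * b1" "poly (pderiv (pderiv Q)) y = v * b2" "poly (pderiv (pderiv (pderiv Q))) y = v * b3"
      using uv by (simp_all add: a1_def a2_def a3_def b1_def b2_def b3_def)
    have pq: "p1 y = y * a1" "p2 y = y\<^sup>2 * a2" "p3 y = y ^ 3 * a3" "q1 y = y * b1" "q2 y = y\<^sup>2 * b2" "q3 y = y ^ 3 * b3"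
      by (simp_all add: p1_def p2_def p3_def q1_def q2_def q3_def a1_def a2_def a3_def b1_def b2_def b3_def u_def v_def)
    have R: "poly (rat1 P Q) y = u * v * (a1 - b1)"
      "poly (rat2 P Q) y = u * v\<^sup>2 * (a2 - 2 * a1 * b1 - b2 + 2 * (b1 * b1))"
      "poly (rat3 P Q) y = u * v ^ 3 * (a3 - 3 * a2 * b1 - 3 * a1 * b2 + 6 * a1 * (b1 * b1) - b3 + 6 * b1 * b2 - 6 * (b1 * b1 * b1))"
      unfolding poly_rat u_def[symmetric] v_def[symmetric] ab
      by (simp_all add: algebra_simps power2_eq_square power3_eq_cube)
    have c: "u * v * K / v\<^sup>2 / (u / v) = K" "u * v\<^sup>2 * K / v ^ 3 / (u / v) = K" "u * v ^ 3 * K / v ^ 4 / (u / v) = K" for K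
      using uv by (simp_all add: power2_eq_square power3_eq_cube power4_eq_xxxx)
    have E: "rat_eval (rat1 P Q) (Q\<^sup>2) y / g y = a1 - b1"
      "rat_eval (rat2 P Q) (Q ^ 3) y / g y = a2 - 2 * a1 * b1 - b2 + 2 * (b1 * b1)"
      "rat_eval (rat3 P Q) (Q ^ 4) y / g y = a3 - 3 * a2 * b1 - 3 * a1 * b2 + 6 * a1 * (b1 * b1) - b3 + 6 * b1 * b2 - 6 * (b1 * b1 * b1)"
      unfolding g_def rat_eval_def poly_power u_def[symmetric] v_def[symmetric] R by (rule c)+
    show "y * rat_eval (rat1 P Q) (Q\<^sup>2) y / g y = p1 y - q1 y"
      "y\<^sup>2 * rat_eval (rat2 P Q) (Q ^ 3) y / g y = p2 y - 2 * p1 y * q1 y - q2 y + 2 * (q1 y * q1 y)"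
      "y ^ 3 * rat_eval (rat3 P Q) (Q ^ 4) y / g y =
        p3 y - 3 * p2 y * q1 y - 3 * p1 y * q2 y + 6 * p1 y * (q1 y * q1 y) - q3 y + 6 * q1 y * q2 y - 6 * (q1 y * q1 y * q1 y)"
      unfolding times_divide_eq_right[symmetric] E pq by (simp_all add: algebra_simps power2_eq_square power3_eq_cube)
  qed
  have "((\<lambda>y. p1 y - q1 y) \<longlongrightarrow> p - q) at_top" by (intro tendsto_intros LP LQ)
  thus "((\<lambda>y. y * rat_eval (rat1 P Q) (Q\<^sup>2) y / g y) \<longlongrightarrow> n) at_top"
    unfolding n_def p_def q_def by (rule Lim_transform_eventually) (rule eventually_mono[OF ev], rule key(1)[symmetric])
  have "((\<lambda>y. p2 y - 2 * p1 y * q1 y - q2 y + 2 * (q1 y * q1 y)) \<longlongrightarrow>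
      p * (p - 1) - 2 * p * q - q * (q - 1) + 2 * (q * q)) at_top" by (intro tendsto_intros LP LQ)
  moreover have "p * (p - 1) - 2 * p * q - q * (q - 1) + 2 * (q * q) = n * (n - 1)"
    by (simp add: n_def p_def q_def algebra_simps)
  ultimately have "((\<lambda>y. p2 y - 2 * p1 y * q1 y - q2 y + 2 * (q1 y * q1 y)) \<longlongrightarrow> n * (n - 1)) at_top" by simp
  thus "((\<lambda>y. y\<^sup>2 * rat_eval (rat2 P Q) (Q ^ 3) y / g y) \<longlongrightarrow> n * (n - 1)) at_top"
    by (rule Lim_transform_eventually) (rule eventually_mono[OF ev], rule key(2)[symmetric])
  have "((\<lambda>y. p3 y - 3 * p2 y * q1 y - 3 * p1 y * q2 y + 6 * p1 y * (q1 y * q1 y) - q3 y + 6 * q1 y * q2 y - 6 * (q1 y * q1 y * q1 y)) \<longlongrightarrow>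
      p * (p - 1) * (p - 2) - 3 * (p * (p - 1)) * q - 3 * p * (q * (q - 1)) + 6 * p * (q * q) - q * (q - 1) * (q - 2) + 6 * q * (q * (q - 1)) - 6 * (q * q * q)) at_top"
    by (intro tendsto_intros LP LQ)
  moreover have "p * (p - 1) * (p - 2) - 3 * (p * (p - 1)) * q - 3 * p * (q * (q - 1)) + 6 * p * (q * q) - q * (q - 1) * (q - 2) + 6 * q * (q * (q - 1)) - 6 * (q * q * q) = n * (n - 1) * (n - 2)"
    by (simp add: n_def p_def q_def algebra_simps)
  ultimately have "((\<lambda>y. p3 y - 3 * p2 y * q1 y - 3 * p1 y * q2 y + 6 * p1 y * (q1 y * q1 y) - q3 y + 6 * q1 y * q2 y - 6 * (q1 y * q1 y * q1 y)) \<longlongrightarrow> n * (n - 1) * (n - 2)) at_top"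
    by simp
  thus "((\<lambda>y. y ^ 3 * rat_eval (rat3 P Q) (Q ^ 4) y / g y) \<longlongrightarrow> n * (n - 1) * (n - 2)) at_top"
    by (rule Lim_transform_eventually) (rule eventually_mono[OF ev], rule key(3)[symmetric])
qed

text \<open>The quotient form is required only off the zeros of \<open>D\<close>: values at poles
  are conventional, and a product of denominators may vanish where the function is regular. The
  finitely many exceptional points do no harm when zeros are only to be shown finite in
  number.\<close>

definition rational_fun :: "(real \<Rightarrow> real) \<Rightarrow> bool" where
  "rational_fun f \<longleftrightarrow> (\<exists>N D. D \<noteq> 0 \<and> (\<forall>y. poly D y \<noteq> 0 \<longrightarrow> f y = poly N y / poly D y))"

lemma rational_fun_rat_eval: "Q \<noteq> 0 \<Longrightarrow> rational_fun (rat_eval P Q)"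
  unfolding rational_fun_def by (intro exI[of _ P] exI[of _ Q]) (simp add: rat_eval_def)

lemma rational_fun_poly: "rational_fun (poly p)"
  unfolding rational_fun_def by (intro exI[of _ p] exI[of _ 1]) simp

lemma rational_fun_const: "rational_fun (\<lambda>_. c)"
  unfolding rational_fun_def by (intro exI[of _ "[:c:]"] exI[of _ 1]) simp

lemma rational_fun_add:
  assumes "rational_fun f" "rational_fun g"
  shows "rational_fun (\<lambda>y. f y + g y)"
proof -
  from assms obtain N D N' D' where *: "D \<noteq> 0" "\<And>y. poly D y \<noteq> 0 \<Longrightarrow> f y = poly N y / poly D y"
    "D' \<noteq> 0" "\<And>y. poly D' y \<noteq> 0 \<Longrightarrow> g y = poly N' y / poly D' y"
    unfolding rational_fun_def by blast
  show ?thesis unfolding rational_fun_def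
    by (intro exI[of _ "N * D' + N' * D"] exI[of _ "D * D'"]) (use * in \<open>auto simp: field_simps\<close>)
qed

lemma rational_fun_mult:
  assumes "rational_fun f" "rational_fun g"
  shows "rational_fun (\<lambda>y. f y * g y)"
proof -
  from assms obtain N D N' D' where *: "D \<noteq> 0" "\<And>y. poly D y \<noteq> 0 \<Longrightarrow> f y = poly N y / poly D y"
    "D' \<noteq> 0" "\<And>y. poly D' y \<noteq> 0 \<Longrightarrow> g y = poly N' y / poly D' y"
    unfolding rational_fun_def by blast
  show ?thesis unfolding rational_fun_def
    by (intro exI[of _ "N * N'"] exI[of _ "D * D'"]) (use * in auto)
qed

lemma rational_fun_diff:
  assumes "rational_fun f" "rational_fun g"
  shows "rational_fun (\<lambda>y. f y - g y)"
  using rational_fun_add[OF assms(1) rational_fun_mult[OF rational_fun_const[of "-1"] assms(2)]] by simp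

lemma rational_fun_finite_zeros:
  assumes f: "rational_fun f" and nz: "\<not> (\<forall>\<^sub>F y in at_top. f y = 0)"
  shows "finite {y. f y = 0}"
proof -
  from f obtain N D where *: "D \<noteq> 0" "\<And>y. poly D y \<noteq> 0 \<Longrightarrow> f y = poly N y / poly D y"
    unfolding rational_fun_def by blast
  have "N \<noteq> 0"
  proof
    assume "N = 0"
    hence "\<forall>\<^sub>F y in at_top. f y = 0"
      using poly_eventually_nonzero_at_top[OF *(1)] by (auto elim!: eventually_mono simp: *(2))
    thus False using nz by blast
  qed
  hence "finite ({y. poly N y = 0} \<union> {y. poly D y = 0})" using * by (simp add: poly_roots_finite)
  moreover have "{y. f y = 0} \<subseteq> {y. poly N y = 0} \<union> {y. poly D y = 0}" using *(2) by fastforce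
  ultimately show ?thesis by (rule finite_subset[rotated])
qed

text \<open>The function $a y / (1 + y^2)$ of the first (McMillan) family and its derivatives.\<close>

definition mcm0 :: "real \<Rightarrow> real \<Rightarrow> real" where "mcm0 a = rat_eval [:0, a:] [:1, 0, 1:]"
definition mcm1 :: "real \<Rightarrow> real \<Rightarrow> real" where "mcm1 a = rat_eval (rat1 [:0, a:] [:1, 0, 1:]) ([:1, 0, 1:]\<^sup>2)"
definition mcm2 :: "real \<Rightarrow> real \<Rightarrow> real" where "mcm2 a = rat_eval (rat2 [:0, a:] [:1, 0, 1:]) ([:1, 0, 1:] ^ 3)"
definition mcm3 :: "real \<Rightarrow> real \<Rightarrow> real" where "mcm3 a = rat_eval (rat3 [:0, a:] [:1, 0, 1:]) ([:1, 0, 1:] ^ 4)"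

lemma poly_1_plus_square [simp]: "poly [:1, 0, 1:] y = 1 + y\<^sup>2" for y :: real
  by (simp add: power2_eq_square)

lemma one_plus_square_nonzero [simp]: "1 + y\<^sup>2 \<noteq> 0" for y :: real
  using zero_le_power2[of y] by linarith

lemma mcm_eq:
  "mcm0 a y = a * y / (1 + y\<^sup>2)"
  "mcm1 a y = a * (1 - y\<^sup>2) / (1 + y\<^sup>2)\<^sup>2"
  "mcm2 a y = 2 * a * y * (y\<^sup>2 - 3) / (1 + y\<^sup>2) ^ 3"
  "mcm3 a y = - 6 * a * (y ^ 4 - 6 * y\<^sup>2 + 1) / (1 + y\<^sup>2) ^ 4"
proof -
  have p: "poly (pderiv [:0, a:]) y = a" "pderiv (pderiv [:0, a:]) = 0" "poly [:0, a:] y = a * y"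
    "poly (pderiv [:1, 0, 1:]) y = 2 * y" "poly (pderiv (pderiv [:1, 0, 1:])) y = 2"
    "pderiv (pderiv (pderiv [:1, 0, 1::real:])) = 0"
    by (simp_all add: pderiv_pCons)
  show "mcm0 a y = a * y / (1 + y\<^sup>2)" unfolding mcm0_def rat_eval_def p poly_1_plus_square by simp
  show "mcm1 a y = a * (1 - y\<^sup>2) / (1 + y\<^sup>2)\<^sup>2"
    unfolding mcm1_def rat_eval_def poly_power poly_rat p poly_1_plus_square
    by (intro arg_cong2[of _ _ _ _ "(/)"]) (simp_all add: algebra_simps power2_eq_square)
  show "mcm2 a y = 2 * a * y * (y\<^sup>2 - 3) / (1 + y\<^sup>2) ^ 3"
    unfolding mcm2_def rat_eval_def poly_power poly_rat p poly_1_plus_square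
    by (intro arg_cong2[of _ _ _ _ "(/)"]) (simp_all add: algebra_simps power2_eq_square)
  show "mcm3 a y = - 6 * a * (y ^ 4 - 6 * y\<^sup>2 + 1) / (1 + y\<^sup>2) ^ 4"
    unfolding mcm3_def rat_eval_def poly_power poly_rat p poly_1_plus_square
    by (intro arg_cong2[of _ _ _ _ "(/)"]) (simp_all add: algebra_simps power2_eq_square power3_eq_cube power4_eq_xxxx)
qed

lemma mcm_derivatives:
  "(mcm0 a has_real_derivative mcm1 a y) (at y)"
  "(mcm1 a has_real_derivative mcm2 a y) (at y)"
  "(mcm2 a has_real_derivative mcm3 a y) (at y)"
  unfolding mcm0_def mcm1_def mcm2_def mcm3_def
  by (rule rat_eval_derivatives, simp del: poly_pCons)+

lemma isCont_mcm: "isCont (mcm1 a) y" "isCont (mcm2 a) y" "isCont (mcm3 a) y"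
  unfolding mcm1_def mcm2_def mcm3_def
  by (rule isCont_rat_eval, simp del: poly_pCons)+

text \<open>The fixed point equation gives \<epsilon> = K(y) / g(y); inserting this into W and
  multiplying by g^3 yields the expression in question. At infinity the McMillan terms are
  negligible and K(y) is close to 2 y, so y^2 W has a limit computed from y^n alone: 8 n (n - 1)^2
  (n + 1)^2, positive for n \<ge> 2.\<close>

lemma finite_twist_zeros:
  fixes P Q :: "real poly"
  assumes a: "a \<noteq> 0" and Q: "Q \<noteq> 0" and deg: "degree P > degree Q + 1"
  defines "K \<equiv> \<lambda>y. 2 * y - mcm0 a y" and "g \<equiv> rat_eval P Q" and "g1 \<equiv> rat_eval (rat1 P Q) (Q\<^sup>2)"
    and "g2 \<equiv> rat_eval (rat2 P Q) (Q ^ 3)" and "g3 \<equiv> rat_eval (rat3 P Q) (Q ^ 4)"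
  shows "finite {y. (mcm3 a y * g y + K y * g3 y) * ((2 - mcm1 a y) * g y - K y * g1 y) * ((1 + mcm1 a y) * g y + K y * g1 y)
      + ((2 * mcm1 a y + 1) * g y + 2 * K y * g1 y) * ((mcm2 a y * g y + K y * g2 y) * (mcm2 a y * g y + K y * g2 y)) = 0}"
    (is "finite {y. ?W y = 0}")
proof (rule rational_fun_finite_zeros)
  have P: "P \<noteq> 0" using deg by auto
  have D: "[:1, 0, 1::real:] \<noteq> 0" by simp
  have K: "rational_fun K"
    using rational_fun_diff[OF rational_fun_poly[of "[:0, 2:]"] rational_fun_rat_eval[OF D, of "[:0, a:]"]]
    unfolding K_def mcm0_def by (simp add: mult.commute)
  have m: "rational_fun (mcm1 a)" "rational_fun (mcm2 a)" "rational_fun (mcm3 a)"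
    unfolding mcm1_def mcm2_def mcm3_def using D by (intro rational_fun_rat_eval; simp)+
  have gs: "rational_fun g" "rational_fun g1" "rational_fun g2" "rational_fun g3"
    unfolding g_def g1_def g2_def g3_def using Q by (intro rational_fun_rat_eval; simp)+
  show "rational_fun ?W"
    by (intro rational_fun_add rational_fun_mult rational_fun_diff rational_fun_const K m gs)
  define n where "n = real (degree P) - real (degree Q)"
  have n: "n \<ge> 2" using deg by (simp add: n_def)
  define G1 G2 G3 where "G1 y = y * g1 y / g y" and "G2 y = y\<^sup>2 * g2 y / g y" and "G3 y = y ^ 3 * g3 y / g y" for y
  note LG = rat_eval_log_derivatives_tendsto[OF P Q, folded g_def g1_def g2_def g3_def n_def, folded G1_def G2_def G3_def]
  have Na: "[:0, a:] \<noteq> 0" using a by simp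
  have dN: "real (degree [:0, a:]) - real (degree [:1, 0, 1::real:]) = - 1" using a by simp
  note LA = rat_eval_log_derivatives_tendsto[OF Na D, folded mcm0_def mcm1_def mcm2_def mcm3_def, unfolded dN]
  have iy: "((\<lambda>y::real. inverse y) \<longlongrightarrow> 0) at_top" by (rule tendsto_inverse_0_at_top[OF filterlim_ident])
  have m0: "((\<lambda>y. mcm0 a y) \<longlongrightarrow> 0) at_top"
  proof -
    have "((\<lambda>y. (poly [:0, a:] y / y\<^sup>2) / (poly [:1, 0, 1:] y / y\<^sup>2)) \<longlongrightarrow> coeff [:0, a:] 2 / coeff [:1, 0, 1:] 2) at_top"
      by (intro tendsto_divide poly_over_power_tendsto) (use a in \<open>auto simp: eval_nat_numeral\<close>)
    moreover have "coeff [:0, a:] 2 = 0" by (simp add: eval_nat_numeral)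
    ultimately have "((\<lambda>y. (poly [:0, a:] y / y\<^sup>2) / (poly [:1, 0, 1:] y / y\<^sup>2)) \<longlongrightarrow> 0) at_top" by simp
    moreover have "\<forall>\<^sub>F y in at_top. (poly [:0, a:] y / y\<^sup>2) / (poly [:1, 0, 1:] y / y\<^sup>2) = mcm0 a y"
      using eventually_gt_at_top[of 0] by eventually_elim (simp add: mcm0_def rat_eval_def del: poly_pCons)
    ultimately show ?thesis by (rule Lim_transform_eventually)
  qed
  define u where "u y = mcm0 a y * inverse y" for y
  have u0: "(u \<longlongrightarrow> 0) at_top" using tendsto_mult[OF m0 iy] by (simp add: u_def[abs_def])
  have pos: "\<forall>\<^sub>F y::real in at_top. y > 0" by (rule eventually_gt_at_top)
  have m0nz: "mcm0 a y \<noteq> 0" if "y > 0" for y using that a by (simp add: mcm_eq)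
  have A1: "((\<lambda>y. mcm1 a y) \<longlongrightarrow> 0) at_top"
  proof -
    have "((\<lambda>y. (y * mcm1 a y / mcm0 a y) * u y) \<longlongrightarrow> - 1 * 0) at_top" by (intro tendsto_mult LA u0)
    hence "((\<lambda>y. (y * mcm1 a y / mcm0 a y) * u y) \<longlongrightarrow> 0) at_top" by simp
    thus ?thesis by (rule Lim_transform_eventually)
      (rule eventually_mono[OF pos], use m0nz in \<open>auto simp: u_def field_simps\<close>)
  qed
  have A2: "((\<lambda>y. y * mcm2 a y) \<longlongrightarrow> 0) at_top"
  proof -
    have "((\<lambda>y. (y\<^sup>2 * mcm2 a y / mcm0 a y) * u y) \<longlongrightarrow> (- 1 * (- 1 - 1)) * 0) at_top" by (intro tendsto_mult LA u0)
    hence "((\<lambda>y. (y\<^sup>2 * mcm2 a y / mcm0 a y) * u y) \<longlongrightarrow> 0) at_top" by simp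
    thus ?thesis by (rule Lim_transform_eventually)
      (rule eventually_mono[OF pos], use m0nz in \<open>auto simp: u_def field_simps power2_eq_square\<close>)
  qed
  have A3: "((\<lambda>y. y\<^sup>2 * mcm3 a y) \<longlongrightarrow> 0) at_top"
  proof -
    have "((\<lambda>y. (y ^ 3 * mcm3 a y / mcm0 a y) * u y) \<longlongrightarrow> (- 1 * (- 1 - 1) * (- 1 - 2)) * 0) at_top" by (intro tendsto_mult LA u0)
    hence "((\<lambda>y. (y ^ 3 * mcm3 a y / mcm0 a y) * u y) \<longlongrightarrow> 0) at_top" by simp
    thus ?thesis by (rule Lim_transform_eventually)
      (rule eventually_mono[OF pos], use m0nz in \<open>auto simp: u_def field_simps power2_eq_square power3_eq_cube\<close>)
  qed
  define k where "k y = 2 - u y" for y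
  have k2: "(k \<longlongrightarrow> 2) at_top" unfolding k_def[abs_def] using tendsto_diff[OF tendsto_const u0, of 2] by simp
  \<comment> \<open>This is y^2 times the expression divided by g^3, arranged as a combination of
    quantities that all converge.\<close>
  define w where "w y = (y\<^sup>2 * mcm3 a y + k y * G3 y) * ((2 - mcm1 a y) - k y * G1 y) * ((1 + mcm1 a y) + k y * G1 y)
      + ((2 * mcm1 a y + 1) + 2 * k y * G1 y) * ((y * mcm2 a y + k y * G2 y) * (y * mcm2 a y + k y * G2 y))" for y
  have "(w \<longlongrightarrow> (0 + 2 * (n * (n - 1) * (n - 2))) * ((2 - 0) - 2 * n) * ((1 + 0) + 2 * n)
      + ((2 * 0 + 1) + 2 * 2 * n) * ((0 + 2 * (n * (n - 1))) * (0 + 2 * (n * (n - 1))))) at_top"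
    unfolding w_def[abs_def] by (intro tendsto_intros A1 A2 A3 k2 LG)
  moreover have "(0 + 2 * (n * (n - 1) * (n - 2))) * ((2 - 0) - 2 * n) * ((1 + 0) + 2 * n)
      + ((2 * 0 + 1) + 2 * 2 * n) * ((0 + 2 * (n * (n - 1))) * (0 + 2 * (n * (n - 1)))) = 8 * n * (n - 1)\<^sup>2 * (n + 1)\<^sup>2"
    by (simp add: algebra_simps power2_eq_square)
  ultimately have w: "(w \<longlongrightarrow> 8 * n * (n - 1)\<^sup>2 * (n + 1)\<^sup>2) at_top" by simp
  have "8 * n * (n - 1)\<^sup>2 * (n + 1)\<^sup>2 > 0" using n by (intro mult_pos_pos) auto
  from order_tendstoD(1)[OF w this] have wpos: "\<forall>\<^sub>F y in at_top. w y > 0" .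
  have gnz: "\<forall>\<^sub>F y in at_top. g y \<noteq> 0"
    using poly_eventually_nonzero_at_top[OF P] poly_eventually_nonzero_at_top[OF Q]
    by eventually_elim (simp add: g_def rat_eval_def)
  have "\<forall>\<^sub>F y in at_top. ?W y \<noteq> 0"
    using wpos gnz pos
  proof eventually_elim
    case (elim y)
    have y: "y \<noteq> 0" using elim by simp
    have e: "g1 y = G1 y * g y / y" "g2 y = G2 y * g y / y\<^sup>2" "g3 y = G3 y * g y / y ^ 3" "K y = k y * y"
      using elim y by (simp_all add: G1_def G2_def G3_def K_def k_def u_def algebra_simps)
    have "K y * g1 y = k y * G1 y * g y" "y * (K y * g2 y) = k y * G2 y * g y" "y\<^sup>2 * (K y * g3 y) = k y * G3 y * g y"
      unfolding e using y by (simp_all add: power2_eq_square power3_eq_cube)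
    hence "y\<^sup>2 * ?W y = w y * (g y * g y * g y)"
      unfolding w_def by algebra
    thus "?W y \<noteq> 0" using elim by auto
  qed
  thus "\<not> (\<forall>\<^sub>F y in at_top. ?W y = 0)"
    using eventually_elim2[of "\<lambda>y. ?W y \<noteq> 0" at_top "\<lambda>y. ?W y = 0" "\<lambda>_. False"] by auto
qed

lemma finite_avoid_at:
  fixes c :: real
  assumes "finite S"
  shows "\<forall>\<^sub>F y in at c. y \<notin> S"
  using assms by (simp add: eventually_at_topological)
    (metis Diff_iff finite_imp_closed[of "S - {c}"] finite_Diff insertCI open_Compl ComplD ComplI singletonD)

text \<open>At a = 8 and c^2 = 3 the unperturbed values are t = -1 and h2 = 0, so W vanishes and
  passing to the limit decides nothing. If g(c) is nonzero, the fixed point leaves c as soon as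
  \<epsilon> \<noteq> 0 and moves in a punctured neighbourhood free of zeros of W. If g(c) = 0 it
  stays at c, with t = -1 + \<epsilon> g'(c) and h2 = \<epsilon> g''(c): then W is asymptotic to
  (9/2) \<epsilon> g'(c), or, when g'(c) = 0, t = -1 exactly while h3 tends to 3/2.\<close>

lemma twist_at_resonance:
  fixes P Q :: "real poly" and z :: "real \<Rightarrow> real"
  assumes c: "c\<^sup>2 = 3" and Q: "poly Q c \<noteq> 0" and deg: "degree P > degree Q + 1" and e: "e > 0"
    and z0: "z 0 = c" and zc: "isCont z 0"
    and z: "\<And>\<epsilon>. \<bar>\<epsilon>\<bar> < e \<Longrightarrow> 2 * z \<epsilon> - mcm0 8 (z \<epsilon>) = \<epsilon> * rat_eval P Q (z \<epsilon>)"
    and uniq: "\<And>\<epsilon>. \<bar>\<epsilon>\<bar> < e \<Longrightarrow> rat_eval P Q c = 0 \<Longrightarrow> z \<epsilon> = c"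
  defines "t \<equiv> \<lambda>\<epsilon>. mcm1 8 (z \<epsilon>) + \<epsilon> * rat_eval (rat1 P Q) (Q\<^sup>2) (z \<epsilon>)"
    and "h2 \<equiv> \<lambda>\<epsilon>. mcm2 8 (z \<epsilon>) + \<epsilon> * rat_eval (rat2 P Q) (Q ^ 3) (z \<epsilon>)"
    and "h3 \<equiv> \<lambda>\<epsilon>. mcm3 8 (z \<epsilon>) + \<epsilon> * rat_eval (rat3 P Q) (Q ^ 4) (z \<epsilon>)"
  shows "\<forall>\<^sub>F \<epsilon> in at 0. h3 \<epsilon> * (2 - t \<epsilon>) * (1 + t \<epsilon>) + (2 * t \<epsilon> + 1) * (h2 \<epsilon>)\<^sup>2 \<noteq> 0 \<or> t \<epsilon> = - 1 \<and> h3 \<epsilon> \<noteq> 0"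
proof -
  have c4: "c ^ 4 = 9" using c by (metis numeral_power_eq_of_nat_cancel_iff power2_eq_square power4_eq_xxxx mult.assoc mult_numeral_1 numeral_times_numeral semiring_norm power_mult_distrib)
  have m: "mcm1 8 c = - 1" "mcm2 8 c = 0" "mcm3 8 c = 3 / 2" by (simp_all add: mcm_eq c c4)
  have smalle: "\<forall>\<^sub>F \<epsilon> in at 0. \<bar>\<epsilon>\<bar> < e" unfolding eventually_at using e by (auto simp: dist_norm)
  have z_lim: "(z \<longlongrightarrow> c) (at 0)" using zc z0 by (simp add: continuous_at)
  have gc: "isCont (rat_eval R (Q ^ k)) c" for R k by (rule isCont_rat_eval) (use Q in simp)
  have glim: "((\<lambda>\<epsilon>. rat_eval R (Q ^ k) (z \<epsilon>)) \<longlongrightarrow> rat_eval R (Q ^ k) c) (at 0)" for R k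
    by (rule isCont_tendsto_compose[OF gc z_lim])
  have h3lim: "(h3 \<longlongrightarrow> 3 / 2 + 0 * rat_eval (rat3 P Q) (Q ^ 4) c) (at 0)"
    unfolding h3_def m(3)[symmetric] by (intro tendsto_intros glim isCont_tendsto_compose[OF isCont_mcm(3) z_lim])
  hence "\<forall>\<^sub>F \<epsilon> in at 0. h3 \<epsilon> > 0" by (intro order_tendstoD(1)) auto
  hence h3nz: "\<forall>\<^sub>F \<epsilon> in at 0. h3 \<epsilon> \<noteq> 0" by (rule eventually_mono) auto
  show ?thesis
  proof (cases "rat_eval P Q c = 0")
    case True
    define g1 g2 where "g1 = rat_eval (rat1 P Q) (Q\<^sup>2) c" and "g2 = rat_eval (rat2 P Q) (Q ^ 3) c"
    have th: "\<forall>\<^sub>F \<epsilon> in at 0. t \<epsilon> = - 1 + \<epsilon> * g1 \<and> h2 \<epsilon> = \<epsilon> * g2"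
      using smalle by eventually_elim (use uniq[OF _ True] m in \<open>simp add: t_def h2_def g1_def g2_def\<close>)
    show ?thesis
    proof (cases "g1 = 0")
      case True
      show ?thesis using th h3nz by eventually_elim (simp add: True)
    next
      case False
      have "((\<lambda>\<epsilon>. h3 \<epsilon> * (3 - \<epsilon> * g1) * g1 + (- 1 + 2 * (\<epsilon> * g1)) * (\<epsilon> * (g2 * g2))) \<longlongrightarrow>
          (3 / 2 + 0 * rat_eval (rat3 P Q) (Q ^ 4) c) * (3 - 0 * g1) * g1 + (- 1 + 2 * (0 * g1)) * (0 * (g2 * g2))) (at 0)"
        by (intro tendsto_intros h3lim)
      hence "\<forall>\<^sub>F \<epsilon> in at 0. h3 \<epsilon> * (3 - \<epsilon> * g1) * g1 + (- 1 + 2 * (\<epsilon> * g1)) * (\<epsilon> * (g2 * g2)) \<noteq> 0"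
        by (rule tendsto_imp_eventually_ne) (use False in simp)
      moreover have "\<forall>\<^sub>F \<epsilon>::real in at 0. \<epsilon> \<noteq> 0" by (simp add: eventually_at_filter)
      ultimately show ?thesis using th
      proof eventually_elim
        case (elim \<epsilon>)
        have "h3 \<epsilon> * (2 - t \<epsilon>) * (1 + t \<epsilon>) + (2 * t \<epsilon> + 1) * (h2 \<epsilon>)\<^sup>2 =
            \<epsilon> * (h3 \<epsilon> * (3 - \<epsilon> * g1) * g1 + (- 1 + 2 * (\<epsilon> * g1)) * (\<epsilon> * (g2 * g2)))"
        proof -
          have te: "t \<epsilon> = - 1 + \<epsilon> * g1" "h2 \<epsilon> = \<epsilon> * g2" using elim(3) by auto
          show ?thesis unfolding te by (simp add: algebra_simps power2_eq_square)
        qed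
        thus ?case using elim by auto
      qed
    qed
  next
    case False
    have Q0: "Q \<noteq> 0" using Q by auto
    define K where "K y = 2 * y - mcm0 8 y" for y
    define g g1 g2 g3 where "g = rat_eval P Q" and "g1 = rat_eval (rat1 P Q) (Q\<^sup>2)"
      and "g2 = rat_eval (rat2 P Q) (Q ^ 3)" and "g3 = rat_eval (rat3 P Q) (Q ^ 4)"
    define W where "W y = (mcm3 8 y * g y + K y * g3 y) * ((2 - mcm1 8 y) * g y - K y * g1 y) * ((1 + mcm1 8 y) * g y + K y * g1 y)
      + ((2 * mcm1 8 y + 1) * g y + 2 * K y * g1 y) * ((mcm2 8 y * g y + K y * g2 y) * (mcm2 8 y * g y + K y * g2 y))" for y
    have "finite {y. W y = 0}"
      unfolding W_def K_def g_def g1_def g2_def g3_def by (rule finite_twist_zeros) (use Q0 deg in auto)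
    hence Wnz: "\<forall>\<^sub>F y in at c. W y \<noteq> 0" using finite_avoid_at[of "{y. W y = 0}" c] by simp
    have nz: "\<forall>\<^sub>F \<epsilon>::real in at 0. \<epsilon> \<noteq> 0" by (simp add: eventually_at_filter)
    have "((\<lambda>\<epsilon>. g (z \<epsilon>)) \<longlongrightarrow> g c) (at 0)" using glim[of P 1] by (simp add: g_def)
    hence gz: "\<forall>\<^sub>F \<epsilon> in at 0. g (z \<epsilon>) \<noteq> 0" by (rule tendsto_imp_eventually_ne) (use False g_def in simp)
    have zne: "\<forall>\<^sub>F \<epsilon> in at 0. z \<epsilon> \<noteq> c"
      using smalle nz
    proof eventually_elim
      case (elim \<epsilon>)
      show ?case
      proof
        assume "z \<epsilon> = c"
        hence "2 * c - mcm0 8 c = \<epsilon> * rat_eval P Q c" using z[OF elim(1)] by simp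
        moreover have "2 * c - mcm0 8 c = 0" using z[of 0] z0 e by simp
        ultimately show False using elim False by simp
      qed
    qed
    have "filterlim z (at c) (at 0)" using z_lim zne by (simp add: filterlim_at eventually_conj)
    hence "\<forall>\<^sub>F \<epsilon> in at 0. W (z \<epsilon>) \<noteq> 0" by (rule eventually_compose_filterlim[OF Wnz])
    thus ?thesis using gz smalle
    proof eventually_elim
      case (elim \<epsilon>)
      define y where "y = z \<epsilon>"
      have K: "K y = \<epsilon> * g y" using z[OF elim(3)] by (simp add: K_def y_def g_def)
      have "W y = (g y * g y * g y) * (h3 \<epsilon> * (2 - t \<epsilon>) * (1 + t \<epsilon>) + (2 * t \<epsilon> + 1) * (h2 \<epsilon>)\<^sup>2)"
        unfolding W_def K t_def h2_def h3_def y_def[symmetric] g1_def[symmetric] g2_def[symmetric] g3_def[symmetric]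
        by (simp add: algebra_simps power2_eq_square)
      thus ?case using elim by (auto simp: y_def)
    qed
  qed
qed

subsection \<open>The two families\<close>

lemma fixed_point_branch_mono:
  assumes "fixed_point_branch D F e p0 p" "0 < e'" "e' \<le> e"
  shows "fixed_point_branch D F e' p0 p"
proof -
  have s: "{- e'<..<e'} \<subseteq> {- e<..<e}" using assms by auto
  show ?thesis using assms(1) continuous_on_subset[OF _ s] s unfolding fixed_point_branch_def by blast
qed

lemma uniform_branch:
  assumes fin: "finite {p0. E p0}"
    and pt: "\<And>p0. E p0 \<Longrightarrow> \<exists>e>0. \<exists>p. fixed_point_branch D F e p0 p \<and> (\<forall>\<epsilon>. \<bar>\<epsilon>\<bar> < e \<longrightarrow> R \<epsilon> (p \<epsilon>))"
  shows "\<exists>e>0. \<forall>p0. E p0 \<longrightarrow> (\<exists>p. fixed_point_branch D F e p0 p \<and> (\<forall>\<epsilon>. \<bar>\<epsilon>\<bar> < e \<longrightarrow> R \<epsilon> (p \<epsilon>)))"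
proof -
  from pt obtain e where e: "\<And>p0. E p0 \<Longrightarrow> e p0 > 0 \<and> (\<exists>p. fixed_point_branch D F (e p0) p0 p \<and> (\<forall>\<epsilon>. \<bar>\<epsilon>\<bar> < e p0 \<longrightarrow> R \<epsilon> (p \<epsilon>)))"
    by metis
  \<comment> \<open>The inserted 1 keeps the minimum defined when there is no point to
    consider.\<close>
  define m where "m = Min (insert 1 (e ` {p0. E p0}))"
  have m: "m > 0" unfolding m_def using fin e by (subst Min_gr_iff) auto
  have le: "m \<le> e p0" if "E p0" for p0 unfolding m_def using fin that by (intro Min_le) auto
  show ?thesis
  proof (intro exI[of _ m] conjI allI impI m)
    fix p0 assume p0: "E p0"
    from e[OF p0] obtain p where "fixed_point_branch D F (e p0) p0 p" "\<forall>\<epsilon>. \<bar>\<epsilon>\<bar> < e p0 \<longrightarrow> R \<epsilon> (p \<epsilon>)" by blast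
    thus "\<exists>p. fixed_point_branch D F m p0 p \<and> (\<forall>\<epsilon>. \<bar>\<epsilon>\<bar> < m \<longrightarrow> R \<epsilon> (p \<epsilon>))"
      using fixed_point_branch_mono[OF _ m le[OF p0]] le[OF p0] by (meson less_le_trans)
  qed
qed

lemma eventually_at_0E:
  assumes "\<forall>\<^sub>F \<epsilon>::real in at 0. R \<epsilon>"
  obtains e where "e > 0" "\<And>\<epsilon>. \<bar>\<epsilon>\<bar> < e \<Longrightarrow> \<epsilon> \<noteq> 0 \<Longrightarrow> R \<epsilon>"
  using assms unfolding eventually_at by (auto simp: dist_norm)

lemma poly_nonzero_neighbourhood:
  fixes Q :: "real poly"
  assumes "poly Q c \<noteq> 0"
  obtains \<rho> where "\<rho> > 0" "\<And>y. \<bar>y - c\<bar> < \<rho> \<Longrightarrow> poly Q y \<noteq> 0"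
proof -
  have "open {y. poly Q y \<noteq> 0}" by (intro open_Collect_neq continuous_intros)
  then obtain \<rho> where "\<rho> > 0" "ball c \<rho> \<subseteq> {y. poly Q y \<noteq> 0}" using assms open_contains_ball by blast
  thus ?thesis using that[of \<rho>] by (auto simp: dist_norm abs_minus_commute subset_iff)
qed

lemma continuous_on_diagonal:
  assumes "continuous_on S z"
  shows "continuous_on S (\<lambda>\<epsilon>. vector [z \<epsilon>, z \<epsilon>] :: real^2)"
  unfolding vector2_eq_axis by (intro continuous_intros assms)

text \<open>At c = 0 one finds W = -6 a (2 - a) (1 + a), which explains the exclusion of a = 0 and a
  = -1. For c \<noteq> 0 the fixed point equation gives a = 2 s with s = 1 + c^2, and W = 64 (s - 1)
  (4 - s) (s + 2) / s^5 vanishes only for s = 4, that is a = 8.\<close>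

lemma F_map_unperturbed_twist:
  assumes fx: "2 * c = mcm0 a c" and t: "\<bar>mcm1 a c\<bar> < 2" and a: "a \<noteq> -1" "a \<noteq> 0" and n8: "\<not> (a = 8 \<and> c \<noteq> 0)"
  shows "mcm3 a c * (2 - mcm1 a c) * (1 + mcm1 a c) + (2 * mcm1 a c + 1) * (mcm2 a c)\<^sup>2 \<noteq> 0"
proof (cases "c = 0")
  case True
  have v: "mcm1 a c = a" "mcm2 a c = 0" "mcm3 a c = - 6 * a" by (simp_all add: mcm_eq True)
  show ?thesis using t a unfolding v by auto
next
  case False
  define s where "s = 1 + c\<^sup>2"
  have "2 * c * s = a * c" using fx unfolding mcm_eq s_def by (simp add: field_simps)
  hence as: "a = 2 * s" using False by simp
  have s1: "s > 1" using False by (simp add: s_def)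
  have c2: "c\<^sup>2 = s - 1" by (simp add: s_def)
  have c4: "c ^ 4 = (s - 1) * (s - 1)" using c2 by (metis power2_eq_square power4_eq_xxxx mult.assoc)
  have v1: "mcm1 a c = 2 * (2 - s) / s"
    unfolding mcm_eq s_def[symmetric] c2 as using s1 by (simp add: field_simps power2_eq_square)
  have v2: "(mcm2 a c)\<^sup>2 = 16 * (s - 1) * (s - 4)\<^sup>2 / s ^ 4"
  proof -
    have "(mcm2 a c)\<^sup>2 = 16 * s\<^sup>2 * c\<^sup>2 * (s - 4)\<^sup>2 / (s ^ 3)\<^sup>2"
      unfolding mcm_eq s_def[symmetric] c2 as by (simp add: power_divide power_mult_distrib c2)
    also have "\<dots> = 16 * (s - 1) * (s - 4)\<^sup>2 / s ^ 4"
      unfolding c2 using s1 by (simp add: field_simps power2_eq_square power3_eq_cube power4_eq_xxxx)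
    finally show ?thesis .
  qed
  have v3: "mcm3 a c = - 12 * (s\<^sup>2 - 8 * s + 8) / s ^ 3"
    unfolding mcm_eq s_def[symmetric] c2 c4 as using s1
    by (simp add: field_simps power2_eq_square power3_eq_cube power4_eq_xxxx)
  have "mcm3 a c * (2 - mcm1 a c) * (1 + mcm1 a c) + (2 * mcm1 a c + 1) * (mcm2 a c)\<^sup>2
      = 64 * (s - 1) * (4 - s) * (s + 2) / s ^ 5"
  proof -
    have w1: "2 - mcm1 a c = 4 * (s - 1) / s" "1 + mcm1 a c = (4 - s) / s" "2 * mcm1 a c + 1 = (8 - 3 * s) / s"
      unfolding v1 using s1 by (simp_all add: field_simps)
    have "mcm3 a c * (2 - mcm1 a c) * (1 + mcm1 a c) + (2 * mcm1 a c + 1) * (mcm2 a c)\<^sup>2 =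
      (- 12 * (s\<^sup>2 - 8 * s + 8) * (4 * (s - 1)) * (4 - s) + (8 - 3 * s) * (16 * (s - 1) * (s - 4)\<^sup>2)) / s ^ 5"
      unfolding w1 v2 v3 using s1 by (simp add: add_divide_distrib eval_nat_numeral)
    also have "- 12 * (s\<^sup>2 - 8 * s + 8) * (4 * (s - 1)) * (4 - s) + (8 - 3 * s) * (16 * (s - 1) * (s - 4)\<^sup>2) = 64 * (s - 1) * (4 - s) * (s + 2)"
      by algebra
    finally show ?thesis .
  qed
  moreover have "s \<noteq> 4" using n8 as False by auto
  ultimately show ?thesis using s1 by simp
qed

text \<open>Ellipticity and nonvanishing twist are open conditions and pass from \<epsilon> = 0 to
  small \<epsilon>; only at a = 8 off the origin does the twist need the analysis along the branch.
  Integrability at \<epsilon> = 0 comes from the explicit invariant.\<close>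

lemma F_map_branch:
  fixes P Q :: "real poly"
  assumes deg: "degree P > degree Q + 1" and a: "a \<noteq> -1" "a \<noteq> 0" and Qc: "poly Q c \<noteq> 0"
    and fx: "2 * c = mcm0 a c" and t0: "\<bar>mcm1 a c\<bar> < 2"
  defines "F \<equiv> F_map a (rat_eval P Q)"
  shows "\<exists>e>0. \<exists>p. fixed_point_branch (F_dom Q) F e (vector [c, c]) p \<and>
     (\<forall>\<epsilon>. \<bar>\<epsilon>\<bar> < e \<longrightarrow> elliptic_fixed_point (F_dom Q) (F \<epsilon>) (p \<epsilon>) \<and>
        (locally_integrable_at 6 (F_dom Q) (F \<epsilon>) (p \<epsilon>) \<longleftrightarrow> \<epsilon> = 0))"
proof -
  have Q0: "Q \<noteq> 0" using Qc by auto
  obtain \<rho> where \<rho>: "\<rho> > 0" "\<And>y. \<bar>y - c\<bar> < \<rho> \<Longrightarrow> poly Q y \<noteq> 0"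
    by (rule poly_nonzero_neighbourhood[OF Qc]) blast
  define g g1 g2 g3 where "g = rat_eval P Q" and "g1 = rat_eval (rat1 P Q) (Q\<^sup>2)"
    and "g2 = rat_eval (rat2 P Q) (Q ^ 3)" and "g3 = rat_eval (rat3 P Q) (Q ^ 4)"
  note dg = rat_eval_derivatives[where P = P and Q = Q, folded g_def g1_def g2_def g3_def, OF \<rho>(2)]
  have "\<exists>\<delta> e z. 0 < \<delta> \<and> \<delta> < \<rho> \<and> e > 0 \<and> z 0 = c \<and> continuous_on {-e<..<e} z \<and>
      (\<forall>\<epsilon>. \<bar>\<epsilon>\<bar> < e \<longrightarrow> \<bar>z \<epsilon> - c\<bar> < \<delta> \<and> (\<forall>x. \<bar>x - c\<bar> < \<delta> \<longrightarrow> (2 * x - mcm0 a x = \<epsilon> * g x \<longleftrightarrow> x = z \<epsilon>)))"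
  proof (rule zero_branch[OF \<rho>(1)])
    show "((\<lambda>x. 2 * x - mcm0 a x) has_real_derivative 2 - mcm1 a x) (at x)" for x
      by (auto intro!: derivative_eq_intros mcm_derivatives)
    show "(g has_real_derivative g1 x) (at x)" if "\<bar>x - c\<bar> < \<rho>" for x by (rule dg(1)[OF that])
    show "isCont (\<lambda>x. 2 - mcm1 a x) c" by (intro continuous_intros isCont_mcm)
    show "isCont g1 c" unfolding g1_def using Qc by (intro isCont_rat_eval) simp
    show "2 * c - mcm0 a c = 0" "2 - mcm1 a c \<noteq> 0" using fx t0 by auto
  qed
  then obtain \<delta> e z where \<delta>: "0 < \<delta>" "\<delta> < \<rho>" and e: "e > 0" and z0: "z 0 = c"
    and zc: "continuous_on {-e<..<e} z" and z: "\<And>\<epsilon>. \<bar>\<epsilon>\<bar> < e \<Longrightarrow> \<bar>z \<epsilon> - c\<bar> < \<delta>"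
      "\<And>\<epsilon> x. \<bar>\<epsilon>\<bar> < e \<Longrightarrow> \<bar>x - c\<bar> < \<delta> \<Longrightarrow> (2 * x - mcm0 a x = \<epsilon> * g x \<longleftrightarrow> x = z \<epsilon>)" by metis
  have z\<rho>: "\<bar>z \<epsilon> - c\<bar> < \<rho>" if "\<bar>\<epsilon>\<bar> < e" for \<epsilon> using z(1)[OF that] \<delta> by linarith
  have zfix: "2 * z \<epsilon> - mcm0 a (z \<epsilon>) = \<epsilon> * g (z \<epsilon>)" if "\<bar>\<epsilon>\<bar> < e" for \<epsilon>
    using z(2)[OF that z(1)[OF that]] by simp
  have zc0: "isCont z 0" using zc e by (simp add: continuous_on_eq_continuous_at)
  have z_lim: "(z \<longlongrightarrow> c) (at 0)" using zc0 z0 by (simp add: continuous_at)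
  define t where "t \<epsilon> = mcm1 a (z \<epsilon>) + \<epsilon> * g1 (z \<epsilon>)" for \<epsilon>
  define h2 where "h2 \<epsilon> = mcm2 a (z \<epsilon>) + \<epsilon> * g2 (z \<epsilon>)" for \<epsilon>
  define h3 where "h3 \<epsilon> = mcm3 a (z \<epsilon>) + \<epsilon> * g3 (z \<epsilon>)" for \<epsilon>
  have gc: "isCont (rat_eval R (Q ^ k)) c" for R k by (rule isCont_rat_eval) (use Qc in simp)
  have glim: "((\<lambda>\<epsilon>. rat_eval R (Q ^ k) (z \<epsilon>)) \<longlongrightarrow> rat_eval R (Q ^ k) c) (at 0)" for R k
    by (rule isCont_tendsto_compose[OF gc z_lim])
  have tl: "(t \<longlongrightarrow> mcm1 a c + 0 * g1 c) (at 0)" unfolding t_def[abs_def] g1_def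
    by (intro tendsto_intros glim isCont_tendsto_compose[OF isCont_mcm(1) z_lim])
  have h2l: "(h2 \<longlongrightarrow> mcm2 a c + 0 * g2 c) (at 0)" unfolding h2_def[abs_def] g2_def
    by (intro tendsto_intros glim isCont_tendsto_compose[OF isCont_mcm(2) z_lim])
  have h3l: "(h3 \<longlongrightarrow> mcm3 a c + 0 * g3 c) (at 0)" unfolding h3_def[abs_def] g3_def
    by (intro tendsto_intros glim isCont_tendsto_compose[OF isCont_mcm(3) z_lim])
  have t2: "\<forall>\<^sub>F \<epsilon> in at 0. \<bar>t \<epsilon>\<bar> < 2"
    by (rule order_tendstoD(2)[OF tendsto_rabs[OF tl]]) (use t0 in simp)
  have tw: "\<forall>\<^sub>F \<epsilon> in at 0. h3 \<epsilon> * (2 - t \<epsilon>) * (1 + t \<epsilon>) + (2 * t \<epsilon> + 1) * (h2 \<epsilon>)\<^sup>2 \<noteq> 0 \<or> t \<epsilon> = - 1 \<and> h3 \<epsilon> \<noteq> 0"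
  proof (cases "a = 8 \<and> c \<noteq> 0")
    case True
    have "2 * (1 + c\<^sup>2) = 8"
    proof -
      have "c * (2 * (1 + c\<^sup>2)) = c * 8" using fx True unfolding mcm_eq by (simp add: field_simps)
      thus ?thesis using True by simp
    qed
    hence c3: "c\<^sup>2 = 3" by simp
    show ?thesis unfolding t_def h2_def h3_def g1_def g2_def g3_def True[THEN conjunct1]
    proof (rule twist_at_resonance[OF c3 Qc deg e z0 zc0])
      show "2 * z \<epsilon> - mcm0 8 (z \<epsilon>) = \<epsilon> * rat_eval P Q (z \<epsilon>)" if "\<bar>\<epsilon>\<bar> < e" for \<epsilon>
        using zfix[OF that] True by (simp add: g_def)
      show "z \<epsilon> = c" if "\<bar>\<epsilon>\<bar> < e" "rat_eval P Q c = 0" for \<epsilon>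
        using z(2)[OF that(1), of c] \<delta> fx that(2) by (simp add: g_def)
    qed
  next
    case False
    have "((\<lambda>\<epsilon>. h3 \<epsilon> * (2 - t \<epsilon>) * (1 + t \<epsilon>) + (2 * t \<epsilon> + 1) * (h2 \<epsilon>)\<^sup>2) \<longlongrightarrow>
      (mcm3 a c + 0 * g3 c) * (2 - (mcm1 a c + 0 * g1 c)) * (1 + (mcm1 a c + 0 * g1 c)) + (2 * (mcm1 a c + 0 * g1 c) + 1) * (mcm2 a c + 0 * g2 c)\<^sup>2) (at 0)"
      by (intro tendsto_intros tl h2l h3l)
    hence "\<forall>\<^sub>F \<epsilon> in at 0. h3 \<epsilon> * (2 - t \<epsilon>) * (1 + t \<epsilon>) + (2 * t \<epsilon> + 1) * (h2 \<epsilon>)\<^sup>2 \<noteq> 0"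
      by (rule tendsto_imp_eventually_ne) (use F_map_unperturbed_twist[OF fx t0 a False] in simp)
    thus ?thesis by (rule eventually_mono) simp
  qed
  obtain e2 where e2: "e2 > 0" "\<And>\<epsilon>. \<bar>\<epsilon>\<bar> < e2 \<Longrightarrow> \<epsilon> \<noteq> 0 \<Longrightarrow> \<bar>t \<epsilon>\<bar> < 2 \<and>
      (h3 \<epsilon> * (2 - t \<epsilon>) * (1 + t \<epsilon>) + (2 * t \<epsilon> + 1) * (h2 \<epsilon>)\<^sup>2 \<noteq> 0 \<or> t \<epsilon> = - 1 \<and> h3 \<epsilon> \<noteq> 0)"
    by (rule eventually_at_0E[OF eventually_conj[OF t2 tw]]) blast
  define p where "p \<epsilon> = (vector [z \<epsilon>, z \<epsilon>] :: real^2)" for \<epsilon>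
  have fixiff: "F \<epsilon> q = q \<longleftrightarrow> q $ 1 = q $ 2 \<and> 2 * q $ 2 - mcm0 a (q $ 2) = \<epsilon> * g (q $ 2)" for \<epsilon> and q :: "real^2"
    unfolding F_def F_map_fixed_iff mcm_eq g_def ..
  have pD: "p \<epsilon> \<in> F_dom Q" if "\<bar>\<epsilon>\<bar> < e" for \<epsilon>
    using \<rho>(2)[OF z\<rho>[OF that]] by (simp add: p_def F_dom_def vector_2)
  have pfix: "F \<epsilon> (p \<epsilon>) = p \<epsilon>" if "\<bar>\<epsilon>\<bar> < e" for \<epsilon>
    using zfix[OF that] unfolding fixiff by (simp add: p_def vector_2)
  have br: "fixed_point_branch (F_dom Q) F e (vector [c, c]) p"
    unfolding fixed_point_branch_def
  proof (intro conjI exI[of _ "{q :: real^2. \<bar>q $ 2 - c\<bar> < \<delta>}"] ballI)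
    show "p 0 = vector [c, c]" by (simp add: p_def z0)
    show "continuous_on {- e<..<e} p" unfolding p_def[abs_def] by (rule continuous_on_diagonal[OF zc])
    show "open {q::real^2. \<bar>q $ 2 - c\<bar> < \<delta>}" by (intro open_Collect_less continuous_intros)
    show "vector [c, c] \<in> {q::real^2. \<bar>q $ 2 - c\<bar> < \<delta>}" using \<delta> by (simp add: vector_2)
    fix \<epsilon> assume "\<epsilon> \<in> {- e<..<e}"
    hence \<epsilon>: "\<bar>\<epsilon>\<bar> < e" by auto
    show "{q \<in> F_dom Q \<inter> {q. \<bar>q $ 2 - c\<bar> < \<delta>}. F \<epsilon> q = q} = {p \<epsilon>}"
    proof (intro equalityI subsetI)
      fix q assume "q \<in> {q \<in> F_dom Q \<inter> {q. \<bar>q $ 2 - c\<bar> < \<delta>}. F \<epsilon> q = q}"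
      hence q: "\<bar>q $ 2 - c\<bar> < \<delta>" "F \<epsilon> q = q" by auto
      thus "q \<in> {p \<epsilon>}" using z(2)[OF \<epsilon> q(1)] unfolding fixiff p_def by (simp add: vec2_diagonal)
    next
      fix q assume "q \<in> {p \<epsilon>}"
      thus "q \<in> {q \<in> F_dom Q \<inter> {q. \<bar>q $ 2 - c\<bar> < \<delta>}. F \<epsilon> q = q}"
        using pD[OF \<epsilon>] pfix[OF \<epsilon>] z(1)[OF \<epsilon>] by (simp add: p_def vector_2)
    qed
  qed
  have dh: "((\<lambda>y. mcm0 a y + \<epsilon> * g y) has_real_derivative mcm1 a y + \<epsilon> * g1 y) (at y)"
    "((\<lambda>y. mcm1 a y + \<epsilon> * g1 y) has_real_derivative mcm2 a y + \<epsilon> * g2 y) (at y)"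
    "((\<lambda>y. mcm2 a y + \<epsilon> * g2 y) has_real_derivative mcm3 a y + \<epsilon> * g3 y) (at y)" if "\<bar>y - c\<bar> < \<rho>" for \<epsilon> y
    by (intro DERIV_add DERIV_cmult mcm_derivatives dg[OF that])+
  define e' where "e' = min e e2"
  have e': "e' > 0" "e' \<le> e" "e' \<le> e2" using e e2 by (auto simp: e'_def)
  show ?thesis
  proof (intro exI[of _ e'] conjI exI[of _ p] allI impI e'(1) fixed_point_branch_mono[OF br e'(1,2)])
    fix \<epsilon> assume "\<bar>\<epsilon>\<bar> < e'"
    hence \<epsilon>: "\<bar>\<epsilon>\<bar> < e" "\<bar>\<epsilon>\<bar> < e2" using e' by auto
    have t\<epsilon>: "\<bar>t \<epsilon>\<bar> < 2" using e2(2)[OF \<epsilon>(2)] t0 by (cases "\<epsilon> = 0") (auto simp: t_def z0)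
    have "(F \<epsilon> has_derivative (\<lambda>d. vector [d $ 2, - d $ 1 + t \<epsilon> * d $ 2])) (at (p \<epsilon>))"
      unfolding F_def p_def
    proof (rule F_map_has_derivative)
      show "((\<lambda>y. a * y / (1 + y\<^sup>2) + \<epsilon> * rat_eval P Q y) has_real_derivative t \<epsilon>) (at (z \<epsilon>))"
        using dh(1)[OF z\<rho>[OF \<epsilon>(1)], of \<epsilon>] by (simp add: mcm_eq(1) t_def g_def)
    qed
    from elliptic_fixed_point_iff[OF this, of "F_dom Q"]
    show "elliptic_fixed_point (F_dom Q) (F \<epsilon>) (p \<epsilon>)" using pD[OF \<epsilon>(1)] pfix[OF \<epsilon>(1)] t\<epsilon> by blast
    show "locally_integrable_at 6 (F_dom Q) (F \<epsilon>) (p \<epsilon>) \<longleftrightarrow> \<epsilon> = 0"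
    proof
      assume \<epsilon>0: "\<epsilon> = 0"
      have "2 * c * (1 + c\<^sup>2) = a * c" using fx unfolding mcm_eq by (simp add: field_simps)
      moreover have "\<bar>4 * c\<^sup>2 - a\<bar> < 2 * c\<^sup>2 + 2"
      proof (cases "c = 0")
        case True
        thus ?thesis using t0 by (simp add: mcm_eq)
      next
        case False
        \<comment> \<open>Off the origin a = 2 (1 + c^2), so the off-diagonal Hessian entry is 2 c^2
          - 2 and definiteness is automatic. At the origin it is the ellipticity condition |a| <
          2.\<close>
        have "c * (2 * (1 + c\<^sup>2)) = c * a" using fx unfolding mcm_eq by (simp add: field_simps)
        hence "a = 2 * (1 + c\<^sup>2)" using False by simp
        moreover have "c\<^sup>2 > 0" using False by simp
        ultimately show ?thesis by (simp add: abs_less_iff)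
      qed
      ultimately show "locally_integrable_at 6 (F_dom Q) (F \<epsilon>) (p \<epsilon>)"
        unfolding F_def p_def \<epsilon>0 z0 by (intro F_map_0_integrable Qc)
    next
      assume int: "locally_integrable_at 6 (F_dom Q) (F \<epsilon>) (p \<epsilon>)"
      show "\<epsilon> = 0"
      proof (rule ccontr)
        assume ne: "\<epsilon> \<noteq> 0"
        \<comment> \<open>The derivatives are known within \<rho> of c; around the displaced fixed
          point the reduced radius stays inside that interval.\<close>
        have near: "\<bar>y - c\<bar> < \<rho>" if "\<bar>y - z \<epsilon>\<bar> < \<rho> - \<bar>z \<epsilon> - c\<bar>" for y using that by linarith
        have "\<not> locally_integrable_at 6 (F_dom Q) (F_map a (rat_eval P Q) \<epsilon>) (vector [z \<epsilon>, z \<epsilon>])"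
        proof (rule F_map_not_integrable[OF ne deg Q0, where h = "\<lambda>y. mcm0 a y + \<epsilon> * g y"
              and ?h1.0 = "\<lambda>y. mcm1 a y + \<epsilon> * g1 y" and ?h2.0 = "\<lambda>y. mcm2 a y + \<epsilon> * g2 y" and ?h3.0 = "h3 \<epsilon>"
              and \<rho> = "\<rho> - \<bar>z \<epsilon> - c\<bar>"])
          show "\<rho> - \<bar>z \<epsilon> - c\<bar> > 0" using z\<rho>[OF \<epsilon>(1)] by simp
          show "mcm0 a (z \<epsilon>) + \<epsilon> * g (z \<epsilon>) = 2 * z \<epsilon>" using zfix[OF \<epsilon>(1)] by simp
          show "((\<lambda>y. mcm2 a y + \<epsilon> * g2 y) has_real_derivative h3 \<epsilon>) (at (z \<epsilon>))"
            unfolding h3_def by (rule dh(3)[OF z\<rho>[OF \<epsilon>(1)]])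
          show "h3 \<epsilon> * (2 - (mcm1 a (z \<epsilon>) + \<epsilon> * g1 (z \<epsilon>))) * (1 + (mcm1 a (z \<epsilon>) + \<epsilon> * g1 (z \<epsilon>))) +
             (2 * (mcm1 a (z \<epsilon>) + \<epsilon> * g1 (z \<epsilon>)) + 1) * (mcm2 a (z \<epsilon>) + \<epsilon> * g2 (z \<epsilon>))\<^sup>2 \<noteq> 0 \<or>
             mcm1 a (z \<epsilon>) + \<epsilon> * g1 (z \<epsilon>) = - 1 \<and> h3 \<epsilon> \<noteq> 0"
            using e2(2)[OF \<epsilon>(2) ne] unfolding t_def h2_def by blast
        qed (use dh near t\<epsilon> in \<open>auto simp: mcm_eq(1) g_def t_def\<close>)
        thus False using int by (simp add: F_def p_def)
      qed
    qed
  qed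
qed

text \<open>With a = c^2 - c the twist expression at \<epsilon> = 0 is 2 (c - 1) (a - 1) / c^4. It
  vanishes only for a = 1 and for c = 1, where a = 0: the parameters at which the Lyness map is
  globally periodic, of period five and six.\<close>

lemma G_map_branch:
  fixes P Q :: "real poly"
  assumes deg: "degree P > degree Q + 2" and a: "a \<noteq> 0" "a \<noteq> 1" and Qc: "poly Q c \<noteq> 0" and c: "c \<noteq> 0" "c \<noteq> -1"
    and fx: "c\<^sup>2 = a + c" and t0: "\<bar>1 / c\<bar> < 2"
  defines "F \<equiv> G_map a (rat_eval P Q)"
  shows "\<exists>e>0. \<exists>p. fixed_point_branch (G_dom Q) F e (vector [c, c]) p \<and>
     (\<forall>\<epsilon>. \<bar>\<epsilon>\<bar> < e \<longrightarrow> elliptic_fixed_point (G_dom Q) (F \<epsilon>) (p \<epsilon>) \<and>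
        (locally_integrable_at 6 (G_dom Q) (F \<epsilon>) (p \<epsilon>) \<longleftrightarrow> \<epsilon> = 0))"
proof -
  have Q0: "Q \<noteq> 0" using Qc by auto
  \<comment> \<open>The extra factor y keeps the neighbourhood away from 0 as well, where the map is
    undefined.\<close>
  have "poly (Q * [:0, 1:]) c \<noteq> 0" using Qc c by simp
  then obtain \<rho> where \<rho>: "\<rho> > 0" "\<And>y. \<bar>y - c\<bar> < \<rho> \<Longrightarrow> poly (Q * [:0, 1:]) y \<noteq> 0"
    by (rule poly_nonzero_neighbourhood) blast
  have nz: "poly Q y \<noteq> 0" "y \<noteq> 0" if "\<bar>y - c\<bar> < \<rho>" for y using \<rho>(2)[OF that] by auto
  define g g1 g2 g3 where "g = rat_eval P Q" and "g1 = rat_eval (rat1 P Q) (Q\<^sup>2)"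
    and "g2 = rat_eval (rat2 P Q) (Q ^ 3)" and "g3 = rat_eval (rat3 P Q) (Q ^ 4)"
  note dg = rat_eval_derivatives[where P = P and Q = Q, folded g_def g1_def g2_def g3_def, OF nz(1)]
  \<comment> \<open>The derivative of x^2 - (a + x) at c. It vanishes at the double fixed point c =
    1/2, where 1/c = 2 and ellipticity fails.\<close>
  have chalf: "2 * c - 1 \<noteq> 0"
  proof
    assume "2 * c - 1 = 0"
    hence "c = 1 / 2" by simp
    from t0[unfolded this] show False by simp
  qed
  have "\<exists>\<delta> e z. 0 < \<delta> \<and> \<delta> < \<rho> \<and> e > 0 \<and> z 0 = c \<and> continuous_on {-e<..<e} z \<and>
      (\<forall>\<epsilon>. \<bar>\<epsilon>\<bar> < e \<longrightarrow> \<bar>z \<epsilon> - c\<bar> < \<delta> \<and> (\<forall>x. \<bar>x - c\<bar> < \<delta> \<longrightarrow> (x\<^sup>2 - (a + x) = \<epsilon> * g x \<longleftrightarrow> x = z \<epsilon>)))"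
  proof (rule zero_branch[OF \<rho>(1)])
    show "((\<lambda>x. x\<^sup>2 - (a + x)) has_real_derivative 2 * x - 1) (at x)" for x
      by (auto intro!: derivative_eq_intros)
    show "(g has_real_derivative g1 x) (at x)" if "\<bar>x - c\<bar> < \<rho>" for x by (rule dg(1)[OF that])
    show "isCont (\<lambda>x. 2 * x - 1) c" by (intro continuous_intros)
    show "isCont g1 c" unfolding g1_def using Qc by (intro isCont_rat_eval) simp
    show "c\<^sup>2 - (a + c) = 0" "2 * c - 1 \<noteq> 0" using fx chalf by auto
  qed
  then obtain \<delta> e z where \<delta>: "0 < \<delta>" "\<delta> < \<rho>" and e: "e > 0" and z0: "z 0 = c"
    and zc: "continuous_on {-e<..<e} z" and z: "\<And>\<epsilon>. \<bar>\<epsilon>\<bar> < e \<Longrightarrow> \<bar>z \<epsilon> - c\<bar> < \<delta>"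
      "\<And>\<epsilon> x. \<bar>\<epsilon>\<bar> < e \<Longrightarrow> \<bar>x - c\<bar> < \<delta> \<Longrightarrow> (x\<^sup>2 - (a + x) = \<epsilon> * g x \<longleftrightarrow> x = z \<epsilon>)" by metis
  have z\<rho>: "\<bar>z \<epsilon> - c\<bar> < \<rho>" if "\<bar>\<epsilon>\<bar> < e" for \<epsilon> using z(1)[OF that] \<delta> by linarith
  have zfix: "(z \<epsilon>)\<^sup>2 - (a + z \<epsilon>) = \<epsilon> * g (z \<epsilon>)" if "\<bar>\<epsilon>\<bar> < e" for \<epsilon>
    using z(2)[OF that z(1)[OF that]] by simp
  have zc0: "isCont z 0" using zc e by (simp add: continuous_on_eq_continuous_at)
  have z_lim: "(z \<longlongrightarrow> c) (at 0)" using zc0 z0 by (simp add: continuous_at)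
  define k1 where "k1 \<epsilon> = (1 + \<epsilon> * g1 (z \<epsilon>)) / z \<epsilon>" for \<epsilon>
  define k2 where "k2 \<epsilon> = k1 \<epsilon> + \<epsilon> * g2 (z \<epsilon>) - (k1 \<epsilon>)\<^sup>2" for \<epsilon>
  define k3 where "k3 \<epsilon> = k1 \<epsilon> + 3 * (\<epsilon> * g2 (z \<epsilon>)) + z \<epsilon> * (\<epsilon> * g3 (z \<epsilon>)) - 3 * (k1 \<epsilon>)\<^sup>2
      - 3 * k1 \<epsilon> * (\<epsilon> * g2 (z \<epsilon>)) + 2 * (k1 \<epsilon>) ^ 3" for \<epsilon>
  define W where "W \<epsilon> = k3 \<epsilon> * (2 - k1 \<epsilon>) * (1 + k1 \<epsilon>) + (2 * k1 \<epsilon> + 1) * (k2 \<epsilon>)\<^sup>2" for \<epsilon>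
  have gc: "isCont (rat_eval R (Q ^ k)) c" for R k by (rule isCont_rat_eval) (use Qc in simp)
  have glim: "((\<lambda>\<epsilon>. rat_eval R (Q ^ k) (z \<epsilon>)) \<longlongrightarrow> rat_eval R (Q ^ k) c) (at 0)" for R k
    by (rule isCont_tendsto_compose[OF gc z_lim])
  have el: "((\<lambda>\<epsilon>. \<epsilon> * rat_eval R (Q ^ k) (z \<epsilon>)) \<longlongrightarrow> 0) (at 0)" for R k
    using tendsto_mult[OF tendsto_ident_at[of 0 UNIV] glim[of R k]] by simp
  have k1l: "(k1 \<longlongrightarrow> (1 + 0) / c) (at 0)" unfolding k1_def[abs_def] g1_def
    by (intro tendsto_intros el z_lim c)
  hence k1l: "(k1 \<longlongrightarrow> 1 / c) (at 0)" by simp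
  have k2l: "(k2 \<longlongrightarrow> 1 / c + 0 - (1 / c)\<^sup>2) (at 0)" unfolding k2_def[abs_def] g2_def
    by (intro tendsto_intros el k1l)
  have k3l: "(k3 \<longlongrightarrow> 1 / c + 3 * 0 + c * 0 - 3 * (1 / c)\<^sup>2 - 3 * (1 / c) * 0 + 2 * (1 / c) ^ 3) (at 0)"
    unfolding k3_def[abs_def] g2_def g3_def by (intro tendsto_intros el k1l z_lim)
  have "(W \<longlongrightarrow> (1 / c + 3 * 0 + c * 0 - 3 * (1 / c)\<^sup>2 - 3 * (1 / c) * 0 + 2 * (1 / c) ^ 3) * (2 - 1 / c) * (1 + 1 / c)
      + (2 * (1 / c) + 1) * (1 / c + 0 - (1 / c)\<^sup>2)\<^sup>2) (at 0)"
    unfolding W_def[abs_def] by (intro tendsto_intros k1l k2l k3l)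
  moreover have "(1 / c + 3 * 0 + c * 0 - 3 * (1 / c)\<^sup>2 - 3 * (1 / c) * 0 + 2 * (1 / c) ^ 3) * (2 - 1 / c) * (1 + 1 / c)
      + (2 * (1 / c) + 1) * (1 / c + 0 - (1 / c)\<^sup>2)\<^sup>2 = 2 * (c - 1) * (a - 1) / c ^ 4"
  proof -
    define r where "r = 1 / c"
    have rc: "r * c = 1" using c by (simp add: r_def)
    have ac: "a = c\<^sup>2 - c" using fx by simp
    have "2 * (c - 1) * (a - 1) / c ^ 4 = 2 * (c - 1) * (c\<^sup>2 - c - 1) * r ^ 4"
      unfolding ac r_def by (simp add: power_one_over)
    moreover have "(r - 3 * r\<^sup>2 + 2 * r ^ 3) * (2 - r) * (1 + r) + (2 * r + 1) * (r - r\<^sup>2)\<^sup>2 = 2 * (c - 1) * (c\<^sup>2 - c - 1) * r ^ 4"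
      using rc by algebra
    ultimately show ?thesis unfolding r_def[symmetric] by simp
  qed
  ultimately have Wl: "(W \<longlongrightarrow> 2 * (c - 1) * (a - 1) / c ^ 4) (at 0)" by simp
  have "c \<noteq> 1" using fx a by auto
  hence "2 * (c - 1) * (a - 1) / c ^ 4 \<noteq> 0" using a c by simp
  hence tw: "\<forall>\<^sub>F \<epsilon> in at 0. W \<epsilon> \<noteq> 0" by (rule tendsto_imp_eventually_ne[OF Wl])
  have t2: "\<forall>\<^sub>F \<epsilon> in at 0. \<bar>k1 \<epsilon>\<bar> < 2"
    by (rule order_tendstoD(2)[OF tendsto_rabs[OF k1l] t0])
  obtain e2 where e2: "e2 > 0" "\<And>\<epsilon>. \<bar>\<epsilon>\<bar> < e2 \<Longrightarrow> \<epsilon> \<noteq> 0 \<Longrightarrow> \<bar>k1 \<epsilon>\<bar> < 2 \<and> W \<epsilon> \<noteq> 0"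
    by (rule eventually_at_0E[OF eventually_conj[OF t2 tw]]) blast
  define p where "p \<epsilon> = (vector [z \<epsilon>, z \<epsilon>] :: real^2)" for \<epsilon>
  have pD: "p \<epsilon> \<in> G_dom Q" if "\<bar>\<epsilon>\<bar> < e" for \<epsilon>
    using nz[OF z\<rho>[OF that]] by (simp add: p_def G_dom_def vector_2)
  have fixiff: "F \<epsilon> q = q \<longleftrightarrow> q $ 1 = q $ 2 \<and> (q $ 2)\<^sup>2 - (a + q $ 2) = \<epsilon> * g (q $ 2)" if "q \<in> G_dom Q" for \<epsilon> and q :: "real^2"
    unfolding F_def g_def by (rule G_map_fixed_iff) (use that in \<open>simp add: G_dom_def\<close>)
  have pfix: "F \<epsilon> (p \<epsilon>) = p \<epsilon>" if "\<bar>\<epsilon>\<bar> < e" for \<epsilon>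
    using zfix[OF that] unfolding fixiff[OF pD[OF that]] by (simp add: p_def vector_2)
  have br: "fixed_point_branch (G_dom Q) F e (vector [c, c]) p"
    unfolding fixed_point_branch_def
  proof (intro conjI exI[of _ "{q :: real^2. \<bar>q $ 2 - c\<bar> < \<delta>}"] ballI)
    show "p 0 = vector [c, c]" by (simp add: p_def z0)
    show "continuous_on {- e<..<e} p" unfolding p_def[abs_def] by (rule continuous_on_diagonal[OF zc])
    show "open {q::real^2. \<bar>q $ 2 - c\<bar> < \<delta>}" by (intro open_Collect_less continuous_intros)
    show "vector [c, c] \<in> {q::real^2. \<bar>q $ 2 - c\<bar> < \<delta>}" using \<delta> by (simp add: vector_2)
    fix \<epsilon> assume "\<epsilon> \<in> {- e<..<e}"
    hence \<epsilon>: "\<bar>\<epsilon>\<bar> < e" by auto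
    show "{q \<in> G_dom Q \<inter> {q. \<bar>q $ 2 - c\<bar> < \<delta>}. F \<epsilon> q = q} = {p \<epsilon>}"
    proof (intro equalityI subsetI)
      fix q assume "q \<in> {q \<in> G_dom Q \<inter> {q. \<bar>q $ 2 - c\<bar> < \<delta>}. F \<epsilon> q = q}"
      hence q: "\<bar>q $ 2 - c\<bar> < \<delta>" "F \<epsilon> q = q" "q \<in> G_dom Q" by auto
      thus "q \<in> {p \<epsilon>}" using z(2)[OF \<epsilon> q(1)] unfolding fixiff[OF q(3)] p_def by (simp add: vec2_diagonal)
    next
      fix q assume "q \<in> {p \<epsilon>}"
      thus "q \<in> {q \<in> G_dom Q \<inter> {q. \<bar>q $ 2 - c\<bar> < \<delta>}. F \<epsilon> q = q}"
        using pD[OF \<epsilon>] pfix[OF \<epsilon>] z(1)[OF \<epsilon>] by (simp add: p_def vector_2)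
    qed
  qed
  have df: "((\<lambda>y. a + y + \<epsilon> * g y) has_real_derivative 1 + \<epsilon> * g1 y) (at y)"
    "((\<lambda>y. 1 + \<epsilon> * g1 y) has_real_derivative \<epsilon> * g2 y) (at y)"
    "((\<lambda>y. \<epsilon> * g2 y) has_real_derivative \<epsilon> * g3 y) (at y)" if "\<bar>y - c\<bar> < \<rho>" for \<epsilon> y
    using dg[OF that] by (auto intro!: derivative_eq_intros)
  define e' where "e' = min e e2"
  have e': "e' > 0" "e' \<le> e" "e' \<le> e2" using e e2 by (auto simp: e'_def)
  show ?thesis
  proof (intro exI[of _ e'] conjI exI[of _ p] allI impI e'(1) fixed_point_branch_mono[OF br e'(1,2)])
    fix \<epsilon> assume "\<bar>\<epsilon>\<bar> < e'"
    hence \<epsilon>: "\<bar>\<epsilon>\<bar> < e" "\<bar>\<epsilon>\<bar> < e2" using e' by auto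
    have t\<epsilon>: "\<bar>k1 \<epsilon>\<bar> < 2" using e2(2)[OF \<epsilon>(2)] t0 by (cases "\<epsilon> = 0") (auto simp: k1_def z0)
    have zn: "z \<epsilon> \<noteq> 0" by (rule nz(2)[OF z\<rho>[OF \<epsilon>(1)]])
    have fz: "a + z \<epsilon> + \<epsilon> * g (z \<epsilon>) = (z \<epsilon>)\<^sup>2" using zfix[OF \<epsilon>(1)] by simp
    have "(F \<epsilon> has_derivative (\<lambda>d. vector [d $ 2, - d $ 1 + (1 + \<epsilon> * g1 (z \<epsilon>)) / z \<epsilon> * d $ 2])) (at (p \<epsilon>))"
      unfolding F_def p_def g_def[symmetric]
      by (rule G_map_has_derivative[OF df(1)[OF z\<rho>[OF \<epsilon>(1)]] zn fz])
    from elliptic_fixed_point_iff[OF this, of "G_dom Q", folded k1_def]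
    show "elliptic_fixed_point (G_dom Q) (F \<epsilon>) (p \<epsilon>)" using pD[OF \<epsilon>(1)] pfix[OF \<epsilon>(1)] t\<epsilon> by blast
    show "locally_integrable_at 6 (G_dom Q) (F \<epsilon>) (p \<epsilon>) \<longleftrightarrow> \<epsilon> = 0"
    proof
      assume \<epsilon>0: "\<epsilon> = 0"
      show "locally_integrable_at 6 (G_dom Q) (F \<epsilon>) (p \<epsilon>)"
        unfolding F_def p_def \<epsilon>0 z0 by (rule G_map_0_integrable[OF Qc c fx t0])
    next
      assume int: "locally_integrable_at 6 (G_dom Q) (F \<epsilon>) (p \<epsilon>)"
      show "\<epsilon> = 0"
      proof (rule ccontr)
        assume ne: "\<epsilon> \<noteq> 0"
        have near: "\<bar>y - c\<bar> < \<rho>" if "\<bar>y - z \<epsilon>\<bar> < \<rho> - \<bar>z \<epsilon> - c\<bar>" for y using that by linarith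
        have "\<not> locally_integrable_at 6 (G_dom Q) (G_map a (rat_eval P Q) \<epsilon>) (vector [z \<epsilon>, z \<epsilon>])"
        proof (rule G_map_not_integrable[OF ne deg Q0, where f = "\<lambda>y. a + y + \<epsilon> * g y"
              and ?f1.0 = "\<lambda>y. 1 + \<epsilon> * g1 y" and ?f2.0 = "\<lambda>y. \<epsilon> * g2 y" and ?f3.0 = "\<epsilon> * g3 (z \<epsilon>)"
              and ?k1.0 = "k1 \<epsilon>" and ?k2.0 = "k2 \<epsilon>" and ?k3.0 = "k3 \<epsilon>"
              and ?\<rho>0.0 = "\<rho> - \<bar>z \<epsilon> - c\<bar>"])
          show "\<rho> - \<bar>z \<epsilon> - c\<bar> > 0" using z\<rho>[OF \<epsilon>(1)] by simp
          show "((\<lambda>y. \<epsilon> * g2 y) has_real_derivative \<epsilon> * g3 (z \<epsilon>)) (at (z \<epsilon>))"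
            by (rule df(3)[OF z\<rho>[OF \<epsilon>(1)]])
          show "k3 \<epsilon> * (2 - k1 \<epsilon>) * (1 + k1 \<epsilon>) + (2 * k1 \<epsilon> + 1) * (k2 \<epsilon>)\<^sup>2 \<noteq> 0"
            using e2(2)[OF \<epsilon>(2) ne] unfolding W_def by blast
          show "k1 \<epsilon> = (1 + \<epsilon> * g1 (z \<epsilon>)) / z \<epsilon>" "k2 \<epsilon> = k1 \<epsilon> + \<epsilon> * g2 (z \<epsilon>) - (k1 \<epsilon>)\<^sup>2"
            "k3 \<epsilon> = k1 \<epsilon> + 3 * (\<epsilon> * g2 (z \<epsilon>)) + z \<epsilon> * (\<epsilon> * g3 (z \<epsilon>)) - 3 * (k1 \<epsilon>)\<^sup>2 - 3 * k1 \<epsilon> * (\<epsilon> * g2 (z \<epsilon>)) + 2 * (k1 \<epsilon>) ^ 3"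
            by (rule k1_def k2_def k3_def)+
        qed (use df near t\<epsilon> zn fz in \<open>auto simp: g_def\<close>)
        thus False using int by (simp add: F_def p_def)
      qed
    qed
  qed
qed

section \<open>Elliptic points of the unperturbed maps and the conclusion for both families\<close>

lemma F_map_elliptic_unperturbed:
  assumes "elliptic_fixed_point (F_dom Q) (F_map a (rat_eval P Q) 0) p0"
  obtains c where "p0 = vector [c, c]" "poly Q c \<noteq> 0" "2 * c = mcm0 a c" "\<bar>mcm1 a c\<bar> < 2"
proof -
  define c where "c = p0 $ 2"
  have D: "p0 \<in> F_dom Q" and fx: "F_map a (rat_eval P Q) 0 p0 = p0"
    using assms by (auto simp: elliptic_fixed_point_def)
  have Q: "poly Q c \<noteq> 0" using D by (simp add: F_dom_def c_def)
  have p0: "p0 = vector [c, c]" using fx unfolding F_map_fixed_iff vec2_diagonal by (simp add: c_def)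
  have fc: "2 * c = mcm0 a c" using fx unfolding F_map_fixed_iff by (simp add: mcm_eq c_def)
  have "((\<lambda>y. a * y / (1 + y\<^sup>2) + 0 * rat_eval P Q y) has_real_derivative mcm1 a c) (at c)"
    using mcm_derivatives(1)[of a c] unfolding mcm_eq(1)[abs_def] by simp
  from elliptic_fixed_point_iff[OF F_map_has_derivative[OF this], of "F_dom Q"] assms
  have "\<bar>mcm1 a c\<bar> < 2" unfolding p0 by blast
  thus ?thesis using that p0 Q fc by blast
qed

lemma G_map_elliptic_unperturbed:
  assumes "elliptic_fixed_point (G_dom Q) (G_map a (rat_eval P Q) 0) p0"
  obtains c where "p0 = vector [c, c]" "poly Q c \<noteq> 0" "c \<noteq> 0" "c\<^sup>2 = a + c" "\<bar>1 / c\<bar> < 2"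
proof -
  define c where "c = p0 $ 2"
  have D: "p0 \<in> G_dom Q" and fx: "G_map a (rat_eval P Q) 0 p0 = p0"
    using assms by (auto simp: elliptic_fixed_point_def)
  have n1: "p0 $ 1 \<noteq> 0" using D by (simp add: G_dom_def)
  have Q: "poly Q c \<noteq> 0" using D by (simp add: G_dom_def c_def)
  have p0: "p0 = vector [c, c]" using fx unfolding G_map_fixed_iff[OF n1] vec2_diagonal by (simp add: c_def)
  have c: "c \<noteq> 0" using n1 by (simp add: p0 vector_2)
  have fc: "c\<^sup>2 = a + c" using fx unfolding G_map_fixed_iff[OF n1] by (simp add: c_def)
  have d: "((\<lambda>y. a + y + 0 * rat_eval P Q y) has_real_derivative 1) (at c)"
    by (auto intro!: derivative_eq_intros)
  have "a + c + 0 * rat_eval P Q c = c\<^sup>2" using fc by simp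
  from elliptic_fixed_point_iff[OF G_map_has_derivative[OF d c this], of "G_dom Q"] assms
  have "\<bar>1 / c\<bar> < 2" unfolding p0 by blast
  thus ?thesis using that p0 Q c fc by blast
qed

lemma F_map_integrable_iff:
  fixes P Q :: "real poly"
  assumes deg: "degree P > degree Q + 1" and an: "a \<noteq> -1" "a \<noteq> 0" "a \<noteq> 2"
  shows "\<exists>e>0. \<forall>p0. elliptic_fixed_point (F_dom Q) (F_map a (rat_eval P Q) 0) p0 \<longrightarrow>
     (\<exists>p. fixed_point_branch (F_dom Q) (F_map a (rat_eval P Q)) e p0 p \<and>
       (\<forall>\<epsilon>. \<bar>\<epsilon>\<bar> < e \<longrightarrow> elliptic_fixed_point (F_dom Q) (F_map a (rat_eval P Q) \<epsilon>) (p \<epsilon>) \<and>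
          (locally_integrable_at 6 (F_dom Q) (F_map a (rat_eval P Q) \<epsilon>) (p \<epsilon>) \<longleftrightarrow> \<epsilon> = 0)))"
proof (rule uniform_branch[where R = "\<lambda>\<epsilon> q. elliptic_fixed_point (F_dom Q) (F_map a (rat_eval P Q) \<epsilon>) q \<and>
        (locally_integrable_at 6 (F_dom Q) (F_map a (rat_eval P Q) \<epsilon>) q \<longleftrightarrow> \<epsilon> = 0)"])
  have "{p0. elliptic_fixed_point (F_dom Q) (F_map a (rat_eval P Q) 0) p0} \<subseteq>
      (\<lambda>c. vector [c, c]) ` {c. poly [:0, 2 - a, 0, 2:] c = 0}"
  proof
    fix p0 assume "p0 \<in> {p0. elliptic_fixed_point (F_dom Q) (F_map a (rat_eval P Q) 0) p0}"
    hence "elliptic_fixed_point (F_dom Q) (F_map a (rat_eval P Q) 0) p0" by simp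
    then obtain c where c: "p0 = vector [c, c]" "2 * c = mcm0 a c" by (rule F_map_elliptic_unperturbed)
    have "2 * c * (1 + c\<^sup>2) = a * c" using c(2) unfolding mcm_eq by (simp add: field_simps)
    hence "poly [:0, 2 - a, 0, 2:] c = 0" by (simp add: algebra_simps power2_eq_square)
    thus "p0 \<in> (\<lambda>c. vector [c, c]) ` {c. poly [:0, 2 - a, 0, 2:] c = 0}" using c(1) by blast
  qed
  moreover have "finite {c. poly [:0, 2 - a, 0, 2:] c = 0}" by (rule poly_roots_finite) simp
  ultimately show "finite {p0. elliptic_fixed_point (F_dom Q) (F_map a (rat_eval P Q) 0) p0}"
    using finite_subset by blast
  fix p0 assume "elliptic_fixed_point (F_dom Q) (F_map a (rat_eval P Q) 0) p0"
  then obtain c where c: "p0 = vector [c, c]" "poly Q c \<noteq> 0" "2 * c = mcm0 a c" "\<bar>mcm1 a c\<bar> < 2"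
    by (rule F_map_elliptic_unperturbed)
  show "\<exists>e>0. \<exists>p. fixed_point_branch (F_dom Q) (F_map a (rat_eval P Q)) e p0 p \<and>
     (\<forall>\<epsilon>. \<bar>\<epsilon>\<bar> < e \<longrightarrow> elliptic_fixed_point (F_dom Q) (F_map a (rat_eval P Q) \<epsilon>) (p \<epsilon>) \<and>
        (locally_integrable_at 6 (F_dom Q) (F_map a (rat_eval P Q) \<epsilon>) (p \<epsilon>) \<longleftrightarrow> \<epsilon> = 0))"
    unfolding c(1) by (rule F_map_branch[OF deg an(1,2) c(2,3,4)])
qed

lemma G_map_integrable_iff:
  fixes P Q :: "real poly"
  assumes deg: "degree P > degree Q + 2" and an: "a \<noteq> 0" "a \<noteq> 1"
  shows "\<exists>e>0. \<forall>p0. elliptic_fixed_point (G_dom Q) (G_map a (rat_eval P Q) 0) p0 \<and> p0 \<noteq> vector [-1, -1] \<longrightarrow>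
     (\<exists>p. fixed_point_branch (G_dom Q) (G_map a (rat_eval P Q)) e p0 p \<and>
       (\<forall>\<epsilon>. \<bar>\<epsilon>\<bar> < e \<longrightarrow> elliptic_fixed_point (G_dom Q) (G_map a (rat_eval P Q) \<epsilon>) (p \<epsilon>) \<and>
          (locally_integrable_at 6 (G_dom Q) (G_map a (rat_eval P Q) \<epsilon>) (p \<epsilon>) \<longleftrightarrow> \<epsilon> = 0)))"
proof (rule uniform_branch[where R = "\<lambda>\<epsilon> q. elliptic_fixed_point (G_dom Q) (G_map a (rat_eval P Q) \<epsilon>) q \<and>
        (locally_integrable_at 6 (G_dom Q) (G_map a (rat_eval P Q) \<epsilon>) q \<longleftrightarrow> \<epsilon> = 0)"])
  have "{p0. elliptic_fixed_point (G_dom Q) (G_map a (rat_eval P Q) 0) p0 \<and> p0 \<noteq> vector [-1, -1]} \<subseteq>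
      (\<lambda>c. vector [c, c]) ` {c. poly [:- a, - 1, 1:] c = 0}"
  proof
    fix p0 assume "p0 \<in> {p0. elliptic_fixed_point (G_dom Q) (G_map a (rat_eval P Q) 0) p0 \<and> p0 \<noteq> vector [-1, -1]}"
    hence "elliptic_fixed_point (G_dom Q) (G_map a (rat_eval P Q) 0) p0" by simp
    then obtain c where c: "p0 = vector [c, c]" "c\<^sup>2 = a + c" by (rule G_map_elliptic_unperturbed)
    have "poly [:- a, - 1, 1:] c = 0" using c(2) by (simp add: algebra_simps power2_eq_square)
    thus "p0 \<in> (\<lambda>c. vector [c, c]) ` {c. poly [:- a, - 1, 1:] c = 0}" using c(1) by blast
  qed
  moreover have "finite {c. poly [:- a, - 1, 1:] c = 0}" by (rule poly_roots_finite) simp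
  ultimately show "finite {p0. elliptic_fixed_point (G_dom Q) (G_map a (rat_eval P Q) 0) p0 \<and> p0 \<noteq> vector [-1, -1]}"
    using finite_subset by blast
  fix p0 assume p0: "elliptic_fixed_point (G_dom Q) (G_map a (rat_eval P Q) 0) p0 \<and> p0 \<noteq> vector [-1, -1]"
  then obtain c where c: "p0 = vector [c, c]" "poly Q c \<noteq> 0" "c \<noteq> 0" "c\<^sup>2 = a + c" "\<bar>1 / c\<bar> < 2"
    using G_map_elliptic_unperturbed by blast
  \<comment> \<open>Only the excluded point has c = -1; there the normalising factor 1 / (c + 1) of
    the invariant breaks down.\<close>
  have c1: "c \<noteq> -1" using p0 c(1) by auto
  show "\<exists>e>0. \<exists>p. fixed_point_branch (G_dom Q) (G_map a (rat_eval P Q)) e p0 p \<and>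
     (\<forall>\<epsilon>. \<bar>\<epsilon>\<bar> < e \<longrightarrow> elliptic_fixed_point (G_dom Q) (G_map a (rat_eval P Q) \<epsilon>) (p \<epsilon>) \<and>
        (locally_integrable_at 6 (G_dom Q) (G_map a (rat_eval P Q) \<epsilon>) (p \<epsilon>) \<longleftrightarrow> \<epsilon> = 0))"
    unfolding c(1) by (rule G_map_branch[OF deg an c(2,3) c1 c(4,5)])
qed

theorem corollary9:
  fixes P Q :: "real poly"
  assumes "Q \<noteq> 0" and "coprime P Q"
  shows
    "(\<forall>a. rat_degree P Q > 1 \<and> a \<in> {-2<..} - {-1, 0, 2} \<longrightarrow>
        (\<exists>e>0. \<forall>p0.
           elliptic_fixed_point (F_dom Q) (F_map a (rat_eval P Q) 0) p0 \<longrightarrow>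
           (\<exists>p. fixed_point_branch (F_dom Q) (F_map a (rat_eval P Q)) e p0 p \<and>
              (\<forall>\<epsilon>. \<bar>\<epsilon>\<bar> < e \<longrightarrow>
                 elliptic_fixed_point (F_dom Q) (F_map a (rat_eval P Q) \<epsilon>) (p \<epsilon>) \<and>
                 (locally_integrable_at 6 (F_dom Q) (F_map a (rat_eval P Q) \<epsilon>) (p \<epsilon>)
                    \<longleftrightarrow> \<epsilon> = 0)))))
     \<and>
     (\<forall>a. rat_degree P Q > 2 \<and> a \<in> {-1/4<..} - {0, 1} \<longrightarrow>
        (\<exists>e>0. \<forall>p0.
           elliptic_fixed_point (G_dom Q) (G_map a (rat_eval P Q) 0) p0 \<and>
           p0 \<noteq> vector [-1, -1] \<longrightarrow>
           (\<exists>p. fixed_point_branch (G_dom Q) (G_map a (rat_eval P Q)) e p0 p \<and>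
              (\<forall>\<epsilon>. \<bar>\<epsilon>\<bar> < e \<longrightarrow>
                 elliptic_fixed_point (G_dom Q) (G_map a (rat_eval P Q) \<epsilon>) (p \<epsilon>) \<and>
                 (locally_integrable_at 6 (G_dom Q) (G_map a (rat_eval P Q) \<epsilon>) (p \<epsilon>)
                    \<longleftrightarrow> \<epsilon> = 0)))))"
  by (intro conjI allI impI F_map_integrable_iff G_map_integrable_iff) (auto simp: rat_degree_def)

end
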